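(* Let $\mathcal{M}$ be a $\sigma$-finite factor of type III and let $A,B\in\mathcal{M}^+$ with $B\ne0$. Then $A=\sum_{j=1}^\infty C_j$ for some $C_j\cong B$ if and only if one of the following mutually exclusive conditions holds: (i) $\|A\|>\|B\|$, $0\in\sigma(B)$ and $N_A\prec N_B$; (ii) $\|A\|=\|B\|$, $\chi_{\{\|B\|\}}(B)=0$, $0\in\sigma(B)$ and $N_A\prec N_B$; (iii) $\|A\|=\|B\|$, $\chi_{\{\|B\|\}}(B)\ne0$, $B\ne\|B\|\chi_{\{\|B\|\}}(B)$, $\chi_{\{\|A\|\}}(A)\ne0$ and $N_B\ne0$; (iv) $\|A\|=\|B\|$, $B=\|B\|\chi_{\{\|B\|\}}(B)$, $A=\|A\|\chi_{\{\|A\|\}}(A)$, $\chi_{\{\|A\|\}}(A)\ne0$ and $N_B\ne0$.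
   Context: $\mathcal{M}$ acts on a Hilbert space; $\mathcal{M}^+$ is its set of positive elements. $C\cong B$ means $C=UBU^*$ for some unitary $U\in\mathcal{M}$. For projections, $P\prec Q$ means $P$ is Murray-von Neumann equivalent in $\mathcal{M}$ to a subprojection of $Q$. $N_A$ is the projection on the null space of $A$. $\chi_S(B)$ is the spectral projection of $B$ for the Borel set $S$. Infinite sums of operators converge in the strong operator topology. *)

theory Defs
  imports "HOL-Analysis.Analysis"
begin

text \<open>
  A complex Hilbert space, as a real Hilbert space of the library together with its complex
  scalar multiplication and its inner product, which is linear in the first argument.
  Completeness is the class \<^class>\<open>complete_space\<close>; the norm is that of \<^class>\<open>real_inner\<close>,
  so its square is the real part of \<open>cinner x x\<close>, which is a real number by conjugate symmetry.
\<close>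

class chilbert_space = real_inner + complete_space +
  fixes scaleC :: "complex \<Rightarrow> 'a \<Rightarrow> 'a"  (infixr "*\<^sub>C" 75)
    and cinner :: "'a \<Rightarrow> 'a \<Rightarrow> complex"
  assumes scaleC_add_right: "a *\<^sub>C (x + y) = a *\<^sub>C x + a *\<^sub>C y"
    and scaleC_add_left: "(a + b) *\<^sub>C x = a *\<^sub>C x + b *\<^sub>C x"
    and scaleC_scaleC: "a *\<^sub>C b *\<^sub>C x = (a * b) *\<^sub>C x"
    and scaleR_eq_scaleC: "r *\<^sub>R x = complex_of_real r *\<^sub>C x"
    and cinner_commute: "cinner x y = cnj (cinner y x)"
    and cinner_add_left: "cinner (x + y) z = cinner x z + cinner y z"
    and cinner_scaleC_left: "cinner (a *\<^sub>C x) y = a * cinner x y"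
    and inner_eq_Re_cinner: "inner x y = Re (cinner x y)"

lemma norm_scaleC: "norm (a *\<^sub>C x) = cmod a * norm (x :: 'a::chilbert_space)"
proof -
  have "cinner (a *\<^sub>C x) (a *\<^sub>C x) = a * cnj a * cinner x x"
    by (metis cinner_commute cinner_scaleC_left complex_cnj_mult mult.assoc)
  also have "a * cnj a = complex_of_real ((cmod a)\<^sup>2)"
    by (rule complex_norm_square [symmetric])
  finally have "inner (a *\<^sub>C x) (a *\<^sub>C x) = (cmod a)\<^sup>2 * inner x x"
    by (simp add: inner_eq_Re_cinner)
  then show ?thesis
    by (simp add: norm_eq_sqrt_inner real_sqrt_mult)
qed


text \<open>
  The library type of bounded operators consists of real-linear maps; its norm is the operator
  norm. The algebra of all bounded operators of the complex Hilbert space is the following set.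
\<close>

definition bounded_ops :: "('a::chilbert_space \<Rightarrow>\<^sub>L 'a) set" where
  "bounded_ops = {T. \<forall>c x. blinfun_apply T (c *\<^sub>C x) = c *\<^sub>C blinfun_apply T x}"

lift_definition scalar_op :: "complex \<Rightarrow> ('a::chilbert_space \<Rightarrow>\<^sub>L 'a)" is "\<lambda>c x. c *\<^sub>C x"
proof (rule bounded_linear_intro)
  fix c :: complex and x y :: 'a and r :: real
  show "c *\<^sub>C (x + y) = c *\<^sub>C x + c *\<^sub>C y"
    by (rule scaleC_add_right)
  show "c *\<^sub>C r *\<^sub>R x = r *\<^sub>R c *\<^sub>C x"
    by (simp add: scaleR_eq_scaleC scaleC_scaleC mult.commute)
  show "norm (c *\<^sub>C x) \<le> norm x * cmod c"
    by (simp add: norm_scaleC)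
qed

definition adj :: "('a::chilbert_space \<Rightarrow>\<^sub>L 'a) \<Rightarrow> ('a \<Rightarrow>\<^sub>L 'a)" where
  "adj T = (THE S. \<forall>x y. cinner (blinfun_apply T x) y = cinner x (blinfun_apply S y))"

definition positive_op :: "('a::chilbert_space \<Rightarrow>\<^sub>L 'a) \<Rightarrow> bool" where
  "positive_op T \<longleftrightarrow> T \<in> bounded_ops \<and>
     (\<forall>x. cinner (blinfun_apply T x) x \<in> \<real> \<and> 0 \<le> Re (cinner (blinfun_apply T x) x))"

definition is_projection :: "('a::chilbert_space \<Rightarrow>\<^sub>L 'a) \<Rightarrow> bool" where
  "is_projection P \<longleftrightarrow> P \<in> bounded_ops \<and> adj P = P \<and> P o\<^sub>L P = P"

definition spectrum :: "('a::chilbert_space \<Rightarrow>\<^sub>L 'a) \<Rightarrow> complex set" where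
  "spectrum T = {z. \<not> (\<exists>S\<in>bounded_ops. S o\<^sub>L (T - scalar_op z) = id_blinfun
                                     \<and> (T - scalar_op z) o\<^sub>L S = id_blinfun)}"

definition null_proj :: "('a::chilbert_space \<Rightarrow>\<^sub>L 'a) \<Rightarrow> ('a \<Rightarrow>\<^sub>L 'a)" where
  "null_proj T = (THE P. is_projection P \<and> range (blinfun_apply P) = {x. blinfun_apply T x = 0})"


text \<open>
  A (compactly supported) projection-valued Borel measure on the real line, strongly countably
  additive. Its values outside the Borel sets are irrelevant.
\<close>

definition projection_valued_measure :: "(real set \<Rightarrow> ('a::chilbert_space \<Rightarrow>\<^sub>L 'a)) \<Rightarrow> bool" where
  "projection_valued_measure E \<longleftrightarrow>
     (\<forall>S\<in>sets borel. is_projection (E S)) \<and>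
     E UNIV = id_blinfun \<and>
     (\<exists>K. E {-K..K} = id_blinfun) \<and>
     (\<forall>S :: nat \<Rightarrow> real set. range S \<subseteq> sets borel \<longrightarrow> disjoint_family S \<longrightarrow>
        (\<forall>x. (\<lambda>n. blinfun_apply (E (S n)) x) sums blinfun_apply (E (\<Union>n. S n)) x))"

definition diagonal_measure ::
    "(real set \<Rightarrow> ('a::chilbert_space \<Rightarrow>\<^sub>L 'a)) \<Rightarrow> 'a \<Rightarrow> real measure" where
  "diagonal_measure E x =
     measure_of UNIV (sets borel) (\<lambda>S. ennreal (Re (cinner (blinfun_apply (E S) x) x)))"

text \<open>
  \<open>T = \<integral> t dE(t)\<close>, in the weak sense; by polarization the quadratic form determines \<open>T\<close>.
\<close>

definition is_spectral_measure ::
    "('a::chilbert_space \<Rightarrow>\<^sub>L 'a) \<Rightarrow> (real set \<Rightarrow> ('a \<Rightarrow>\<^sub>L 'a)) \<Rightarrow> bool" where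
  "is_spectral_measure T E \<longleftrightarrow> projection_valued_measure E \<and>
     (\<forall>x. cinner (blinfun_apply T x) x
            = complex_of_real (integral\<^sup>L (diagonal_measure E x) (\<lambda>t. t)))"

text \<open>
  The spectral projection \<open>\<chi>\<^sub>S(T)\<close> of a self-adjoint \<open>T\<close> for a Borel set \<open>S\<close>: the value at \<open>S\<close>
  of the spectral measure of \<open>T\<close>, which the spectral theorem shows to exist and to be unique
  on the Borel sets.
\<close>

definition spectral_proj ::
    "real set \<Rightarrow> ('a::chilbert_space \<Rightarrow>\<^sub>L 'a) \<Rightarrow> ('a \<Rightarrow>\<^sub>L 'a)" where
  "spectral_proj S T = (THE P. \<exists>E. is_spectral_measure T E \<and> P = E S)"


definition commutant :: "('a::chilbert_space \<Rightarrow>\<^sub>L 'a) set \<Rightarrow> ('a \<Rightarrow>\<^sub>L 'a) set" where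
  "commutant M = {T \<in> bounded_ops. \<forall>S\<in>M. T o\<^sub>L S = S o\<^sub>L T}"

definition von_neumann_algebra :: "('a::chilbert_space \<Rightarrow>\<^sub>L 'a) set \<Rightarrow> bool" where
  "von_neumann_algebra M \<longleftrightarrow>
     M \<subseteq> bounded_ops \<and> (\<forall>T\<in>M. adj T \<in> M) \<and> commutant (commutant M) = M"

definition factor :: "('a::chilbert_space \<Rightarrow>\<^sub>L 'a) set \<Rightarrow> bool" where
  "factor M \<longleftrightarrow> von_neumann_algebra M \<and> M \<inter> commutant M = range scalar_op"

definition projections :: "('a::chilbert_space \<Rightarrow>\<^sub>L 'a) set \<Rightarrow> ('a \<Rightarrow>\<^sub>L 'a) set" where
  "projections M = {P \<in> M. is_projection P}"

definition subprojection :: "('a::chilbert_space \<Rightarrow>\<^sub>L 'a) \<Rightarrow> ('a \<Rightarrow>\<^sub>L 'a) \<Rightarrow> bool" where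
  "subprojection P Q \<longleftrightarrow> Q o\<^sub>L P = P"

definition mvn_equiv ::
    "('a::chilbert_space \<Rightarrow>\<^sub>L 'a) set \<Rightarrow> ('a \<Rightarrow>\<^sub>L 'a) \<Rightarrow> ('a \<Rightarrow>\<^sub>L 'a) \<Rightarrow> bool" where
  "mvn_equiv M P Q \<longleftrightarrow> (\<exists>V\<in>M. adj V o\<^sub>L V = P \<and> V o\<^sub>L adj V = Q)"

definition mvn_subequiv ::
    "('a::chilbert_space \<Rightarrow>\<^sub>L 'a) set \<Rightarrow> ('a \<Rightarrow>\<^sub>L 'a) \<Rightarrow> ('a \<Rightarrow>\<^sub>L 'a) \<Rightarrow> bool" where
  "mvn_subequiv M P Q \<longleftrightarrow> (\<exists>R\<in>projections M. subprojection R Q \<and> mvn_equiv M P R)"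

definition finite_projection ::
    "('a::chilbert_space \<Rightarrow>\<^sub>L 'a) set \<Rightarrow> ('a \<Rightarrow>\<^sub>L 'a) \<Rightarrow> bool" where
  "finite_projection M P \<longleftrightarrow> P \<in> projections M \<and>
     (\<forall>Q\<in>projections M. subprojection Q P \<longrightarrow> mvn_equiv M P Q \<longrightarrow> Q = P)"

definition type_III :: "('a::chilbert_space \<Rightarrow>\<^sub>L 'a) set \<Rightarrow> bool" where
  "type_III M \<longleftrightarrow> (\<forall>P. finite_projection M P \<longrightarrow> P = 0)"

text \<open>\<open>\<sigma>\<close>-finite, also called countably decomposable.\<close>

definition sigma_finite_algebra :: "('a::chilbert_space \<Rightarrow>\<^sub>L 'a) set \<Rightarrow> bool" where
  "sigma_finite_algebra M \<longleftrightarrow>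
     (\<forall>F \<subseteq> projections M - {0}. pairwise (\<lambda>P Q. P o\<^sub>L Q = 0) F \<longrightarrow> countable F)"

definition positive_part :: "('a::chilbert_space \<Rightarrow>\<^sub>L 'a) set \<Rightarrow> ('a \<Rightarrow>\<^sub>L 'a) set" where
  "positive_part M = {T \<in> M. positive_op T}"

definition unitary_op :: "('a::chilbert_space \<Rightarrow>\<^sub>L 'a) \<Rightarrow> bool" where
  "unitary_op U \<longleftrightarrow> U \<in> bounded_ops \<and> adj U o\<^sub>L U = id_blinfun \<and> U o\<^sub>L adj U = id_blinfun"

definition unitarily_equiv ::
    "('a::chilbert_space \<Rightarrow>\<^sub>L 'a) set \<Rightarrow> ('a \<Rightarrow>\<^sub>L 'a) \<Rightarrow> ('a \<Rightarrow>\<^sub>L 'a) \<Rightarrow> bool" where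
  "unitarily_equiv M C B \<longleftrightarrow> (\<exists>U\<in>M. unitary_op U \<and> C = U o\<^sub>L B o\<^sub>L adj U)"

definition strong_sums ::
    "(nat \<Rightarrow> ('a::chilbert_space \<Rightarrow>\<^sub>L 'a)) \<Rightarrow> ('a \<Rightarrow>\<^sub>L 'a) \<Rightarrow> bool"  (infix "strong'_sums" 80) where
  "C strong_sums A \<longleftrightarrow> (\<forall>x. (\<lambda>j. blinfun_apply (C j) x) sums blinfun_apply A x)"

end

theory Submission
  imports Defs
begin

text \<open>
  Everything but the interface to the definitions takes place in the real Hilbert space with inner
  product \<open>Re \<langle>x, y\<rangle>\<close>, where complex linearity is just commutation with the scalars.

  Necessity is elementary: \<open>0 \<le> C\<^sub>j \<le> A\<close> bounds the norm and the kernels, \<open>C\<^sub>j x \<longlonglongrightarrow> 0\<close> shows that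
  \<open>B\<close> is not invertible, and if \<open>\<parallel>A\<parallel> = \<parallel>B\<parallel>\<close>, then an eigenvector of \<open>C\<^sub>j\<close> for \<open>\<parallel>B\<parallel>\<close> is one of \<open>A\<close> and is
  annihilated by all the other copies.

  For sufficiency, all nonzero projections of a \<open>\<sigma>\<close>-finite factor of type III are equivalent, so
  spectral pieces of \<open>B\<close> can be moved to any place where \<open>A\<close> has room. Suppose that \<open>\<parallel>A\<parallel> \<ge> \<alpha> \<ge> \<parallel>B\<parallel>\<close>
  and that \<open>\<alpha>\<close> is not an eigenvalue of \<open>B\<close>. Then one finds a copy \<open>C \<le> A\<close> of \<open>B\<close> such that
  \<open>A - C\<close> satisfies the same hypotheses and \<open>\<phi> C\<close>, for a fixed faithful state \<open>\<phi>\<close>, is bounded from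
  below in terms of \<open>\<phi> A\<close> and \<open>\<parallel>A\<parallel>\<close> only. Subtracting such copies greedily exhausts \<open>A\<close>. If \<open>\<alpha>\<close> is an
  eigenvalue of \<open>B\<close>, the eigenprojections are split off first.
\<close>

section \<open>Operators on real Hilbert spaces\<close>

text \<open>A residual must keep norm at least \<alpha> after each subtraction, although A may have
  only a sliver of spectrum near \<alpha>. The sliver is therefore divided into infinitely many
  orthogonal slots, with A at least \<alpha> - \<epsilon> k on the k-th; some slots take the part of
  B close to \<alpha>, infinitely many stay empty or nearly so and preserve the norm. Such slots can
  be made negligible for \<phi>, so the guaranteed loss of \<phi>-mass is taken elsewhere, from the
  bulk E of A above a level c chosen independently of A. If B has a kernel, B can be moved by an
  isometry that is not onto, since the kernel can absorb the defect. If B is injective, the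
  transport has to be onto and A - C has to stay injective, or no later copy could lie below it.
  Here the accumulation of the spectrum of B at 0 is used: its infinitely many nonzero pieces near 0
  are spread over all the remaining space, each consuming only a fraction of A there.\<close>

class real_hilbert = real_inner + complete_space

instance chilbert_space \<subseteq> real_hilbert ..

type_synonym 'h op = "'h \<Rightarrow>\<^sub>L 'h"

text \<open>A minimising sequence for the distance is Cauchy by the parallelogram law, because
  midpoints stay in L. Moving its limit along z by the optimal multiple would shorten the distance
  unless x - y is orthogonal to z.\<close>

lemma ex_orthogonal_foot:
  fixes L :: "'h::real_hilbert set"
  assumes "closed L" "subspace L"
  shows "\<exists>y\<in>L. \<forall>z\<in>L. (x - y) \<bullet> z = 0"
proof -
  define d where "d = infdist x L"
  have L0: "L \<noteq> {}" using assms(2) by (auto simp: subspace_def)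
  have d0: "d \<ge> 0" unfolding d_def by (rule infdist_nonneg)
  have dle: "d \<le> norm (x - u)" if "u \<in> L" for u
    using infdist_le[OF that, of x] by (simp add: d_def dist_norm)
  have par: "(norm (u - v))\<^sup>2 \<le> 2 * (norm (x - u))\<^sup>2 + 2 * (norm (x - v))\<^sup>2 - 4 * d\<^sup>2"
    if "u \<in> L" "v \<in> L" for u v
  proof -
    have "(1/2) *\<^sub>R (u + v) \<in> L"
      using that assms(2) by (simp add: subspace_add subspace_scale)
    then have "d\<^sup>2 \<le> (norm (x - (1/2) *\<^sub>R (u + v)))\<^sup>2"
      using dle d0 by (meson power_mono)
    moreover have "(norm (u - v))\<^sup>2 = 2 * (norm (x - u))\<^sup>2 + 2 * (norm (x - v))\<^sup>2
        - 4 * (norm (x - (1/2) *\<^sub>R (u + v)))\<^sup>2"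
      by (simp add: power2_norm_eq_inner inner_diff_left inner_diff_right inner_add_left
          inner_add_right inner_commute algebra_simps)
    ultimately show ?thesis by linarith
  qed
  have "\<exists>y\<in>L. (norm (x - y))\<^sup>2 < d\<^sup>2 + 1 / real (Suc n)" for n
  proof -
    have "sqrt (d\<^sup>2 + 1 / real (Suc n)) > d"
      using d0 by (intro real_less_rsqrt) auto
    then have "\<exists>y\<in>L. dist x y < sqrt (d\<^sup>2 + 1 / real (Suc n))"
      unfolding d_def using infdist_notempty[OF L0, of x] cInf_lessD[of "dist x ` L"] L0 by auto
    then obtain y where y: "y \<in> L" "norm (x - y) < sqrt (d\<^sup>2 + 1 / real (Suc n))"
      by (auto simp: dist_norm)
    have "(norm (x - y))\<^sup>2 < (sqrt (d\<^sup>2 + 1 / real (Suc n)))\<^sup>2"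
      using y by (intro power_strict_mono) auto
    then show ?thesis using y by auto
  qed
  then obtain Y where YL: "\<And>n. Y n \<in> L"
    and Yd: "\<And>n. (norm (x - Y n))\<^sup>2 < d\<^sup>2 + 1 / real (Suc n)" by metis
  have Ydiff: "(norm (Y m - Y n))\<^sup>2 \<le> 2 / real (Suc m) + 2 / real (Suc n)" for m n
    using par[OF YL[of m] YL[of n]] Yd[of m] Yd[of n] by simp
  have "Cauchy Y"
    unfolding Cauchy_def
  proof (intro allI impI)
    fix e :: real assume "e > 0"
    then obtain N where N: "inverse (real (Suc N)) < e\<^sup>2 / 4"
      using reals_Archimedean[of "e\<^sup>2/4"] by auto
    have "dist (Y m) (Y n) < e" if "m \<ge> N" "n \<ge> N" for m n
    proof -
      have "1 / real (Suc m) \<le> 1 / real (Suc N)" "1 / real (Suc n) \<le> 1 / real (Suc N)"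
        using that by (auto simp: frac_le)
      then have "(norm (Y m - Y n))\<^sup>2 < e\<^sup>2"
        using Ydiff[of m n] N by (simp add: inverse_eq_divide)
      then show ?thesis using \<open>e > 0\<close> by (simp add: dist_norm power2_less_imp_less)
    qed
    then show "\<exists>M. \<forall>m\<ge>M. \<forall>n\<ge>M. dist (Y m) (Y n) < e" by blast
  qed
  then obtain y where y: "Y \<longlonglongrightarrow> y" using Cauchy_convergent convergent_def by blast
  have yL: "y \<in> L" using assms(1) y YL closed_sequentially by blast
  have "(\<lambda>n. (norm (x - Y n))\<^sup>2) \<longlonglongrightarrow> (norm (x - y))\<^sup>2"
    by (intro tendsto_intros y)
  moreover have "(\<lambda>n. d\<^sup>2 + 1 / real (Suc n)) \<longlonglongrightarrow> d\<^sup>2 + 0"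
    using LIMSEQ_inverse_real_of_nat by (intro tendsto_intros) (simp add: inverse_eq_divide)
  ultimately have yd: "(norm (x - y))\<^sup>2 \<le> d\<^sup>2"
    using Yd by (intro LIMSEQ_le[of _ _ "\<lambda>n. d\<^sup>2 + 1 / real (Suc n)"]) (auto intro: less_imp_le)
  have "(x - y) \<bullet> z = 0" if "z \<in> L" for z
  proof (cases "z = 0")
    case False
    define t where "t = ((x - y) \<bullet> z) / (z \<bullet> z)"
    have "y + t *\<^sub>R z \<in> L" using yL that assms(2) by (simp add: subspace_add subspace_scale)
    then have "d\<^sup>2 \<le> (norm (x - (y + t *\<^sub>R z)))\<^sup>2" using dle d0 by (meson power_mono)
    then have "(norm (x - y))\<^sup>2 \<le> (norm (x - y - t *\<^sub>R z))\<^sup>2"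
      using yd by (metis diff_diff_eq order_trans)
    also have "\<dots> = (norm (x - y))\<^sup>2 - 2 * t * ((x - y) \<bullet> z) + t\<^sup>2 * (z \<bullet> z)"
    proof -
      have "(norm (u - t *\<^sub>R z))\<^sup>2 = (norm u)\<^sup>2 - 2 * t * (u \<bullet> z) + t\<^sup>2 * (z \<bullet> z)" for u
        unfolding power2_norm_eq_inner inner_diff_left inner_diff_right
        by (simp add: inner_commute power2_eq_square algebra_simps)
      then show ?thesis .
    qed
    also have "\<dots> = (norm (x - y))\<^sup>2 - ((x - y) \<bullet> z)\<^sup>2 / (z \<bullet> z)"
      using False by (simp add: t_def power2_eq_square field_simps)
    finally have "((x - y) \<bullet> z)\<^sup>2 / (z \<bullet> z) \<le> 0" by simp
    then have "((x - y) \<bullet> z)\<^sup>2 \<le> 0" using False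
      by (metis divide_le_0_iff inner_ge_zero inner_eq_zero_iff antisym_conv zero_le_power2)
    then show ?thesis by simp
  qed simp
  then show ?thesis using yL by blast
qed

section \<open>Selfadjoint and positive operators, orthogonal projections\<close>

definition selfadj :: "('h::real_inner \<Rightarrow>\<^sub>L 'h) \<Rightarrow> bool" where
  "selfadj T \<longleftrightarrow> (\<forall>x y. T x \<bullet> y = x \<bullet> T y)"

definition psd :: "('h::real_inner \<Rightarrow>\<^sub>L 'h) \<Rightarrow> bool" where
  "psd T \<longleftrightarrow> selfadj T \<and> (\<forall>x. 0 \<le> T x \<bullet> x)"

definition orth_proj :: "('h::real_inner \<Rightarrow>\<^sub>L 'h) \<Rightarrow> bool" where
  "orth_proj P \<longleftrightarrow> selfadj P \<and> (\<forall>x. P (P x) = P x)"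

lemma selfadjD: "selfadj T \<Longrightarrow> T x \<bullet> y = x \<bullet> T y"
  by (simp add: selfadj_def)

lemma psd_selfadj: "psd T \<Longrightarrow> selfadj T" and psd_nonneg: "psd T \<Longrightarrow> 0 \<le> T x \<bullet> x"
  by (auto simp: psd_def)

lemma orth_proj_selfadj: "orth_proj P \<Longrightarrow> selfadj P"
  and orth_proj_idem: "orth_proj P \<Longrightarrow> P (P x) = P x"
  by (auto simp: orth_proj_def)

lemma orth_proj_inner: "orth_proj P \<Longrightarrow> P x \<bullet> x = (norm (P x))\<^sup>2"
  by (metis orth_proj_idem orth_proj_selfadj power2_norm_eq_inner selfadjD)

lemma orth_proj_psd: "orth_proj P \<Longrightarrow> psd P"
  by (simp add: psd_def orth_proj_selfadj orth_proj_inner)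

lemma orth_proj_id [simp]: "orth_proj id_blinfun" and orth_proj_0 [simp]: "orth_proj 0"
  by (auto simp: orth_proj_def selfadj_def)

lemma orth_proj_norm_split:
  "orth_proj P \<Longrightarrow> (norm x)\<^sup>2 = (norm (P x))\<^sup>2 + (norm (x - P x))\<^sup>2"
  by (simp add: orth_proj_inner[symmetric] power2_norm_eq_inner inner_diff_left inner_diff_right
      selfadjD[OF orth_proj_selfadj] orth_proj_idem inner_commute)

lemma orth_proj_norm_le: "orth_proj P \<Longrightarrow> norm (P x) \<le> norm x"
  using orth_proj_norm_split[of P x] by (simp add: power2_le_imp_le)

lemma orth_proj_eqI:
  assumes "orth_proj P" "orth_proj Q" "range P = range Q"
  shows "P = Q"
proof (rule blinfun_eqI)
  fix x
  have QP: "Q (P y) = P y" for y using assms by (metis orth_proj_idem rangeE rangeI)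
  have PQ: "P (Q y) = Q y" for y using assms by (metis orth_proj_idem rangeE rangeI)
  have "(P x - Q x) \<bullet> z = 0" for z
  proof -
    have "P x \<bullet> z = Q (P x) \<bullet> z" by (simp add: QP)
    also have "\<dots> = x \<bullet> P (Q z)"
      using assms by (simp add: selfadjD orth_proj_selfadj)
    also have "\<dots> = Q x \<bullet> z" using assms by (simp add: PQ selfadjD orth_proj_selfadj)
    finally show ?thesis by (simp add: inner_diff_left)
  qed
  then show "P x = Q x" by (metis all_zero_iff right_minus_eq)
qed

lemma ex_orth_proj:
  fixes L :: "'h::real_hilbert set"
  assumes "closed L" "subspace L"
  shows "\<exists>P. orth_proj P \<and> range (blinfun_apply P) = L"
proof -
  obtain p where pL: "\<And>x. p x \<in> L" and ort: "\<And>x z. z \<in> L \<Longrightarrow> (x - p x) \<bullet> z = 0"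
    using ex_orthogonal_foot[OF assms] by metis
  have uniq: "y = p x" if "y \<in> L" "\<And>z. z \<in> L \<Longrightarrow> (x - y) \<bullet> z = 0" for x y
  proof -
    have yp: "y - p x \<in> L" using that pL assms(2) by (simp add: subspace_diff)
    have "(x - p x) - (x - y) = y - p x" by simp
    then have "(y - p x) \<bullet> (y - p x) = (x - p x) \<bullet> (y - p x) - (x - y) \<bullet> (y - p x)"
      by (metis inner_diff_left)
    also have "\<dots> = 0" using yp that ort by simp
    finally show ?thesis by simp
  qed
  have bl: "bounded_linear p"
  proof (rule bounded_linear_intro[where K = 1])
    fix x y r
    have "p x + p y = p (x + y)"
    proof (rule uniq)
      show "p x + p y \<in> L" using pL assms(2) by (simp add: subspace_add)
      fix z assume "z \<in> L"
      then have "(x - p x) \<bullet> z = 0" "(y - p y) \<bullet> z = 0" using ort by auto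
      then show "(x + y - (p x + p y)) \<bullet> z = 0" by (simp add: inner_diff_left inner_add_left)
    qed
    then show "p (x + y) = p x + p y" by simp
    have "r *\<^sub>R p x = p (r *\<^sub>R x)"
    proof (rule uniq)
      show "r *\<^sub>R p x \<in> L" using pL assms(2) by (simp add: subspace_scale)
      fix z assume "z \<in> L"
      then have "(x - p x) \<bullet> z = 0" using ort by auto
      then show "(r *\<^sub>R x - r *\<^sub>R p x) \<bullet> z = 0" by (simp add: inner_diff_left)
    qed
    then show "p (r *\<^sub>R x) = r *\<^sub>R p x" by simp
    have "(norm (p x))\<^sup>2 = x \<bullet> p x"
      using ort[OF pL, of x x] by (simp add: power2_norm_eq_inner inner_diff_left)
    also have "\<dots> \<le> norm x * norm (p x)" by (rule norm_cauchy_schwarz)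
    finally show "norm (p x) \<le> norm x * 1"
      by (cases "norm (p x) = 0") (auto simp: power2_eq_square)
  qed
  have pz: "p z = z" if "z \<in> L" for z using uniq[of z z] that by simp
  have sa: "p x \<bullet> y = x \<bullet> p y" for x y
    using ort[OF pL, of x y] ort[OF pL, of y x]
    by (simp add: inner_diff_left inner_diff_right inner_commute)
  have "range p = L" using pz pL by (metis image_subset_iff rangeI subsetI subset_antisym)
  then show ?thesis
    using pz[OF pL] sa
    by (intro exI[of _ "Blinfun p"])
       (simp add: orth_proj_def selfadj_def bounded_linear_Blinfun_apply[OF bl])
qed

definition proj_on :: "'h::real_hilbert set \<Rightarrow> 'h \<Rightarrow>\<^sub>L 'h" where
  "proj_on L = (SOME P. orth_proj P \<and> range (blinfun_apply P) = L)"

lemma proj_on: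
  assumes "closed L" "subspace L"
  shows "orth_proj (proj_on L)" "range (blinfun_apply (proj_on L)) = L"
  using someI_ex[OF ex_orth_proj[OF assms]] by (auto simp: proj_on_def)

lemma orth_proj_range: "orth_proj P \<Longrightarrow> x \<in> range (blinfun_apply P) \<longleftrightarrow> P x = x"
  by (metis orth_proj_idem rangeE rangeI)

lemma proj_on_eq: "closed L \<Longrightarrow> subspace L \<Longrightarrow> proj_on L x = x \<longleftrightarrow> x \<in> L"
  using proj_on orth_proj_range by metis

section \<open>Riesz representation and the adjoint for the real inner product\<close>

lemma riesz_representation:
  fixes f :: "'h::real_hilbert \<Rightarrow> real"
  assumes "bounded_linear f"
  shows "\<exists>a. \<forall>x. f x = a \<bullet> x"
proof (cases "\<forall>x. f x = 0")
  case True
  then show ?thesis by (intro exI[of _ 0]) simp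
next
  case False
  then obtain x0 where x0: "f x0 \<noteq> 0" by blast
  interpret f: bounded_linear f by fact
  define L where "L = {x. f x = 0}"
  have "closed L" unfolding L_def
    by (intro closed_Collect_eq continuous_intros f.continuous_on)
  moreover have "subspace L" unfolding L_def subspace_def by (simp add: f.add f.scale)
  ultimately obtain y where y: "y \<in> L" "\<And>z. z \<in> L \<Longrightarrow> (x0 - y) \<bullet> z = 0"
    using ex_orthogonal_foot by blast
  define z where "z = x0 - y"
  have fz: "f z = f x0" using y by (simp add: z_def L_def f.diff)
  then have z0: "z \<bullet> z \<noteq> 0" using x0 f.zero by (metis inner_eq_zero_iff)
  have "f x = ((f z / (z \<bullet> z)) *\<^sub>R z) \<bullet> x" for x
  proof -
    have "x - (f x / f z) *\<^sub>R z \<in> L"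
      using x0 fz by (simp add: L_def f.diff f.scale)
    then have "z \<bullet> (x - (f x / f z) *\<^sub>R z) = 0" using y(2) by (simp add: z_def)
    then have "z \<bullet> x = (f x / f z) * (z \<bullet> z)" by (simp add: inner_diff_right)
    then show ?thesis using x0 fz z0 by simp
  qed
  then show ?thesis by blast
qed

text \<open>The adjoint for the real inner product. On complex-linear operators it is the complex
  adjoint (\<open>adj_eq_hadj\<close>), which lets the argument run over the reals.\<close>

definition hadj :: "('h::real_hilbert \<Rightarrow>\<^sub>L 'h) \<Rightarrow> 'h \<Rightarrow>\<^sub>L 'h" where
  "hadj T = (SOME S. \<forall>x y. blinfun_apply T x \<bullet> y = x \<bullet> blinfun_apply S y)"

lemma hadj:
  fixes T :: "'h::real_hilbert op"
  shows "T x \<bullet> y = x \<bullet> hadj T y"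
proof -
  have "\<exists>a. \<forall>x. T x \<bullet> y = a \<bullet> x" for y
    by (rule riesz_representation) (intro bounded_linear_intros)
  then obtain s where s: "\<And>x y. T x \<bullet> y = s y \<bullet> x" by metis
  have eq: "u = v" if "\<And>x. u \<bullet> x = v \<bullet> x" for u v :: 'h
    using that by (metis all_zero_iff inner_diff_left right_minus_eq)
  have "bounded_linear s"
  proof (rule bounded_linear_intro[where K = "norm T"])
    fix x y r
    show "s (x + y) = s x + s y"
      by (rule eq) (simp add: s[symmetric] inner_add_left inner_add_right)
    show "s (r *\<^sub>R x) = r *\<^sub>R s x"
      by (rule eq) (simp add: s[symmetric])
    have "(norm (s x))\<^sup>2 = T (s x) \<bullet> x" by (simp add: s power2_norm_eq_inner)
    also have "\<dots> \<le> norm (T (s x)) * norm x" by (rule norm_cauchy_schwarz)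
    also have "\<dots> \<le> norm T * norm (s x) * norm x"
      by (intro mult_right_mono norm_blinfun) simp
    finally show "norm (s x) \<le> norm x * norm T"
      by (cases "norm (s x) = 0") (auto simp: power2_eq_square mult.commute)
  qed
  then have "\<forall>x y. T x \<bullet> y = x \<bullet> blinfun_apply (Blinfun s) y"
    by (simp add: bounded_linear_Blinfun_apply s) (simp add: inner_commute)
  then have "\<exists>S. \<forall>x y. T x \<bullet> y = x \<bullet> blinfun_apply S y" by blast
  from someI_ex[OF this] show ?thesis unfolding hadj_def by blast
qed

lemma hadj':
  fixes T :: "'h::real_hilbert op"
  shows "hadj T x \<bullet> y = x \<bullet> T y"
  using hadj[of T y x] by (simp add: inner_commute)

lemma inner_eqI: "(\<And>z. x \<bullet> z = y \<bullet> z) \<Longrightarrow> x = (y :: 'h::real_inner)"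
  by (metis all_zero_iff inner_diff_left right_minus_eq)

lemma hadj_unique:
  fixes T S :: "'h::real_hilbert op"
  shows "(\<And>x y. T x \<bullet> y = x \<bullet> S y) \<Longrightarrow> hadj T = S"
proof (rule blinfun_eqI, rule inner_eqI)
  fix y z
  assume a: "\<And>x y. T x \<bullet> y = x \<bullet> S y"
  show "hadj T y \<bullet> z = S y \<bullet> z"
    using a[of z y] hadj'[of T y z] by (simp add: inner_commute)
qed

lemma hadj_hadj [simp]: "hadj (hadj T) = T"
  by (rule hadj_unique) (rule hadj')

lemma hadj_compose: "hadj (S o\<^sub>L T) = hadj T o\<^sub>L hadj S"
  by (rule hadj_unique) (simp add: hadj)

lemma hadj_add: "hadj (S + T) = hadj S + hadj T"
  by (rule hadj_unique) (simp add: hadj inner_add_left inner_add_right blinfun.bilinear_simps)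

lemma hadj_scaleR: "hadj (r *\<^sub>R T) = r *\<^sub>R hadj T"
  by (rule hadj_unique) (simp add: hadj blinfun.bilinear_simps)

lemma selfadj_hadj: "selfadj T \<longleftrightarrow> hadj T = T"
proof
  assume "selfadj T" then show "hadj T = T" by (intro hadj_unique) (simp add: selfadj_def)
next
  assume "hadj T = T" then show "selfadj T" using hadj[of T] by (simp add: selfadj_def)
qed

lemma psd_Cauchy_Schwarz:
  fixes T :: "'h::real_inner op"
  assumes "psd T"
  shows "(T x \<bullet> y)\<^sup>2 \<le> (T x \<bullet> x) * (T y \<bullet> y)"
proof -
  define a b c where "a = T x \<bullet> x" and "b = T x \<bullet> y" and "c = T y \<bullet> y"
  have sa: "T y \<bullet> x = b" using selfadjD[OF psd_selfadj[OF assms], of y x] by (simp add: b_def inner_commute)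
  have q: "0 \<le> a + 2 * t * b + t\<^sup>2 * c" for t
    using psd_nonneg[OF assms, of "x + t *\<^sub>R y"] sa
    by (simp add: blinfun.bilinear_simps inner_add_left inner_add_right a_def b_def c_def
        power2_eq_square algebra_simps)
  have c0: "c \<ge> 0" using psd_nonneg[OF assms] by (simp add: c_def)
  have "b\<^sup>2 \<le> a * c"
  proof (cases "c = 0")
    case True
    have "b = 0"
    proof (rule ccontr)
      assume "b \<noteq> 0"
      \<comment> \<open>With c = 0 the quadratic is linear in t, and at this t it has the value
        -1.\<close>
      then show False using q[of "- (a + 1) / (2 * b)"] True by (simp add: field_simps)
    qed
    then show ?thesis using True by simp
  next
    case False
    then have "0 \<le> a - b\<^sup>2 / c"
      using q[of "- b / c"] by (simp add: power2_eq_square field_simps)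
    then show ?thesis using False c0 by (simp add: field_simps)
  qed
  then show ?thesis by (simp add: a_def b_def c_def)
qed

text \<open>Cauchy--Schwarz for the form of T at x and T x, divided by the squared norm of T x. It
  converts bounds on the quadratic form into bounds on vectors, hence monotone convergence of forms
  into strong convergence.\<close>

lemma psd_bound_sq:
  fixes T :: "'h::real_inner op"
  assumes "psd T" "\<And>x. T x \<bullet> x \<le> K * (norm x)\<^sup>2"
  shows "(norm (T x))\<^sup>2 \<le> K * (T x \<bullet> x)"
proof (cases "T x = 0")
  case False
  have "(T x \<bullet> T x)\<^sup>2 \<le> (T x \<bullet> x) * (T (T x) \<bullet> T x)" by (rule psd_Cauchy_Schwarz[OF assms(1)])
  also have "\<dots> \<le> (T x \<bullet> x) * (K * (norm (T x))\<^sup>2)"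
    by (intro mult_left_mono assms(2) psd_nonneg[OF assms(1)])
  finally have "(norm (T x))\<^sup>2 * (norm (T x))\<^sup>2 \<le> (K * (T x \<bullet> x)) * (norm (T x))\<^sup>2"
    by (simp add: power2_norm_eq_inner[symmetric] power2_eq_square ac_simps)
  then show ?thesis using False by (metis mult_right_le_imp_le zero_less_power2 norm_eq_zero)
qed simp

lemma psd_le_norm:
  fixes T :: "'h::real_inner op"
  shows "T x \<bullet> x \<le> norm T * (norm x)\<^sup>2"
proof -
  have "T x \<bullet> x \<le> norm (T x) * norm x" by (rule norm_cauchy_schwarz)
  also have "\<dots> \<le> norm T * norm x * norm x" by (intro mult_right_mono norm_blinfun) simp
  finally show ?thesis by (simp add: power2_eq_square mult.assoc)
qed

lemma psd_zero_iff:
  fixes T :: "'h::real_inner op"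
  assumes "psd T"
  shows "T x \<bullet> x = 0 \<longleftrightarrow> T x = 0"
  using psd_bound_sq[OF assms psd_le_norm, of x] by auto

lemma psd_norm_le:
  fixes T :: "'h::real_inner op"
  assumes "psd T" "\<And>x. T x \<bullet> x \<le> K * (norm x)\<^sup>2" "K \<ge> 0"
  shows "norm T \<le> K"
proof (rule norm_blinfun_bound[OF assms(3)])
  fix x
  have "(norm (T x))\<^sup>2 \<le> K * (T x \<bullet> x)" by (rule psd_bound_sq[OF assms(1,2)])
  also have "\<dots> \<le> K * (K * (norm x)\<^sup>2)" by (intro mult_left_mono assms)
  also have "\<dots> = (K * norm x)\<^sup>2" by (simp add: power2_eq_square)
  finally show "norm (T x) \<le> K * norm x" by (rule power2_le_imp_le) (simp add: assms(3))
qed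

section \<open>Strong limits of bounded and of monotone sequences\<close>

lemma strong_limit_exists:
  fixes T :: "nat \<Rightarrow> 'h::real_inner op"
  assumes "\<And>x. convergent (\<lambda>n. T n x)" "\<And>n x. norm (T n x) \<le> K * norm x"
  shows "\<exists>S::'h op. \<forall>x. (\<lambda>n. T n x) \<longlonglongrightarrow> S x"
proof -
  define s where "s x = lim (\<lambda>n. T n x)" for x
  have s: "(\<lambda>n. T n x) \<longlonglongrightarrow> s x" for x
    using assms(1) by (simp add: s_def convergent_LIMSEQ_iff)
  have "bounded_linear s"
  proof (rule bounded_linear_intro[where K = K])
    fix x y r
    show "s (x + y) = s x + s y"
      using tendsto_add[OF s[of x] s[of y]] s[of "x + y"]
      by (auto simp: blinfun.bilinear_simps intro: LIMSEQ_unique)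
    show "s (r *\<^sub>R x) = r *\<^sub>R s x"
      using tendsto_scaleR[OF tendsto_const s[of x], of r] s[of "r *\<^sub>R x"]
      by (auto simp: blinfun.bilinear_simps intro: LIMSEQ_unique)
    show "norm (s x) \<le> norm x * K"
      using assms(2)[of _ x] by (intro LIMSEQ_le_const2[OF tendsto_norm[OF s]]) (auto simp: mult.commute)
  qed
  then show ?thesis using s by (intro exI[of _ "Blinfun s"]) (simp add: bounded_linear_Blinfun_apply)
qed

lemma strong_limit_selfadj:
  fixes T :: "nat \<Rightarrow> 'h::real_inner op" and S :: "'h op"
  assumes "\<And>x. (\<lambda>n. T n x) \<longlonglongrightarrow> S x" "\<And>n. selfadj (T n)"
  shows "selfadj S"
proof -
  have "S x \<bullet> y = x \<bullet> S y" for x y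
  proof (rule LIMSEQ_unique)
    show "(\<lambda>n. T n x \<bullet> y) \<longlonglongrightarrow> S x \<bullet> y" by (intro tendsto_intros assms)
    have "(\<lambda>n. x \<bullet> T n y) \<longlonglongrightarrow> x \<bullet> S y" by (intro tendsto_intros assms)
    then show "(\<lambda>n. T n x \<bullet> y) \<longlonglongrightarrow> x \<bullet> S y" by (simp add: selfadjD[OF assms(2)])
  qed
  then show ?thesis by (simp add: selfadj_def)
qed

lemma psd_diffI:
  "selfadj S \<Longrightarrow> selfadj T \<Longrightarrow> (\<And>x. S x \<bullet> x \<le> T x \<bullet> x) \<Longrightarrow> psd (T - S)"
  by (simp add: psd_def selfadj_def blinfun.bilinear_simps inner_diff_left inner_diff_right)

lemma Cauchy_from_real:
  fixes f :: "nat \<Rightarrow> 'h::real_normed_vector" and g :: "nat \<Rightarrow> real"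
  assumes "Cauchy g" "\<And>m n. m \<le> n \<Longrightarrow> (norm (f n - f m))\<^sup>2 \<le> C * \<bar>g n - g m\<bar>"
  shows "Cauchy f"
  unfolding Cauchy_altdef
proof (intro allI impI)
  fix e :: real assume e: "e > 0"
  define C' where "C' = max C 1"
  have C': "C' > 0" "C \<le> C'" by (auto simp: C'_def)
  have "e\<^sup>2 / C' > 0" using e C' by simp
  then obtain M where M: "\<And>m n. m \<ge> M \<Longrightarrow> n > m \<Longrightarrow> dist (g m) (g n) < e\<^sup>2 / C'"
    using assms(1) unfolding Cauchy_altdef by meson
  have "dist (f m) (f n) < e" if "m \<ge> M" "n > m" for m n
  proof -
    have "(norm (f n - f m))\<^sup>2 \<le> C * \<bar>g n - g m\<bar>" using that by (intro assms(2)) simp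
    also have "\<dots> \<le> C' * \<bar>g n - g m\<bar>" using C' by (intro mult_right_mono) auto
    also have "\<dots> < C' * (e\<^sup>2 / C')"
      using M[OF that] C' by (intro mult_strict_left_mono) (auto simp: dist_real_def)
    finally have "(norm (f n - f m))\<^sup>2 < e\<^sup>2" using C' by simp
    then show ?thesis using e by (simp add: dist_norm power2_less_imp_less norm_minus_commute)
  qed
  then show "\<exists>M. \<forall>m\<ge>M. \<forall>n>m. dist (f m) (f n) < e" by blast
qed

text \<open>For m \<le> n the difference is positive with a bound C independent of m and n, so
  \<open>psd_bound_sq\<close> makes the vectors \<open>T n x\<close> Cauchy as soon as the monotone
  bounded numbers \<open>T n x \<bullet> x\<close> are.\<close>

lemma monotone_strong_limit:
  fixes T :: "nat \<Rightarrow> 'h::real_hilbert op"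
  assumes sa: "\<And>n. selfadj (T n)" and inc: "\<And>n x. T n x \<bullet> x \<le> T (Suc n) x \<bullet> x"
    and bd: "\<And>n x. T n x \<bullet> x \<le> K * (norm x)\<^sup>2"
  shows "\<exists>S::'h op. selfadj S \<and> (\<forall>x. (\<lambda>n. T n x) \<longlonglongrightarrow> S x) \<and> (\<forall>n x. T n x \<bullet> x \<le> S x \<bullet> x)"
proof -
  have mono: "T m x \<bullet> x \<le> T n x \<bullet> x" if "m \<le> n" for m n x
    using lift_Suc_mono_le[of "\<lambda>n. T n x \<bullet> x", OF inc that] .
  define C where "C = \<bar>K\<bar> + norm (T 0)"
  have C0: "C \<ge> 0" by (simp add: C_def)
  have psd: "psd (T n - T m)" if "m \<le> n" for m n
    by (rule psd_diffI[OF sa sa]) (rule mono[OF that])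
  have le: "(T n - T m) x \<bullet> x \<le> C * (norm x)\<^sup>2" if "m \<le> n" for m n x
  proof -
    have "- (T m x \<bullet> x) \<le> - (T 0 x \<bullet> x)" using mono[of 0 m] by simp
    also have "\<dots> \<le> norm (T 0) * (norm x)\<^sup>2"
      using psd_le_norm[of "- T 0" x] by (simp add: blinfun.bilinear_simps)
    finally have "(T n - T m) x \<bullet> x \<le> K * (norm x)\<^sup>2 + norm (T 0) * (norm x)\<^sup>2"
      using bd[of n x] by (simp add: blinfun.bilinear_simps inner_diff_left)
    also have "\<dots> \<le> C * (norm x)\<^sup>2" unfolding C_def distrib_right
      by (intro add_right_mono mult_right_mono) auto
    finally show ?thesis .
  qed
  have key: "(norm (T n x - T m x))\<^sup>2 \<le> C * \<bar>T n x \<bullet> x - T m x \<bullet> x\<bar>" if "m \<le> n" for m n x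
    using psd_bound_sq[OF psd le, OF that that, of x] mono[OF that, of x]
    by (simp add: blinfun.bilinear_simps inner_diff_left)
  have "convergent (\<lambda>n. T n x)" for x
  proof -
    have "convergent (\<lambda>n. T n x \<bullet> x)"
    proof (rule Bseq_mono_convergent)
      have "\<bar>T n x \<bullet> x\<bar> \<le> \<bar>T 0 x \<bullet> x\<bar> + \<bar>K * (norm x)\<^sup>2\<bar>" for n
        using mono[of 0 n x] bd[of n x] by linarith
      then show "Bseq (\<lambda>n. T n x \<bullet> x)" by (intro BseqI'[of _ "\<bar>T 0 x \<bullet> x\<bar> + \<bar>K * (norm x)\<^sup>2\<bar>"]) simp
    qed (use mono in auto)
    then have "Cauchy (\<lambda>n. T n x)"
      by (intro Cauchy_from_real[OF convergent_Cauchy key]) auto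
    then show ?thesis by (rule Cauchy_convergent)
  qed
  moreover have "norm (T n x) \<le> (C + norm (T 0)) * norm x" for n x
  proof -
    have "(norm ((T n - T 0) x))\<^sup>2 \<le> C * ((T n - T 0) x \<bullet> x)"
      by (rule psd_bound_sq[OF psd le]) auto
    also have "\<dots> \<le> C * (C * (norm x)\<^sup>2)" by (intro mult_left_mono le C0) auto
    also have "\<dots> = (C * norm x)\<^sup>2" by (simp add: power2_eq_square)
    finally have "norm ((T n - T 0) x) \<le> C * norm x"
      by (rule power2_le_imp_le) (simp add: C0)
    then have "norm (T n x - T 0 x) \<le> C * norm x" by (simp add: blinfun.diff_left)
    moreover have "norm (T n x) \<le> norm (T n x - T 0 x) + norm (T 0 x)"
      using norm_triangle_ineq[of "T n x - T 0 x" "T 0 x"] by simp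
    ultimately show ?thesis using norm_blinfun[of "T 0" x] by (simp add: algebra_simps)
  qed
  ultimately obtain S :: "'h op" where S: "\<And>x. (\<lambda>n. T n x) \<longlonglongrightarrow> S x"
    using strong_limit_exists by metis
  have "selfadj S" by (rule strong_limit_selfadj[OF S sa])
  moreover have "T n x \<bullet> x \<le> S x \<bullet> x" for n x
  proof (rule LIMSEQ_le_const)
    show "(\<lambda>n. T n x \<bullet> x) \<longlonglongrightarrow> S x \<bullet> x" by (intro tendsto_intros S)
    show "\<exists>N. \<forall>m\<ge>N. T n x \<bullet> x \<le> T m x \<bullet> x" using mono by blast
  qed
  ultimately show ?thesis using S by blast
qed

subsection \<open>Partial isometries and orthogonal sums\<close>

text \<open>V is a partial isometry with initial projection P and final projection Q. The predicate
  carries both projections, since the later bookkeeping is done with them.\<close>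

definition pisom :: "'h::real_hilbert op \<Rightarrow> 'h op \<Rightarrow> 'h op \<Rightarrow> bool" where
  "pisom V P Q \<longleftrightarrow> orth_proj P \<and> orth_proj Q \<and>
     (\<forall>x. hadj V (V x) = P x) \<and> (\<forall>x. V (hadj V x) = Q x)"

lemma pisomD:
  assumes "pisom V P Q"
  shows "orth_proj P" "orth_proj Q" "hadj V (V x) = P x" "V (hadj V x) = Q x"
    "V (P x) = V x" "Q (V x) = V x" "hadj V (Q x) = hadj V x" "P (hadj V x) = hadj V x"
    "norm (V x) = norm (P x)" "norm (hadj V x) = norm (Q x)"
proof -
  show P: "orth_proj P" and Q: "orth_proj Q"
    and 1: "\<And>x. hadj V (V x) = P x" and 2: "\<And>x. V (hadj V x) = Q x"
    using assms by (auto simp: pisom_def)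
  have n: "norm (V x) = norm (P x)" for x
  proof -
    have "(norm (V x))\<^sup>2 = hadj V (V x) \<bullet> x" by (simp add: power2_norm_eq_inner hadj')
    then show ?thesis by (simp add: 1 orth_proj_inner[OF P])
  qed
  have n': "norm (hadj V x) = norm (Q x)" for x
  proof -
    have "(norm (hadj V x))\<^sup>2 = V (hadj V x) \<bullet> x" by (simp add: power2_norm_eq_inner hadj)
    then show ?thesis by (simp add: 2 orth_proj_inner[OF Q])
  qed
  show "norm (V x) = norm (P x)" "norm (hadj V x) = norm (Q x)" by (rule n n')+
  have "norm (V (P x - x)) = 0"
    unfolding n by (simp add: blinfun.diff_right orth_proj_idem[OF P])
  then show VP: "V (P x) = V x" for x
    by (metis (no_types) blinfun.diff_right n norm_eq_zero orth_proj_idem[OF P] right_minus_eq)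
  have HQ: "hadj V (Q x) = hadj V x" for x
    by (metis (no_types) blinfun.diff_right n' norm_eq_zero orth_proj_idem[OF Q] right_minus_eq)
  show "hadj V (Q x) = hadj V x" by (rule HQ)
  show "Q (V x) = V x" by (metis 1 2 VP)
  show "P (hadj V x) = hadj V x" by (metis 1 2 HQ)
qed

text \<open>V x and P x have equal norms, so V vanishes on the complement of P and
  \<open>V (P x) = V x\<close>. This makes V composed with its adjoint idempotent.\<close>

lemma pisomI:
  fixes V P :: "'h::real_hilbert op"
  assumes P: "orth_proj P" and 1: "\<And>x. hadj V (V x) = P x"
  shows "pisom V P (V o\<^sub>L hadj V)"
proof -
  have n: "norm (V x) = norm (P x)" for x
  proof -
    have "(norm (V x))\<^sup>2 = hadj V (V x) \<bullet> x" by (simp add: power2_norm_eq_inner hadj')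
    then show ?thesis by (simp add: 1 orth_proj_inner[OF P])
  qed
  have VP: "V (P x) = V x" for x
    by (metis (no_types) blinfun.diff_right n norm_eq_zero orth_proj_idem[OF P] right_minus_eq)
  have "selfadj (V o\<^sub>L hadj V)"
    by (simp add: selfadj_hadj hadj_compose)
  then have "orth_proj (V o\<^sub>L hadj V)" by (simp add: orth_proj_def 1 VP)
  then show ?thesis by (simp add: pisom_def P 1)
qed

lemma pisom_hadj: "pisom V P Q \<Longrightarrow> pisom (hadj V) Q P"
  by (simp add: pisom_def)

lemma pisom_self: "orth_proj P \<Longrightarrow> pisom P P P"
  by (simp add: pisom_def orth_proj_idem selfadj_hadj[THEN iffD1, OF orth_proj_selfadj])

text \<open>Members may be zero, so that a countable orthogonal family of any size can be written as
  a sequence.\<close>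

definition orth_seq :: "(nat \<Rightarrow> 'h::real_inner op) \<Rightarrow> bool" where
  "orth_seq P \<longleftrightarrow> (\<forall>n. orth_proj (P n)) \<and> (\<forall>m n. m \<noteq> n \<longrightarrow> (\<forall>x. P m (P n x) = 0))"

lemma orth_seqD:
  "orth_seq P \<Longrightarrow> orth_proj (P n)"
  "orth_seq P \<Longrightarrow> m \<noteq> n \<Longrightarrow> P m (P n x) = 0"
  by (auto simp: orth_seq_def)

lemma orth_seq_sum_norm:
  fixes P :: "nat \<Rightarrow> 'h::real_inner op"
  assumes "orth_seq P" "finite I"
  shows "orth_proj (\<Sum>i\<in>I. P i)" "(norm (\<Sum>i\<in>I. P i x))\<^sup>2 = (\<Sum>i\<in>I. (norm (P i x))\<^sup>2)"
proof -
  have sa: "selfadj (\<Sum>i\<in>I. P i)"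
    using orth_proj_selfadj[OF orth_seqD(1)[OF assms(1)]]
    by (simp add: selfadj_def blinfun.sum_left inner_sum_left inner_sum_right)
  have "(\<Sum>i\<in>I. P i (\<Sum>j\<in>I. P j x)) = (\<Sum>i\<in>I. P i x)" for x
  proof (rule sum.cong[OF refl])
    fix i assume "i \<in> I"
    have "P i (\<Sum>j\<in>I. P j x) = (\<Sum>j\<in>I. if j = i then P i x else 0)"
      unfolding blinfun.sum_right
      using orth_seqD[OF assms(1)] by (intro sum.cong refl) (auto simp: orth_proj_idem)
    then show "P i (\<Sum>j\<in>I. P j x) = P i x" using \<open>i \<in> I\<close> assms(2) by simp
  qed
  then show *: "orth_proj (\<Sum>i\<in>I. P i)" using sa by (simp add: orth_proj_def blinfun.sum_left)
  have "(norm (\<Sum>i\<in>I. P i x))\<^sup>2 = (\<Sum>i\<in>I. P i x) \<bullet> x"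
    using orth_proj_inner[OF *, of x] by (simp add: blinfun.sum_left)
  also have "\<dots> = (\<Sum>i\<in>I. (norm (P i x))\<^sup>2)"
    using orth_seqD(1)[OF assms(1)] by (simp add: inner_sum_left orth_proj_inner)
  finally show "(norm (\<Sum>i\<in>I. P i x))\<^sup>2 = (\<Sum>i\<in>I. (norm (P i x))\<^sup>2)" .
qed

text \<open>The partial sums are increasing projections below the identity, so they converge
  strongly; multiplying the series by one term leaves only that term.\<close>

lemma orth_seq_sums:
  fixes P :: "nat \<Rightarrow> 'h::real_hilbert op"
  assumes "orth_seq P"
  shows "\<exists>S::'h op. orth_proj S \<and> (\<forall>x. (\<lambda>n. P n x) sums S x) \<and> (\<forall>n x. S (P n x) = P n x) \<and>
      (\<forall>n x. P n (S x) = P n x)"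
proof -
  define T where "T n = (\<Sum>i<n. P i)" for n
  have Tp: "orth_proj (T n)" for n unfolding T_def using orth_seq_sum_norm[OF assms] by simp
  have "\<exists>S::'h op. selfadj S \<and> (\<forall>x. (\<lambda>n. T n x) \<longlonglongrightarrow> S x) \<and> (\<forall>n x. T n x \<bullet> x \<le> S x \<bullet> x)"
  proof (rule monotone_strong_limit[where K = 1])
    show "selfadj (T n)" for n by (rule orth_proj_selfadj[OF Tp])
    show "T n x \<bullet> x \<le> T (Suc n) x \<bullet> x" for n x
      using orth_proj_inner[OF orth_seqD(1)[OF assms], of n x]
      by (simp add: T_def blinfun.bilinear_simps inner_add_left)
    show "T n x \<bullet> x \<le> 1 * (norm x)\<^sup>2" for n x
      using orth_proj_inner[OF Tp, of n x] orth_proj_norm_le[OF Tp, of n x] by (simp add: power_mono)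
  qed
  then obtain S :: "'h op" where S: "selfadj S" "\<And>x. (\<lambda>n. T n x) \<longlonglongrightarrow> S x" by blast
  have sm: "(\<lambda>n. P n x) sums S x" for x
    using S(2)[of x] by (simp add: sums_def T_def blinfun.sum_left)
  have PS: "P n (S x) = P n x" for n x
  proof (rule LIMSEQ_unique)
    show "(\<lambda>m. P n (T m x)) \<longlonglongrightarrow> P n (S x)" by (intro blinfun.tendsto tendsto_const S)
    have "P n (T m x) = P n x" if "m > n" for m
    proof -
      have "P n (T m x) = (\<Sum>j<m. if j = n then P n x else 0)"
        unfolding T_def blinfun.sum_left blinfun.sum_right
        using orth_seqD[OF assms] by (intro sum.cong refl) (auto simp: orth_proj_idem)
      then show ?thesis using that by simp
    qed
    then show "(\<lambda>m. P n (T m x)) \<longlonglongrightarrow> P n x"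
      by (intro tendsto_eventually eventually_sequentiallyI[of "Suc n"]) simp
  qed
  have SP: "S (P n x) = P n x" for n x
  proof (rule inner_eqI)
    fix z
    show "S (P n x) \<bullet> z = P n x \<bullet> z"
      using PS[of n z] selfadjD[OF S(1)] selfadjD[OF orth_proj_selfadj[OF orth_seqD(1)[OF assms]]] by metis
  qed
  have "S (S x) = S x" for x
    using sm[of "S x"] sm[of x] by (simp add: PS sums_unique2)
  then show ?thesis using S(1) sm PS SP by (auto simp: orth_proj_def)
qed

text \<open>The ranges of the \<open>V\<^sub>n\<close> being orthogonal, \<open>\<parallel>\<Sum> V\<^sub>n x\<parallel>\<^sup>2 = \<Sum> \<parallel>P\<^sub>n x\<parallel>\<^sup>2\<close>.\<close>

lemma pisom_sums_aux:
  fixes V :: "nat \<Rightarrow> 'h::real_hilbert op"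
  assumes V: "\<And>n. pisom (V n) (P n) (Q n)" and P: "orth_seq P" and Q: "orth_seq Q"
  shows "\<exists>W::'h op. \<forall>x. (\<lambda>n. V n x) sums W x"
proof -
  obtain S :: "'h op" where S: "orth_proj S" "\<And>x. (\<lambda>n. P n x) sums S x"
    using orth_seq_sums[OF P] by blast
  have orth: "V m x \<bullet> V n y = 0" if "m \<noteq> n" for m n x y
  proof -
    have "V m x \<bullet> V n y = Q m (V m x) \<bullet> Q n (V n y)" by (simp add: pisomD(6)[OF V])
    also have "\<dots> = V m x \<bullet> Q m (Q n (V n y))"
      by (rule selfadjD[OF orth_proj_selfadj[OF orth_seqD(1)[OF Q]]])
    finally show ?thesis using orth_seqD(2)[OF Q that] by simp
  qed
  have nrm: "(norm (\<Sum>i\<in>I. V i x))\<^sup>2 = (\<Sum>i\<in>I. (norm (P i x))\<^sup>2)" if "finite I" for I x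
    using that
  proof (induction I rule: finite_induct)
    case (insert i I)
    have "V i x \<bullet> (\<Sum>j\<in>I. V j x) = 0"
      using insert orth[of i] unfolding inner_sum_right by (intro sum.neutral) metis
    then have "(norm (V i x + (\<Sum>j\<in>I. V j x)))\<^sup>2 = (norm (V i x))\<^sup>2 + (norm (\<Sum>j\<in>I. V j x))\<^sup>2"
      by (simp add: power2_norm_eq_inner inner_add_left inner_add_right inner_commute)
    then show ?case using insert by (simp add: pisomD(9)[OF V])
  qed simp
  have nrm': "norm (\<Sum>i\<in>I. V i x) = norm (\<Sum>i\<in>I. P i x)" if "finite I" for I x
    using nrm[OF that, of x] orth_seq_sum_norm(2)[OF P that, of x]
    by (metis norm_ge_zero power2_eq_imp_eq)
  define T where "T n = (\<Sum>i<n. V i)" for n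
  have "\<exists>W::'h op. \<forall>x. (\<lambda>n. T n x) \<longlonglongrightarrow> W x"
  proof (rule strong_limit_exists[where K = 1])
    fix n x
    show "norm (T n x) \<le> 1 * norm x"
      using nrm'[of "{..<n}" x] orth_proj_norm_le[OF orth_seq_sum_norm(1)[OF P, of "{..<n}"], of x]
      by (simp add: T_def blinfun.sum_left)
    have "Cauchy (\<lambda>n. \<Sum>i<n. P i x)"
      using S(2)[of x] by (intro convergent_Cauchy) (auto simp: sums_def convergent_def)
    then have "Cauchy (\<lambda>n. T n x)"
    proof (clarsimp simp: Cauchy_altdef)
      fix e :: real
      assume a: "\<forall>e>0. \<exists>M. \<forall>m\<ge>M. \<forall>n>m. dist (\<Sum>i<m. P i x) (\<Sum>i<n. P i x) < e" and "0 < e"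
      then obtain M where M: "\<And>m n. m \<ge> M \<Longrightarrow> n > m \<Longrightarrow> dist (\<Sum>i<m. P i x) (\<Sum>i<n. P i x) < e"
        by meson
      have "dist (T m x) (T n x) < e" if "m \<ge> M" "n > m" for m n
      proof -
        have *: "(\<Sum>i<n. f i) - (\<Sum>i<m. f i) = (\<Sum>i=m..<n. f i)" for f :: "nat \<Rightarrow> 'h"
          using sum.atLeastLessThan_concat[of 0 m n f] that by (simp add: atLeast0LessThan algebra_simps)
        show ?thesis
          using M[OF that] nrm'[of "{m..<n}" x]
          by (simp add: T_def blinfun.sum_left dist_norm norm_minus_commute[of "\<Sum>i<m. _ i"] *)
      qed
      then show "\<exists>M. \<forall>m\<ge>M. \<forall>n>m. dist (T m x) (T n x) < e" by blast
    qed
    then show "convergent (\<lambda>n. T n x)" by (rule Cauchy_convergent)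
  qed
  then show ?thesis by (simp add: T_def sums_def blinfun.sum_left)
qed

text \<open>Strong convergence does not pass to adjoints in general; here the adjoint series
  converges by the same argument with P and Q exchanged. The last two identities recover a block
  from the sum on either side.\<close>

lemma pisom_sums:
  fixes V P Q :: "nat \<Rightarrow> 'h::real_hilbert op"
  assumes V: "\<And>n. pisom (V n) (P n) (Q n)" and P: "orth_seq P" and Q: "orth_seq Q"
  shows "\<exists>W S R::'h op. pisom W S R \<and> (\<forall>x. (\<lambda>n. V n x) sums W x) \<and>
     (\<forall>x. (\<lambda>n. hadj (V n) x) sums hadj W x) \<and>
     (\<forall>x. (\<lambda>n. P n x) sums S x) \<and> (\<forall>x. (\<lambda>n. Q n x) sums R x) \<and>
     (\<forall>n x. W (P n x) = V n x) \<and> (\<forall>n x. Q n (W x) = V n x)"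
proof -
  obtain W :: "'h op" where W: "\<And>x. (\<lambda>n. V n x) sums W x" using pisom_sums_aux[OF V P Q] by blast
  obtain W' :: "'h op" where W': "\<And>x. (\<lambda>n. hadj (V n) x) sums W' x"
    using pisom_sums_aux[OF pisom_hadj[OF V] Q P] by blast
  obtain S :: "'h op" where S: "orth_proj S" "\<And>x. (\<lambda>n. P n x) sums S x" using orth_seq_sums[OF P] by blast
  obtain R :: "'h op" where R: "orth_proj R" "\<And>x. (\<lambda>n. Q n x) sums R x" using orth_seq_sums[OF Q] by blast
  have hW: "hadj W = W'"
  proof (rule hadj_unique)
    fix x y
    have "(\<lambda>n. V n x \<bullet> y) sums (W x \<bullet> y)"
      by (rule bounded_linear.sums[OF bounded_linear_inner_left W])
    moreover have "(\<lambda>n. V n x \<bullet> y) sums (x \<bullet> W' y)"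
      using bounded_linear.sums[OF bounded_linear_inner_right W'] by (simp add: hadj)
    ultimately show "W x \<bullet> y = x \<bullet> W' y" by (rule sums_unique2)
  qed
  have QW: "Q n (W x) = V n x" for n x
  proof (rule sums_unique2)
    show "(\<lambda>m. Q n (V m x)) sums Q n (W x)"
      by (rule bounded_linear.sums[OF blinfun.bounded_linear_right W])
    have "Q n (V m x) = 0" if "m \<noteq> n" for m
      using orth_seqD(2)[OF Q, of n m "V m x"] that by (simp add: pisomD(6)[OF V])
    then show "(\<lambda>m. Q n (V m x)) sums V n x"
      using sums_finite[of "{n}" "\<lambda>m. Q n (V m x)"] by (simp add: pisomD(6)[OF V])
  qed
  have VV: "hadj (V n) (W x) = P n x" for n x
    by (metis QW pisomD(3,7) V)
  have WP: "W (P n x) = V n x" for n x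
  proof (rule sums_unique2)
    show "(\<lambda>m. V m (P n x)) sums W (P n x)" by (rule W)
    have "V m (P n x) = 0" if "m \<noteq> n" for m
      using orth_seqD(2)[OF P that, of x] pisomD(5)[OF V, of m "P n x"] by simp
    then show "(\<lambda>m. V m (P n x)) sums V n x"
      using sums_finite[of "{n}" "\<lambda>m. V m (P n x)"] by (simp add: pisomD(5)[OF V])
  qed
  have "hadj W (W x) = S x" for x
    using W'[of "W x"] S(2)[of x] by (simp add: hW VV sums_unique2)
  moreover have "W (hadj W x) = R x" for x
  proof (rule sums_unique2)
    show "(\<lambda>n. W (hadj (V n) x)) sums W (hadj W x)"
      unfolding hW by (rule bounded_linear.sums[OF blinfun.bounded_linear_right W'])
    have "W (hadj (V n) x) = Q n x" for n
      by (metis WP pisomD(4,8) V)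
    then show "(\<lambda>n. W (hadj (V n) x)) sums R x" using R(2) by simp
  qed
  ultimately have "pisom W S R" using S R by (simp add: pisom_def)
  then show ?thesis using W W' S R WP QW hW by blast
qed

subsection \<open>Square roots and sign projections\<close>

definition commutes :: "'h::real_inner op \<Rightarrow> 'h op \<Rightarrow> bool" where
  "commutes X Y \<longleftrightarrow> (\<forall>x. X (Y x) = Y (X x))"

text \<open>Membership of Z in the bicommutant of T, taken among all bounded real-linear operators.
  Recording it for square roots and spectral projections puts them into every von Neumann algebra
  that contains T.\<close>

definition bicommutes :: "'h::real_inner op \<Rightarrow> 'h op \<Rightarrow> bool" where
  "bicommutes T Z \<longleftrightarrow> (\<forall>X. commutes X T \<longrightarrow> commutes X Z)"

lemma commutesD: "commutes X Y \<Longrightarrow> X (Y x) = Y (X x)"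
  by (simp add: commutes_def)

lemma commutes_sym: "commutes X Y \<longleftrightarrow> commutes Y X"
  by (metis commutes_def)

lemma commutes_self [simp]: "commutes X X" "commutes X id_blinfun" "commutes id_blinfun X"
  "commutes X 0" "commutes 0 X"
  by (auto simp: commutes_def)

lemma commutes_intros:
  "commutes X Y \<Longrightarrow> commutes X Z \<Longrightarrow> commutes X (Y + Z)"
  "commutes X Y \<Longrightarrow> commutes X Z \<Longrightarrow> commutes X (Y - Z)"
  "commutes X Y \<Longrightarrow> commutes X (r *\<^sub>R Y)"
  "commutes X Y \<Longrightarrow> commutes X Z \<Longrightarrow> commutes X (Y o\<^sub>L Z)"
  by (auto simp: commutes_def blinfun.bilinear_simps)

lemma commutes_hadj: "commutes X Y \<Longrightarrow> commutes (hadj X) (hadj Y)"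
  unfolding commutes_def
proof (intro allI, rule inner_eqI)
  fix x z assume "\<forall>x. X (Y x) = Y (X x)"
  then show "hadj X (hadj Y x) \<bullet> z = hadj Y (hadj X x) \<bullet> z" by (simp add: hadj')
qed

lemma commutes_strong_limit:
  fixes T :: "nat \<Rightarrow> 'h::real_inner op" and X S :: "'h op"
  assumes "\<And>n. commutes X (T n)" "\<And>x. (\<lambda>n. T n x) \<longlonglongrightarrow> S x"
  shows "commutes X S"
  unfolding commutes_def
proof (intro allI, rule LIMSEQ_unique)
  fix x
  show "(\<lambda>n. X (T n x)) \<longlonglongrightarrow> X (S x)" by (intro blinfun.tendsto tendsto_const assms)
  show "(\<lambda>n. X (T n x)) \<longlonglongrightarrow> S (X x)" using assms by (simp add: commutes_def)
qed

lemma commutes_sums: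
  fixes T :: "nat \<Rightarrow> 'h::real_inner op" and X S :: "'h op"
  assumes "\<And>n. commutes X (T n)" "\<And>x. (\<lambda>n. T n x) sums S x"
  shows "commutes X S"
  unfolding commutes_def
proof (intro allI, rule sums_unique2)
  fix x
  show "(\<lambda>n. X (T n x)) sums X (S x)"
    by (rule bounded_linear.sums[OF blinfun.bounded_linear_right assms(2)])
  show "(\<lambda>n. X (T n x)) sums S (X x)" using assms by (simp add: commutes_def)
qed

text \<open>Polynomials in X with nonnegative coefficients. For positive X they are positive and
  commute with each other, so the cone supplies the order facts for the square root
  iteration.\<close>

inductive_set pcone :: "'h::real_inner op \<Rightarrow> 'h op set" for X where
  zero: "0 \<in> pcone X"
| one: "id_blinfun \<in> pcone X"
| add: "Y \<in> pcone X \<Longrightarrow> Z \<in> pcone X \<Longrightarrow> Y + Z \<in> pcone X"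
| scale: "r \<ge> 0 \<Longrightarrow> Y \<in> pcone X \<Longrightarrow> r *\<^sub>R Y \<in> pcone X"
| mult: "Y \<in> pcone X \<Longrightarrow> X o\<^sub>L Y \<in> pcone X"

lemma pcone_compose: "Y \<in> pcone X \<Longrightarrow> Z \<in> pcone X \<Longrightarrow> Y o\<^sub>L Z \<in> pcone X"
proof (induction Y rule: pcone.induct)
  case zero
  have "0 o\<^sub>L Z = 0" by (rule blinfun_eqI) simp
  then show ?case by (simp add: pcone.zero)
next
  case one
  have "id_blinfun o\<^sub>L Z = Z" by (rule blinfun_eqI) simp
  then show ?case using one by simp
next
  case (add Y Y')
  have "(Y + Y') o\<^sub>L Z = (Y o\<^sub>L Z) + (Y' o\<^sub>L Z)" by (rule blinfun_eqI) (simp add: blinfun.add_left)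
  then show ?case using add by (simp add: pcone.add)
next
  case (scale r Y)
  have "(r *\<^sub>R Y) o\<^sub>L Z = r *\<^sub>R (Y o\<^sub>L Z)" by (rule blinfun_eqI) (simp add: blinfun.scaleR_left)
  then show ?case using scale by (simp add: pcone.scale)
next
  case (mult Y)
  have "(X o\<^sub>L Y) o\<^sub>L Z = X o\<^sub>L (Y o\<^sub>L Z)" by (rule blinfun_eqI) simp
  then show ?case using mult by (simp add: pcone.mult)
qed

lemma pcone_commutes: "Y \<in> pcone X \<Longrightarrow> commutes W X \<Longrightarrow> commutes W Y"
  by (induction Y rule: pcone.induct) (auto intro: commutes_intros)

lemma psdI:
  fixes T :: "'h::real_inner op"
  shows "(\<And>x y. T x \<bullet> y = x \<bullet> T y) \<Longrightarrow> (\<And>x. 0 \<le> T x \<bullet> x) \<Longrightarrow> psd T"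
  by (simp add: psd_def selfadj_def)

lemma psd_add: "psd S \<Longrightarrow> psd T \<Longrightarrow> psd (S + T)"
  by (rule psdI; simp add: blinfun.add_left inner_add_left inner_add_right psd_nonneg)
    (simp add: selfadjD[OF psd_selfadj])

lemma psd_scaleR: "psd S \<Longrightarrow> r \<ge> 0 \<Longrightarrow> psd (r *\<^sub>R S)"
  by (rule psdI) (simp_all add: blinfun.scaleR_left psd_nonneg, simp add: selfadjD[OF psd_selfadj])

lemma psd_0 [simp]: "psd 0" and psd_id [simp]: "psd id_blinfun"
  by (auto simp: psd_def selfadj_def)

lemma psd_conj:
  assumes "psd T" shows "psd (hadj X o\<^sub>L T o\<^sub>L X)"
proof (rule psdI)
  fix x y
  show "(hadj X o\<^sub>L T o\<^sub>L X) x \<bullet> y = x \<bullet> (hadj X o\<^sub>L T o\<^sub>L X) y"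
    using selfadjD[OF psd_selfadj[OF assms], of "X x" "X y"] by (simp add: hadj' hadj[of X])
  show "0 \<le> (hadj X o\<^sub>L T o\<^sub>L X) x \<bullet> x"
    using psd_nonneg[OF assms, of "X x"] by (simp add: hadj')
qed

text \<open>The induction must carry \<open>X o\<^sub>L Y\<close> along with Y: after the next
  multiplication by X, one X is moved across the inner product, which leaves the form of Y at
  \<open>X x\<close>.\<close>

lemma pcone_psd: 
  assumes "psd X" "Y \<in> pcone X" shows "psd Y \<and> psd (X o\<^sub>L Y)"
  using assms(2)
proof (induction Y rule: pcone.induct)
  case zero
  have "X o\<^sub>L 0 = 0" by (rule blinfun_eqI) simp
  then show ?case by simp
next
  case one
  have "X o\<^sub>L id_blinfun = X" by (rule blinfun_eqI) simp
  then show ?case using assms by simp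
next
  case (add Y Z)
  have "X o\<^sub>L (Y + Z) = (X o\<^sub>L Y) + (X o\<^sub>L Z)"
    by (rule blinfun_eqI) (simp add: blinfun.bilinear_simps)
  then show ?case using add by (simp add: psd_add)
next
  case (scale r Y)
  have "X o\<^sub>L (r *\<^sub>R Y) = r *\<^sub>R (X o\<^sub>L Y)" by (rule blinfun_eqI) (simp add: blinfun.bilinear_simps)
  then show ?case using scale by (simp add: psd_scaleR)
next
  case (mult Y)
  have c: "commutes X Y" using pcone_commutes[OF mult(1)] by simp
  have sX: "selfadj X" and sY: "selfadj Y" using assms(1) mult by (auto simp: psd_selfadj)
  have "psd (X o\<^sub>L (X o\<^sub>L Y))"
    unfolding psd_def selfadj_def
  proof (intro conjI allI)
    fix x y
    show "(X o\<^sub>L (X o\<^sub>L Y)) x \<bullet> y = x \<bullet> (X o\<^sub>L (X o\<^sub>L Y)) y"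
      using c by (simp add: commutes_def selfadjD[OF sX] selfadjD[OF sY])
    have "(X o\<^sub>L (X o\<^sub>L Y)) x \<bullet> x = X (Y x) \<bullet> X x"
      by (simp add: selfadjD[OF sX])
    also have "X (Y x) = Y (X x)" by (rule commutesD[OF c])
    finally have "(X o\<^sub>L (X o\<^sub>L Y)) x \<bullet> x = Y (X x) \<bullet> X x" .
    then show "0 \<le> (X o\<^sub>L (X o\<^sub>L Y)) x \<bullet> x" using psd_nonneg mult.IH by metis
  qed
  then show ?case using mult by simp
qed

text \<open>A fixed point S satisfies (1 - S)^2 = 1 - X, so for X = 1 - T the limit yields the root
  1 - S of T.\<close>

fun sqrt_iter :: "'h::real_inner op \<Rightarrow> nat \<Rightarrow> 'h op" where
  "sqrt_iter X 0 = 0"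
| "sqrt_iter X (Suc n) = (1/2) *\<^sub>R (X + (sqrt_iter X n o\<^sub>L sqrt_iter X n))"

lemma sqrt_iter_pcone: "sqrt_iter X n \<in> pcone X"
proof (induction n)
  case (Suc n)
  have "X o\<^sub>L id_blinfun = X" by (rule blinfun_eqI) simp
  then have "X \<in> pcone X" using pcone.mult[OF pcone.one] by metis
  then show ?case using Suc by (auto intro!: pcone.scale pcone.add pcone_compose)
qed (simp add: pcone.zero)

text \<open>All iterates commute, so the next difference is half of the product (Z - Y)(Z + Y) of
  two members of the cone. Positivity of the differences is the monotonicity of the
  iteration.\<close>

lemma sqrt_iter_diff: "sqrt_iter X (Suc n) - sqrt_iter X n \<in> pcone X"
proof (induction n)
  case 0
  have "X o\<^sub>L id_blinfun = X" by (rule blinfun_eqI) simp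
  then have "X \<in> pcone X" using pcone.mult[OF pcone.one] by metis
  moreover have "(1/2) *\<^sub>R (X + (0 o\<^sub>L 0)) - 0 = (1/2) *\<^sub>R X"
    by (rule blinfun_eqI) (simp add: blinfun.bilinear_simps)
  ultimately show ?case by (simp add: pcone.scale)
next
  case (Suc n)
  define Y Z where "Y = sqrt_iter X n" and "Z = sqrt_iter X (Suc n)"
  have "commutes Y Z"
    unfolding Y_def Z_def by (intro pcone_commutes[OF sqrt_iter_pcone]) 
      (metis commutes_sym commutes_self(1) pcone_commutes sqrt_iter_pcone)
  then have "(1/2) *\<^sub>R (X + (Z o\<^sub>L Z)) - (1/2) *\<^sub>R (X + (Y o\<^sub>L Y)) = (1/2) *\<^sub>R ((Z - Y) o\<^sub>L (Z + Y))"
    by (intro blinfun_eqI) (simp add: blinfun.bilinear_simps commutes_def algebra_simps)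
  moreover have "(1/2) *\<^sub>R ((Z - Y) o\<^sub>L (Z + Y)) \<in> pcone X"
    using Suc unfolding Y_def Z_def
    by (intro pcone.scale pcone_compose pcone.add sqrt_iter_pcone) auto
  ultimately show ?case by (simp add: Y_def Z_def)
qed

lemma ex_sqrt_contraction:
  fixes T :: "'h::real_hilbert op"
  assumes "psd T" "\<And>x. T x \<bullet> x \<le> (norm x)\<^sup>2"
  shows "\<exists>R. psd R \<and> (\<forall>x. R (R x) = T x) \<and> bicommutes T R"
proof -
  define X where "X = id_blinfun - T"
  have X: "psd X" unfolding X_def
    by (rule psd_diffI) (auto simp: assms psd_selfadj power2_norm_eq_inner[symmetric])
  have Xn: "norm (X x) \<le> norm x" for x
  proof -
    have "norm X \<le> 1"
      by (rule psd_norm_le[OF X])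
        (auto simp: X_def blinfun.diff_left inner_diff_left psd_nonneg[OF assms(1)] power2_norm_eq_inner)
    then show ?thesis
      by (metis mult_1 mult_right_mono norm_blinfun norm_ge_zero order_trans)
  qed
  define Y where "Y = sqrt_iter X"
  have Yp: "psd (Y n)" for n using pcone_psd[OF X sqrt_iter_pcone] by (simp add: Y_def)
  have Yn: "norm (Y n x) \<le> norm x" for n x
  proof (induction n arbitrary: x)
    case (Suc n)
    have "norm (X x + Y n (Y n x)) \<le> norm x + norm x"
      using Xn[of x] Suc[of "Y n x"] Suc[of x] norm_triangle_ineq[of "X x" "Y n (Y n x)"] by linarith
    then show ?case by (simp add: Y_def blinfun.bilinear_simps)
  qed (simp add: Y_def)
  have "\<exists>S::'h op. selfadj S \<and> (\<forall>x. (\<lambda>n. Y n x) \<longlonglongrightarrow> S x) \<and> (\<forall>n x. Y n x \<bullet> x \<le> S x \<bullet> x)"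
  proof (rule monotone_strong_limit[where K = 1])
    show "selfadj (Y n)" for n by (rule psd_selfadj[OF Yp])
    show "Y n x \<bullet> x \<le> Y (Suc n) x \<bullet> x" for n x
      using psd_nonneg[OF conjunct1[OF pcone_psd[OF X sqrt_iter_diff]], of n x]
      unfolding Y_def blinfun.diff_left inner_diff_left by simp
    show "Y n x \<bullet> x \<le> 1 * (norm x)\<^sup>2" for n x
      using norm_cauchy_schwarz[of "Y n x" x] mult_right_mono[OF Yn[of n x], of "norm x"]
      by (simp add: power2_eq_square)
  qed
  then obtain S :: "'h op" where S: "selfadj S" "\<And>x. (\<lambda>n. Y n x) \<longlonglongrightarrow> S x" by blast
  have YY: "(\<lambda>n. Y n (Y n x)) \<longlonglongrightarrow> S (S x)" for x
  proof -
    \<comment> \<open>The iterates are contractions, which is what allows a strong limit to be taken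
      in the product.\<close>
    have "(\<lambda>n. Y n (Y n x - S x)) \<longlonglongrightarrow> 0"
    proof (rule tendsto_norm_zero_cancel, rule real_tendsto_sandwich)
      show "\<forall>\<^sub>F n in sequentially. 0 \<le> norm (Y n (Y n x - S x))" by simp
      show "\<forall>\<^sub>F n in sequentially. norm (Y n (Y n x - S x)) \<le> norm (Y n x - S x)" using Yn by simp
      show "(\<lambda>n. norm (Y n x - S x)) \<longlonglongrightarrow> 0"
        using S(2)[of x] by (intro tendsto_norm_zero) (simp add: LIM_zero_iff)
    qed simp
    then have "(\<lambda>n. Y n (Y n x - S x) + Y n (S x)) \<longlonglongrightarrow> 0 + S (S x)"
      by (intro tendsto_add S(2))
    then show ?thesis by (simp add: blinfun.bilinear_simps)
  qed
  have fix_S: "S x = (1/2) *\<^sub>R (X x + S (S x))" for x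
  proof (rule LIMSEQ_unique)
    show "(\<lambda>n. Y (Suc n) x) \<longlonglongrightarrow> S x" using S(2) by (rule LIMSEQ_Suc)
    have "(\<lambda>n. (1/2) *\<^sub>R (X x + Y n (Y n x))) \<longlonglongrightarrow> (1/2) *\<^sub>R (X x + S (S x))"
      by (intro tendsto_intros YY)
    then show "(\<lambda>n. Y (Suc n) x) \<longlonglongrightarrow> (1/2) *\<^sub>R (X x + S (S x))"
      by (simp add: Y_def blinfun.bilinear_simps)
  qed
  define R where "R = id_blinfun - S"
  have "R (R x) = T x" for x
  proof -
    have "R (R x) = x - S x - S x + S (S x)" by (simp add: R_def blinfun.bilinear_simps)
    moreover have "S x + S x = X x + S (S x)"
    proof -
      have "S x + S x = (2::real) *\<^sub>R S x" by (simp add: scaleR_2)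
      also have "\<dots> = X x + S (S x)" by (subst fix_S) simp
      finally show ?thesis .
    qed
    ultimately show ?thesis by (simp add: X_def blinfun.bilinear_simps algebra_simps)
  qed
  moreover have "psd R" unfolding R_def
  proof (rule psd_diffI)
    fix x
    have "S x \<bullet> x \<le> norm (S x) * norm x" by (rule norm_cauchy_schwarz)
    also have "norm (S x) \<le> norm x"
      using Yn by (intro LIMSEQ_le_const2[OF tendsto_norm[OF S(2)]]) auto
    finally show "S x \<bullet> x \<le> id_blinfun x \<bullet> x"
      by (simp add: mult_right_mono power2_norm_eq_inner[symmetric] power2_eq_square)
  qed (use S(1) in \<open>auto simp: selfadj_def\<close>)
  moreover have "bicommutes T R"
    unfolding bicommutes_def
  proof (intro allI impI)
    fix W assume "commutes W T"
    then have "commutes W X" unfolding X_def by (intro commutes_intros) auto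
    then have "commutes W (Y n)" for n unfolding Y_def by (rule pcone_commutes[OF sqrt_iter_pcone])
    then have "commutes W S" by (rule commutes_strong_limit[OF _ S(2)])
    then show "commutes W R" unfolding R_def by (intro commutes_intros) auto
  qed
  ultimately show ?thesis by blast
qed

lemma ex_psd_sqrt:
  fixes T :: "'h::real_hilbert op"
  assumes "psd T"
  shows "\<exists>R. psd R \<and> (\<forall>x. R (R x) = T x) \<and> bicommutes T R"
proof -
  define K where "K = norm T + 1"
  have K: "K > 0" by (simp add: K_def add_nonneg_pos)
  have "psd ((1/K) *\<^sub>R T)" using assms K by (intro psd_scaleR) auto
  moreover have "((1/K) *\<^sub>R T) x \<bullet> x \<le> (norm x)\<^sup>2" for x
  proof -
    have "T x \<bullet> x \<le> norm T * (norm x)\<^sup>2" by (rule psd_le_norm)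
    also have "\<dots> \<le> K * (norm x)\<^sup>2" by (intro mult_right_mono) (auto simp: K_def)
    finally show ?thesis using K by (simp add: blinfun.bilinear_simps field_simps)
  qed
  ultimately obtain R where R: "psd R" "\<And>x. R (R x) = ((1/K) *\<^sub>R T) x" "bicommutes ((1/K) *\<^sub>R T) R"
    using ex_sqrt_contraction by metis
  have "psd (sqrt K *\<^sub>R R)" using R K by (intro psd_scaleR) auto
  moreover have "(sqrt K *\<^sub>R R) ((sqrt K *\<^sub>R R) x) = T x" for x
    using K by (simp add: blinfun.bilinear_simps R)
  moreover have "bicommutes T (sqrt K *\<^sub>R R)"
    using R(3) by (simp add: bicommutes_def commutes_intros)
  ultimately show ?thesis by blast
qed

lemma proj_on_commutes:
  fixes X :: "'h::real_hilbert op"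
  assumes "closed L" "subspace L" "\<And>x. x \<in> L \<Longrightarrow> X x \<in> L" "\<And>x. x \<in> L \<Longrightarrow> hadj X x \<in> L"
  shows "commutes X (proj_on L)"
  unfolding commutes_def
proof (intro allI, rule inner_eqI)
  fix x z
  define N where "N = proj_on L"
  have N: "orth_proj N" and NL: "\<And>x. N x \<in> L" and Nid: "\<And>x. x \<in> L \<Longrightarrow> N x = x"
    using proj_on[OF assms(1,2)] proj_on_eq[OF assms(1,2)] by (auto simp: N_def)
  note sa = selfadjD[OF orth_proj_selfadj[OF N]]
  have "X (N x) \<bullet> z = X (N x) \<bullet> N z" by (simp add: sa[symmetric] Nid assms NL)
  also have "\<dots> = N x \<bullet> hadj X (N z)" by (rule hadj)
  also have "\<dots> = x \<bullet> hadj X (N z)" by (simp add: sa Nid assms NL)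
  also have "\<dots> = X x \<bullet> N z" by (simp add: hadj)
  also have "\<dots> = N (X x) \<bullet> z" by (simp add: sa)
  finally show "X (proj_on L x) \<bullet> z = proj_on L (X x) \<bullet> z" by (simp add: N_def)
qed

lemma kernel_closed_subspace:
  fixes T :: "'h::real_inner op"
  shows "closed {x. T x = 0}" "subspace {x. T x = 0}"
proof -
  show "closed {x. T x = 0}" by (intro closed_Collect_eq continuous_intros)
  show "subspace {x. T x = 0}" by (simp add: subspace_def blinfun.bilinear_simps)
qed

definition ker_proj :: "'h::real_hilbert op \<Rightarrow> 'h op" where
  "ker_proj T = proj_on {x. T x = 0}"

lemma ker_proj:
  fixes T :: "'h::real_hilbert op"
  shows "orth_proj (ker_proj T)" "T (ker_proj T x) = 0" "ker_proj T x = x \<longleftrightarrow> T x = 0"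
    "range (ker_proj T) = {x. T x = 0}"
  using proj_on[OF kernel_closed_subspace, of T] proj_on_eq[OF kernel_closed_subspace, of T]
  by (auto simp: ker_proj_def)

lemma ker_proj_bicommutes:
  fixes T :: "'h::real_hilbert op"
  assumes "selfadj T"
  shows "bicommutes T (ker_proj T)"
  unfolding bicommutes_def ker_proj_def
proof (intro allI impI)
  fix X assume c: "commutes X T"
  then have c': "commutes (hadj X) T"
    using commutes_hadj[OF c] assms by (simp add: selfadj_hadj)
  show "commutes X (proj_on {x. T x = 0})"
    by (rule proj_on_commutes[OF kernel_closed_subspace])
      (simp_all add: commutesD[OF c, symmetric] commutesD[OF c', symmetric])
qed

text \<open>With R the root of S squared, that is the absolute value of S, N projects onto the
  kernel of R + S. There S = -R; on the orthogonal complement S = R because (R + S)(R - S) = 0. The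
  null space of S lies in the range of N, which gives the strict inequality off N.\<close>

lemma ex_sign_proj:
  fixes S :: "'h::real_hilbert op"
  assumes "selfadj S"
  shows "\<exists>N. orth_proj N \<and> bicommutes S N \<and> (\<forall>x. N x = x \<longrightarrow> S x \<bullet> x \<le> 0) \<and>
    (\<forall>x. N x = 0 \<longrightarrow> x \<noteq> 0 \<longrightarrow> S x \<bullet> x > 0)"
proof -
  have "psd (S o\<^sub>L S)"
    by (rule psdI) (simp_all add: selfadjD[OF assms, of "S _"], simp add: selfadjD[OF assms, symmetric])
  then obtain R where R: "psd R" "\<And>x. R (R x) = S (S x)" "bicommutes (S o\<^sub>L S) R"
    using ex_psd_sqrt[of "S o\<^sub>L S"] by auto
  have bR: "bicommutes S R"
    using R(3) by (auto simp: bicommutes_def intro: commutes_intros)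
  then have RS: "R (S x) = S (R x)" for x by (metis bicommutes_def commutes_def commutes_self(1))
  define SP where "SP = R + S"
  have saP: "selfadj SP" using psd_selfadj[OF R(1)] assms
    by (simp add: SP_def selfadj_def blinfun.bilinear_simps inner_add_left inner_add_right)
  have bP: "bicommutes S SP" using bR by (auto simp: bicommutes_def SP_def intro: commutes_intros)
  define N where "N = ker_proj SP"
  have N: "orth_proj N" by (simp add: N_def ker_proj)
  have bN: "bicommutes S N" using ker_proj_bicommutes[OF saP] bP by (auto simp: bicommutes_def N_def)
  have NS: "N (S x) = S (N x)" for x using bN by (metis bicommutes_def commutes_def commutes_self(1))
  have NR: "N (R x) = R (N x)" for x
    using bN RS by (metis bicommutes_def commutes_def commutes_sym)
  have le: "S x \<bullet> x \<le> 0" if "N x = x" for x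
  proof -
    have "SP x = 0" using that by (simp add: N_def ker_proj)
    then have "S x = - R x" by (simp add: SP_def blinfun.bilinear_simps eq_neg_iff_add_eq_0 add.commute)
    then show ?thesis using psd_nonneg[OF R(1), of x] by simp
  qed
  have ge: "S x \<bullet> x > 0" if "N x = 0" "x \<noteq> 0" for x
  proof -
    have "SP (R x - S x) = 0"
      by (simp add: SP_def blinfun.bilinear_simps R RS)
    then have "N (R x - S x) = R x - S x" by (simp add: N_def ker_proj)
    then have "R x = S x" using that by (simp add: blinfun.bilinear_simps NR NS)
    then have "S x \<bullet> x \<ge> 0" using psd_nonneg[OF R(1), of x] by simp
    moreover have "S x \<bullet> x \<noteq> 0"
    proof
      assume "S x \<bullet> x = 0"
      then have "R x = 0" using \<open>R x = S x\<close> psd_zero_iff[OF R(1), of x] by simp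
      then have "SP x = 0" using \<open>R x = S x\<close> by (simp add: SP_def blinfun.bilinear_simps)
      then have "N x = x" by (simp add: N_def ker_proj)
      then show False using that by simp
    qed
    ultimately show ?thesis by simp
  qed
  show ?thesis using N bN le ge by blast
qed

subsection \<open>The spectral theorem for selfadjoint operators\<close>

text \<open>The spectral projection for the half-line up to and including l, pinned down by form
  bounds on its range and on the complement. The strict bound on the complement places an eigenvalue
  l inside the range and yields continuity from the right.\<close>

definition spec_fam :: "'h::real_hilbert op \<Rightarrow> real \<Rightarrow> 'h op" where
  "spec_fam T l = (SOME N. orth_proj N \<and> bicommutes T N \<and>
     (\<forall>x. N x = x \<longrightarrow> T x \<bullet> x \<le> l * (norm x)\<^sup>2) \<and>
     (\<forall>x. N x = 0 \<longrightarrow> x \<noteq> 0 \<longrightarrow> T x \<bullet> x > l * (norm x)\<^sup>2))"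

lemma spec_fam:
  fixes T :: "'h::real_hilbert op"
  assumes "selfadj T"
  shows "orth_proj (spec_fam T l)" "bicommutes T (spec_fam T l)"
    "spec_fam T l x = x \<Longrightarrow> T x \<bullet> x \<le> l * (norm x)\<^sup>2"
    "spec_fam T l x = 0 \<Longrightarrow> x \<noteq> 0 \<Longrightarrow> T x \<bullet> x > l * (norm x)\<^sup>2"
proof -
  define S where "S = T - l *\<^sub>R id_blinfun"
  have "selfadj S" using assms
    by (simp add: S_def selfadj_def blinfun.bilinear_simps inner_diff_left inner_diff_right)
  from ex_sign_proj[OF this] obtain N where N: "orth_proj N" "bicommutes S N"
    "\<forall>x. N x = x \<longrightarrow> S x \<bullet> x \<le> 0" "\<forall>x. N x = 0 \<longrightarrow> x \<noteq> 0 \<longrightarrow> S x \<bullet> x > 0"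
    by (elim exE conjE)
  have "commutes X S" if "commutes X T" for X
    unfolding S_def by (intro commutes_intros that) simp
  then have "bicommutes T N" using N(2) by (simp add: bicommutes_def)
  then have "\<exists>N. orth_proj N \<and> bicommutes T N \<and>
     (\<forall>x. N x = x \<longrightarrow> T x \<bullet> x \<le> l * (norm x)\<^sup>2) \<and>
     (\<forall>x. N x = 0 \<longrightarrow> x \<noteq> 0 \<longrightarrow> T x \<bullet> x > l * (norm x)\<^sup>2)"
    using N(1,3,4)
    by (intro exI[of _ N]) (auto simp: S_def blinfun.bilinear_simps inner_diff_left power2_norm_eq_inner)
  from someI_ex[OF this] show "orth_proj (spec_fam T l)" "bicommutes T (spec_fam T l)"
    "spec_fam T l x = x \<Longrightarrow> T x \<bullet> x \<le> l * (norm x)\<^sup>2"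
    "spec_fam T l x = 0 \<Longrightarrow> x \<noteq> 0 \<Longrightarrow> T x \<bullet> x > l * (norm x)\<^sup>2"
    unfolding spec_fam_def by blast+
qed

context
  fixes T :: "'h::real_hilbert op"
  assumes sa: "selfadj T"
begin

lemma sf_commute: "spec_fam T l (spec_fam T m x) = spec_fam T m (spec_fam T l x)"
  using spec_fam(2)[OF sa] by (metis bicommutes_def commutes_def commutes_self(1))

text \<open>A unit vector in the range for l and in the complement of the range for m would have
  form at most l and above m. The bounds at both ends of the spectrum follow the same
  scheme.\<close>

lemma sf_mono: "l \<le> m \<Longrightarrow> spec_fam T m (spec_fam T l x) = spec_fam T l x"
proof (rule ccontr)
  assume lm: "l \<le> m" and neq: "spec_fam T m (spec_fam T l x) \<noteq> spec_fam T l x"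
  define y where "y = spec_fam T l x - spec_fam T m (spec_fam T l x)"
  have y0: "y \<noteq> 0" using neq by (simp add: y_def)
  have "spec_fam T m y = 0" "spec_fam T l y = y"
    by (simp_all add: y_def blinfun.diff_right orth_proj_idem[OF spec_fam(1)[OF sa]] sf_commute[of l m])
  then have "T y \<bullet> y > m * (norm y)\<^sup>2" "T y \<bullet> y \<le> l * (norm y)\<^sup>2"
    using spec_fam(3,4)[OF sa] y0 by blast+
  moreover have "l * (norm y)\<^sup>2 \<le> m * (norm y)\<^sup>2" using lm by (intro mult_right_mono) auto
  ultimately show False by linarith
qed

lemma sf_mono': "l \<le> m \<Longrightarrow> spec_fam T l (spec_fam T m x) = spec_fam T l x"
  using sf_mono sf_commute by metis

lemma sf_norm_mono: "l \<le> m \<Longrightarrow> norm (spec_fam T l x) \<le> norm (spec_fam T m x)"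
  by (metis orth_proj_norm_le sf_mono' spec_fam(1)[OF sa])

lemma sf_low: "l < - norm T \<Longrightarrow> spec_fam T l x = 0"
proof (rule ccontr)
  assume l: "l < - norm T" and y0: "spec_fam T l x \<noteq> 0"
  define y where "y = spec_fam T l x"
  have "T y \<bullet> y \<le> l * (norm y)\<^sup>2"
    by (rule spec_fam(3)[OF sa]) (simp add: y_def orth_proj_idem[OF spec_fam(1)[OF sa]])
  moreover have "- (T y \<bullet> y) \<le> norm T * (norm y)\<^sup>2"
    using psd_le_norm[of "- T" y] by (simp add: blinfun.bilinear_simps)
  moreover have "l * (norm y)\<^sup>2 < - norm T * (norm y)\<^sup>2"
    using l y0 by (intro mult_strict_right_mono) (auto simp: y_def)
  ultimately show False by simp
qed

lemma sf_high: "norm T \<le> l \<Longrightarrow> spec_fam T l x = x"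
proof (rule ccontr)
  assume l: "norm T \<le> l" and neq: "spec_fam T l x \<noteq> x"
  define y where "y = x - spec_fam T l x"
  have "T y \<bullet> y > l * (norm y)\<^sup>2"
    using neq by (intro spec_fam(4)[OF sa])
      (auto simp: y_def blinfun.diff_right orth_proj_idem[OF spec_fam(1)[OF sa]])
  moreover have "T y \<bullet> y \<le> norm T * (norm y)\<^sup>2" by (rule psd_le_norm)
  moreover have "norm T * (norm y)\<^sup>2 \<le> l * (norm y)\<^sup>2" using l by (intro mult_right_mono) auto
  ultimately show False by simp
qed

text \<open>The decreasing projections converge at x to some q that lies in all their ranges. If q
  were not in the range for l, its part y outside would have form above l times its squared norm,
  but at most l + 1/(n+1) times it for every n.\<close>

lemma sf_right_limit: "(\<lambda>n. spec_fam T (l + 1 / real (Suc n)) x) \<longlonglongrightarrow> spec_fam T l x"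
proof -
  let ?m = "\<lambda>n. l + 1 / real (Suc n)" and ?E = "\<lambda>m. spec_fam T m"
  note pr = spec_fam(1)[OF sa]
  have "\<exists>S::'h op. selfadj S \<and> (\<forall>x. (\<lambda>n. (- ?E (?m n)) x) \<longlonglongrightarrow> S x) \<and>
      (\<forall>n x. (- ?E (?m n)) x \<bullet> x \<le> S x \<bullet> x)"
  proof (rule monotone_strong_limit[where K = 0])
    show "selfadj (- ?E (?m n))" for n
      using orth_proj_selfadj[OF pr, of "?m n"] by (simp add: selfadj_def blinfun.bilinear_simps)
    show "(- ?E (?m n)) x \<bullet> x \<le> (- ?E (?m (Suc n))) x \<bullet> x" for n x
      using sf_norm_mono[of "?m (Suc n)" "?m n" x]
      by (simp add: blinfun.bilinear_simps orth_proj_inner[OF pr] frac_le power_mono)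
    show "(- ?E (?m n)) x \<bullet> x \<le> 0 * (norm x)\<^sup>2" for n x
      by (simp add: blinfun.bilinear_simps orth_proj_inner[OF pr])
  qed
  then obtain S :: "'h op" where "\<And>x. (\<lambda>n. (- ?E (?m n)) x) \<longlonglongrightarrow> S x" by blast
  then have Q: "(\<lambda>n. ?E (?m n) x) \<longlonglongrightarrow> (- S) x" for x
    using tendsto_minus[of "\<lambda>n. (- ?E (?m n)) x" "S x" sequentially] by (simp add: blinfun.bilinear_simps)
  define q where "q = (- S) x"
  have Eq: "?E (?m n) q = q" for n
  proof (rule LIMSEQ_unique)
    show "(\<lambda>k. ?E (?m n) (?E (?m k) x)) \<longlonglongrightarrow> ?E (?m n) q"
      unfolding q_def by (intro blinfun.tendsto tendsto_const Q)
    have "?E (?m n) (?E (?m k) x) = ?E (?m k) x" if "k \<ge> n" for k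
      using that by (intro sf_mono) (simp add: frac_le)
    then have "\<forall>\<^sub>F k in sequentially. ?E (?m k) x = ?E (?m n) (?E (?m k) x)"
      by (intro eventually_sequentiallyI[of n]) (rule sym)
    then show "(\<lambda>k. ?E (?m n) (?E (?m k) x)) \<longlonglongrightarrow> q"
      using Q[of x] unfolding q_def by (rule Lim_transform_eventually[rotated])
  qed
  have "?E l q = ?E l x"
  proof (rule LIMSEQ_unique)
    show "(\<lambda>k. ?E l (?E (?m k) x)) \<longlonglongrightarrow> ?E l q"
      unfolding q_def by (intro blinfun.tendsto tendsto_const Q)
    show "(\<lambda>k. ?E l (?E (?m k) x)) \<longlonglongrightarrow> ?E l x" by (simp add: sf_mono')
  qed
  moreover have "?E l q = q"
  proof (rule ccontr)
    assume neq: "?E l q \<noteq> q"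
    define y where "y = q - ?E l q"
    have y0: "y \<noteq> 0" using neq by (simp add: y_def)
    have "T y \<bullet> y > l * (norm y)\<^sup>2"
      using y0 by (intro spec_fam(4)[OF sa]) (simp_all add: y_def blinfun.diff_right orth_proj_idem[OF pr])
    moreover have "T y \<bullet> y \<le> l * (norm y)\<^sup>2"
    proof (rule LIMSEQ_le_const)
      have "(\<lambda>n. ?m n * (norm y)\<^sup>2) \<longlonglongrightarrow> (l + 0) * (norm y)\<^sup>2"
        using LIMSEQ_inverse_real_of_nat by (intro tendsto_intros) (simp add: inverse_eq_divide)
      then show "(\<lambda>n. ?m n * (norm y)\<^sup>2) \<longlonglongrightarrow> l * (norm y)\<^sup>2" by simp
      have "T y \<bullet> y \<le> ?m n * (norm y)\<^sup>2" for n
      proof (rule spec_fam(3)[OF sa])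
        show "?E (?m n) y = y"
          unfolding y_def blinfun.diff_right Eq by (subst sf_mono) simp_all
      qed
      then show "\<exists>N. \<forall>n\<ge>N. T y \<bullet> y \<le> ?m n * (norm y)\<^sup>2" by blast
    qed
    ultimately show False by simp
  qed
  ultimately show ?thesis using Q[of x] by (simp add: q_def)
qed

abbreviation sfn :: "'h \<Rightarrow> real \<Rightarrow> real" where "sfn x l \<equiv> (norm (spec_fam T l x))\<^sup>2"

lemma sfn_mono: "l \<le> m \<Longrightarrow> sfn x l \<le> sfn x m"
  by (intro power_mono sf_norm_mono) auto

lemma sfn_right_cont: "continuous (at_right l) (sfn x)"
  unfolding continuous_within
proof (rule order_tendstoI)
  fix a assume "a < sfn x l"
  then have "\<And>m. m > l \<Longrightarrow> a < sfn x m" using sfn_mono by (meson less_imp_le less_le_trans)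
  then show "\<forall>\<^sub>F m in at_right l. a < sfn x m" by (auto simp: eventually_at_filter)
next
  fix a assume a: "sfn x l < a"
  have "(\<lambda>n. sfn x (l + 1 / real (Suc n))) \<longlonglongrightarrow> sfn x l" by (intro tendsto_intros sf_right_limit)
  from order_tendstoD(2)[OF this a] obtain n where n: "sfn x (l + 1 / real (Suc n)) < a"
    by (auto simp: eventually_sequentially)
  have "\<forall>\<^sub>F m in at_right l. m \<in> {l<..<l + 1 / real (Suc n)}"
    by (rule eventually_at_right_real) simp
  then show "\<forall>\<^sub>F m in at_right l. sfn x m < a"
  proof eventually_elim
    case (elim m)
    then have "sfn x m \<le> sfn x (l + 1 / real (Suc n))" by (intro sfn_mono) simp
    then show ?case using n by (rule le_less_trans)
  qed
qed

abbreviation smeas :: "'h \<Rightarrow> real measure" where "smeas x \<equiv> interval_measure (sfn x)"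

lemma smeas_Ioc: "a \<le> b \<Longrightarrow> emeasure (smeas x) {a<..b} = ennreal (sfn x b - sfn x a)"
  by (rule emeasure_interval_measure_Ioc) (assumption | rule sfn_mono sfn_right_cont)+

lemma smeas_UNIV: "emeasure (smeas x) UNIV = ennreal ((norm x)\<^sup>2)"
proof -
  have "(\<lambda>n. emeasure (smeas x) {- real n<..real n}) \<longlonglongrightarrow> emeasure (smeas x) (\<Union>n. {- real n<..real n})"
    by (rule Lim_emeasure_incseq) (auto simp: incseq_def)
  moreover have "(\<Union>n. {- real n<..real n}) = UNIV"
  proof -
    have "\<exists>n. y \<in> {- real n<..real n}" for y
      using reals_Archimedean2[of "\<bar>y\<bar>"] by (auto simp: abs_less_iff intro: less_imp_le minus_less_iff[THEN iffD1])
    then show ?thesis by blast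
  qed
  moreover have "emeasure (smeas x) {- real n<..real n} = ennreal ((norm x)\<^sup>2)" if "real n > norm T" for n
    using that smeas_Ioc[of "- real n" "real n" x] by (simp add: sf_low sf_high)
  moreover obtain n0 where "real n0 > norm T" using reals_Archimedean2 by blast
  ultimately have "(\<lambda>n. emeasure (smeas x) {- real n<..real n}) \<longlonglongrightarrow> emeasure (smeas x) UNIV"
    "(\<lambda>n. emeasure (smeas x) {- real n<..real n}) \<longlonglongrightarrow> ennreal ((norm x)\<^sup>2)"
    by (simp, intro tendsto_eventually eventually_sequentiallyI[of n0]) simp
  then show ?thesis by (rule LIMSEQ_unique)
qed

lemma smeas_finite: "finite_measure (smeas x)"
  by (rule finite_measureI) (simp add: smeas_UNIV)

lemma smeas_measure_UNIV: "measure (smeas x) UNIV = (norm x)\<^sup>2"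
  by (simp add: measure_def smeas_UNIV)

text \<open>The Borel sets that have a spectral projection form a Dynkin system containing the
  half-open intervals.\<close>

lemma ex_spec_proj:
  assumes "S \<in> sets borel"
  shows "\<exists>Q. orth_proj Q \<and> bicommutes T Q \<and> (\<forall>x. Q x \<bullet> x = measure (smeas x) S)"
proof -
  let ?G = "range (\<lambda>(a, b). {a<..b::real})"
  have "S \<in> sigma_sets UNIV ?G" using assms by (simp add: borel_sigma_sets_Ioc)
  have "Int_stable ?G"
    unfolding Int_stable_def
  proof (intro ballI)
    fix A B assume "A \<in> ?G" "B \<in> ?G"
    then obtain a b c d where "A = {a<..b}" "B = {c<..d}" by auto
    then have "A \<inter> B = (\<lambda>(a, b). {a<..b}) (max a c, min b d)" by auto
    then show "A \<inter> B \<in> ?G" by (metis rangeI)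
  qed
  moreover have "?G \<subseteq> Pow UNIV" by auto
  ultimately show ?thesis using \<open>S \<in> sigma_sets UNIV ?G\<close>
  proof (induction rule: sigma_sets_induct_disjoint)
    case (basic S)
    then obtain a b where S: "S = {a<..b}" by auto
    show ?case
    proof (cases "a \<le> b")
      case True
      let ?Q = "spec_fam T b - spec_fam T a"
      have "orth_proj ?Q"
        using orth_proj_selfadj[OF spec_fam(1)[OF sa]]
        by (auto simp: orth_proj_def selfadj_def blinfun.bilinear_simps inner_diff_left inner_diff_right
            sf_mono[OF True] sf_mono'[OF True] orth_proj_idem[OF spec_fam(1)[OF sa]])
      moreover have "bicommutes T ?Q"
        using spec_fam(2)[OF sa] by (auto simp: bicommutes_def intro: commutes_intros)
      moreover have "?Q x \<bullet> x = measure (smeas x) S" for x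
        unfolding S using smeas_Ioc[OF True, of x] sfn_mono[OF True, of x]
        by (simp add: measure_def blinfun.diff_left inner_diff_left orth_proj_inner[OF spec_fam(1)[OF sa]])
      ultimately show ?thesis by blast
    next
      case False
      then have "S = {}" using S by auto
      then show ?thesis by (intro exI[of _ 0]) (simp add: bicommutes_def)
    qed
  next
    case empty
    show ?case by (intro exI[of _ 0]) (simp add: bicommutes_def)
  next
    case (compl S)
    then obtain Q where Q: "orth_proj Q" "bicommutes T Q" "\<And>x. Q x \<bullet> x = measure (smeas x) S" by blast
    have "orth_proj (id_blinfun - Q)"
      using orth_proj_selfadj[OF Q(1)]
      by (auto simp: orth_proj_def selfadj_def blinfun.bilinear_simps inner_diff_left inner_diff_right
          orth_proj_idem[OF Q(1)])
    moreover have "bicommutes T (id_blinfun - Q)"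
      using Q(2) by (auto simp: bicommutes_def intro: commutes_intros)
    moreover have "(id_blinfun - Q) x \<bullet> x = measure (smeas x) (UNIV - S)" for x
      using finite_measure.finite_measure_compl[OF smeas_finite, of S x] compl(1)
      by (simp add: blinfun.diff_left inner_diff_left Q smeas_measure_UNIV dot_square_norm
          borel_sigma_sets_Ioc)
    ultimately show ?case by blast
  next
    case (union A)
    then have "\<forall>i. \<exists>Q. orth_proj Q \<and> bicommutes T Q \<and> (\<forall>x. Q x \<bullet> x = measure (smeas x) (A i))" by blast
    then obtain Q where Q: "\<And>i. orth_proj (Q i)" "\<And>i. bicommutes T (Q i)"
      "\<And>i x. Q i x \<bullet> x = measure (smeas x) (A i)" by metis
    have Ab: "range A \<subseteq> sets (smeas x)" for x using union(2) by (simp add: borel_sigma_sets_Ioc)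
    have os: "orth_seq Q"
      unfolding orth_seq_def
    proof (intro conjI allI impI Q)
      fix i j :: nat and x assume "i \<noteq> j"
      let ?y = "Q j x"
      \<comment> \<open>For y in the range of \<open>Q j\<close> the set \<open>A j\<close> already
        carries the full mass, the squared norm of y, and leaves nothing for the disjoint
        \<open>A i\<close>.\<close>
      have "measure (smeas ?y) (A i) + measure (smeas ?y) (A j) = measure (smeas ?y) (A i \<union> A j)"
        using Ab[of ?y] \<open>i \<noteq> j\<close> union(1)
        by (intro finite_measure.finite_measure_Union[OF smeas_finite, symmetric])
          (auto simp: disjoint_family_on_def)
      also have "\<dots> \<le> measure (smeas ?y) (space (smeas ?y))"
        by (rule finite_measure.bounded_measure[OF smeas_finite])
      also have "\<dots> = (norm ?y)\<^sup>2" by (simp add: smeas_measure_UNIV)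
      finally have "Q i ?y \<bullet> ?y + Q j ?y \<bullet> ?y \<le> (norm ?y)\<^sup>2" by (simp add: Q)
      then have "(norm (Q i ?y))\<^sup>2 \<le> 0"
        by (simp add: orth_proj_inner[OF Q(1)] orth_proj_idem[OF Q(1)] dot_square_norm)
      then show "Q i (Q j x) = 0" by simp
    qed
    then obtain R :: "'h op" where R: "orth_proj R" "\<And>x. (\<lambda>n. Q n x) sums R x"
      using orth_seq_sums by blast
    have "bicommutes T R"
      unfolding bicommutes_def using Q(2) R(2) by (metis bicommutes_def commutes_sums)
    moreover have "R x \<bullet> x = measure (smeas x) (\<Union>i. A i)" for x
    proof (rule sums_unique2)
      show "(\<lambda>n. Q n x \<bullet> x) sums (R x \<bullet> x)"
        by (rule bounded_linear.sums[OF bounded_linear_inner_left R(2)])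
      show "(\<lambda>n. Q n x \<bullet> x) sums measure (smeas x) (\<Union>i. A i)"
        unfolding Q using Ab union(1) by (intro finite_measure.finite_measure_UNION[OF smeas_finite])
    qed
    ultimately show ?case using R by blast
  qed
qed

end

section \<open>The projection-valued spectral measure and its integral\<close>

definition spec_meas :: "'h::real_hilbert op \<Rightarrow> real set \<Rightarrow> 'h op" where
  "spec_meas T S = (SOME Q. orth_proj Q \<and> bicommutes T Q \<and>
     (\<forall>x. Q x \<bullet> x = measure (interval_measure (\<lambda>l. (norm (spec_fam T l x))\<^sup>2)) S))"

lemma selfadj_form_eqI:
  fixes S T :: "'h::real_inner op"
  assumes "selfadj S" "selfadj T" "\<And>x. S x \<bullet> x = T x \<bullet> x"
  shows "S = T"
proof -
  have "psd (T - S)" by (rule psd_diffI[OF assms(1,2)]) (simp add: assms(3))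
  then have "(T - S) x = 0" for x
    using psd_zero_iff[of "T - S" x] assms(3) by (simp add: blinfun.diff_left inner_diff_left)
  then show ?thesis by (intro blinfun_eqI) (simp add: blinfun.diff_left)
qed

lemma integral_concentrated:
  assumes "finite_measure M" "sets M = sets borel" "I \<in> sets borel" "I \<subseteq> {s..t::real}"
    "measure M (- I) = 0"
  shows "integrable M (\<lambda>t. t)" "s * measure M UNIV \<le> (\<integral>t. t \<partial>M)" "(\<integral>t. t \<partial>M) \<le> t * measure M UNIV"
proof -
  interpret finite_measure M by fact
  have sp: "space M = UNIV" using sets_eq_imp_space_eq[OF assms(2)] by simp
  have "emeasure M (- I) = 0" using assms(5) by (simp add: emeasure_eq_measure)
  then have ae: "AE u in M. s \<le> u \<and> u \<le> t"
    using assms by (intro AE_I'[of "- I"]) (auto simp: null_sets_def)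
  have meas: "(\<lambda>t. t) \<in> borel_measurable M"
    by (metis assms(2) measurable_cong_sets measurable_ident_sets)
  show int: "integrable M (\<lambda>t. t)"
    by (rule integrable_const_bound[of _ "\<bar>s\<bar> + \<bar>t\<bar>", OF eventually_mono[OF ae] meas]) auto
  have "(\<integral>u. s \<partial>M) \<le> (\<integral>u. u \<partial>M)"
    by (intro integral_mono_AE int integrable_const eventually_mono[OF ae]) auto
  then show "s * measure M UNIV \<le> (\<integral>t. t \<partial>M)" by (simp add: sp mult.commute)
  have "(\<integral>u. u \<partial>M) \<le> (\<integral>u. t \<partial>M)"
    by (intro integral_mono_AE int integrable_const eventually_mono[OF ae]) auto
  then show "(\<integral>t. t \<partial>M) \<le> t * measure M UNIV" by (simp add: sp mult.commute)
qed

context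
  fixes T :: "'h::real_hilbert op"
  assumes sa: "selfadj T"
begin

abbreviation sm :: "'h \<Rightarrow> real measure" where
  "sm x \<equiv> interval_measure (\<lambda>l. (norm (spec_fam T l x))\<^sup>2)"

lemma spec_meas:
  assumes "S \<in> sets borel"
  shows "orth_proj (spec_meas T S)" "bicommutes T (spec_meas T S)"
    "spec_meas T S x \<bullet> x = measure (sm x) S"
  using someI_ex[OF ex_spec_proj[OF sa assms]] by (auto simp: spec_meas_def)

lemma spec_meas_eqI:
  assumes "S \<in> sets borel" "selfadj Q" "\<And>x. Q x \<bullet> x = measure (sm x) S"
  shows "spec_meas T S = Q"
  by (rule selfadj_form_eqI[OF orth_proj_selfadj[OF spec_meas(1)]]) (simp_all add: assms spec_meas)

lemma spec_meas_UNIV [simp]: "spec_meas T UNIV = id_blinfun"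
  by (rule spec_meas_eqI) (auto simp: selfadj_def smeas_measure_UNIV[OF sa] dot_square_norm)

lemma spec_meas_empty [simp]: "spec_meas T {} = 0"
  by (rule spec_meas_eqI) (auto simp: selfadj_def)

lemma spec_meas_Ioc: "a \<le> b \<Longrightarrow> spec_meas T {a<..b} = spec_fam T b - spec_fam T a"
proof (rule spec_meas_eqI)
  assume ab: "a \<le> b"
  note saf = orth_proj_selfadj[OF spec_fam(1)[OF sa]]
  show "selfadj (spec_fam T b - spec_fam T a)"
    using saf[of a] saf[of b] by (simp add: selfadj_def blinfun.diff_left inner_diff_left inner_diff_right)
  show "(spec_fam T b - spec_fam T a) x \<bullet> x = measure (sm x) {a<..b}" for x
    using smeas_Ioc[OF sa ab, of x] sfn_mono[OF sa ab, of x]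
    by (simp add: measure_def blinfun.diff_left inner_diff_left orth_proj_inner[OF spec_fam(1)[OF sa]])
qed simp

lemma spec_meas_Un:
  assumes "A \<in> sets borel" "B \<in> sets borel" "A \<inter> B = {}"
  shows "spec_meas T (A \<union> B) = spec_meas T A + spec_meas T B"
proof (rule spec_meas_eqI)
  note saf = orth_proj_selfadj[OF spec_meas(1)]
  show "selfadj (spec_meas T A + spec_meas T B)"
    using saf[OF assms(1)] saf[OF assms(2)] 
    by (simp add: selfadj_def blinfun.add_left inner_add_left inner_add_right)
  show "(spec_meas T A + spec_meas T B) x \<bullet> x = measure (sm x) (A \<union> B)" for x
    using finite_measure.finite_measure_Union[OF smeas_finite[OF sa], of A x B] assms
    by (simp add: blinfun.add_left inner_add_left spec_meas)
qed (use assms in auto)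

text \<open>On the range of the projection for B, that projection alone attains the full squared
  norm, and the sum of both, being a projection, cannot exceed it.\<close>

lemma spec_meas_disjoint:
  assumes "A \<in> sets borel" "B \<in> sets borel" "A \<inter> B = {}"
  shows "spec_meas T A (spec_meas T B x) = 0"
proof -
  let ?y = "spec_meas T B x"
  have "orth_proj (spec_meas T A + spec_meas T B)"
    using spec_meas(1)[of "A \<union> B"] assms by (simp add: spec_meas_Un)
  then have "(spec_meas T A + spec_meas T B) ?y \<bullet> ?y \<le> (norm ?y)\<^sup>2"
    using orth_proj_norm_le[of "spec_meas T A + spec_meas T B" ?y]
    by (simp add: orth_proj_inner power_mono)
  then have "(norm (spec_meas T A ?y))\<^sup>2 + (norm ?y)\<^sup>2 \<le> (norm ?y)\<^sup>2"
    using assms by (simp add: blinfun.add_left inner_add_left orth_proj_inner[OF spec_meas(1)]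
        orth_proj_idem[OF spec_meas(1)] dot_square_norm)
  then show ?thesis by simp
qed

lemma spec_meas_Int:
  assumes "A \<in> sets borel" "B \<in> sets borel"
  shows "spec_meas T A (spec_meas T B x) = spec_meas T (A \<inter> B) x"
proof -
  have "spec_meas T A = spec_meas T (A \<inter> B) + spec_meas T (A - B)"
    using spec_meas_Un[of "A \<inter> B" "A - B"] assms by (simp add: Int_Diff_Un) blast
  moreover have "spec_meas T B = spec_meas T (A \<inter> B) + spec_meas T (B - A)"
  proof -
    have "B = A \<inter> B \<union> (B - A)" "A \<inter> B \<inter> (B - A) = {}" by auto
    then show ?thesis using spec_meas_Un[of "A \<inter> B" "B - A"] assms by simp
  qed
  moreover have "A \<inter> B \<inter> (B - A) = {}" "(A - B) \<inter> (A \<inter> B) = {}" "(A - B) \<inter> (B - A) = {}" by auto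
  ultimately show ?thesis using assms
    by (simp add: blinfun.add_left blinfun.add_right spec_meas_disjoint orth_proj_idem[OF spec_meas(1)])
qed

lemma spec_meas_sums:
  assumes "range S \<subseteq> sets borel" "disjoint_family S"
  shows "orth_seq (\<lambda>n. spec_meas T (S n))"
    "(\<lambda>n. spec_meas T (S n) x) sums spec_meas T (\<Union>n. S n) x"
proof -
  have Sn: "S n \<in> sets borel" for n using assms(1) by auto
  show os: "orth_seq (\<lambda>n. spec_meas T (S n))"
    using assms(2) by (auto simp: orth_seq_def spec_meas Sn disjoint_family_on_def intro!: spec_meas_disjoint)
  obtain R :: "'h op" where R: "orth_proj R" "\<And>x. (\<lambda>n. spec_meas T (S n) x) sums R x"
    using orth_seq_sums[OF os] by blast
  have "spec_meas T (\<Union>n. S n) = R"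
  proof (rule spec_meas_eqI)
    show "R x \<bullet> x = measure (sm x) (\<Union>n. S n)" for x
    proof (rule sums_unique2)
      show "(\<lambda>n. spec_meas T (S n) x \<bullet> x) sums (R x \<bullet> x)"
        by (rule bounded_linear.sums[OF bounded_linear_inner_left R(2)])
      show "(\<lambda>n. spec_meas T (S n) x \<bullet> x) sums measure (sm x) (\<Union>n. S n)"
        unfolding spec_meas[OF Sn] using assms
        by (intro finite_measure.finite_measure_UNION[OF smeas_finite[OF sa]]) auto
    qed
  qed (use R Sn orth_proj_selfadj in auto)
  then show "(\<lambda>n. spec_meas T (S n) x) sums spec_meas T (\<Union>n. S n) x" using R by simp
qed

lemma spec_meas_commute_op: "S \<in> sets borel \<Longrightarrow> spec_meas T S (T x) = T (spec_meas T S x)"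
  using spec_meas(2) by (metis bicommutes_def commutes_def commutes_self(1))

lemma spec_meas_bounded:
  assumes "K > norm T" shows "spec_meas T {-K<..K} = id_blinfun"
proof -
  have "-K \<le> K" using assms norm_ge_zero[of T] by linarith
  then show ?thesis using assms
    by (intro blinfun_eqI) (simp add: spec_meas_Ioc blinfun.diff_left sf_low[OF sa] sf_high[OF sa])
qed

lemma spec_meas_atMost: "spec_meas T {..t} = spec_fam T t"
proof -
  define K where "K = max (norm T) (- t) + 1"
  have K: "K > norm T" "- K \<le> t" by (auto simp: K_def)
  have "spec_meas T {..t} x = spec_fam T t x" for x
  proof -
    have "spec_meas T {..t} x = spec_meas T {..t} (spec_meas T {-K<..K} x)"
      using spec_meas_bounded[OF K(1)] by simp
    also have "\<dots> = spec_meas T {-K<..min t K} x"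
    proof -
      have "{..t} \<inter> {-K<..K} = {-K<..min t K}" by auto
      then show ?thesis by (simp add: spec_meas_Int)
    qed
    also have "\<dots> = spec_fam T (min t K) x"
    proof -
      have "0 < K" using K norm_ge_zero[of T] by linarith
      then show ?thesis
        using K by (subst spec_meas_Ioc) (auto simp: blinfun.diff_left sf_low[OF sa])
    qed
    also have "\<dots> = spec_fam T t x"
      using K by (cases "t \<le> K") (auto simp: min_def sf_high[OF sa])
    finally show ?thesis .
  qed
  then show ?thesis by (rule blinfun_eqI)
qed

lemma spec_meas_le:
  assumes "S \<in> sets borel" "S \<subseteq> {..t}" "spec_meas T S x = x"
  shows "T x \<bullet> x \<le> t * (norm x)\<^sup>2"
proof (rule spec_fam(3)[OF sa])
  have "{..t} \<inter> S = S" using assms(2) by auto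
  then show "spec_fam T t x = x"
    using spec_meas_Int[of "{..t}" S x] assms by (simp add: spec_meas_atMost)
qed

lemma spec_meas_ge:
  assumes "S \<in> sets borel" "S \<subseteq> {s..}" "spec_meas T S x = x"
  shows "s * (norm x)\<^sup>2 \<le> T x \<bullet> x"
proof (cases "x = 0")
  case False
  \<comment> \<open>The spectral family gives strict bounds for every r below s; letting r tend to s
    recovers s itself.\<close>
  have "r * (norm x)\<^sup>2 < T x \<bullet> x" if "r < s" for r
  proof (rule spec_fam(4)[OF sa _ False])
    have "{..r} \<inter> S = {}" using assms(2) that by auto
    then show "spec_fam T r x = 0"
      using spec_meas_Int[of "{..r}" S x] assms by (simp add: spec_meas_atMost)
  qed
  then have "r < T x \<bullet> x / (norm x)\<^sup>2" if "r < s" for r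
    using that False by (simp add: field_simps)
  then have "s \<le> T x \<bullet> x / (norm x)\<^sup>2" by (meson dense_le less_imp_le)
  then show ?thesis using False by (simp add: field_simps)
qed (simp)

text \<open>This lets the integral of a vector be split over the spectral subspaces of two halves of
  an interval.\<close>

lemma sm_restrict:
  assumes "I \<in> sets borel"
  shows "sm (spec_meas T I x) = density (sm x) (indicator I)"
proof (rule measure_eqI)
  fix A assume "A \<in> sets (sm (spec_meas T I x))"
  then have A: "A \<in> sets borel" by simp
  have "measure (sm (spec_meas T I x)) A = measure (sm x) (I \<inter> A)"
  proof -
    have "measure (sm (spec_meas T I x)) A = spec_meas T A (spec_meas T I x) \<bullet> spec_meas T I x"
      by (simp add: spec_meas A)
    also have "\<dots> = spec_meas T I (spec_meas T A (spec_meas T I x)) \<bullet> x"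
      by (simp add: selfadjD[OF orth_proj_selfadj[OF spec_meas(1)]] assms A)
    also have "\<dots> = spec_meas T (I \<inter> A) x \<bullet> x"
      using assms A by (simp add: spec_meas_Int Int_commute Int_left_commute Int_absorb)
    finally show ?thesis using assms A by (simp add: spec_meas)
  qed
  then show "emeasure (sm (spec_meas T I x)) A = emeasure (density (sm x) (indicator I)) A"
    using assms A by (simp add: emeasure_restricted finite_measure.emeasure_eq_measure[OF smeas_finite[OF sa]])
qed simp

lemma sm_concentrated:
  assumes "I \<in> sets borel" "spec_meas T I x = x"
  shows "measure (sm x) (- I) = 0"
proof -
  have "measure (sm x) (- I) = spec_meas T (- I) (spec_meas T I x) \<bullet> x"
    using assms by (simp add: spec_meas(3)[symmetric] del: spec_meas)
  also have "\<dots> = 0" using assms(1) by (simp add: spec_meas_disjoint)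
  finally show ?thesis .
qed

lemma sm_integrable: "integrable (sm x) (\<lambda>t. t)"
proof -
  define K where "K = norm T + 1"
  have "spec_meas T {-K<..K} x = x" using spec_meas_bounded[of K] by (simp add: K_def)
  then show ?thesis
    by (intro integral_concentrated(1)[of _ "{-K<..K}" "-K" K] smeas_finite[OF sa] sm_concentrated) auto
qed

text \<open>The defect of the spectral integral formula is additive over orthogonal spectral subspaces
  and at most the length of the interval, so repeated halving shows that it vanishes.\<close>

lemma spectral_defect:
  assumes "s \<le> t" "spec_meas T {s<..t} x = x"
  shows "\<bar>T x \<bullet> x - (\<integral>u. u \<partial>sm x)\<bar> \<le> (t - s) / 2 ^ n * (norm x)\<^sup>2"
  using assms
proof (induction n arbitrary: s t x)
  case 0
  have "{s<..t} \<subseteq> {s..}" "{s<..t} \<subseteq> {..t}" by auto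
  then have "s * (norm x)\<^sup>2 \<le> T x \<bullet> x" "T x \<bullet> x \<le> t * (norm x)\<^sup>2"
    using spec_meas_ge[of "{s<..t}" s x] spec_meas_le[of "{s<..t}" t x] 0 by auto
  moreover have "s * measure (sm x) UNIV \<le> (\<integral>u. u \<partial>sm x)" "(\<integral>u. u \<partial>sm x) \<le> t * measure (sm x) UNIV"
    by (rule integral_concentrated[of _ "{s<..t}" s t];
        use 0 in \<open>auto intro: smeas_finite[OF sa] sm_concentrated\<close>)+
  ultimately show ?case by (simp add: smeas_measure_UNIV[OF sa] abs_le_iff algebra_simps)
next
  case (Suc n)
  define m where "m = (s + t) / 2"
  define y z where "y = spec_meas T {s<..m} x" and "z = spec_meas T {m<..t} x"
  have m: "s \<le> m" "m \<le> t" using Suc by (auto simp: m_def)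
  have "{s<..m} \<union> {m<..t} = {s<..t}" using m by auto
  then have "spec_meas T {s<..t} = spec_meas T {s<..m} + spec_meas T {m<..t}"
    using spec_meas_Un[of "{s<..m}" "{m<..t}"] by (auto simp: disjoint_iff)
  then have x: "x = y + z" using Suc by (simp add: y_def z_def blinfun.add_left)
  have yz: "y \<bullet> z = 0"
    unfolding y_def z_def using spec_meas_disjoint[of "{s<..m}" "{m<..t}" x]
    by (simp add: selfadjD[OF orth_proj_selfadj[OF spec_meas(1)]] disjoint_iff)
  have Ey: "spec_meas T {s<..m} y = y" and Ez: "spec_meas T {m<..t} z = z"
    by (simp_all add: y_def z_def orth_proj_idem[OF spec_meas(1)])
  have Tyz: "T y \<bullet> z = 0"
  proof -
    have "T y \<bullet> z = spec_meas T {s<..m} (T y) \<bullet> z" by (simp add: spec_meas_commute_op Ey)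
    also have "\<dots> = T y \<bullet> spec_meas T {s<..m} (spec_meas T {m<..t} z)"
      by (simp add: selfadjD[OF orth_proj_selfadj[OF spec_meas(1)]] Ez)
    also have "\<dots> = 0" by (subst spec_meas_disjoint) auto
    finally show ?thesis .
  qed
  have T: "T x \<bullet> x = T y \<bullet> y + T z \<bullet> z"
    using Tyz selfadjD[OF sa, of z y]
    by (simp add: x blinfun.add_right inner_add_left inner_add_right inner_commute)
  have nx: "(norm x)\<^sup>2 = (norm y)\<^sup>2 + (norm z)\<^sup>2"
    using yz by (simp add: x power2_norm_eq_inner inner_add_left inner_add_right inner_commute)
  have dens: "(\<integral>u. u \<partial>sm (spec_meas T I x)) = (\<integral>u. indicator I u * u \<partial>sm x)"
    if "I \<in> sets borel" for I
  proof -
    have *: "density (sm x) (indicator I) = density (sm x) (\<lambda>u. ennreal (indicator I u))"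
      by (rule arg_cong2[where f = density]) (auto simp: ennreal_indicator)
    show ?thesis unfolding sm_restrict[OF that] * using that
      by (subst integral_density) auto
  qed
  have "(\<integral>u. u \<partial>sm y) + (\<integral>u. u \<partial>sm z) =
      (\<integral>u. indicator {s<..m} u * u \<partial>sm x) + (\<integral>u. indicator {m<..t} u * u \<partial>sm x)"
    by (simp add: y_def z_def dens)
  also have "\<dots> = (\<integral>u. indicator {s<..m} u * u + indicator {m<..t} u * u \<partial>sm x)"
    using integrable_mult_indicator[OF _ sm_integrable[of x]]
    by (intro Bochner_Integration.integral_add[symmetric]) (auto simp flip: real_scaleR_def)
  also have "\<dots> = (\<integral>u. indicator {s<..t} u * u \<partial>sm x)"
    using m by (intro Bochner_Integration.integral_cong) (auto simp: indicator_def)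
  also have "\<dots> = (\<integral>u. u \<partial>sm x)" using dens[of "{s<..t}"] Suc.prems by simp
  finally have I: "(\<integral>u. u \<partial>sm x) = (\<integral>u. u \<partial>sm y) + (\<integral>u. u \<partial>sm z)" by simp
  have "\<bar>T x \<bullet> x - (\<integral>u. u \<partial>sm x)\<bar> \<le>
      \<bar>T y \<bullet> y - (\<integral>u. u \<partial>sm y)\<bar> + \<bar>T z \<bullet> z - (\<integral>u. u \<partial>sm z)\<bar>"
    unfolding T I by linarith
  also have "\<dots> \<le> (m - s) / 2 ^ n * (norm y)\<^sup>2 + (t - m) / 2 ^ n * (norm z)\<^sup>2"
    by (intro add_mono Suc.IH m Ey Ez)
  also have "\<dots> = (t - s) / 2 ^ Suc n * (norm x)\<^sup>2"
    by (simp add: nx m_def field_simps)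
  finally show ?case .
qed

lemma spectral_integral: "T x \<bullet> x = (\<integral>u. u \<partial>sm x)"
proof -
  define K where "K = norm T + 1"
  have K: "spec_meas T {-K<..K} x = x" using spec_meas_bounded[of K] by (simp add: K_def)
  have "(\<lambda>n. (K - (-K)) * (norm x)\<^sup>2 * (1/2) ^ n) \<longlonglongrightarrow> (K - (-K)) * (norm x)\<^sup>2 * 0"
    by (intro tendsto_intros LIMSEQ_realpow_zero) auto
  moreover have "\<bar>T x \<bullet> x - (\<integral>u. u \<partial>sm x)\<bar> \<le> (K - (-K)) * (norm x)\<^sup>2 * (1/2) ^ n" for n
    using spectral_defect[of "-K" K x n] K norm_ge_zero[of T] by (simp add: K_def power_one_over field_simps)
  ultimately have "\<bar>T x \<bullet> x - (\<integral>u. u \<partial>sm x)\<bar> \<le> 0"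
    by (intro LIMSEQ_le_const[of _ 0]) auto
  then show ?thesis by simp
qed

text \<open>\<open>diagonal_measure\<close> is built by \<open>measure_of\<close> from this very set
  function, so the Stieltjes measure used here is the one in the definition of a spectral
  measure.\<close>

lemma spec_meas_measure_of:
  "measure_of UNIV (sets borel) (\<lambda>S. ennreal (spec_meas T S x \<bullet> x)) = sm x"
proof -
  have "measure_of UNIV (sets borel) (\<lambda>S. ennreal (spec_meas T S x \<bullet> x))
      = measure_of UNIV (sets borel) (emeasure (sm x))"
  proof (rule measure_of_eq)
    fix S :: "real set" assume "S \<in> sigma_sets UNIV (sets borel)"
    then have "S \<in> sets borel" using sets.sigma_sets_eq[of "borel :: real measure"] by simp
    then show "ennreal (spec_meas T S x \<bullet> x) = emeasure (sm x) S"
      by (simp add: spec_meas finite_measure.emeasure_eq_measure[OF smeas_finite[OF sa]])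
  qed simp
  then show ?thesis using measure_of_of_measure[of "sm x"] by simp
qed

end

section \<open>Comparison of projections\<close>

text \<open>The lower bound makes the range closed, and by selfadjointness its orthogonal complement
  is the kernel of R, which is zero.\<close>

lemma selfadj_inverse:
  fixes R :: "'h::real_hilbert op"
  assumes sa: "selfadj R" and c: "c > 0" "\<And>x. c * norm x \<le> norm (R x)"
  shows "\<exists>G. selfadj G \<and> (\<forall>x. R (G x) = x) \<and> (\<forall>x. G (R x) = x)"
proof -
  have bl: "bounded_linear (blinfun_apply R)" by (rule blinfun.bounded_linear_right)
  have "complete (range R)"
    using complete_isometric_image[OF c(1) subspace_UNIV bl] c(2) complete_UNIV by simp
  then have cl: "closed (range R)" by (rule complete_imp_closed)
  have sub: "subspace (range R)"
    by (rule linear_subspace_image[OF bounded_linear.linear[OF bl] subspace_UNIV])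
  have inj: "x = y" if "R x = R y" for x y
    using c(2)[of "x - y"] c(1) that by (simp add: blinfun.diff_right mult_le_0_iff)
  have surj: "\<exists>y. R y = x" for x
  proof -
    obtain y where y: "y \<in> range R" "\<And>z. z \<in> range R \<Longrightarrow> (x - y) \<bullet> z = 0"
      using ex_orthogonal_foot[OF cl sub] by blast
    have "R (x - y) \<bullet> z = 0" for z using y(2)[of "R z"] by (simp add: selfadjD[OF sa])
    then have "R (x - y) = 0" by (metis inner_eq_zero_iff)
    then have "R (x - y) = R 0" by simp
    then have "x - y = 0" by (rule inj)
    then show ?thesis using y(1) by auto
  qed
  then obtain g where g: "\<And>x. R (g x) = x" by metis
  have gR: "g (R x) = x" for x by (rule inj) (simp add: g)
  have "bounded_linear g"
  proof (rule bounded_linear_intro[where K = "1 / c"])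
    show "g (x + y) = g x + g y" for x y by (rule inj) (simp add: g blinfun.add_right)
    show "g (r *\<^sub>R x) = r *\<^sub>R g x" for r x by (rule inj) (simp add: g blinfun.scaleR_right)
    show "norm (g x) \<le> norm x * (1 / c)" for x using c(2)[of "g x"] c(1) by (simp add: g field_simps)
  qed
  then have G: "blinfun_apply (Blinfun g) = g" by (rule bounded_linear_Blinfun_apply)
  have "g x \<bullet> y = x \<bullet> g y" for x y
    using selfadjD[OF sa, of "g x" "g y"] by (simp add: g)
  then show ?thesis by (intro exI[of _ "Blinfun g"]) (simp add: G g gR selfadj_def)
qed

section \<open>Order and orthogonality of projections\<close>

definition psub :: "'h::real_inner op \<Rightarrow> 'h op \<Rightarrow> bool" where
  "psub P Q \<longleftrightarrow> (\<forall>x. Q (P x) = P x)"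

lemma psubD: "psub P Q \<Longrightarrow> Q (P x) = P x"
  by (simp add: psub_def)

lemma psubD':
  fixes P Q :: "'h::real_inner op"
  assumes "psub P Q" "orth_proj P" "orth_proj Q"
  shows "P (Q x) = P x"
proof (rule inner_eqI)
  fix z
  have "P (Q x) \<bullet> z = x \<bullet> Q (P z)"
    by (simp add: selfadjD[OF orth_proj_selfadj[OF assms(2)]] selfadjD[OF orth_proj_selfadj[OF assms(3)]])
  also have "\<dots> = P x \<bullet> z"
    by (simp add: psubD[OF assms(1)] selfadjD[OF orth_proj_selfadj[OF assms(2)]])
  finally show "P (Q x) \<bullet> z = P x \<bullet> z" .
qed

lemma orth_sym:
  fixes P Q :: "'h::real_inner op"
  assumes "\<And>x. P (Q x) = 0" "orth_proj P" "orth_proj Q"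
  shows "Q (P x) = 0"
proof (rule inner_eqI)
  fix z
  have "Q (P x) \<bullet> z = x \<bullet> P (Q z)"
    by (simp add: selfadjD[OF orth_proj_selfadj[OF assms(2)]] selfadjD[OF orth_proj_selfadj[OF assms(3)]])
  then show "Q (P x) \<bullet> z = 0 \<bullet> z" by (simp add: assms(1))
qed

lemma psub_refl: "orth_proj P \<Longrightarrow> psub P P"
  by (simp add: psub_def orth_proj_idem)

lemma psub_trans: "psub P Q \<Longrightarrow> psub Q R \<Longrightarrow> psub P R"
  by (metis psub_def)

lemma psub_0 [simp]: "psub 0 P" and psub_id [simp]: "psub P id_blinfun"
  by (auto simp: psub_def)

lemma psub_norm_le: "psub P Q \<Longrightarrow> orth_proj P \<Longrightarrow> orth_proj Q \<Longrightarrow> norm (P x) \<le> norm (Q x)"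
  by (metis orth_proj_norm_le psubD')

lemma orth_proj_diff:
  fixes P Q :: "'h::real_inner op"
  assumes "psub P Q" "orth_proj P" "orth_proj Q"
  shows "orth_proj (Q - P)"
  unfolding orth_proj_def selfadj_def
  by (simp add: blinfun.bilinear_simps inner_diff_left inner_diff_right psubD[OF assms(1)]
      psubD'[OF assms] orth_proj_idem assms selfadjD[OF orth_proj_selfadj[OF assms(2)]]
      selfadjD[OF orth_proj_selfadj[OF assms(3)]])

lemma psub_diff:
  assumes "psub P Q" "orth_proj P" "orth_proj Q"
  shows "psub (Q - P) Q" "P ((Q - P) x) = 0" "(Q - P) (P x) = 0"
  using assms by (simp_all add: psub_def blinfun.bilinear_simps orth_proj_idem psubD'[OF assms])

lemma orth_proj_add:
  fixes P Q :: "'h::real_inner op"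
  assumes "orth_proj P" "orth_proj Q" "\<And>x. P (Q x) = 0"
  shows "orth_proj (P + Q)"
  unfolding orth_proj_def selfadj_def
  by (simp add: blinfun.bilinear_simps inner_add_left inner_add_right assms orth_sym[OF assms(3,1,2)]
      orth_proj_idem selfadjD[OF orth_proj_selfadj[OF assms(1)]] selfadjD[OF orth_proj_selfadj[OF assms(2)]])

lemma psub_add:
  "psub P R \<Longrightarrow> psub Q R \<Longrightarrow> psub (P + Q) R"
  by (simp add: psub_def blinfun.bilinear_simps)

lemma orth_psub:
  fixes P Q :: "'h::real_inner op"
  assumes "\<And>x. P (Q x) = 0" "psub P' P" "psub Q' Q" "orth_proj P'" "orth_proj P"
  shows "P' (Q' x) = 0"
  by (metis assms psubD psubD' blinfun.zero_right)

lemma orth_seq_psub: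
  fixes P Q :: "nat \<Rightarrow> 'h::real_inner op"
  assumes "orth_seq Q" "\<And>n. orth_proj (P n)" "\<And>n. psub (P n) (Q n)"
  shows "orth_seq P"
  unfolding orth_seq_def
  using assms(2) orth_psub[OF orth_seqD(2)[OF assms(1)] assms(3,3,2) orth_seqD(1)[OF assms(1)]] by blast

lemma psub_sums:
  fixes P :: "nat \<Rightarrow> 'h::real_inner op" and S Q :: "'h op"
  assumes "\<And>x. (\<lambda>n. P n x) sums S x" "\<And>n. psub (P n) Q"
  shows "psub S Q"
  unfolding psub_def
proof (intro allI, rule sums_unique2)
  fix x
  show "(\<lambda>n. Q (P n x)) sums Q (S x)" by (rule bounded_linear.sums[OF blinfun.bounded_linear_right assms(1)])
  show "(\<lambda>n. Q (P n x)) sums S x" using assms(1) by (simp add: psubD[OF assms(2)])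
qed

lemma orth_seq_psub_sum:
  fixes P :: "nat \<Rightarrow> 'h::real_hilbert op" and S :: "'h op"
  assumes "orth_seq P" "\<And>x. (\<lambda>n. P n x) sums S x"
  shows "orth_proj S" "psub (P n) S"
proof -
  obtain S' :: "'h op" where S': "orth_proj S'" "\<And>x. (\<lambda>n. P n x) sums S' x" "\<And>n x. S' (P n x) = P n x"
    using orth_seq_sums[OF assms(1)] by blast
  have "S = S'" by (rule blinfun_eqI) (rule sums_unique2[OF assms(2) S'(2)])
  then show "orth_proj S" "psub (P n) S" using S' by (auto simp: psub_def)
qed

lemma orth_sums:
  fixes P :: "nat \<Rightarrow> 'h::real_inner op" and S Q :: "'h op"
  assumes "\<And>x. (\<lambda>n. P n x) sums S x" "\<And>n x. Q (P n x) = 0"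
  shows "Q (S x) = 0"
proof (rule sums_unique2)
  show "(\<lambda>n. Q (P n x)) sums Q (S x)" by (rule bounded_linear.sums[OF blinfun.bounded_linear_right assms(1)])
  show "(\<lambda>n. Q (P n x)) sums 0" by (simp add: assms(2))
qed

lemma pisom_compose:
  assumes "pisom V P Q" "pisom W Q R"
  shows "pisom (W o\<^sub>L V) P R"
proof -
  have "hadj V (hadj W (W (V x))) = P x" for x
    by (simp add: pisomD(3)[OF assms(2)] pisomD(6,3)[OF assms(1)])
  moreover have "W (V (hadj V (hadj W x))) = R x" for x
    by (simp add: pisomD(4)[OF assms(1)] pisomD(8,4)[OF assms(2)])
  ultimately show ?thesis
    using pisomD(1)[OF assms(1)] pisomD(2)[OF assms(2)] by (simp add: pisom_def hadj_compose)
qed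

lemma pisom_restrict:
  fixes V R :: "'h::real_hilbert op"
  assumes "pisom V P Q" "orth_proj R" "psub R P"
  shows "pisom (V o\<^sub>L R) R (V o\<^sub>L R o\<^sub>L hadj V)" "psub (V o\<^sub>L R o\<^sub>L hadj V) Q"
proof -
  have h: "hadj R = R" using assms(2) by (simp add: selfadj_hadj[symmetric] orth_proj_selfadj)
  have "pisom (V o\<^sub>L R) R ((V o\<^sub>L R) o\<^sub>L hadj (V o\<^sub>L R))"
    by (rule pisomI[OF assms(2)])
      (simp add: hadj_compose h pisomD[OF assms(1)] psubD[OF assms(3)] orth_proj_idem[OF assms(2)])
  moreover have "(V o\<^sub>L R) o\<^sub>L hadj (V o\<^sub>L R) = V o\<^sub>L R o\<^sub>L hadj V"
    by (rule blinfun_eqI) (simp add: hadj_compose h orth_proj_idem[OF assms(2)])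
  ultimately show "pisom (V o\<^sub>L R) R (V o\<^sub>L R o\<^sub>L hadj V)" by simp
  show "psub (V o\<^sub>L R o\<^sub>L hadj V) Q" by (simp add: psub_def pisomD[OF assms(1)])
qed

lemma pisom_add:
  fixes V W P1 P2 Q1 Q2 :: "'h::real_hilbert op"
  assumes V: "pisom V P1 Q1" and W: "pisom W P2 Q2"
    and P: "\<And>x. P1 (P2 x) = 0" and Q: "\<And>x. Q1 (Q2 x) = 0"
  shows "pisom (V + W) (P1 + P2) (Q1 + Q2)"
proof -
  note o = orth_sym[OF P pisomD(1)[OF V] pisomD(1)[OF W]] orth_sym[OF Q pisomD(2)[OF V] pisomD(2)[OF W]]
  have "hadj V (W x) = 0" for x
    by (metis (no_types, opaque_lifting) Q V W blinfun.zero_right pisomD(6) pisomD(7))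
  moreover have "hadj W (V x) = 0" for x
    by (metis (no_types, opaque_lifting) o V W blinfun.zero_right pisomD(6) pisomD(7))
  moreover have "V (hadj W x) = 0" for x
    by (metis (no_types, opaque_lifting) P V W blinfun.zero_right pisomD(5) pisomD(8))
  moreover have "W (hadj V x) = 0" for x
    by (metis (no_types, opaque_lifting) o V W blinfun.zero_right pisomD(5) pisomD(8))
  ultimately show ?thesis
    unfolding pisom_def
    using orth_proj_add[OF pisomD(1)[OF V] pisomD(1)[OF W] P] orth_proj_add[OF pisomD(2)[OF V] pisomD(2)[OF W] Q]
    by (simp add: hadj_add blinfun.bilinear_simps pisomD[OF V] pisomD[OF W])
qed

lemma pisom_zero_iff:
  fixes V P Q :: "'h::real_hilbert op"
  assumes "pisom V P Q" shows "P = 0 \<longleftrightarrow> Q = 0"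
proof
  assume "P = 0"
  then have "Q x = 0" for x using pisomD(4)[OF assms, of x] pisomD(8)[OF assms, of x] by simp
  then show "Q = 0" by (intro blinfun_eqI) simp
next
  assume "Q = 0"
  then have "P x = 0" for x using pisomD(3)[OF assms, of x] pisomD(6)[OF assms, of x] by simp
  then show "P = 0" by (intro blinfun_eqI) simp
qed

subsection \<open>Von Neumann algebras\<close>

text \<open>The algebra is given by its commutant \<open>N\<close>, so that it is automatically weakly closed.\<close>

locale vn_alg =
  fixes N :: "'h::real_hilbert op set"
  assumes N_hadj: "S \<in> N \<Longrightarrow> hadj S \<in> N"
begin

definition vn :: "'h op set" where
  "vn = {T. \<forall>S\<in>N. commutes S T}"

lemma vn_intros:
  "id_blinfun \<in> vn" "0 \<in> vn" "S \<in> vn \<Longrightarrow> T \<in> vn \<Longrightarrow> S + T \<in> vn" "S \<in> vn \<Longrightarrow> T \<in> vn \<Longrightarrow> S - T \<in> vn"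
  "T \<in> vn \<Longrightarrow> r *\<^sub>R T \<in> vn" "S \<in> vn \<Longrightarrow> T \<in> vn \<Longrightarrow> S o\<^sub>L T \<in> vn"
  by (auto simp: vn_def intro: commutes_intros)

lemma vn_hadj: "T \<in> vn \<Longrightarrow> hadj T \<in> vn"
proof -
  assume T: "T \<in> vn"
  have "commutes S (hadj T)" if "S \<in> N" for S
  proof -
    have "commutes (hadj S) T" using T N_hadj[OF that] by (simp add: vn_def)
    from commutes_hadj[OF this] show ?thesis by simp
  qed
  then show ?thesis by (simp add: vn_def)
qed

lemma vn_sums: "(\<And>n. T n \<in> vn) \<Longrightarrow> (\<And>x. (\<lambda>n. T n x) sums blinfun_apply S x) \<Longrightarrow> S \<in> vn"
  unfolding vn_def using commutes_sums by blast

lemma vn_limit: "(\<And>n. T n \<in> vn) \<Longrightarrow> (\<And>x. (\<lambda>n. T n x) \<longlonglongrightarrow> blinfun_apply S x) \<Longrightarrow> S \<in> vn"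
  unfolding vn_def using commutes_strong_limit by blast

lemma vn_bicommutes: "T \<in> vn \<Longrightarrow> bicommutes T Z \<Longrightarrow> Z \<in> vn"
  by (auto simp: vn_def bicommutes_def)

lemma vn_proj_on:
  assumes "closed L" "subspace L" "\<And>S x. S \<in> N \<Longrightarrow> x \<in> L \<Longrightarrow> S x \<in> L"
  shows "proj_on L \<in> vn"
  unfolding vn_def using proj_on_commutes[OF assms(1,2)] assms(3) N_hadj by blast

definition prj :: "'h op \<Rightarrow> bool" where "prj P \<longleftrightarrow> P \<in> vn \<and> orth_proj P"

lemma prjD: "prj P \<Longrightarrow> P \<in> vn" "prj P \<Longrightarrow> orth_proj P"
  by (auto simp: prj_def)

lemma prj_simps [simp]: "prj 0" "prj id_blinfun"
  by (auto simp: prj_def vn_intros)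

lemma prj_diff: "prj P \<Longrightarrow> prj Q \<Longrightarrow> psub P Q \<Longrightarrow> prj (Q - P)"
  by (simp add: prj_def vn_intros orth_proj_diff)

lemma prj_add: "prj P \<Longrightarrow> prj Q \<Longrightarrow> (\<And>x. P (Q x) = 0) \<Longrightarrow> prj (P + Q)"
  by (simp add: prj_def vn_intros orth_proj_add)

lemma prj_sums:
  "orth_seq P \<Longrightarrow> (\<And>n. prj (P n)) \<Longrightarrow> (\<And>x. (\<lambda>n. P n x) sums blinfun_apply S x) \<Longrightarrow> prj S"
  unfolding prj_def using vn_sums orth_seq_psub_sum(1) by blast

lemma prj_spec_meas: "selfadj T \<Longrightarrow> T \<in> vn \<Longrightarrow> S \<in> sets borel \<Longrightarrow> prj (spec_meas T S)"
  unfolding prj_def using spec_meas(1)[of T S] vn_bicommutes[OF _ spec_meas(2)[of T S]] by simp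

definition eqv :: "'h op \<Rightarrow> 'h op \<Rightarrow> bool" where
  "eqv P Q \<longleftrightarrow> (\<exists>V\<in>vn. pisom V P Q)"

definition subeqv :: "'h op \<Rightarrow> 'h op \<Rightarrow> bool" where
  "subeqv P Q \<longleftrightarrow> (\<exists>R. prj R \<and> psub R Q \<and> eqv P R)"

lemma eqv_refl: "prj P \<Longrightarrow> eqv P P"
  unfolding eqv_def prj_def using pisom_self by blast

lemma eqv_trans: "eqv P Q \<Longrightarrow> eqv Q R \<Longrightarrow> eqv P R"
  unfolding eqv_def using pisom_compose vn_intros(6) by blast

lemma eqv_prj: "eqv P Q \<Longrightarrow> prj P \<and> prj Q"
proof -
  assume "eqv P Q"
  then obtain V where V: "V \<in> vn" "pisom V P Q" by (auto simp: eqv_def)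
  have "P = hadj V o\<^sub>L V" "Q = V o\<^sub>L hadj V"
    by (rule blinfun_eqI, simp add: pisomD[OF V(2)])+
  then show "prj P \<and> prj Q" using V pisomD(1,2)[OF V(2)] vn_intros(6) vn_hadj by (metis prj_def)
qed

lemma eqv_zero_iff: "eqv P Q \<Longrightarrow> P = 0 \<longleftrightarrow> Q = 0"
  unfolding eqv_def using pisom_zero_iff by blast

lemma eqv_restrict:
  assumes "eqv P Q" "prj R" "psub R P"
  shows "\<exists>S. prj S \<and> psub S Q \<and> eqv R S"
proof -
  obtain V where V: "V \<in> vn" "pisom V P Q" using assms(1) by (auto simp: eqv_def)
  let ?S = "V o\<^sub>L R o\<^sub>L hadj V"
  have "eqv R ?S"
    unfolding eqv_def using pisom_restrict(1)[OF V(2)] assms V prjD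
    by (intro bexI[of _ "V o\<^sub>L R"] vn_intros) auto
  then show ?thesis using eqv_prj pisom_restrict(2)[OF V(2)] assms prjD by blast
qed

lemma subeqv_eqv: "subeqv P Q \<Longrightarrow> eqv Q R \<Longrightarrow> subeqv P R"
  unfolding subeqv_def using eqv_restrict eqv_trans by blast

text \<open>A truncated polar decomposition. Let e be the spectral projection of
  \<open>hadj T o\<^sub>L T\<close> for [\<epsilon>, \<infinity>), nonzero for small \<epsilon>. On
  its range the square root is invertible, and T composed with that inverse is a partial isometry
  inside the algebra. The last two clauses bound e by the support and q by the range of T.\<close>

lemma polar_piece:
  fixes T :: "'h op"
  assumes "T \<in> vn" "T \<noteq> 0"
  shows "\<exists>V e q. V \<in> vn \<and> pisom V e q \<and> e \<noteq> 0 \<and>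
    (\<forall>P :: 'h op. (\<forall>x. blinfun_apply T (blinfun_apply P x) = blinfun_apply T x) \<longrightarrow> orth_proj P \<longrightarrow> psub e P) \<and>
    (\<forall>Q :: 'h op. (\<forall>x. blinfun_apply Q (blinfun_apply T x) = blinfun_apply T x) \<longrightarrow> psub q Q)"
proof -
  define A where "A = hadj T o\<^sub>L T"
  have Av: "A \<in> vn" unfolding A_def using assms vn_hadj vn_intros(6) by blast
  have A: "psd A" unfolding A_def by (rule psdI) (simp_all add: hadj' hadj[symmetric])
  note sA = psd_selfadj[OF A]
  have Ax: "A x \<bullet> x = (norm (T x))\<^sup>2" for x by (simp add: A_def hadj' dot_square_norm)
  have "\<exists>\<epsilon>>0. spec_meas A {\<epsilon>..} \<noteq> 0"
  proof (rule ccontr)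
    assume "\<not> ?thesis"
    then have z: "spec_meas A {\<epsilon>..} = 0" if "\<epsilon> > 0" for \<epsilon> using that by blast
    have le: "A x \<bullet> x \<le> \<epsilon> * (norm x)\<^sup>2" if "\<epsilon> > 0" for \<epsilon> x
    proof (rule spec_meas_le[OF sA])
      have "UNIV = {..<\<epsilon>} \<union> {\<epsilon>..}" by auto
      then have "id_blinfun = spec_meas A {..<\<epsilon>} + spec_meas A {\<epsilon>..}"
        using spec_meas_Un[OF sA, of "{..<\<epsilon>}" "{\<epsilon>..}"] spec_meas_UNIV[OF sA]
        by (metis atLeast_borel disjoint_iff lessThan_borel lessThan_iff atLeast_iff not_le)
      then show "spec_meas A {..<\<epsilon>} x = x" using z[OF that]
        by (metis add.right_neutral blinfun_apply_id_blinfun id_apply)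
    qed auto
    have "T x = 0" for x
    proof (rule ccontr)
      assume "T x \<noteq> 0"
      then have x: "x \<noteq> 0" "A x \<bullet> x > 0" by (auto simp: Ax)
      then show False using le[of "A x \<bullet> x / (2 * (norm x)\<^sup>2)" x] by (simp add: field_simps)
    qed
    then have "T = 0" by (intro blinfun_eqI) simp
    then show False using assms by simp
  qed
  then obtain \<epsilon> where eps: "\<epsilon> > 0" "spec_meas A {\<epsilon>..} \<noteq> 0" by blast
  define e where "e = spec_meas A {\<epsilon>..}"
  have e: "orth_proj e" "e \<in> vn" using prj_spec_meas[OF sA Av] by (auto simp: e_def prj_def)
  note sae = selfadjD[OF orth_proj_selfadj[OF e(1)]]
  have eA: "e (A x) = A (e x)" for x by (simp add: e_def spec_meas_commute_op[OF sA])
  have ge: "\<epsilon> * (norm y)\<^sup>2 \<le> A y \<bullet> y" if "e y = y" for y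
    using spec_meas_ge[OF sA, of "{\<epsilon>..}" \<epsilon> y] that by (simp add: e_def)
  \<comment> \<open>Adding the identity off e makes B bounded below on the whole space, so its
    square root R has a bounded inverse G.\<close>
  define B where "B = (A o\<^sub>L e) + (id_blinfun - e)"
  define c where "c = min \<epsilon> 1"
  have c: "c > 0" using eps by (simp add: c_def)
  have Bx: "c * (norm x)\<^sup>2 \<le> B x \<bullet> x" for x
  proof -
    have "(A (e x)) \<bullet> x = A (e x) \<bullet> e x"
      by (metis eA sae orth_proj_idem[OF e(1)])
    then have "B x \<bullet> x = A (e x) \<bullet> e x + (norm (x - e x))\<^sup>2"
      using orth_proj_norm_split[OF e(1), of x] orth_proj_inner[OF e(1), of x]
      by (simp add: B_def blinfun.bilinear_simps inner_add_left inner_diff_left dot_square_norm)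
    moreover have "c * (norm (e x))\<^sup>2 \<le> \<epsilon> * (norm (e x))\<^sup>2" by (intro mult_right_mono) (auto simp: c_def)
    moreover have "\<epsilon> * (norm (e x))\<^sup>2 \<le> A (e x) \<bullet> e x" by (rule ge) (simp add: orth_proj_idem[OF e(1)])
    moreover have "c * (norm (x - e x))\<^sup>2 \<le> 1 * (norm (x - e x))\<^sup>2" by (intro mult_right_mono) (auto simp: c_def)
    moreover have "c * (norm x)\<^sup>2 = c * (norm (e x))\<^sup>2 + c * (norm (x - e x))\<^sup>2"
      using orth_proj_norm_split[OF e(1), of x] by (simp add: distrib_left)
    ultimately show ?thesis by linarith
  qed
  have "psd B"
  proof (rule psdI)
    show "0 \<le> B x \<bullet> x" for x using Bx[of x] c by (meson mult_nonneg_nonneg order_trans zero_le_power2 less_imp_le)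
    have "A (e x) \<bullet> y = x \<bullet> A (e y)" for x y
      by (metis eA sae selfadjD[OF sA])
    then show "B x \<bullet> y = x \<bullet> B y" for x y
      by (simp add: B_def blinfun.bilinear_simps inner_add_left inner_add_right inner_diff_left
          inner_diff_right sae)
  qed
  then obtain R where R: "psd R" "\<And>x. R (R x) = B x" "bicommutes B R" using ex_psd_sqrt by blast
  note sR = psd_selfadj[OF R(1)]
  have "sqrt c * norm x \<le> norm (R x)" for x
  proof -
    have "(norm (R x))\<^sup>2 = B x \<bullet> x"
      using selfadjD[OF sR, of "R x" x] by (simp add: R power2_norm_eq_inner)
    then have "(sqrt c * norm x)\<^sup>2 \<le> (norm (R x))\<^sup>2" using Bx[of x] c by (simp add: power_mult_distrib)
    then show ?thesis by (rule power2_le_imp_le) simp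
  qed
  then obtain G where G: "selfadj G" "\<And>x. R (G x) = x" "\<And>x. G (R x) = x"
    using selfadj_inverse[OF sR, of "sqrt c"] c by auto
  have comm: "commutes X G" if "commutes X B" for X
    unfolding commutes_def
  proof
    fix x
    have RX: "R (X y) = X (R y)" for y using R(3) that by (metis bicommutes_def commutes_def)
    have "G (R (X (G x))) = G (X x)" by (simp add: RX G)
    then show "X (G x) = G (X x)" by (simp add: G)
  qed
  have "commutes e B" unfolding B_def
    by (intro commutes_intros) (auto simp: commutes_def eA)
  then have eG: "e (G x) = G (e x)" for x using comm by (metis commutes_def)
  have Bv: "B \<in> vn" unfolding B_def by (intro vn_intros Av e)
  have Gv: "G \<in> vn" using Bv comm by (auto simp: vn_def)
  define V where "V = T o\<^sub>L G o\<^sub>L e"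
  have Vv: "V \<in> vn" unfolding V_def by (intro vn_intros assms Gv e)
  have hV: "hadj V = e o\<^sub>L G o\<^sub>L hadj T"
    using G(1) orth_proj_selfadj[OF e(1)] unfolding V_def
    by (intro blinfun_eqI) (simp add: hadj_compose selfadj_hadj)
  have V: "pisom V e (V o\<^sub>L hadj V)"
  proof (rule pisomI[OF e(1)])
    fix x
    have "A (e y) = R (R (e y))" for y
      by (simp add: R B_def blinfun.bilinear_simps orth_proj_idem[OF e(1)])
    then have "A (G (e x)) = R (R (e (G x)))" by (metis eG)
    then have "G (A (G (e x))) = G (R (R (e (G x))))" by simp
    also have "\<dots> = e x" by (simp add: G eG)
    finally have "G (hadj T (T (G (e x)))) = e x" by (simp add: A_def)
    then show "hadj V (V x) = e x"
      unfolding hV by (simp add: V_def orth_proj_idem[OF e(1)])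
  qed
  \<comment> \<open>T P = T makes P commute with A, hence with e. Thus e x - P (e x) stays in the
    range of e while A annihilates it, against the lower bound \<epsilon>.\<close>
  moreover have "psub e P" if P: "\<forall>x. T (P x) = T x" "orth_proj P" for P :: "'h op"
    unfolding psub_def
  proof
    fix x
    define y where "y = e x - P (e x)"
    have AP: "P (A z) = A z" for z
    proof (rule inner_eqI)
      fix w show "P (A z) \<bullet> w = A z \<bullet> w"
        by (simp add: selfadjD[OF orth_proj_selfadj[OF P(2)]] A_def hadj' P(1))
    qed
    have "commutes P A" using P AP by (auto simp: commutes_def A_def)
    then have "commutes P e" using spec_meas(2)[OF sA, of "{\<epsilon>..}"] by (simp add: e_def bicommutes_def)
    then have "e y = y" by (simp add: y_def blinfun.diff_right orth_proj_idem[OF e(1)] commutes_def)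
    moreover have "A y = 0" using P by (simp add: y_def A_def blinfun.diff_right)
    ultimately have "\<epsilon> * (norm y)\<^sup>2 \<le> 0" using ge[of y] by simp
    then have "y = 0" using eps by (simp add: mult_le_0_iff)
    then show "P (e x) = e x" by (simp add: y_def)
  qed
  moreover have "psub (V o\<^sub>L hadj V) Q" if "\<forall>x. Q (T x) = T x" for Q :: "'h op"
    using that by (simp add: psub_def V_def)
  ultimately show ?thesis using Vv eps(2) by (intro exI[of _ V] exI[of _ e] exI[of _ "V o\<^sub>L hadj V"]) (auto simp: e_def)
qed

end

section \<open>Comparison in a \<sigma>-finite factor of type III\<close>

locale vn_factor_III = vn_alg N for N :: "'h::real_hilbert op set" +
  assumes central: "prj Z \<Longrightarrow> (\<And>T. T \<in> vn \<Longrightarrow> commutes T Z) \<Longrightarrow> Z = 0 \<or> Z = id_blinfun"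
    and countable_orth: "(\<And>P. P \<in> F \<Longrightarrow> prj P \<and> P \<noteq> 0) \<Longrightarrow>
      pairwise (\<lambda>P Q. \<forall>x. blinfun_apply P (blinfun_apply Q x) = 0) F \<Longrightarrow> countable F"
    and infinite_prj: "prj P \<Longrightarrow> P \<noteq> 0 \<Longrightarrow> \<exists>Q. prj Q \<and> psub Q P \<and> eqv P Q \<and> Q \<noteq> P"
begin

text \<open>Were all Q T P zero, consider the orthogonal complement L of all vectors T (P x). It is
  invariant under the algebra and under its commutant, so its projection is central, hence 0 or 1:
  the first kills Q, the second kills P.\<close>

lemma ex_intertwiner:
  assumes P: "prj P" "P \<noteq> 0" and Q: "prj Q" "Q \<noteq> 0"
  shows "\<exists>T\<in>vn. Q o\<^sub>L T o\<^sub>L P \<noteq> 0"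
proof (rule ccontr)
  assume "\<not> ?thesis"
  then have 0: "Q o\<^sub>L T o\<^sub>L P = 0" if "T \<in> vn" for T using that by blast
  have QTP: "Q (T (P x)) = 0" if "T \<in> vn" for T x
    using arg_cong[OF 0[OF that], of "\<lambda>S. blinfun_apply S x"] by simp
  define L where "L = {z. \<forall>T\<in>vn. \<forall>x. z \<bullet> T (P x) = 0}"
  have cl: "closed L"
  proof -
    have "L = (\<Inter>T\<in>vn. \<Inter>x. {z. z \<bullet> blinfun_apply T (P x) = 0})" by (auto simp: L_def)
    then show ?thesis by (auto intro!: closed_INT closed_Collect_eq continuous_intros)
  qed
  have sub: "subspace L" by (auto simp: L_def subspace_def inner_add_left)
  have Z: "prj (proj_on L)"
  proof -
    have "S z \<in> L" if "S \<in> N" "z \<in> L" for S z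
      unfolding L_def
    proof (clarsimp)
      fix T x assume T: "T \<in> vn"
      have "commutes (hadj S) T" "commutes (hadj S) P"
        using T P(1) N_hadj[OF that(1)] by (auto simp: vn_def prj_def)
      then have "S z \<bullet> T (P x) = z \<bullet> T (P (hadj S x))" by (simp add: hadj commutes_def)
      then show "S z \<bullet> T (P x) = 0" using that T by (simp add: L_def)
    qed
    then show ?thesis using vn_proj_on[OF cl sub] proj_on(1)[OF cl sub] by (simp add: prj_def)
  qed
  have "commutes X (proj_on L)" if "X \<in> vn" for X
  proof (rule proj_on_commutes[OF cl sub])
    have *: "X z \<in> L" if "X \<in> vn" "z \<in> L" for X z
      unfolding L_def
    proof (clarsimp)
      fix T x assume T: "T \<in> vn"
      have "hadj X o\<^sub>L T \<in> vn" using T that vn_hadj vn_intros(6) by blast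
      moreover have "\<forall>S\<in>vn. \<forall>x. z \<bullet> blinfun_apply S (P x) = 0" using that by (simp add: L_def)
      ultimately have "z \<bullet> (hadj X o\<^sub>L T) (P x) = 0" by blast
      then show "X z \<bullet> T (P x) = 0" by (simp add: hadj)
    qed
    show "X x \<in> L" "hadj X x \<in> L" if "x \<in> L" for x using *[OF _ that] vn_hadj \<open>X \<in> vn\<close> by blast+
  qed
  from central[OF Z this] consider "proj_on L = 0" | "proj_on L = id_blinfun" by blast
  then show False
  proof cases
    case 1
    have "Q y = 0" for y
    proof -
      have "Q y \<in> L"
        using QTP by (simp add: L_def selfadjD[OF orth_proj_selfadj[OF prjD(2)[OF Q(1)]]])
      then have "proj_on L (Q y) = Q y" using proj_on_eq[OF cl sub] by blast
      then show ?thesis by (simp add: 1)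
    qed
    then show False using Q(2) by (metis blinfun_eqI zero_blinfun.rep_eq)
  next
    case 2
    have "P x = 0" for x
    proof -
      have "P x \<in> L" using proj_on_eq[OF cl sub, of "P x"] 2 by simp
      then have "\<forall>S\<in>vn. \<forall>y. P x \<bullet> blinfun_apply S (P y) = 0" by (simp add: L_def)
      then have "P x \<bullet> id_blinfun (P x) = 0" using vn_intros(1) by blast
      then show ?thesis by simp
    qed
    then show False using P(2) by (metis blinfun_eqI zero_blinfun.rep_eq)
  qed
qed

lemma ex_equivalent_pieces:
  assumes P: "prj P" "P \<noteq> 0" and Q: "prj Q" "Q \<noteq> 0"
  shows "\<exists>e q. prj e \<and> prj q \<and> e \<noteq> 0 \<and> psub e P \<and> psub q Q \<and> eqv e q"
proof -
  obtain T where T: "T \<in> vn" "Q o\<^sub>L T o\<^sub>L P \<noteq> 0" using ex_intertwiner[OF assms] by blast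
  have "Q o\<^sub>L T o\<^sub>L P \<in> vn" using T P Q prjD vn_intros(6) by blast
  from polar_piece[OF this T(2)] obtain V e q where V: "V \<in> vn" "pisom V e q" "e \<noteq> 0"
    "\<forall>R :: 'h op. (\<forall>x. blinfun_apply (Q o\<^sub>L T o\<^sub>L P) (blinfun_apply R x) = blinfun_apply (Q o\<^sub>L T o\<^sub>L P) x) \<longrightarrow> orth_proj R \<longrightarrow> psub e R"
    "\<forall>R :: 'h op. (\<forall>x. blinfun_apply R (blinfun_apply (Q o\<^sub>L T o\<^sub>L P) x) = blinfun_apply (Q o\<^sub>L T o\<^sub>L P) x) \<longrightarrow> psub q R"
    by (elim exE conjE)
  have "eqv e q" using V by (auto simp: eqv_def)
  moreover have "psub e P" using V(4) prjD(2)[OF P(1)] by (simp add: orth_proj_idem)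
  moreover have "psub q Q" using V(5) prjD(2)[OF Q(1)] by (simp add: orth_proj_idem)
  ultimately show ?thesis using V(3) eqv_prj by blast
qed

text \<open>Take a maximal orthogonal family of nonzero subprojections of P with property D; it is
  countable. What its sum leaves of P would contain a further member by density, so nothing is
  left.\<close>

lemma exhaustion:
  fixes D :: "'h op \<Rightarrow> bool"
  assumes P: "prj P"
    and dense: "\<And>R. prj R \<Longrightarrow> R \<noteq> 0 \<Longrightarrow> psub R P \<Longrightarrow> \<exists>R'. prj R' \<and> R' \<noteq> 0 \<and> psub R' R \<and> D R'"
  shows "\<exists>p. orth_seq p \<and> (\<forall>n::nat. prj (p n) \<and> (p n = 0 \<or> D (p n))) \<and>
    (\<forall>x. (\<lambda>n. blinfun_apply (p n) x) sums P x)"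
proof -
  let ?orth = "\<lambda>P Q :: 'h op. \<forall>x. blinfun_apply P (blinfun_apply Q x) = 0"
  define \<F> where "\<F> = {F. (\<forall>Q\<in>F. prj Q \<and> Q \<noteq> 0 \<and> psub Q P \<and> D Q) \<and> pairwise ?orth F}"
  have "\<exists>F\<in>\<F>. \<forall>X\<in>\<F>. F \<subseteq> X \<longrightarrow> X = F"
  proof (rule subset_Zorn_nonempty)
    show "\<F> \<noteq> {}" by (auto simp: \<F>_def intro!: exI[of _ "{}"])
    fix \<C> assume "\<C> \<noteq> {}" "subset.chain \<F> \<C>"
    then have C: "\<C> \<subseteq> \<F>" and ch: "\<And>X Y. X \<in> \<C> \<Longrightarrow> Y \<in> \<C> \<Longrightarrow> X \<subseteq> Y \<or> Y \<subseteq> X"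
      by (auto simp: subset.chain_def)
    have "pairwise ?orth (\<Union>\<C>)"
      unfolding pairwise_def
    proof (intro ballI impI)
      fix A B assume "A \<in> \<Union>\<C>" "B \<in> \<Union>\<C>" and ne: "A \<noteq> B"
      then obtain X Y where "X \<in> \<C>" "A \<in> X" "Y \<in> \<C>" "B \<in> Y" by blast
      then obtain Z where "Z \<in> \<C>" "A \<in> Z" "B \<in> Z" using ch by blast
      then show "?orth A B" using C ne by (auto simp: \<F>_def pairwise_def)
    qed
    then show "\<Union>\<C> \<in> \<F>" using C by (auto simp: \<F>_def)
  qed
  then obtain F where F: "F \<in> \<F>" and max: "\<And>X. X \<in> \<F> \<Longrightarrow> F \<subseteq> X \<Longrightarrow> X = F" by blast
  have Fp: "\<And>Q. Q \<in> F \<Longrightarrow> prj Q \<and> Q \<noteq> 0 \<and> psub Q P \<and> D Q" and Fo: "pairwise ?orth F"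
    using F by (auto simp: \<F>_def)
  have cF: "countable F" by (rule countable_orth[OF _ Fo]) (simp add: Fp)
  \<comment> \<open>Indices that number no member of F get the value 0; distinct indices with
    nonzero values name distinct members, since the numbering returns the index.\<close>
  define p where "p n = (if n \<in> to_nat_on F ` F then from_nat_into F n else 0)" for n
  have pF: "p n \<in> F \<and> to_nat_on F (p n) = n \<or> p n = 0" for n
    using cF by (auto simp: p_def)
  have Fpn: "\<exists>n. p n = Q" if "Q \<in> F" for Q
    using that cF by (intro exI[of _ "to_nat_on F Q"]) (simp add: p_def)
  have pp: "prj (p n)" "psub (p n) P" "p n = 0 \<or> D (p n)" for n using pF[of n] Fp by auto
  have os: "orth_seq p"
    unfolding orth_seq_def
  proof (intro conjI allI impI)
    show "orth_proj (p n)" for n using pp prjD by blast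
    fix m n :: nat and x assume "m \<noteq> n"
    then have "p m = 0 \<or> p n = 0 \<or> p m \<in> F \<and> p n \<in> F \<and> p m \<noteq> p n" using pF by metis
    then show "p m (p n x) = 0" using Fo by (auto simp: pairwise_def)
  qed
  obtain S :: "'h op" where S: "orth_proj S" "\<And>x. (\<lambda>n. p n x) sums S x"
    "\<And>n x. S (p n x) = p n x" "\<And>n x. p n (S x) = p n x"
    using orth_seq_sums[OF os] by blast
  have prjS: "prj S" using prj_sums[OF os pp(1) S(2)] .
  have SP: "psub S P" by (rule psub_sums[OF S(2) pp(2)])
  have "S = P"
  proof (rule ccontr)
    assume "S \<noteq> P"
    then have "P - S \<noteq> 0" by simp
    moreover have "prj (P - S)" by (rule prj_diff[OF prjS P SP])
    moreover have "psub (P - S) P" by (rule psub_diff(1)[OF SP S(1) prjD(2)[OF P]])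
    ultimately obtain R where R: "prj R" "R \<noteq> 0" "psub R (P - S)" "D R" using dense by blast
    have RS: "?orth S R" "?orth R S"
      using orth_psub[of S "P - S" S R] psub_diff(2)[OF SP S(1) prjD(2)[OF P]] R S(1) psub_refl
        orth_sym[of S R] prjD(2)[OF R(1)] by blast+
    have "R \<notin> F"
    proof
      assume "R \<in> F"
      then obtain n where "p n = R" using Fpn by blast
      then have "R x = 0" for x using S(3)[of n x] RS(1) by simp
      then show False using R(2) by (metis blinfun_eqI zero_blinfun.rep_eq)
    qed
    moreover have "insert R F \<in> \<F>"
    proof -
      have "?orth R Q" "?orth Q R" if "Q \<in> F" for Q
        using RS S(3,4) Fpn[OF that] by (metis, metis blinfun.zero_right)
      then have "pairwise ?orth (insert R F)" using Fo by (auto simp: pairwise_insert)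
      moreover have "psub R P" using R(3) psub_diff(1)[OF SP S(1) prjD(2)[OF P]] psub_trans by blast
      ultimately show ?thesis using Fp R by (auto simp: \<F>_def)
    qed
    ultimately show False using max[of "insert R F"] by blast
  qed
  then show ?thesis using os pp S(2) by blast
qed

text \<open>The terms are the images of R under the powers of V, as in the Wold decomposition.
  Pulling back by V reduces the orthogonality of two terms to that of R and a projection below
  Q.\<close>

lemma wandering_sequence:
  assumes V: "V \<in> vn" "pisom V P Q" and QP: "psub Q P" and R: "prj R" "psub R P" "\<And>x. R (Q x) = 0"
  shows "\<exists>r. orth_seq r \<and> r 0 = R \<and> (\<forall>n::nat. prj (r n) \<and> psub (r n) P \<and> eqv R (r n) \<and>
     r (Suc n) = V o\<^sub>L r n o\<^sub>L hadj V)"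
proof -
  define r where "r = rec_nat R (\<lambda>_ S. V o\<^sub>L S o\<^sub>L hadj V)"
  have r0: "r 0 = R" and rS: "r (Suc n) = V o\<^sub>L r n o\<^sub>L hadj V" for n by (simp_all add: r_def)
  have rQ: "prj (r n) \<and> psub (r n) P \<and> eqv R (r n) \<and> psub (r (Suc n)) Q" for n
  proof (induction n)
    case 0
    show ?case using R eqv_refl pisom_restrict(2)[OF V(2) prjD(2)[OF R(1)] R(2)] by (simp add: r0 rS)
  next
    case (Suc n)
    then have pr: "prj (r n)" "psub (r n) P" "eqv R (r n)" "psub (r (Suc n)) Q" by blast+
    have "eqv (r n) (r (Suc n))"
      unfolding eqv_def rS using pisom_restrict(1)[OF V(2) prjD(2)[OF pr(1)] pr(2)] V(1) prjD(1)[OF pr(1)]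
      by (intro bexI[of _ "V o\<^sub>L r n"] vn_intros) auto
    then have "prj (r (Suc n))" "eqv R (r (Suc n))" using eqv_prj eqv_trans pr by blast+
    moreover have "psub (r (Suc n)) P" using pr QP psub_trans by blast
    ultimately show ?case
      using pisom_restrict(2)[OF V(2), of "r (Suc n)"] prjD(2) rS[of "Suc n"] by metis
  qed
  have lt: "r m (r (m + Suc k) x) = 0" for m k x
  proof (induction m arbitrary: x)
    case 0
    have "r (Suc k) x = Q (r (Suc k) x)" using rQ by (simp add: psub_def)
    then show ?case using R(3) by (metis add_0 r0)
  next
    case (Suc m)
    have "P (r (m + Suc k) y) = r (m + Suc k) y" for y using rQ by (simp add: psub_def)
    then show ?case using Suc by (simp add: rS pisomD[OF V(2)])
  qed
  have "orth_seq r"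
    unfolding orth_seq_def
  proof (intro conjI allI impI)
    show op: "orth_proj (r n)" for n using rQ prjD by blast
    fix m n :: nat and x assume "m \<noteq> n"
    then consider "m < n" | "n < m" by linarith
    then show "r m (r n x) = 0"
    proof cases
      case 1
      then obtain k where "n = m + Suc k" using less_imp_Suc_add by auto
      then show ?thesis using lt by simp
    next
      case 2
      then obtain k where "m = n + Suc k" using less_imp_Suc_add by auto
      then show ?thesis using orth_sym[OF lt op op] by simp
    qed
  qed
  then show ?thesis using r0 rS rQ by blast
qed

text \<open>The nonzero gap between P and an equivalent proper subprojection wanders under the
  partial isometry.\<close>

lemma ex_orth_copies:
  assumes "prj P" "P \<noteq> 0"
  shows "\<exists>r R. orth_seq r \<and> R \<noteq> 0 \<and> (\<forall>n::nat. prj (r n) \<and> psub (r n) P \<and> eqv R (r n))"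
proof -
  obtain Q where Q: "prj Q" "psub Q P" "eqv P Q" "Q \<noteq> P" using infinite_prj[OF assms] by blast
  then obtain V where V: "V \<in> vn" "pisom V P Q" by (auto simp: eqv_def)
  note d = psub_diff[OF Q(2) prjD(2)[OF Q(1)] prjD(2)[OF assms(1)]]
  have "P - Q \<noteq> 0" using Q(4) by simp
  then show ?thesis
    using wandering_sequence[OF V Q(2) prj_diff[OF Q(1) assms(1) Q(2)] d(1) d(3)] by blast
qed

text \<open>Q contains a sequence of orthogonal copies of one nonzero R, and P is a countable sum of
  pieces that each embed into R. The n-th piece goes into the n-th copy; that a sequence of pieces
  is enough is where \<sigma>-finiteness acts.\<close>

lemma subeqv_any:
  assumes P: "prj P" and Q: "prj Q" "Q \<noteq> 0"
  shows "subeqv P Q"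
proof -
  obtain r R where r: "orth_seq r" "R \<noteq> 0" "\<And>n::nat. prj (r n)" "\<And>n. psub (r n) Q" "\<And>n. eqv R (r n)"
    using ex_orth_copies[OF Q] by blast
  have R: "prj R" using r(5) eqv_prj by blast
  have "\<exists>S'. prj S' \<and> S' \<noteq> 0 \<and> psub S' S \<and> subeqv S' R" if "prj S" "S \<noteq> 0" "psub S P" for S
    using ex_equivalent_pieces[OF that(1,2) R r(2)] unfolding subeqv_def by blast
  from exhaustion[OF P this] obtain p where p: "orth_seq p" "\<And>n::nat. prj (p n)"
    "\<And>n. p n = 0 \<or> subeqv (p n) R" "\<And>x. (\<lambda>n. blinfun_apply (p n) x) sums P x" by blast
  have "subeqv (p n) (r n)" for n
  proof (cases "p n = 0")
    case True
    then show ?thesis unfolding subeqv_def using eqv_refl by (intro exI[of _ 0]) auto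
  next
    case False
    then show ?thesis using p(3)[of n] subeqv_eqv r(5) by blast
  qed
  then have "\<exists>V g. V \<in> vn \<and> pisom V (p n) g \<and> prj g \<and> psub g (r n)" for n
    unfolding subeqv_def eqv_def by blast
  then obtain V g where V: "\<And>n. V n \<in> vn" "\<And>n. pisom (V n) (p n) (g n)" "\<And>n. prj (g n)" "\<And>n. psub (g n) (r n)"
    by metis
  have g: "orth_seq g" using orth_seq_psub[OF r(1) prjD(2)[OF V(3)] V(4)] .
  obtain W S G :: "'h op" where W: "pisom W S G" "\<And>x. (\<lambda>n. V n x) sums W x"
    "\<And>x. (\<lambda>n. p n x) sums S x" "\<And>x. (\<lambda>n. g n x) sums G x"
    using pisom_sums[OF V(2) p(1) g] by blast
  have "S = P" by (rule blinfun_eqI) (rule sums_unique2[OF W(3) p(4)])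
  moreover have "psub G Q" by (rule psub_sums[OF W(4)]) (rule psub_trans[OF V(4) r(4)])
  moreover have "W \<in> vn" by (rule vn_sums[OF V(1) W(2)])
  ultimately show ?thesis
    unfolding subeqv_def eqv_def using W(1) prj_sums[OF g V(3) W(4)] by blast
qed

text \<open>The Cantor--Bernstein argument for projections. With V embedding P into Q and W
  embedding Q onto Q' below P, let E be the sum of the images of the gap P - Q' under the powers of
  T = W V; use V on E and the adjoint of W on P - E.\<close>

lemma eqv_any:
  assumes P: "prj P" "P \<noteq> 0" and Q: "prj Q" "Q \<noteq> 0"
  shows "eqv P Q"
proof -
  obtain P' V where P': "prj P'" "psub P' Q" and V: "V \<in> vn" "pisom V P P'"
    using subeqv_any[OF P(1) Q] by (auto simp: subeqv_def eqv_def)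
  obtain Q' W where Q': "prj Q'" "psub Q' P" and W: "W \<in> vn" "pisom W Q Q'"
    using subeqv_any[OF Q(1) P] by (auto simp: subeqv_def eqv_def)
  define T where "T = W o\<^sub>L V"
  note WV = pisom_restrict[OF W(2) prjD(2)[OF P'(1)] P'(2)]
  define P'' where "P'' = W o\<^sub>L P' o\<^sub>L hadj W"
  have "pisom ((W o\<^sub>L P') o\<^sub>L V) P P''"
    unfolding P''_def by (rule pisom_compose[OF V(2) WV(1)])
  moreover have "(W o\<^sub>L P') o\<^sub>L V = T"
    by (rule blinfun_eqI) (simp add: T_def pisomD[OF V(2)])
  ultimately have T: "pisom T P P''" by simp
  have Tv: "T \<in> vn" unfolding T_def by (intro vn_intros V W)
  have P''Q': "psub P'' Q'" unfolding P''_def by (rule WV(2))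
  note dQ = psub_diff[OF Q'(2) prjD(2)[OF Q'(1)] prjD(2)[OF P(1)]]
  have "(P - Q') (P'' x) = 0" for x
    using dQ(3) psubD[OF P''Q'] by metis
  from wandering_sequence[OF Tv T psub_trans[OF P''Q' Q'(2)] prj_diff[OF Q'(1) P(1) Q'(2)] dQ(1) this]
  obtain r where r: "orth_seq r" "r 0 = P - Q'" "\<And>n::nat. prj (r n)" "\<And>n. psub (r n) P"
    "\<And>n. r (Suc n) = T o\<^sub>L r n o\<^sub>L hadj T" by blast
  obtain E :: "'h op" where E: "orth_proj E" "\<And>x. (\<lambda>n. r n x) sums E x" "\<And>n x. E (r n x) = r n x"
    "\<And>n x. r n (E x) = r n x"
    using orth_seq_sums[OF r(1)] by blast
  have Ep: "prj E" using prj_sums[OF r(1,3) E(2)] .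
  have EP: "psub E P" by (rule psub_sums[OF E(2) r(4)])
  note dE = psub_diff[OF EP E(1) prjD(2)[OF P(1)]]
  have PE: "prj (P - E)" by (rule prj_diff[OF Ep P(1) EP])
  \<comment> \<open>E equals the gap P - Q' plus its own image under T. This self-similarity is what
    matches the two final projections.\<close>
  have ETE: "E x = (P - Q') x + T (E (hadj T x))" for x
  proof (rule sums_unique2[OF E(2)])
    have "(\<lambda>n. T (r n (hadj T x))) sums T (E (hadj T x))"
      by (rule bounded_linear.sums[OF blinfun.bounded_linear_right E(2)])
    then have "(\<lambda>n. r (Suc n) x) sums T (E (hadj T x))" by (simp add: r(5))
    then have "(\<lambda>n. r n x) sums (T (E (hadj T x)) + r 0 x)" by (rule sums_Suc)
    then show "(\<lambda>n. r n x) sums ((P - Q') x + T (E (hadj T x)))" by (simp add: r(2) add.commute)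
  qed
  \<comment> \<open>E contains the gap, so the remainder lies below Q', where the adjoint of W is
    isometric.\<close>
  have PEQ': "psub (P - E) Q'"
    unfolding psub_def
  proof
    fix x
    have "(P - Q') ((P - E) x) = 0"
      using E(4)[of 0 x] unfolding blinfun.diff_left[of P E] blinfun.diff_right
        psubD'[OF dQ(1) prjD(2)[OF prj_diff[OF Q'(1) P(1) Q'(2)]] prjD(2)[OF P(1)]]
      by (simp add: r(2) blinfun.bilinear_simps)
    then show "Q' ((P - E) x) = (P - E) x"
      by (simp add: blinfun.diff_left blinfun.diff_right orth_proj_idem[OF prjD(2)[OF P(1)]] psubD[OF EP]
          algebra_simps)
  qed
  let ?V' = "V o\<^sub>L E" and ?W' = "hadj W o\<^sub>L (P - E)"
  let ?A = "V o\<^sub>L E o\<^sub>L hadj V" and ?B = "hadj W o\<^sub>L (P - E) o\<^sub>L hadj (hadj W)"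
  have V': "pisom ?V' E ?A" by (rule pisom_restrict(1)[OF V(2) E(1) EP])
  have W': "pisom ?W' (P - E) ?B" by (rule pisom_restrict(1)[OF pisom_hadj[OF W(2)] prjD(2)[OF PE] PEQ'])
  \<comment> \<open>Pulling E back along W kills the gap and undoes the W in T, leaving E pushed
    forward by V. Hence the two final projections sum to Q.\<close>
  have AB: "?A x + ?B x = Q x" for x
  proof -
    have "hadj W (P (W x)) = Q x"
      using psubD[OF Q'(2), of "W x"] by (simp add: pisomD[OF W(2)])
    moreover have "hadj W (E (W x)) = V (E (hadj V x))"
    proof -
      have "hadj W ((P - Q') (W x)) = 0"
        using psubD[OF Q'(2), of "W x"] by (simp add: blinfun.bilinear_simps pisomD[OF W(2)])
      moreover have "Q (V (E y)) = V (E y)" for y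
        using psubD[OF P'(2), of "V (E y)"] by (simp add: pisomD[OF V(2)])
      moreover have "hadj V (Q x) = hadj V x"
        using psubD'[OF P'(2) prjD(2)[OF P'(1)] prjD(2)[OF Q(1)], of x] pisomD(7)[OF V(2)] by metis
      ultimately show ?thesis
        by (simp add: ETE[of "W x"] blinfun.add_right T_def hadj_compose pisomD[OF W(2)])
    qed
    ultimately show ?thesis by (simp add: blinfun.bilinear_simps)
  qed
  have AQ: "psub ?A Q" using pisom_restrict(2)[OF V(2) E(1) EP] P'(2) psub_trans by blast
  have oA: "orth_proj ?A" using pisomD(2)[OF V'] .
  have "?A (?B x) = 0" for x
  proof -
    have "?B x = Q x - ?A x" using AB[of x] by (simp add: algebra_simps)
    then show ?thesis
      using psubD'[OF AQ oA prjD(2)[OF Q(1)], of x] orth_proj_idem[OF oA, of x]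
      by (simp only: blinfun.diff_right) simp
  qed
  then have "pisom (?V' + ?W') (E + (P - E)) (?A + ?B)"
    by (rule pisom_add[OF V' W' dE(2)])
  moreover have "?A + ?B = Q" by (rule blinfun_eqI) (simp only: plus_blinfun.rep_eq AB)
  ultimately have "pisom (?V' + ?W') P Q" by simp
  moreover have "?V' + ?W' \<in> vn" by (intro vn_intros V prjD(1) Ep P vn_hadj W)
  ultimately show ?thesis by (auto simp: eqv_def)
qed

lemma ex_orth_split:
  assumes "prj P" "P \<noteq> 0"
  shows "\<exists>r. orth_seq r \<and> (\<forall>n::nat. prj (r n) \<and> r n \<noteq> 0 \<and> psub (r n) P) \<and>
     (\<forall>x. (\<lambda>n. blinfun_apply (r n) x) sums P x)"
proof -
  obtain r R where r: "orth_seq r" "R \<noteq> 0" "\<And>n::nat. prj (r n)" "\<And>n. psub (r n) P" "\<And>n. eqv R (r n)"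
    using ex_orth_copies[OF assms] by blast
  obtain E :: "'h op" where E: "orth_proj E" "\<And>x. (\<lambda>n. r n x) sums E x" "\<And>n x. E (r n x) = r n x"
    "\<And>n x. r n (E x) = r n x"
    using orth_seq_sums[OF r(1)] by blast
  have Ep: "prj E" using prj_sums[OF r(1,3) E(2)] .
  have EP: "psub E P" by (rule psub_sums[OF E(2) r(4)])
  note dE = psub_diff[OF EP E(1) prjD(2)[OF assms(1)]]
  have PE: "prj (P - E)" by (rule prj_diff[OF Ep assms(1) EP])
  \<comment> \<open>The orthogonal copies need not fill P; the remainder P - E is added to the
    zeroth one.\<close>
  define s where "s n = (if n = 0 then r 0 + (P - E) else r n)" for n
  have o: "r n ((P - E) x) = 0" for n x
    using E(4)[of n x] psubD'[OF r(4) prjD(2)[OF r(3)] prjD(2)[OF assms(1)]] by (simp add: blinfun.bilinear_simps)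
  have o': "(P - E) (r n x) = 0" for n x by (rule orth_sym[OF o prjD(2)[OF r(3)] prjD(2)[OF PE]])
  have sp: "prj (s n)" for n unfolding s_def using r(3) prj_add[OF r(3) PE o] by auto
  have os: "orth_seq s"
    unfolding orth_seq_def
  proof (intro conjI allI impI)
    show "orth_proj (s n)" for n using sp prjD by blast
    fix m n :: nat and x assume "m \<noteq> n"
    then show "s m (s n x) = 0"
      using orth_seqD(2)[OF r(1), of m n x] o o' by (auto simp: s_def blinfun.add_left blinfun.add_right)
  qed
  have nz: "s n \<noteq> 0" for n
  proof
    assume "s n = 0"
    then have "r n x = 0" for x
      using o'[of n x] orth_proj_idem[OF prjD(2)[OF r(3)], of n x]
      by (auto simp: s_def blinfun.add_left split: if_splits)
        (metis add.right_neutral blinfun.add_left blinfun.zero_left)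
    then have "r n = 0" by (intro blinfun_eqI) simp
    then show False using r(2) eqv_zero_iff[OF r(5)] by blast
  qed
  have ps: "psub (s n) P" for n unfolding s_def using r(4) psub_add[OF r(4) dE(1)] by auto
  have "(\<lambda>n. s n x) sums P x" for x
  proof -
    have "(\<lambda>n. r n x + (if n = 0 then (P - E) x else 0)) sums (E x + (P - E) x)"
      using sums_add[OF E(2) sums_single[of 0 "\<lambda>_. (P - E) x"]] by simp
    moreover have "(\<lambda>n. r n x + (if n = 0 then (P - E) x else 0)) = (\<lambda>n. s n x)"
      by (auto simp: s_def blinfun.add_left)
    ultimately show ?thesis by (simp add: blinfun.diff_left)
  qed
  then show ?thesis using os sp nz ps by blast
qed

end

section \<open>Faithful states and diagonal minorants\<close>

lemma orth_commute_form:
  fixes A P :: "'h::real_inner op"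
  assumes "orth_proj P" "commutes A P"
  shows "A x \<bullet> x = A (P x) \<bullet> P x + A (x - P x) \<bullet> (x - P x)"
proof -
  note sa = selfadjD[OF orth_proj_selfadj[OF assms(1)]]
  have 1: "A (P x) \<bullet> y = A (P x) \<bullet> P y" for y
    by (metis assms commutesD orth_proj_idem sa)
  have "A (x - P x) \<bullet> P x = P (A (x - P x)) \<bullet> x" by (simp add: sa)
  also have "P (A (x - P x)) = 0"
    by (simp add: blinfun.diff_right commutesD[OF assms(2)] orth_proj_idem[OF assms(1)])
  finally have "A (x - P x) \<bullet> P x = 0" by simp
  then show ?thesis using 1[of x]
    by (simp add: blinfun.diff_right inner_diff_left inner_diff_right)
qed

lemma orth_commute_form_sum:
  fixes A :: "'h::real_inner op"
  assumes "psd A" "orth_seq F" "\<And>k. commutes A (F k)" "finite I"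
  shows "(\<Sum>k\<in>I. A (F k x) \<bullet> F k x) \<le> A x \<bullet> x"
proof -
  let ?Q = "\<Sum>k\<in>I. F k"
  have Q: "orth_proj ?Q" by (rule orth_seq_sum_norm(1)[OF assms(2,4)])
  have "commutes A ?Q" using assms(3) by (simp add: commutes_def blinfun.sum_left blinfun.sum_right)
  then have "A x \<bullet> x \<ge> A (?Q x) \<bullet> ?Q x"
    using orth_commute_form[OF Q, of A x] psd_nonneg[OF assms(1), of "x - ?Q x"] by linarith
  moreover have "A (?Q x) \<bullet> ?Q x = (\<Sum>k\<in>I. A (F k x) \<bullet> F k x)"
  proof -
    note sa = selfadjD[OF orth_proj_selfadj[OF orth_seqD(1)[OF assms(2)]]]
    have "A (?Q x) \<bullet> ?Q x = (\<Sum>k\<in>I. A (?Q x) \<bullet> F k x)"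
      by (simp add: blinfun.sum_left inner_sum_right)
    also have "\<dots> = (\<Sum>k\<in>I. A (F k x) \<bullet> F k x)"
    proof (rule sum.cong[OF refl])
      fix k assume k: "k \<in> I"
      have "F k (?Q x) = (\<Sum>j\<in>I. if j = k then F k x else 0)"
        unfolding blinfun.sum_left blinfun.sum_right
        using orth_seqD[OF assms(2)] by (intro sum.cong refl) (auto simp: orth_proj_idem)
      then have Fk: "F k (?Q x) = F k x" using k assms(4) by simp
      have "A (?Q x) \<bullet> F k x = A (?Q x) \<bullet> F k (F k x)" by (simp add: orth_proj_idem[OF orth_seqD(1)[OF assms(2)]])
      also have "\<dots> = A (F k (?Q x)) \<bullet> F k x" by (simp add: sa[symmetric] commutesD[OF assms(3)])
      finally show "A (?Q x) \<bullet> F k x = A (F k x) \<bullet> F k x" by (simp add: Fk)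
    qed
    finally show ?thesis .
  qed
  ultimately show ?thesis by simp
qed

lemma orth_commute_form_sums:
  fixes B S :: "'h::real_hilbert op"
  assumes P: "orth_seq P" "\<And>x. (\<lambda>n. P n x) sums S x" and B: "\<And>n. commutes B (P n)"
  shows "(\<lambda>n. B (P n y) \<bullet> P n y) sums (B (S y) \<bullet> S y)"
proof -
  note sa = selfadjD[OF orth_proj_selfadj[OF orth_seqD(1)[OF P(1)]]]
  have "(\<lambda>n. B (P n y) \<bullet> S y) sums (B (S y) \<bullet> S y)"
    by (rule bounded_linear.sums[OF bounded_linear_inner_left])
      (rule bounded_linear.sums[OF blinfun.bounded_linear_right P(2)])
  moreover have "B (P n y) \<bullet> S y = B (P n y) \<bullet> P n y" for n
  proof -
    have "P n (B (P n y)) = B (P n y)"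
      by (metis B P(1) commutesD orth_proj_idem orth_seqD(1))
    then have "B (P n y) \<bullet> S y = B (P n y) \<bullet> P n (S y)" by (metis sa)
    also have "P n (S y) = P n y"
      using psubD'[OF orth_seq_psub_sum(2)[OF P] orth_seqD(1)[OF P(1)] orth_seq_psub_sum(1)[OF P]] by simp
    finally show ?thesis .
  qed
  ultimately show ?thesis by simp
qed

lemma spec_meas_UN_0:
  fixes T :: "'h::real_hilbert op"
  assumes sa: "selfadj T" and S: "\<And>n::nat. S n \<in> sets borel" "\<And>n. spec_meas T (S n) = 0"
  shows "spec_meas T (\<Union>n. S n) = 0"
proof (rule spec_meas_eqI[OF sa])
  show "(\<Union>n. S n) \<in> sets borel" using S by auto
  fix x
  have "emeasure (sm T x) (S n) = 0" for n
    using spec_meas(3)[OF sa S(1), of n x] S(2)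
    by (simp add: finite_measure.emeasure_eq_measure[OF smeas_finite[OF sa]])
  then have "emeasure (sm T x) (\<Union>n. S n) = 0" using S(1) by (intro emeasure_UN_eq_0) auto
  then show "blinfun_apply 0 x \<bullet> x = measure (sm T x) (\<Union>n. S n)" by (simp add: measure_def)
qed (simp add: selfadj_def)

lemma spec_meas_mono:
  fixes T :: "'h::real_hilbert op"
  assumes "selfadj T" "R \<in> sets borel" "S \<in> sets borel" "R \<subseteq> S"
  shows "psub (spec_meas T R) (spec_meas T S)"
  using spec_meas_Int[OF assms(1,3,2)] assms(4) by (simp add: psub_def Int_absorb1)

lemma spec_meas_compl:
  fixes T :: "'h::real_hilbert op"
  assumes "selfadj T" "S \<in> sets borel"
  shows "spec_meas T (- S) = id_blinfun - spec_meas T S"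
  using spec_meas_Un[OF assms(1), of S "- S"] assms spec_meas_UNIV[OF assms(1)]
  by (simp add: Compl_partition algebra_simps)

lemma spec_meas_commutes: "selfadj T \<Longrightarrow> S \<in> sets borel \<Longrightarrow> commutes T (spec_meas T S)"
  by (simp add: commutes_def spec_meas_commute_op)

lemma spec_meas_atLeast_nonzero:
  fixes T :: "'h::real_hilbert op"
  assumes "psd T" "t < norm T" "0 \<le> t"
  shows "spec_meas T {t..} \<noteq> 0"
proof
  assume 0: "spec_meas T {t..} = 0"
  note sa = psd_selfadj[OF assms(1)]
  have "spec_meas T {..<t} = id_blinfun"
    using spec_meas_compl[OF sa, of "{t..}"] 0 by (simp add: Compl_atLeast)
  then have le: "T x \<bullet> x \<le> t * (norm x)\<^sup>2" for x
    by (intro spec_meas_le[OF sa, of "{..<t}"]) auto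
  then show False using psd_norm_le[OF assms(1) le assms(3)] assms(2) by simp
qed

lemma ker_atMost_0:
  fixes T :: "'h::real_hilbert op"
  assumes "psd T" "spec_meas T {..0} x = x" shows "T x = 0"
  using spec_meas_le[OF psd_selfadj[OF assms(1)], of "{..0}" 0 x] psd_nonneg[OF assms(1), of x] assms
    psd_zero_iff[OF assms(1), of x] by simp

lemma disjoint_incseq:
  fixes r :: "nat \<Rightarrow> real"
  assumes "incseq r"
  shows "disjoint_family (\<lambda>k. {r k..<r (Suc k)})"
proof -
  have lt: "{r m..<r (Suc m)} \<inter> {r n..<r (Suc n)} = {}" if "m < n" for m n
    using incseqD[OF assms, of "Suc m" n] that by auto
  show ?thesis unfolding disjoint_family_on_def
    by (metis lt Int_commute linorder_neqE_nat)
qed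

lemma UN_incseq:
  fixes r :: "nat \<Rightarrow> real"
  assumes "r \<longlonglongrightarrow> a" "\<And>n. r n < a" and that: "incseq r"
  shows "(\<Union>k. {r k..<r (Suc k)}) = {r 0..<a}"
proof (intro equalityI subsetI)
  fix x assume "x \<in> (\<Union>k. {r k..<r (Suc k)})"
  then obtain k where "r k \<le> x" "x < r (Suc k)" by auto
  then show "x \<in> {r 0..<a}" using incseqD[OF that, of 0 k] assms(2)[of "Suc k"] by auto
next
  fix x assume x: "x \<in> {r 0..<a}"
  then obtain n where n: "x < r n" using order_tendstoD(1)[OF assms(1), of x] by (auto simp: eventually_sequentially)
  define m where "m = (LEAST n. x < r n)"
  have m: "x < r m" unfolding m_def using n by (rule LeastI)
  then have "m \<noteq> 0" using x by (cases m) auto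
  then obtain k where k: "m = Suc k" using not0_implies_Suc by blast
  have "\<not> x < r k" using not_less_Least[of k "\<lambda>n. x < r n"] k by (simp add: m_def)
  then show "x \<in> (\<Union>k. {r k..<r (Suc k)})" using m k by (intro UN_I[of k]) auto
qed

lemma disjoint_decseq:
  fixes r :: "nat \<Rightarrow> real"
  assumes "decseq r"
  shows "disjoint_family (\<lambda>k. {r (Suc k)..<r k})"
proof -
  have lt: "{r (Suc m)..<r m} \<inter> {r (Suc n)..<r n} = {}" if "m < n" for m n
    using decseqD[OF assms, of "Suc m" n] that by auto
  show ?thesis unfolding disjoint_family_on_def
    by (metis lt Int_commute linorder_neqE_nat)
qed

lemma UN_decseq:
  fixes r :: "nat \<Rightarrow> real"
  assumes "decseq r" "r \<longlonglongrightarrow> a" "\<And>n. a < r n"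
  shows "(\<Union>k. {r (Suc k)..<r k}) = {a<..<r 0}"
proof (intro equalityI subsetI)
  fix x assume "x \<in> (\<Union>k. {r (Suc k)..<r k})"
  then obtain k where "r (Suc k) \<le> x" "x < r k" by auto
  then show "x \<in> {a<..<r 0}" using decseqD[OF assms(1), of 0 k] assms(3)[of "Suc k"] by auto
next
  fix x assume x: "x \<in> {a<..<r 0}"
  then obtain n where "r n < x" using order_tendstoD(2)[OF assms(2), of x] by (auto simp: eventually_sequentially)
  then have n: "r n \<le> x" by simp
  define m where "m = (LEAST n. r n \<le> x)"
  have m: "r m \<le> x" unfolding m_def using n by (rule LeastI)
  then have "m \<noteq> 0" using x by (cases m) auto
  then obtain k where k: "m = Suc k" using not0_implies_Suc by blast
  have "\<not> r k \<le> x" using not_less_Least[of k "\<lambda>n. r n \<le> x"] k by (simp add: m_def)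
  then show "x \<in> (\<Union>k. {r (Suc k)..<r k})" using m k by (intro UN_I[of k]) auto
qed

section \<open>Cyclic vectors and a faithful functional\<close>

context vn_factor_III
begin

definition vn' :: "'h op set" where "vn' = {T. \<forall>S\<in>vn. commutes S T}"

lemma vn'_intros: "id_blinfun \<in> vn'" "S \<in> vn' \<Longrightarrow> T \<in> vn' \<Longrightarrow> S o\<^sub>L T \<in> vn'" "S \<in> N \<Longrightarrow> S \<in> vn'"
  by (auto simp: vn'_def vn_def intro: commutes_intros commutes_sym[THEN iffD1])

text \<open>For a projection R this says that its range lies in the closure of \<open>vn'\<close>
  applied to x. Then x separates: an operator of the algebra that annihilates x vanishes on the
  range of R.\<close>

definition cyclic :: "'h op \<Rightarrow> 'h \<Rightarrow> bool" where
  "cyclic R x \<longleftrightarrow> (\<forall>z. (\<forall>T\<in>vn'. z \<bullet> blinfun_apply T x = 0) \<longrightarrow> R z = 0)"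

text \<open>Project onto the closure of \<open>vn'\<close> applied to a vector x in the range of R.
  Its complement L is invariant under N, so the projection is in the algebra; as R commutes with
  \<open>vn'\<close>, the closure stays in the range of R.\<close>

lemma ex_cyclic_prj:
  assumes R: "prj R" "R \<noteq> 0"
  shows "\<exists>R'. prj R' \<and> R' \<noteq> 0 \<and> psub R' R \<and> (\<exists>x. cyclic R' x)"
proof -
  obtain y where y: "R y \<noteq> 0" using R(2) by (metis blinfun_eqI zero_blinfun.rep_eq)
  define x where "x = R y"
  define L where "L = {z. \<forall>T\<in>vn'. z \<bullet> blinfun_apply T x = 0}"
  have cl: "closed L"
  proof -
    have "L = (\<Inter>T\<in>vn'. {z. z \<bullet> blinfun_apply T x = 0})" by (auto simp: L_def)
    then show ?thesis by (auto intro!: closed_INT closed_Collect_eq continuous_intros)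
  qed
  have sub: "subspace L" by (auto simp: L_def subspace_def inner_add_left)
  have "S z \<in> L" if "S \<in> N" "z \<in> L" for S z
    unfolding L_def
  proof (intro CollectI ballI)
    fix T assume "T \<in> vn'"
    then have "hadj S o\<^sub>L T \<in> vn'" using vn'_intros N_hadj that by blast
    moreover have "\<forall>T\<in>vn'. z \<bullet> blinfun_apply T x = 0" using that by (simp add: L_def)
    ultimately have "z \<bullet> (hadj S o\<^sub>L T) x = 0" by blast
    then show "S z \<bullet> T x = 0" by (simp add: hadj)
  qed
  then have Z: "prj (proj_on L)" using vn_proj_on[OF cl sub] proj_on(1)[OF cl sub] by (simp add: prj_def)
  let ?R = "id_blinfun - proj_on L"
  have "prj ?R" by (rule prj_diff[OF Z]) auto
  moreover have "cyclic ?R x"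
    unfolding cyclic_def
  proof (intro allI impI)
    fix z assume "\<forall>T\<in>vn'. z \<bullet> blinfun_apply T x = 0"
    then have "proj_on L z = z" using proj_on_eq[OF cl sub, of z] by (simp add: L_def)
    then show "?R z = 0" by (simp add: blinfun.diff_left)
  qed
  moreover have "?R \<noteq> 0"
  proof
    assume "?R = 0"
    then have "proj_on L x = x" by (metis blinfun_apply_id_blinfun id_apply right_minus_eq)
    then have "x \<in> L" using proj_on_eq[OF cl sub] by blast
    then have "\<forall>T\<in>vn'. x \<bullet> blinfun_apply T x = 0" by (simp add: L_def)
    then have "x \<bullet> id_blinfun x = 0" using vn'_intros(1) by blast
    then show False using y by (simp add: x_def)
  qed
  moreover have "psub ?R R"
  proof -
    have "psub (id_blinfun - R) (proj_on L)"
      unfolding psub_def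
    proof
      fix z
      have "(z - R z) \<bullet> T x = 0" if "T \<in> vn'" for T
      proof -
        have "commutes R T" using that prjD(1)[OF R(1)] by (simp add: vn'_def)
        then have "R (T x) = T (R x)" by (rule commutesD)
        then have "R (T x) = T x" by (simp add: x_def orth_proj_idem[OF prjD(2)[OF R(1)]])
        then show ?thesis
          using selfadjD[OF orth_proj_selfadj[OF prjD(2)[OF R(1)]], of z "T x"] by (simp add: inner_diff_left)
      qed
      then have "z - R z \<in> L" by (simp add: L_def)
      then show "proj_on L ((id_blinfun - R) z) = (id_blinfun - R) z"
        using proj_on_eq[OF cl sub] by (simp add: blinfun.diff_left)
    qed
    moreover have "orth_proj (id_blinfun - R)" using R by (intro orth_proj_diff prjD) auto
    ultimately have *: "(id_blinfun - R) (proj_on L z) = (id_blinfun - R) z" for z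
      by (intro psubD' prjD(2)[OF Z])
    have "R (z - proj_on L z) = z - proj_on L z" for z
      using *[of z] by (simp add: blinfun.bilinear_simps algebra_simps)
    then show ?thesis by (simp add: psub_def blinfun.diff_left)
  qed
  ultimately show ?thesis by blast
qed

text \<open>Exhaust the identity by countably many cyclic projections and sum the vector functionals
  of the cyclic vectors with summable weights. If the sum vanishes at a positive T of the algebra, T
  kills every cyclic vector, and then every \<open>p n\<close> kills the range of T.\<close>

lemma ex_faithful_functional:
  "\<exists>\<phi> :: 'h op \<Rightarrow> real. (\<forall>S T. \<phi> (S + T) = \<phi> S + \<phi> T) \<and> (\<forall>r T. \<phi> (r *\<^sub>R T) = r * \<phi> T) \<and>
     (\<forall>T. psd T \<longrightarrow> 0 \<le> \<phi> T) \<and> (\<forall>T\<in>vn. psd T \<longrightarrow> \<phi> T = 0 \<longrightarrow> T = 0)"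
proof -
  obtain p where p: "orth_seq p" "\<And>n::nat. prj (p n)" "\<And>n. p n = 0 \<or> (\<exists>x. cyclic (p n) x)"
    "\<And>x. (\<lambda>n. blinfun_apply (p n) x) sums blinfun_apply id_blinfun x"
    using exhaustion[of id_blinfun "\<lambda>R. \<exists>x. cyclic R x"] ex_cyclic_prj by auto
  have "\<exists>x. cyclic (p n) x" for n using p(3)[of n] by (auto simp: cyclic_def)
  then obtain x where x: "\<And>n. cyclic (p n) (x n)" by metis
  \<comment> \<open>The denominator bounds the n-th term by \<open>norm T * (1/2) ^ n\<close>,
    whatever the length of \<open>x n\<close>.\<close>
  define w where "w n = (1/2) ^ n / (1 + (norm (x n))\<^sup>2)" for n
  have w: "w n > 0" for n by (simp add: w_def add_pos_nonneg)
  define \<phi> where "\<phi> T = (\<Sum>n. w n * (blinfun_apply T (x n) \<bullet> x n))" for T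
  have sm: "summable (\<lambda>n. w n * (blinfun_apply T (x n) \<bullet> x n))" for T
  proof (rule summable_comparison_test')
    show "summable (\<lambda>n. norm T * (1/2::real) ^ n)" by (intro summable_mult summable_geometric) simp
    fix n
    have "\<bar>T (x n) \<bullet> x n\<bar> \<le> norm T * (norm (x n))\<^sup>2"
      using psd_le_norm[of T "x n"] psd_le_norm[of "- T" "x n"] by (simp add: blinfun.bilinear_simps abs_le_iff)
    also have "\<dots> \<le> norm T * (1 + (norm (x n))\<^sup>2)" by (intro mult_left_mono) auto
    finally have "w n * \<bar>T (x n) \<bullet> x n\<bar> \<le> w n * (norm T * (1 + (norm (x n))\<^sup>2))"
      using w[of n] by (intro mult_left_mono) auto
    also have "\<dots> = norm T * (1/2) ^ n"
    proof -
      have "1 + (norm (x n))\<^sup>2 \<noteq> 0" by (smt (verit) zero_le_power2)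
      then show ?thesis by (simp add: w_def)
    qed
    finally show "norm (w n * (T (x n) \<bullet> x n)) \<le> norm T * (1/2) ^ n"
      using w[of n] by (simp add: abs_mult)
  qed
  have "\<phi> (S + T) = \<phi> S + \<phi> T" for S T
    unfolding \<phi>_def using suminf_add[OF sm sm] by (simp add: blinfun.add_left inner_add_left distrib_left)
  moreover have "\<phi> (r *\<^sub>R T) = r * \<phi> T" for r T
    unfolding \<phi>_def using suminf_mult[OF sm, of r T] by (simp add: blinfun.scaleR_left mult.left_commute)
  moreover have pos: "0 \<le> w n * (T (x n) \<bullet> x n)" if "psd T" for T n
    using w[of n] psd_nonneg[OF that] by simp
  moreover have "T = 0" if T: "T \<in> vn" "psd T" "\<phi> T = 0" for T
  proof -
    have "w n * (T (x n) \<bullet> x n) = 0" for n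
      using suminf_eq_zero_iff[OF sm pos[OF T(2)]] T(3) by (auto simp: \<phi>_def)
    then have Tx: "T (x n) = 0" for n using w[of n] psd_zero_iff[OF T(2)] by (metis less_irrefl mult_eq_0_iff)
    have "p n (T z) = 0" for n z
    proof -
      have "T z \<bullet> S (x n) = 0" if "S \<in> vn'" for S
        using that T(1) Tx[of n] by (simp add: selfadjD[OF psd_selfadj[OF T(2)]] vn'_def commutesD)
      then show ?thesis using x[of n] by (simp add: cyclic_def)
    qed
    then have "(\<lambda>n. p n (T z)) sums 0" for z by simp
    from sums_unique2[OF this] have "T z = 0" for z using p(4)[of "T z"] by simp
    then show ?thesis by (intro blinfun_eqI) simp
  qed
  moreover have "0 \<le> \<phi> T" if "psd T" for T
    unfolding \<phi>_def by (rule suminf_nonneg[OF sm pos[OF that]])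
  ultimately show ?thesis by blast
qed

section \<open>Unitary equivalence from partial isometries\<close>

definition ueq :: "'h op \<Rightarrow> 'h op \<Rightarrow> bool" where
  "ueq C B \<longleftrightarrow> (\<exists>U\<in>vn. pisom U id_blinfun id_blinfun \<and> C = U o\<^sub>L B o\<^sub>L hadj U)"

lemma prj_ker: "selfadj T \<Longrightarrow> T \<in> vn \<Longrightarrow> prj (ker_proj T)"
  unfolding prj_def using ker_proj(1) vn_bicommutes[OF _ ker_proj_bicommutes] by blast

text \<open>Since R and S are proper, their complements are nonzero and hence equivalent, and W
  extends to a unitary by such an equivalence Y. As B lives under R, the conjugate of B does not see
  Y.\<close>

lemma pisom_ueq:
  assumes B: "B \<in> vn" "selfadj B" and W: "W \<in> vn" "pisom W R S"
    and BR: "\<And>x. B (R x) = blinfun_apply B x" and ne: "R \<noteq> id_blinfun" "S \<noteq> id_blinfun"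
  shows "ueq (W o\<^sub>L B o\<^sub>L hadj W) B"
proof -
  have "eqv R S" using W by (auto simp: eqv_def)
  then have RS: "prj R" "prj S" using eqv_prj by blast+
  have K: "prj (id_blinfun - R)" "prj (id_blinfun - S)"
    by (rule prj_diff, simp_all add: RS)+
  have RB: "R (B x) = B x" for x
  proof (rule inner_eqI)
    fix z
    have "R (B x) \<bullet> z = x \<bullet> B (R z)"
      by (simp add: selfadjD[OF orth_proj_selfadj[OF prjD(2)[OF RS(1)]]] selfadjD[OF B(2)])
    then show "R (B x) \<bullet> z = B x \<bullet> z" by (simp add: BR selfadjD[OF B(2)])
  qed
  obtain Y where Y: "Y \<in> vn" "pisom Y (id_blinfun - R) (id_blinfun - S)"
    using eqv_any[OF K(1) _ K(2)] ne by (auto simp: eqv_def)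
  define U where "U = W + Y"
  have "pisom U (R + (id_blinfun - R)) (S + (id_blinfun - S))"
    unfolding U_def by (rule pisom_add[OF W(2) Y(2)])
      (simp_all add: blinfun.bilinear_simps orth_proj_idem prjD(2) RS)
  then have U: "pisom U id_blinfun id_blinfun" by simp
  have Uv: "U \<in> vn" unfolding U_def by (intro vn_intros W Y)
  have YB: "Y (B x) = 0" for x using pisomD(5)[OF Y(2), of "B x"] by (simp add: blinfun.bilinear_simps RB)
  have BY: "B (hadj Y x) = 0" for x
    using arg_cong[OF pisomD(8)[OF Y(2), of x], of "blinfun_apply B"] by (simp add: blinfun.bilinear_simps BR)
  have "U o\<^sub>L B o\<^sub>L hadj U = W o\<^sub>L B o\<^sub>L hadj W"
    by (rule blinfun_eqI) (simp add: U_def hadj_add blinfun.bilinear_simps YB BY)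
  then show ?thesis using U Uv by (auto simp: ueq_def)
qed

text \<open>A unitary W is immediate. Otherwise B has a kernel K, and cutting W down to the
  complement of K gives proper projections on both sides without changing the conjugate of
  B.\<close>

lemma isometry_ueq:
  assumes B: "B \<in> vn" "selfadj B" and W: "W \<in> vn" "pisom W id_blinfun Q"
    and K: "ker_proj B \<noteq> 0 \<or> Q = id_blinfun"
  shows "ueq (W o\<^sub>L B o\<^sub>L hadj W) B"
proof (cases "Q = id_blinfun")
  case True
  then show ?thesis using W by (auto simp: ueq_def)
next
  case False
  define K where "K = ker_proj B"
  have K0: "K \<noteq> 0" using K False by (simp add: K_def)
  have Kp: "prj K" unfolding K_def by (rule prj_ker[OF B(2,1)])
  have BK: "B (K x) = 0" for x by (simp add: K_def ker_proj)
  define R where "R = id_blinfun - K"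
  have Rp: "prj R" unfolding R_def by (rule prj_diff[OF Kp]) auto
  have RK: "R (K x) = 0" for x
    by (simp add: R_def blinfun.diff_left orth_proj_idem[OF prjD(2)[OF Kp]])
  define S where "S = W o\<^sub>L R o\<^sub>L hadj W"
  have WR: "pisom (W o\<^sub>L R) R S" unfolding S_def by (rule pisom_restrict(1)[OF W(2) prjD(2)[OF Rp]]) simp
  have S1: "S \<noteq> id_blinfun"
  proof
    assume "S = id_blinfun"
    then have SK: "S (W (K x)) = W (K x)" for x by simp
    have "W (K x) = 0" for x using SK[of x] by (simp add: S_def pisomD[OF W(2)] RK)
    then have "K x = 0" for x using pisomD(3)[OF W(2), of "K x"] by simp
    then show False using K0 by (metis blinfun_eqI zero_blinfun.rep_eq)
  qed
  have R1: "R \<noteq> id_blinfun" using K0 by (simp add: R_def)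
  have BR: "B (R x) = B x" for x by (simp add: R_def blinfun.bilinear_simps BK)
  have RB: "R (B x) = B x" for x
  proof (rule inner_eqI)
    fix z
    have "R (B x) \<bullet> z = x \<bullet> B (R z)"
      by (simp add: selfadjD[OF orth_proj_selfadj[OF prjD(2)[OF Rp]]] selfadjD[OF B(2)])
    then show "R (B x) \<bullet> z = B x \<bullet> z" by (simp add: BR selfadjD[OF B(2)])
  qed
  have hR: "hadj R = R" using prjD(2)[OF Rp] by (simp add: selfadj_hadj[symmetric] orth_proj_selfadj)
  have "(W o\<^sub>L R) o\<^sub>L B o\<^sub>L hadj (W o\<^sub>L R) = W o\<^sub>L B o\<^sub>L hadj W"
    by (rule blinfun_eqI) (simp add: hadj_compose hR RB BR)
  moreover have "ueq ((W o\<^sub>L R) o\<^sub>L B o\<^sub>L hadj (W o\<^sub>L R)) B"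
    by (rule pisom_ueq[OF B _ WR BR R1 S1]) (intro vn_intros W prjD(1) Rp)
  ultimately show ?thesis by simp
qed

end

section \<open>Orthogonal slots near the top of the spectrum\<close>

locale vn_state = vn_factor_III N for N :: "'h::real_hilbert op set" +
  fixes \<phi> :: "'h op \<Rightarrow> real"
  assumes phi_add: "\<phi> (S + T) = \<phi> S + \<phi> T"
    and phi_scale: "\<phi> (r *\<^sub>R T) = r * \<phi> T"
    and phi_nonneg: "psd T \<Longrightarrow> 0 \<le> \<phi> T"
    and phi_faithful: "T \<in> vn \<Longrightarrow> psd T \<Longrightarrow> \<phi> T = 0 \<Longrightarrow> T = 0"
begin

lemma phi_0 [simp]: "\<phi> 0 = 0"
  using phi_scale[of 0 0] by simp

lemma phi_diff: "\<phi> (S - T) = \<phi> S - \<phi> T"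
  using phi_add[of "S - T" T] by simp

lemma phi_sum: "\<phi> (\<Sum>i\<in>I. f i) = (\<Sum>i\<in>I. \<phi> (f i))"
  by (induction I rule: infinite_finite_induct) (auto simp: phi_add)

lemma phi_mono: "selfadj S \<Longrightarrow> selfadj T \<Longrightarrow> (\<And>x. S x \<bullet> x \<le> T x \<bullet> x) \<Longrightarrow> \<phi> S \<le> \<phi> T"
  using phi_nonneg[OF psd_diffI[of S T]] by (simp add: phi_diff)

lemma phi_prj_pos: "prj P \<Longrightarrow> P \<noteq> 0 \<Longrightarrow> 0 < \<phi> P"
  using phi_nonneg[OF orth_proj_psd] phi_faithful[of P] orth_proj_psd prjD by (metis order_le_less)

text \<open>The intervals [t, s n) have union [t, a), so their spectral projections cannot all
  vanish. The extra bound l lets the new endpoint meet a prescribed tolerance.\<close>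

lemma ex_interval_refinement:
  fixes T :: "'h op"
  assumes sa: "selfadj T" and ne: "spec_meas T {t..<a} \<noteq> 0" and la: "l < a" "t < a"
  shows "\<exists>s. t < s \<and> l < s \<and> s < a \<and> spec_meas T {t..<s} \<noteq> 0"
proof (rule ccontr)
  assume no: "\<not> ?thesis"
  define m where "m = max t l"
  define s where "s n = a - (a - m) / real (n + 2)" for n
  have am: "a - m > 0" using la by (auto simp: m_def)
  have sn: "t < s n \<and> l < s n \<and> s n < a" for n
  proof -
    have "(a - m) / real (n + 2) < (a - m) / 1"
      using am by (intro divide_strict_left_mono) auto
    moreover have "(a - m) / real (n + 2) > 0" using am by simp
    ultimately show ?thesis by (auto simp: s_def m_def)
  qed
  have "spec_meas T (\<Union>n. {t..<s n}) = 0"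
    by (rule spec_meas_UN_0[OF sa]) (use no sn in auto)
  moreover have "(\<Union>n. {t..<s n}) = {t..<a}"
  proof (intro equalityI subsetI)
    fix x assume "x \<in> {t..<a}"
    moreover have "s \<longlonglongrightarrow> a - 0"
      unfolding s_def
      by (intro tendsto_diff tendsto_const LIMSEQ_ignore_initial_segment[OF lim_const_over_n])
    ultimately obtain n where "x < s n" using order_tendstoD(1)[of s "a" sequentially x] by (auto simp: eventually_sequentially)
    then show "x \<in> (\<Union>n. {t..<s n})" using \<open>x \<in> {t..<a}\<close> by auto
  qed (use sn in \<open>auto intro: less_trans\<close>)
  ultimately show False using ne by simp
qed

text \<open>Either the spectral projection of \<open>A\<close> for \<open>[\<alpha>, \<infinity>)\<close> is nonzero and is split, or the
  spectrum accumulates at \<open>\<alpha>\<close> from below and disjoint spectral intervals are used.\<close>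

lemma ex_top_projections:
  assumes A: "A \<in> vn" "psd A" "norm A \<ge> \<alpha>" "\<alpha> > 0" and eps: "\<And>k::nat. \<epsilon> k > 0"
  shows "\<exists>F. orth_seq F \<and> (\<forall>k. prj (F k) \<and> F k \<noteq> 0) \<and>
    (\<forall>I x. finite I \<longrightarrow> (\<Sum>k\<in>I. (\<alpha> - \<epsilon> k) * (norm (blinfun_apply (F k) x))\<^sup>2) \<le> A x \<bullet> x)"
proof (cases "spec_meas A {\<alpha>..} = 0")
  case False
  note sa = psd_selfadj[OF A(2)]
  let ?T = "spec_meas A {\<alpha>..}"
  have T: "prj ?T" by (rule prj_spec_meas[OF sa A(1)]) simp
  obtain F where F: "orth_seq F" "\<And>n::nat. prj (F n)" "\<And>n. F n \<noteq> 0" "\<And>n. psub (F n) ?T"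
    "\<And>x. (\<lambda>n. blinfun_apply (F n) x) sums ?T x"
    using ex_orth_split[OF T False] by blast
  have "(\<Sum>k\<in>I. (\<alpha> - \<epsilon> k) * (norm (F k x))\<^sup>2) \<le> A x \<bullet> x" if "finite I" for I x
  proof -
    have "(\<Sum>k\<in>I. (\<alpha> - \<epsilon> k) * (norm (F k x))\<^sup>2) \<le> (\<Sum>k\<in>I. \<alpha> * (norm (F k x))\<^sup>2)"
      using eps by (intro sum_mono mult_right_mono) (auto intro: less_imp_le)
    also have "\<dots> = \<alpha> * (norm ((\<Sum>k\<in>I. F k) x))\<^sup>2"
      using orth_seq_sum_norm(2)[OF F(1) that, of x] by (simp add: sum_distrib_left blinfun.sum_left)
    also have "\<dots> \<le> \<alpha> * (norm (?T x))\<^sup>2"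
    proof (intro mult_left_mono power_mono psub_norm_le)
      show "psub (\<Sum>k\<in>I. F k) ?T" using F(4) by (simp add: psub_def blinfun.sum_left blinfun.sum_right)
    qed (use A(4) orth_seq_sum_norm(1)[OF F(1) that] prjD(2)[OF T] in auto)
    also have "\<dots> \<le> A (?T x) \<bullet> ?T x"
      by (rule spec_meas_ge[OF sa, of "{\<alpha>..}"]) (auto simp: orth_proj_idem[OF prjD(2)[OF T]])
    also have "\<dots> \<le> A x \<bullet> x"
      using orth_commute_form[OF prjD(2)[OF T], of A x] psd_nonneg[OF A(2)]
        spec_meas_commutes[OF sa, of "{\<alpha>..}"] by simp
    finally show ?thesis .
  qed
  then show ?thesis using F by blast
next
  case True
  note sa = psd_selfadj[OF A(2)]
  have ne: "spec_meas A {t..<\<alpha>} \<noteq> 0" if "t < \<alpha>" "0 < t" for t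
  proof
    assume "spec_meas A {t..<\<alpha>} = 0"
    moreover have "{t..<\<alpha>} \<union> {\<alpha>..} = {t..}" "{t..<\<alpha>} \<inter> {\<alpha>..} = {}" using that by auto
    ultimately have "spec_meas A {t..} = 0"
      using True spec_meas_Un[OF sa, of "{t..<\<alpha>}" "{\<alpha>..}"] by simp
    then show False using spec_meas_atLeast_nonzero[OF A(2), of t] that A(3) by simp
  qed
  \<comment> \<open>The invariant puts each threshold strictly below \<alpha> and within its
    tolerance. The next one exists because [t, \<alpha>) carries spectrum for every positive t below
    \<alpha>.\<close>
  have "\<exists>t. \<forall>n. (\<alpha> - \<epsilon> n < t n \<and> 0 < t n \<and> t n < \<alpha>) \<and> (t n < t (Suc n) \<and> spec_meas A {t n..<t (Suc n)} \<noteq> 0)"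
  proof (rule dependent_nat_choice)
    show "\<exists>t. \<alpha> - \<epsilon> 0 < t \<and> 0 < t \<and> t < \<alpha>"
      using eps[of 0] A(4) by (intro exI[of _ "max (\<alpha> - \<epsilon> 0 / 2) (\<alpha> / 2)"]) auto
    fix t n assume "\<alpha> - \<epsilon> n < t \<and> 0 < t \<and> t < \<alpha>"
    then show "\<exists>s. (\<alpha> - \<epsilon> (Suc n) < s \<and> 0 < s \<and> s < \<alpha>) \<and> t < s \<and> spec_meas A {t..<s} \<noteq> 0"
      using ex_interval_refinement[OF sa ne[of t], of "\<alpha> - \<epsilon> (Suc n)"] eps[of "Suc n"] by force
  qed
  then obtain t where t: "\<And>n. \<alpha> - \<epsilon> n < t n" "\<And>n. 0 < t n" "\<And>n. t n < t (Suc n)"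
    "\<And>n. spec_meas A {t n..<t (Suc n)} \<noteq> 0" by metis
  have "incseq t" by (rule incseq_SucI) (use t in \<open>auto intro: less_imp_le\<close>)
  define F where "F k = spec_meas A {t k..<t (Suc k)}" for k
  have F: "orth_seq F"
    unfolding F_def by (rule spec_meas_sums(1)[OF sa]) (auto intro: disjoint_incseq \<open>incseq t\<close>)
  have Fp: "prj (F k)" for k unfolding F_def by (rule prj_spec_meas[OF sa A(1)]) simp
  have "(\<Sum>k\<in>I. (\<alpha> - \<epsilon> k) * (norm (F k x))\<^sup>2) \<le> A x \<bullet> x" if "finite I" for I x
  proof -
    have "(\<Sum>k\<in>I. (\<alpha> - \<epsilon> k) * (norm (F k x))\<^sup>2) \<le> (\<Sum>k\<in>I. A (F k x) \<bullet> F k x)"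
    proof (rule sum_mono)
      fix k
      have "(\<alpha> - \<epsilon> k) * (norm (F k x))\<^sup>2 \<le> t k * (norm (F k x))\<^sup>2"
        using t(1)[of k] by (intro mult_right_mono) auto
      also have "\<dots> \<le> A (F k x) \<bullet> F k x"
        by (rule spec_meas_ge[OF sa, of "{t k..<t (Suc k)}"])
          (auto simp: F_def orth_proj_idem[OF spec_meas(1)[OF sa]])
      finally show "(\<alpha> - \<epsilon> k) * (norm (F k x))\<^sup>2 \<le> A (F k x) \<bullet> F k x" .
    qed
    also have "\<dots> \<le> A x \<bullet> x"
      by (rule orth_commute_form_sum[OF A(2) F _ that]) (simp add: F_def spec_meas_commutes[OF sa])
    finally show ?thesis .
  qed
  then show ?thesis using F Fp t(4) by (auto simp: F_def)
qed

text \<open>Divide the slots into infinitely many infinite subfamilies. Their sums are mutually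
  orthogonal and have total \<phi>-mass at most that of the identity, so one of them is as small as
  desired. The pairing is arranged so that the k-th slot of every subfamily has tolerance \<epsilon>
  k.\<close>

lemma ex_small_top_projections:
  assumes A: "A \<in> vn" "psd A" "norm A \<ge> \<alpha>" "\<alpha> > 0"
    and eps: "\<And>k::nat. \<epsilon> k > 0" "\<And>k. \<epsilon> k \<le> \<alpha>" and "\<zeta> > 0"
  shows "\<exists>F S. orth_seq F \<and> (\<forall>k. prj (F k) \<and> F k \<noteq> 0) \<and>
    (\<forall>I x. finite I \<longrightarrow> (\<Sum>k\<in>I. (\<alpha> - \<epsilon> k) * (norm (blinfun_apply (F k) x))\<^sup>2) \<le> A x \<bullet> x) \<and>
    prj S \<and> (\<forall>x. (\<lambda>k. blinfun_apply (F k) x) sums blinfun_apply S x) \<and> \<phi> S \<le> \<zeta>"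
proof -
  obtain F where F: "orth_seq F" "\<And>k::nat. prj (F k)" "\<And>k. F k \<noteq> 0"
    "\<And>I x. finite I \<Longrightarrow> (\<Sum>k\<in>I. (\<alpha> - \<epsilon> (fst (prod_decode k))) * (norm (blinfun_apply (F k) x))\<^sup>2) \<le> A x \<bullet> x"
    using ex_top_projections[OF A eps(1), of "\<lambda>k. fst (prod_decode k)"] by (elim exE conjE) blast
  define G where "G i k = F (prod_encode (k, i))" for i k
  have ne: "prod_encode (k, i) \<noteq> prod_encode (k', i')" if "k \<noteq> k' \<or> i \<noteq> i'" for k i k' i'
    using that by (auto simp: prod_encode_eq)
  have G: "orth_seq (G i)" for i
    unfolding orth_seq_def G_def using orth_seqD[OF F(1)] ne by blast
  have "\<exists>S::'h op. (\<forall>x. (\<lambda>k. G i k x) sums S x)" for i using orth_seq_sums[OF G] by blast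
  then obtain S :: "nat \<Rightarrow> 'h op" where S: "\<And>i x. (\<lambda>k. G i k x) sums S i x" by metis
  have Sp: "prj (S i)" for i by (rule prj_sums[OF G _ S]) (simp add: G_def F)
  have S_orth: "S i (S j x) = 0" if "i \<noteq> j" for i j x
  proof (rule orth_sums[OF S[of j]])
    fix k x
    have "G j k (S i y) = 0" for y
      by (rule orth_sums[OF S[of i]]) (use orth_seqD(2)[OF F(1)] ne that in \<open>auto simp: G_def\<close>)
    then show "S i (G j k x) = 0" by (rule orth_sym) (auto simp: prjD Sp G_def F)
  qed
  have oS: "orth_seq S" unfolding orth_seq_def using S_orth prjD(2)[OF Sp] by blast
  have "\<exists>i. \<phi> (S i) \<le> \<zeta>"
  proof (rule ccontr)
    assume "\<not> ?thesis"
    then have gt: "\<phi> (S i) > \<zeta>" for i by (meson not_le)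
    obtain n where n: "\<phi> id_blinfun < real n * \<zeta>" using reals_Archimedean3[OF \<open>\<zeta> > 0\<close>] by blast
    have "real n * \<zeta> \<le> (\<Sum>i<n. \<phi> (S i))"
      using sum_mono[of "{..<n}" "\<lambda>_. \<zeta>" "\<lambda>i. \<phi> (S i)"] gt by (simp add: less_imp_le)
    also have "\<dots> = \<phi> (\<Sum>i<n. S i)" by (simp add: phi_sum)
    also have "\<dots> \<le> \<phi> id_blinfun"
      using orth_seq_sum_norm(1)[OF oS, of "{..<n}"]
      by (intro phi_mono orth_proj_selfadj)
        (auto simp: orth_proj_inner dot_square_norm intro!: power_mono orth_proj_norm_le)
    finally show False using n by simp
  qed
  then obtain i where i: "\<phi> (S i) \<le> \<zeta>" by blast
  have "(\<Sum>k\<in>I. (\<alpha> - \<epsilon> k) * (norm (G i k x))\<^sup>2) \<le> A x \<bullet> x" if "finite I" for I x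
  proof -
    let ?J = "(\<lambda>k. prod_encode (k, i)) ` I"
    have "(\<Sum>m\<in>?J. (\<alpha> - \<epsilon> (fst (prod_decode m))) * (norm (F m x))\<^sup>2) = (\<Sum>k\<in>I. (\<alpha> - \<epsilon> k) * (norm (G i k x))\<^sup>2)"
      by (subst sum.reindex) (auto simp: inj_on_def prod_encode_eq G_def)
    then show ?thesis using F(4)[of ?J x] that by simp
  qed
  then show ?thesis using G[of i] F(2,3) Sp[of i] S[of i] i by (intro exI[of _ "G i"] exI[of _ "S i"]) (auto simp: G_def)
qed

end

lemma psubI':
  fixes P Q :: "'h::real_inner op"
  assumes "orth_proj P" "orth_proj Q" "\<And>x. P (Q x) = P x"
  shows "psub P Q"
  unfolding psub_def
proof (intro allI, rule inner_eqI)
  fix x z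
  have "Q (P x) \<bullet> z = x \<bullet> P (Q z)"
    by (simp add: selfadjD[OF orth_proj_selfadj[OF assms(1)]] selfadjD[OF orth_proj_selfadj[OF assms(2)]])
  also have "\<dots> = P x \<bullet> z" by (simp add: assms(3) selfadjD[OF orth_proj_selfadj[OF assms(1)]])
  finally show "Q (P x) \<bullet> z = P x \<bullet> z" .
qed

lemma norm_ge_form:
  fixes T :: "'h::real_inner op"
  assumes "x \<noteq> 0" "u * (norm x)\<^sup>2 \<le> T x \<bullet> x"
  shows "u \<le> norm T"
proof -
  have "u * (norm x)\<^sup>2 \<le> norm T * (norm x)\<^sup>2" using assms(2) psd_le_norm[of T x] by simp
  then show ?thesis using assms(1) by simp
qed

lemma ex_compact_interval:
  fixes T :: "'h::real_hilbert op"
  assumes sa: "selfadj T" and ne: "spec_meas T {0<..<\<beta>} \<noteq> 0" and "\<beta> > 0"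
  shows "\<exists>b' b. 0 < b' \<and> b' < b \<and> b < \<beta> \<and> spec_meas T {b'..<b} \<noteq> 0"
proof (rule ccontr)
  assume no: "\<not> ?thesis"
  \<comment> \<open>The offset 3 keeps \<open>s n\<close> below \<beta> / 2, so that the interval
    from \<open>s n\<close> to \<open>\<beta> - s n\<close> is never empty.\<close>
  define s where "s n = \<beta> / real (n + 3)" for n
  have s: "0 < s n" "s n < \<beta> - s n" for n
  proof -
    show "0 < s n" using assms(3) by (simp add: s_def)
    have "\<beta> / real (n + 3) < \<beta> / 2" using assms(3) by (intro divide_strict_left_mono) auto
    then show "s n < \<beta> - s n" unfolding s_def by linarith
  qed
  have "spec_meas T {s n..<\<beta> - s n} = 0" for n
    using no s[of n] by force
  then have "spec_meas T (\<Union>n. {s n..<\<beta> - s n}) = 0" by (intro spec_meas_UN_0[OF sa]) auto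
  moreover have "(\<Union>n. {s n..<\<beta> - s n}) = {0<..<\<beta>}"
  proof (intro equalityI subsetI)
    fix x assume x: "x \<in> {0<..<\<beta>}"
    have "s \<longlonglongrightarrow> 0" unfolding s_def by (rule LIMSEQ_ignore_initial_segment[OF lim_const_over_n])
    from order_tendstoD(2)[OF this, of "min x (\<beta> - x)"] x obtain n where "s n < min x (\<beta> - x)"
      by (auto simp: eventually_sequentially)
    then show "x \<in> (\<Union>n. {s n..<\<beta> - s n})" by (intro UN_I[of n]) auto
  next
    fix x assume "x \<in> (\<Union>n. {s n..<\<beta> - s n})"
    then obtain n where "s n \<le> x" "x < \<beta> - s n" by auto
    then show "x \<in> {0<..<\<beta>}" using s(1)[of n] by auto
  qed
  ultimately show False using ne by simp
qed

section \<open>Assembling a copy of B from blocks\<close>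

context vn_alg
begin

text \<open>Each \<open>P n\<close> reduces B and carries the adjoint of the sum W to the adjoint of
  \<open>V n\<close>. The form of the assembled copy is therefore the series of the block forms
  without cross terms, and can be estimated block by block.\<close>

lemma assemble_blocks:
  fixes V P G :: "nat \<Rightarrow> 'h op" and B :: "'h op"
  assumes V: "\<And>n. V n \<in> vn" "\<And>n. pisom (V n) (P n) (G n)" and P: "orth_seq P" and G: "orth_seq G"
    and B: "\<And>n. commutes B (P n)"
  shows "\<exists>W S R. W \<in> vn \<and> pisom W S R \<and> (\<forall>x. (\<lambda>n. P n x) sums blinfun_apply S x) \<and>
    (\<forall>x. (\<lambda>n. G n x) sums blinfun_apply R x) \<and>
    (\<forall>y. (\<lambda>n. B (hadj (V n) y) \<bullet> hadj (V n) y) sums (B (hadj W y) \<bullet> hadj W y))"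
proof -
  obtain W S R :: "'h op" where W: "pisom W S R" "\<And>x. (\<lambda>n. V n x) sums W x"
    "\<And>x. (\<lambda>n. P n x) sums S x" "\<And>x. (\<lambda>n. G n x) sums R x" "\<And>n x. W (P n x) = V n x"
    using pisom_sums[OF V(2) P G] by blast
  have "P n (hadj W y) = hadj (V n) y" for n y
  proof (rule inner_eqI)
    fix z
    have "P n (hadj W y) \<bullet> z = y \<bullet> W (P n z)"
      by (simp add: selfadjD[OF orth_proj_selfadj[OF orth_seqD(1)[OF P]]] hadj')
    then show "P n (hadj W y) \<bullet> z = hadj (V n) y \<bullet> z" by (simp add: W(5) hadj')
  qed
  then have "(\<lambda>n. B (hadj (V n) y) \<bullet> hadj (V n) y) sums (B (hadj W y) \<bullet> hadj W y)" for y
    using orth_commute_form_sums[OF P W(3) B, of "hadj W y"] by (simp add: pisomD(8)[OF W(1)])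
  moreover have "W \<in> vn" by (rule vn_sums[OF V(1) W(2)])
  ultimately show ?thesis using W by blast
qed

end

lemma pisom_add_form:
  fixes W1 W2 B :: "'h::real_hilbert op"
  assumes W1: "pisom W1 P1 Q1" and W2: "pisom W2 P2 Q2" and o: "\<And>x. P1 (P2 x) = 0"
    and B: "commutes B P1"
  shows "B (hadj (W1 + W2) y) \<bullet> hadj (W1 + W2) y =
    B (hadj W1 y) \<bullet> hadj W1 y + B (hadj W2 y) \<bullet> hadj W2 y"
proof -
  let ?z = "hadj (W1 + W2) y"
  have "P1 (hadj W2 y) = P1 (P2 (hadj W2 y))" by (simp add: pisomD(8)[OF W2])
  then have "P1 ?z = hadj W1 y" by (simp add: hadj_add blinfun.bilinear_simps pisomD(8)[OF W1] o)
  moreover have "?z - hadj W1 y = hadj W2 y" by (simp add: hadj_add blinfun.bilinear_simps)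
  ultimately show ?thesis using orth_commute_form[OF pisomD(1)[OF W1] B, of ?z] by simp
qed

lemma conj_form: "(W o\<^sub>L B o\<^sub>L hadj W) y \<bullet> y = B (hadj W y) \<bullet> hadj W y"
  by (simp add: hadj)

lemma psd_conj': "psd B \<Longrightarrow> psd (W o\<^sub>L B o\<^sub>L hadj W)"
  using psd_conj[of B "hadj W"] by simp

text \<open>Cauchy--Schwarz for the vectors \<open>(sqrt ((1-\<theta>)/a), sqrt (\<theta>/c))\<close> and \<open>(sqrt a p, sqrt c q)\<close>.\<close>

lemma weighted_Cauchy_Schwarz:
  fixes a c \<theta> p q :: real
  assumes "a > 0" "c > 0" "0 \<le> \<theta>" "\<theta> \<le> 1"
  shows "(sqrt (1 - \<theta>) * p + sqrt \<theta> * q)\<^sup>2 \<le> ((1 - \<theta>) / a + \<theta> / c) * (a * p\<^sup>2 + c * q\<^sup>2)"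
proof -
  define u v where "u = sqrt (1 - \<theta>)" and "v = sqrt \<theta>"
  have uv: "u\<^sup>2 = 1 - \<theta>" "v\<^sup>2 = \<theta>" using assms by (simp_all add: u_def v_def)
  have "(u\<^sup>2 / a + v\<^sup>2 / c) * (a * p\<^sup>2 + c * q\<^sup>2) - (u * p + v * q)\<^sup>2
      = (u * q * c - v * p * a)\<^sup>2 / (a * c)"
    using assms by (simp add: field_simps power2_eq_square)
  also have "\<dots> \<ge> 0" using assms by simp
  finally show ?thesis unfolding uv by (simp add: u_def v_def)
qed

section \<open>Room under A, and the step for B with a kernel\<close>

context vn_state
begin

text \<open>Let Q be the part of A above the level c. The excess A - c on Q still has norm at least
  \<alpha> - c, so it has top slots F k; adding c back gives \<alpha> - \<epsilon> k on F k and c on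
  the rest E of Q. Small c makes Q carry \<phi>-mass at least \<gamma> / (2 L), and the slots are
  chosen to take at most half of that. The form of A below c is kept in the last inequality for the
  injective case.\<close>

lemma spectral_profile:
  assumes A: "A \<in> vn" "psd A" "norm A \<ge> \<alpha>" "norm A \<le> L"
    and c: "0 < c" "c < \<alpha>" "c * \<phi> id_blinfun \<le> \<gamma> / 2" and gam: "0 < \<gamma>" "\<gamma> \<le> \<phi> A"
    and eps: "\<And>k::nat. 0 < \<epsilon> k" "\<And>k. \<epsilon> k < \<alpha> - c"
  shows "\<exists>E F S. prj E \<and> orth_seq F \<and> (\<forall>k. prj (F k) \<and> F k \<noteq> 0) \<and> prj S \<and>
    (\<forall>x. (\<lambda>k. blinfun_apply (F k) x) sums blinfun_apply S x) \<and>
    psub S (spec_meas A {c..}) \<and> E = spec_meas A {c..} - S \<and> \<gamma> \<le> 4 * L * \<phi> E \<and>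
    (\<forall>I x. finite I \<longrightarrow> c * (norm (blinfun_apply E x))\<^sup>2 +
       (\<Sum>k\<in>I. (\<alpha> - \<epsilon> k) * (norm (blinfun_apply (F k) x))\<^sup>2) +
       A (x - spec_meas A {c..} x) \<bullet> (x - spec_meas A {c..} x) \<le> A x \<bullet> x)"
proof -
  note sa = psd_selfadj[OF A(2)]
  have L: "L > 0" using A(3,4) c by linarith
  define Q where "Q = spec_meas A {c..}"
  have Q: "prj Q" unfolding Q_def by (rule prj_spec_meas[OF sa A(1)]) simp
  note oQ = prjD(2)[OF Q] and saQ = selfadjD[OF orth_proj_selfadj[OF prjD(2)[OF Q]]]
  have cQ: "commutes A Q" unfolding Q_def by (rule spec_meas_commutes[OF sa]) simp
  have Qc: "Q = id_blinfun - spec_meas A {..<c}"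
    using spec_meas_compl[OF sa, of "{..<c}"] by (simp add: Q_def Compl_lessThan)
  have split: "A x \<bullet> x = A (Q x) \<bullet> Q x + A (x - Q x) \<bullet> (x - Q x)" for x
    by (rule orth_commute_form[OF oQ cQ])
  have low: "A (x - Q x) \<bullet> (x - Q x) \<le> c * (norm (x - Q x))\<^sup>2" for x
    by (rule spec_meas_le[OF sa, of "{..<c}"])
      (auto simp: Qc blinfun.bilinear_simps orth_proj_idem[OF spec_meas(1)[OF sa]])
  have high: "c * (norm (Q x))\<^sup>2 \<le> A (Q x) \<bullet> Q x" for x
    by (rule spec_meas_ge[OF sa, of "{c..}"]) (auto simp: Q_def orth_proj_idem[OF spec_meas(1)[OF sa]])
  define A1 where "A1 = (A o\<^sub>L Q) - c *\<^sub>R Q"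
  have A1v: "A1 \<in> vn" unfolding A1_def by (intro vn_intros A prjD(1) Q)
  have AQ: "A (Q x) \<bullet> y = A (Q x) \<bullet> Q y" for x y
    by (metis cQ commutesD oQ orth_proj_idem saQ)
  have A1x: "A1 x \<bullet> x = A (Q x) \<bullet> Q x - c * (norm (Q x))\<^sup>2" for x
    using AQ[of x x] by (simp add: A1_def blinfun.bilinear_simps inner_diff_left orth_proj_inner[OF oQ])
  have A1p: "psd A1"
  proof (rule psdI)
    show "0 \<le> A1 x \<bullet> x" for x using high[of x] by (simp add: A1x)
    have "A (Q x) \<bullet> y = x \<bullet> A (Q y)" for x y
      by (metis cQ commutesD saQ selfadjD[OF sa])
    then show "A1 x \<bullet> y = x \<bullet> A1 y" for x y
      by (simp add: A1_def blinfun.bilinear_simps inner_diff_left inner_diff_right saQ)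
  qed
  \<comment> \<open>A is at most \<open>A1\<close> plus c, because off Q its form is bounded by
    c.\<close>
  have A1n: "\<alpha> - c \<le> norm A1"
  proof -
    have "A x \<bullet> x \<le> (norm A1 + c) * (norm x)\<^sup>2" for x
    proof -
      have "A x \<bullet> x \<le> A1 x \<bullet> x + c * ((norm (Q x))\<^sup>2 + (norm (x - Q x))\<^sup>2)"
        using split[of x] low[of x] by (simp add: A1x distrib_left)
      also have "\<dots> = A1 x \<bullet> x + c * (norm x)\<^sup>2" using orth_proj_norm_split[OF oQ, of x] by simp
      also have "\<dots> \<le> norm A1 * (norm x)\<^sup>2 + c * (norm x)\<^sup>2" using psd_le_norm[of A1 x] by simp
      finally show ?thesis by (simp add: distrib_right)
    qed
    then have "norm A \<le> norm A1 + c" using c by (intro psd_norm_le[OF A(2)]) (auto simp: add_nonneg_nonneg)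
    then show ?thesis using A(3) by simp
  qed
  have ac: "\<alpha> - c > 0" using c by simp
  have eps': "\<epsilon> k \<le> \<alpha> - c" for k using eps(2)[of k] by simp
  have zeta: "\<gamma> / (4 * L) > 0" using gam L by simp
  obtain F S where F: "orth_seq F" "\<And>k::nat. prj (F k)" "\<And>k. F k \<noteq> 0"
    "\<And>I x. finite I \<Longrightarrow> (\<Sum>k\<in>I. (\<alpha> - c - \<epsilon> k) * (norm (blinfun_apply (F k) x))\<^sup>2) \<le> A1 x \<bullet> x"
    and S: "prj S" "\<And>x. (\<lambda>k. blinfun_apply (F k) x) sums blinfun_apply S x" "\<phi> S \<le> \<gamma> / (4 * L)"
    using ex_small_top_projections[where \<epsilon> = \<epsilon>, OF A1v A1p A1n ac eps(1) eps' zeta] by (elim exE conjE) blast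
  \<comment> \<open>\<open>A1\<close> vanishes off Q, whereas a positive multiple of each slot lies
    below \<open>A1\<close>; so the slots lie in Q.\<close>
  have FQ: "psub (F k) Q" for k
  proof (rule psubI'[OF prjD(2)[OF F(2)] oQ])
    fix x
    define y where "y = x - Q x"
    have "A1 y = 0" by (simp add: A1_def y_def blinfun.bilinear_simps orth_proj_idem[OF oQ])
    then have "(\<alpha> - c - \<epsilon> k) * (norm (F k y))\<^sup>2 \<le> 0" using F(4)[of "{k}" y] by simp
    then have "F k y = 0" using eps(2)[of k] by (simp add: mult_le_0_iff)
    then show "F k (Q x) = F k x" by (simp add: y_def blinfun.diff_right)
  qed
  have SQ: "psub S Q" by (rule psub_sums[OF S(2) FQ])
  define E where "E = Q - S"
  have E: "prj E" unfolding E_def by (rule prj_diff[OF S(1) Q SQ])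
  have EQ: "(norm (Q x))\<^sup>2 = (norm (E x))\<^sup>2 + (norm (S x))\<^sup>2" for x
    using orth_proj_inner[OF oQ, of x] orth_proj_inner[OF prjD(2)[OF S(1)], of x]
      orth_proj_inner[OF prjD(2)[OF E], of x]
    by (simp add: E_def blinfun.diff_left inner_diff_left)
  have FS: "(\<Sum>k\<in>I. (norm (F k x))\<^sup>2) \<le> (norm (S x))\<^sup>2" if "finite I" for I x
  proof -
    have "norm ((\<Sum>k\<in>I. F k) x) \<le> norm (S x)"
    proof (rule psub_norm_le)
      show "psub (\<Sum>k\<in>I. F k) S"
        using orth_seq_psub_sum(2)[OF F(1) S(2)] by (simp add: psub_def blinfun.sum_left blinfun.sum_right)
    qed (use orth_seq_sum_norm(1)[OF F(1) that] prjD(2)[OF S(1)] in auto)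
    then have "(norm (\<Sum>k\<in>I. F k x))\<^sup>2 \<le> (norm (S x))\<^sup>2" by (simp add: blinfun.sum_left power_mono)
    then show ?thesis using orth_seq_sum_norm(2)[OF F(1) that] by simp
  qed
  have main: "c * (norm (E x))\<^sup>2 + (\<Sum>k\<in>I. (\<alpha> - \<epsilon> k) * (norm (F k x))\<^sup>2) +
       A (x - Q x) \<bullet> (x - Q x) \<le> A x \<bullet> x" if "finite I" for I x
  proof -
    have "(\<Sum>k\<in>I. (\<alpha> - \<epsilon> k) * (norm (F k x))\<^sup>2)
        = (\<Sum>k\<in>I. (\<alpha> - c - \<epsilon> k) * (norm (F k x))\<^sup>2) + c * (\<Sum>k\<in>I. (norm (F k x))\<^sup>2)"
      by (simp add: sum_distrib_left sum.distrib[symmetric] algebra_simps)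
    also have "\<dots> \<le> A1 x \<bullet> x + c * (norm (S x))\<^sup>2"
      using F(4)[OF that] FS[OF that] c by (intro add_mono mult_left_mono) auto
    finally show ?thesis using split[of x] EQ[of x] by (simp add: A1x distrib_left)
  qed
  \<comment> \<open>A is at most c off Q and at most L on Q; applying \<phi> bounds the mass of Q
    from below.\<close>
  have "\<phi> A \<le> \<phi> (c *\<^sub>R id_blinfun + L *\<^sub>R Q)"
  proof (rule phi_mono[OF sa])
    show "selfadj (c *\<^sub>R id_blinfun + L *\<^sub>R Q)"
      by (simp add: selfadj_def blinfun.bilinear_simps inner_add_left inner_add_right saQ)
    fix x
    have "A (Q x) \<bullet> Q x \<le> norm A * (norm (Q x))\<^sup>2" by (rule psd_le_norm)
    also have "\<dots> \<le> L * (norm (Q x))\<^sup>2" using A(4) by (intro mult_right_mono) auto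
    finally have "A x \<bullet> x \<le> L * (norm (Q x))\<^sup>2 + c * (norm (x - Q x))\<^sup>2"
      using split[of x] low[of x] by linarith
    also have "\<dots> \<le> L * (norm (Q x))\<^sup>2 + c * (norm x)\<^sup>2"
      using c orth_proj_norm_split[OF oQ, of x] by (intro add_left_mono mult_left_mono) auto
    finally show "A x \<bullet> x \<le> (c *\<^sub>R id_blinfun + L *\<^sub>R Q) x \<bullet> x"
      by (simp add: blinfun.bilinear_simps inner_add_left orth_proj_inner[OF oQ] dot_square_norm)
  qed
  then have "\<gamma> \<le> c * \<phi> id_blinfun + L * \<phi> Q" using gam by (simp add: phi_add phi_scale)
  then have "\<gamma> / 2 \<le> L * \<phi> Q" using c(3) by linarith
  moreover have "L * \<phi> S \<le> L * (\<gamma> / (4 * L))" using S(3) L by (intro mult_left_mono) auto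
  ultimately have "\<gamma> \<le> 4 * L * \<phi> E" using L by (simp add: E_def phi_diff algebra_simps)
  then show ?thesis
    using E F(1-3) S(1,2) SQ main
    by (intro exI[of _ E] exI[of _ F] exI[of _ S]) (simp add: Q_def[symmetric] E_def[symmetric])
qed

text \<open>The spectrum of B may accumulate at \<alpha>, a height that the slots need not reach.
  Cutting [b, \<alpha>) into intervals with right ends strictly below \<alpha> lets each piece fit
  into a slot.\<close>

lemma increasing_thresholds:
  fixes b \<alpha> :: real
  assumes "b < \<alpha>" and r_def: "r = (\<lambda>k::nat. \<alpha> - (\<alpha> - b) / real (k + 1))"
  shows "incseq r" "r 0 = b" "\<And>k. r k < \<alpha>" "\<And>k. b \<le> r k" "(\<Union>k. {r k..<r (Suc k)}) = {b..<\<alpha>}"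
proof -
  show inc: "incseq r" unfolding r_def incseq_def using assms(1) by (auto intro!: divide_left_mono)
  show 0: "r 0 = b" by (simp add: r_def)
  show lt: "r k < \<alpha>" for k using assms(1) by (simp add: r_def)
  show "b \<le> r k" for k using incseqD[OF inc, of 0 k] 0 by simp
  have "r \<longlonglongrightarrow> \<alpha> - 0"
    unfolding r_def by (intro tendsto_diff tendsto_const LIMSEQ_ignore_initial_segment[OF lim_const_over_n])
  then show "(\<Union>k. {r k..<r (Suc k)}) = {b..<\<alpha>}" using UN_incseq[of r \<alpha>] lt inc 0 by simp
qed

lemma le_of_inverse_slack:
  fixes a \<alpha> n :: real
  assumes "\<And>j::nat. \<alpha> - d / real (j + 1) \<le> n"
  shows "\<alpha> \<le> n"
proof (rule LIMSEQ_le_const2)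
  show "(\<lambda>j. \<alpha> - d / real (j + 1)) \<longlonglongrightarrow> \<alpha>"
    using tendsto_diff[OF tendsto_const LIMSEQ_ignore_initial_segment[OF lim_const_over_n, of d 1], of \<alpha>] by simp
qed (use assms in auto)

text \<open>One step when \<open>B\<close> has a kernel. A spectral part \<open>B P\<close> is placed on the graph of a partial
  isometry from a slot \<open>F\<^sub>0\<close> near the top of the spectrum of \<open>A\<close> to \<open>E\<close>, so that it depletes \<open>E\<close> by
  an amount independent of \<open>A\<close>; the rest of \<open>B\<close> is parked in the other slots.\<close>

lemma step_with_kernel:
  assumes B: "B \<in> vn" "psd B" "spec_meas B {0<..<\<alpha>} \<noteq> 0" "spec_meas B {\<alpha>..} = 0" "ker_proj B \<noteq> 0"
    and \<alpha>: "\<alpha> > 0" and gam: "\<gamma> > 0" and L: "L > 0"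
  shows "\<exists>\<delta>>0. \<forall>A\<in>vn. psd A \<longrightarrow> norm A \<ge> \<alpha> \<longrightarrow> norm A \<le> L \<longrightarrow> \<gamma> \<le> \<phi> A \<longrightarrow>
    (\<exists>C\<in>vn. ueq C B \<and> psd C \<and> psd (A - C) \<and> norm (A - C) \<ge> \<alpha> \<and> \<phi> C \<ge> \<delta>)"
proof -
  note sB = psd_selfadj[OF B(2)]
  obtain b' b where b: "0 < b'" "b' < b" "b < \<alpha>" "spec_meas B {b'..<b} \<noteq> 0"
    using ex_compact_interval[OF sB B(3) \<alpha>] by blast
  define P where "P = spec_meas B {b'..<b}"
  have P: "prj P" "P \<noteq> 0" using prj_spec_meas[OF sB B(1)] b(4) by (auto simp: P_def)
  have id0: "id_blinfun \<noteq> (0 :: 'h op)" using P(2) by (metis blinfun_eqI blinfun_apply_id_blinfun id_apply zero_blinfun.rep_eq)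
  have phi1: "\<phi> id_blinfun > 0" by (rule phi_prj_pos[OF _ id0]) simp
  \<comment> \<open>The height of slot 0. Lying strictly above b, it leaves room for tilting the
    piece B P out of the slot.\<close>
  define a where "a = (\<alpha> + b) / 2"
  have a: "b < a" "a < \<alpha>" "0 < a" using b by (auto simp: a_def)
  \<comment> \<open>The first bound is what \<open>spectral_profile\<close> demands of c; the second
    keeps c below a.\<close>
  define c where "c = min (\<gamma> / (2 * \<phi> id_blinfun)) (a / 2)"
  have c: "0 < c" "c < a" "c * \<phi> id_blinfun \<le> \<gamma> / 2"
  proof -
    show "0 < c" "c < a" using gam phi1 a by (auto simp: c_def)
    have "c * \<phi> id_blinfun \<le> \<gamma> / (2 * \<phi> id_blinfun) * \<phi> id_blinfun"
      using phi1 by (intro mult_right_mono) (auto simp: c_def)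
    then show "c * \<phi> id_blinfun \<le> \<gamma> / 2" using phi1 by simp
  qed
  \<comment> \<open>The tilt: a portion \<theta> of the piece goes into E, the portion 1 - \<theta>
    stays in slot 0. By weighted Cauchy--Schwarz, b times the tilted projection lies below a
    \<open>F 0\<close> + c E once b ((1 - \<theta>) / a + \<theta> / c) \<le> 1. The two terms are
    bounded by b / a and 1 - b / a.\<close>
  define \<theta> where "\<theta> = min (1/2) (c * (1 - b / a) / b)"
  have ba: "b / a < 1" using a b by simp
  have \<theta>: "0 < \<theta>" "\<theta> \<le> 1" using c b ba by (auto simp: \<theta>_def)
  have \<theta>b: "b * ((1 - \<theta>) / a + \<theta> / c) \<le> 1"
  proof -
    have "\<theta> \<le> c * (1 - b / a) / b" by (simp add: \<theta>_def)
    then have "b * \<theta> / c \<le> 1 - b / a" using b c by (simp add: field_simps)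
    moreover have "b * ((1 - \<theta>) / a) \<le> b / a" using \<theta> a b by (simp add: field_simps)
    ultimately show ?thesis by (simp add: distrib_left)
  qed
  \<comment> \<open>C dominates b' times the tilted projection, whose \<phi>-value is at least
    \<theta> times that of E, and \<phi> E is at least \<gamma> / (4 L).\<close>
  define \<delta> where "\<delta> = b' * \<theta> * \<gamma> / (4 * L)"
  have \<delta>: "\<delta> > 0" using b \<theta> gam L by (simp add: \<delta>_def)
  \<comment> \<open>Slot 0 gets height exactly a, as \<epsilon> 0 = \<alpha> - a.\<close>
  define \<epsilon> where "\<epsilon> n = (\<alpha> - a) / real (n + 1)" for n
  have eps: "0 < \<epsilon> n" "\<epsilon> n < \<alpha> - c" for n
  proof -
    show "0 < \<epsilon> n" using a by (simp add: \<epsilon>_def)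
    have "\<epsilon> n \<le> (\<alpha> - a) / 1" unfolding \<epsilon>_def using a by (intro divide_left_mono) auto
    then show "\<epsilon> n < \<alpha> - c" using c by simp
  qed
  define r where "r = (\<lambda>k::nat. \<alpha> - (\<alpha> - b) / real (k + 1))"
  note r = increasing_thresholds[OF b(3) r_def]
  \<comment> \<open>The spectrum of B outside [b', b): index 0 takes everything below b', the others
    cut up [b, \<alpha>). The numbers \<open>\<tau> n\<close> are the right ends.\<close>
  define K where "K n = (case n of 0 \<Rightarrow> {..<b'} | Suc k \<Rightarrow> {r k..<r (Suc k)})" for n
  define \<tau> where "\<tau> n = (case n of 0 \<Rightarrow> b' | Suc k \<Rightarrow> r (Suc k))" for n
  have Kb: "K n \<in> sets borel" for n by (simp add: K_def split: nat.split)
  have K0: "K 0 \<inter> K (Suc k) = {}" for k using b r(4)[of k] by (auto simp: K_def)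
  have Kd: "disjoint_family K"
    unfolding disjoint_family_on_def
  proof (intro ballI impI)
    fix m n :: nat assume "m \<noteq> n"
    then show "K m \<inter> K n = {}"
      using K0 disjoint_incseq[OF r(1)] by (cases m; cases n) (auto simp: K_def disjoint_family_on_def)
  qed
  have KU: "(\<Union>n. K n) = {..<b'} \<union> {b..<\<alpha>}"
  proof -
    have "(\<Union>n. K n) = K 0 \<union> (\<Union>k. K (Suc k))" by (metis UN_Un UNIV_nat_eq UN_insert image_UN image_image)
    then show ?thesis using r(5) by (simp add: K_def)
  qed
  define p where "p n = spec_meas B (K n)" for n
  have pp: "prj (p n)" for n unfolding p_def by (rule prj_spec_meas[OF sB B(1) Kb])
  have po: "orth_seq p" and psum: "\<And>x. (\<lambda>n. p n x) sums spec_meas B ({..<b'} \<union> {b..<\<alpha>}) x"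
    using spec_meas_sums[OF sB _ Kd] Kb unfolding p_def KU by auto
  have pB: "commutes B (p n)" for n unfolding p_def by (rule spec_meas_commutes[OF sB Kb])
  have tau: "\<tau> k \<le> \<alpha> - \<epsilon> (2 * k + 1)" for k
  proof (cases k)
    case 0
    then show ?thesis using b a by (simp add: \<tau>_def \<epsilon>_def field_simps)
  next
    case (Suc j)
    have "(\<alpha> - a) / real (2 * k + 2) \<le> (\<alpha> - b) / real (j + 2)"
      using a Suc by (intro frac_le) auto
    then show ?thesis by (simp add: \<tau>_def \<epsilon>_def r_def Suc)
  qed
  have ptau: "B (p k y) \<bullet> p k y \<le> \<tau> k * (norm (p k y))\<^sup>2" for k y
    by (rule spec_meas_le[OF sB Kb[of k]])
      (auto simp: K_def \<tau>_def p_def orth_proj_idem[OF spec_meas(1)[OF sB]] Kb split: nat.splits)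
  have PP: "P (spec_meas B ({..<b'} \<union> {b..<\<alpha>}) x) = 0" for x
    unfolding P_def by (rule spec_meas_disjoint[OF sB]) auto
  have Pid: "P + spec_meas B ({..<b'} \<union> {b..<\<alpha>}) = id_blinfun"
  proof -
    have "{b'..<b} \<union> ({..<b'} \<union> {b..<\<alpha>}) = - {\<alpha>..}" "{b'..<b} \<inter> ({..<b'} \<union> {b..<\<alpha>}) = {}" using b by auto
    then show ?thesis
      using spec_meas_Un[OF sB, of "{b'..<b}" "{..<b'} \<union> {b..<\<alpha>}"] spec_meas_compl[OF sB, of "{\<alpha>..}"] B(4)
      by (simp add: P_def)
  qed
  have PB: "commutes B P" unfolding P_def by (rule spec_meas_commutes[OF sB]) simp
  have Ple: "B y \<bullet> y \<le> b * (norm y)\<^sup>2" "b' * (norm y)\<^sup>2 \<le> B y \<bullet> y" if "P y = y" for y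
    by (rule spec_meas_le[OF sB, of "{b'..<b}"]; use that in \<open>auto simp: P_def\<close>)
      (rule spec_meas_ge[OF sB, of "{b'..<b}"]; use that in \<open>auto simp: P_def\<close>)
  have "\<exists>C\<in>vn. ueq C B \<and> psd C \<and> psd (A - C) \<and> norm (A - C) \<ge> \<alpha> \<and> \<phi> C \<ge> \<delta>"
    if A: "A \<in> vn" "psd A" "norm A \<ge> \<alpha>" "norm A \<le> L" "\<gamma> \<le> \<phi> A" for A
  proof -
    have c\<alpha>: "c < \<alpha>" using c a by simp
    obtain E F S where E: "prj E" and F: "orth_seq F" "\<And>k::nat. prj (F k)" "\<And>k. F k \<noteq> 0" and S: "prj S"
      "\<And>x. (\<lambda>k. blinfun_apply (F k) x) sums blinfun_apply S x" "psub S (spec_meas A {c..})"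
      and ES: "E = spec_meas A {c..} - S" and phiE: "\<gamma> \<le> 4 * L * \<phi> E"
      and room: "\<And>I x. finite I \<Longrightarrow> c * (norm (blinfun_apply E x))\<^sup>2 +
       (\<Sum>k\<in>I. (\<alpha> - \<epsilon> k) * (norm (blinfun_apply (F k) x))\<^sup>2) +
       A (x - spec_meas A {c..} x) \<bullet> (x - spec_meas A {c..} x) \<le> A x \<bullet> x"
      using spectral_profile[where \<epsilon> = \<epsilon>, OF A(1-4) c(1) c\<alpha> c(3) gam A(5) eps]
      by (elim exE conjE) blast
    have EF: "E (F k x) = 0" for k x
      using orth_seq_psub_sum(2)[OF F(1) S(2), of k] S(3) by (simp add: ES blinfun.diff_left psub_def) (metis)
    have FE: "F k (E x) = 0" for k x by (rule orth_sym[OF EF prjD(2)[OF E] prjD(2)[OF F(2)]])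
    have E0: "E \<noteq> 0" using phiE gam L by auto
    obtain V where V: "V \<in> vn" "pisom V P (F 0)" using eqv_any[OF P F(2,3)] by (auto simp: eqv_def)
    obtain T where T: "T \<in> vn" "pisom T P E" using eqv_any[OF P E E0] by (auto simp: eqv_def)
    have VT: "hadj V (T x) = 0" "hadj T (V x) = 0" for x
      using pisomD(6,7)[OF V(2)] pisomD(6,7)[OF T(2)] EF FE by (metis blinfun.zero_right)+
    define X where "X = (V o\<^sub>L hadj T) + (T o\<^sub>L hadj V)"
    \<comment> \<open>The tilted projection contains the cross term X, whose \<phi>-value may have
      either sign. Choosing the sign of the tilt makes its contribution nonnegative.\<close>
    define s :: real where "s = (if \<phi> X \<ge> 0 then 1 else - 1)"
    have s: "s * s = 1" "s * \<phi> X \<ge> 0" by (auto simp: s_def mult_nonpos_nonneg)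
    define u v where "u = sqrt (1 - \<theta>)" and "v = s * sqrt \<theta>"
    have uv: "u * u = 1 - \<theta>" "v * v = \<theta>" using \<theta> s by (auto simp: u_def v_def algebra_simps)
    define W1 where "W1 = u *\<^sub>R V + v *\<^sub>R T"
    have W1v: "W1 \<in> vn" unfolding W1_def by (intro vn_intros V T)
    have hW1: "hadj W1 y = u *\<^sub>R hadj V y + v *\<^sub>R hadj T y" for y
      by (simp add: W1_def hadj_add hadj_scaleR blinfun.bilinear_simps)
    define Q1 where "Q1 = W1 o\<^sub>L hadj W1"
    have W1: "pisom W1 P Q1"
      unfolding Q1_def
    proof (rule pisomI[OF prjD(2)[OF P(1)]])
      fix x
      have "hadj W1 (W1 x) = (u * u + v * v) *\<^sub>R P x"
        by (simp add: hW1, simp add: W1_def blinfun.bilinear_simps VT pisomD(3)[OF V(2)] pisomD(3)[OF T(2)]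
            scaleR_add_left)
      then show "hadj W1 (W1 x) = P x" by (simp add: uv)
    qed
    have W1form: "B (hadj W1 y) \<bullet> hadj W1 y \<le> a * (norm (F 0 y))\<^sup>2 + c * (norm (E y))\<^sup>2" for y
    proof -
      have "norm (hadj W1 y) \<le> norm (u *\<^sub>R hadj V y) + norm (v *\<^sub>R hadj T y)"
        unfolding hW1 by (rule norm_triangle_ineq)
      also have "\<dots> = sqrt (1 - \<theta>) * norm (F 0 y) + sqrt \<theta> * norm (E y)"
        using \<theta> by (simp add: pisomD(10)[OF V(2)] pisomD(10)[OF T(2)] u_def v_def s_def)
      finally have "(norm (hadj W1 y))\<^sup>2 \<le> (sqrt (1 - \<theta>) * norm (F 0 y) + sqrt \<theta> * norm (E y))\<^sup>2"
        by (intro power_mono) auto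
      also have "\<dots> \<le> ((1 - \<theta>) / a + \<theta> / c) * (a * (norm (F 0 y))\<^sup>2 + c * (norm (E y))\<^sup>2)"
        by (rule weighted_Cauchy_Schwarz) (use a c \<theta> in auto)
      finally have "b * (norm (hadj W1 y))\<^sup>2 \<le>
          b * (((1 - \<theta>) / a + \<theta> / c) * (a * (norm (F 0 y))\<^sup>2 + c * (norm (E y))\<^sup>2))"
        using b by (intro mult_left_mono) auto
      also have "\<dots> \<le> 1 * (a * (norm (F 0 y))\<^sup>2 + c * (norm (E y))\<^sup>2)"
        unfolding mult.assoc[symmetric] using \<theta>b a c by (intro mult_right_mono) auto
      finally show ?thesis using Ple(1)[OF pisomD(8)[OF W1], of y] by simp
    qed
    \<comment> \<open>Slot 0 holds the tilted piece and the odd slots the remaining pieces; the even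
      slots from 2 on stay empty, to keep the norm of A - C at least \<alpha>.\<close>
    have "\<exists>V G. V \<in> vn \<and> pisom V (p k) G \<and> prj G \<and> psub G (F (2 * k + 1))" for k
      using subeqv_any[OF pp F(2,3), of k] unfolding subeqv_def eqv_def by blast
    then obtain V' G where V': "\<And>k. V' k \<in> vn" "\<And>k. pisom (V' k) (p k) (G k)"
      and G: "\<And>k. prj (G k)" "\<And>k. psub (G k) (F (2 * k + 1))" by metis
    have oF: "orth_seq (\<lambda>k. F (2 * k + 1))"
      using orth_seqD[OF F(1)] by (simp add: orth_seq_def)
    have oG: "orth_seq G" by (rule orth_seq_psub[OF oF prjD(2)[OF G(1)] G(2)])
    obtain W2 P2 R where W2: "W2 \<in> vn" "pisom W2 P2 R" "\<And>x. (\<lambda>n. p n x) sums blinfun_apply P2 x"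
      "\<And>x. (\<lambda>n. G n x) sums blinfun_apply R x"
      "\<And>y. (\<lambda>n. B (hadj (V' n) y) \<bullet> hadj (V' n) y) sums (B (hadj W2 y) \<bullet> hadj W2 y)"
      using assemble_blocks[OF V' po oG pB] by blast
    have P2: "P2 = spec_meas B ({..<b'} \<union> {b..<\<alpha>})"
      by (rule blinfun_eqI) (rule sums_unique2[OF W2(3) psum])
    have F0R: "F 0 (R x) = 0" for x
    proof (rule orth_sums[OF W2(4)])
      fix n x
      show "F 0 (G n x) = 0" using psubD[OF G(2), of n x] orth_seqD(2)[OF F(1), of 0 "2 * n + 1" "G n x"] by simp
    qed
    have ER: "E (R x) = 0" for x
    proof (rule orth_sums[OF W2(4)])
      fix n x
      show "E (G n x) = 0" using psubD[OF G(2), of n x] EF[of "2 * n + 1" "G n x"] by simp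
    qed
    have QR: "Q1 (R x) = 0" for x
    proof -
      have "hadj V (R x) = 0" "hadj T (R x) = 0"
        using pisomD(7)[OF V(2), of "R x"] pisomD(7)[OF T(2), of "R x"] F0R ER by simp_all
      then show ?thesis by (simp add: Q1_def hW1)
    qed
    define W where "W = W1 + W2"
    have "pisom W (P + P2) (Q1 + R)"
      unfolding W_def by (rule pisom_add[OF W1 W2(2) _ QR]) (simp add: P2 PP)
    then have W: "pisom W id_blinfun (Q1 + R)" by (simp add: P2 Pid)
    have Wv: "W \<in> vn" unfolding W_def by (intro vn_intros W1v W2)
    define C where "C = W o\<^sub>L B o\<^sub>L hadj W"
    have Cform: "C y \<bullet> y = B (hadj W1 y) \<bullet> hadj W1 y + B (hadj W2 y) \<bullet> hadj W2 y" for y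
      unfolding C_def conj_form W_def by (rule pisom_add_form[OF W1 W2(2) _ PB]) (simp add: P2 PP)
    have Cv: "C \<in> vn" unfolding C_def by (intro vn_intros Wv B vn_hadj)
    have Cp: "psd C" unfolding C_def by (rule psd_conj'[OF B(2)])
    have ueq: "ueq C B" unfolding C_def by (rule isometry_ueq[OF B(1) sB Wv W]) (simp add: B(5))
    \<comment> \<open>One empty slot is retained in the estimate, so that its full height is
      available to A - C.\<close>
    have bound: "C y \<bullet> y + (\<alpha> - \<epsilon> (2 * j + 2)) * (norm (F (2 * j + 2) y))\<^sup>2 \<le> A y \<bullet> y" for y j
    proof -
      have "(\<Sum>k<n. B (hadj (V' k) y) \<bullet> hadj (V' k) y) \<le>
         A y \<bullet> y - B (hadj W1 y) \<bullet> hadj W1 y - (\<alpha> - \<epsilon> (2 * j + 2)) * (norm (F (2 * j + 2) y))\<^sup>2" for n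
      proof -
        have "B (hadj (V' k) y) \<bullet> hadj (V' k) y \<le> (\<alpha> - \<epsilon> (2 * k + 1)) * (norm (F (2 * k + 1) y))\<^sup>2" for k
        proof -
          have "B (hadj (V' k) y) \<bullet> hadj (V' k) y \<le> \<tau> k * (norm (G k y))\<^sup>2"
            using ptau[of k "hadj (V' k) y"] by (simp add: pisomD(8,10)[OF V'(2)])
          also have "\<dots> \<le> (\<alpha> - \<epsilon> (2 * k + 1)) * (norm (G k y))\<^sup>2"
            using tau by (intro mult_right_mono) auto
          also have "\<dots> \<le> (\<alpha> - \<epsilon> (2 * k + 1)) * (norm (F (2 * k + 1) y))\<^sup>2"
            using eps(2)[of "2 * k + 1"] c psub_norm_le[OF G(2) prjD(2)[OF G(1)] prjD(2)[OF F(2)]]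
            by (intro mult_left_mono power_mono) auto
          finally show ?thesis .
        qed
        then have "(\<Sum>k<n. B (hadj (V' k) y) \<bullet> hadj (V' k) y) \<le>
            (\<Sum>k<n. (\<alpha> - \<epsilon> (2 * k + 1)) * (norm (F (2 * k + 1) y))\<^sup>2)" by (intro sum_mono)
        also have "\<dots> = (\<Sum>m\<in>(\<lambda>k. 2 * k + 1) ` {..<n}. (\<alpha> - \<epsilon> m) * (norm (F m y))\<^sup>2)"
          by (subst sum.reindex) (auto simp: inj_on_def)
        finally have *: "(\<Sum>k<n. B (hadj (V' k) y) \<bullet> hadj (V' k) y) \<le>
            (\<Sum>m\<in>(\<lambda>k. 2 * k + 1) ` {..<n}. (\<alpha> - \<epsilon> m) * (norm (F m y))\<^sup>2)" .
        let ?I = "insert 0 (insert (2 * j + 2) ((\<lambda>k. 2 * k + 1) ` {..<n}))"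
        have notin: "0 \<notin> insert (2 * j + 2) ((\<lambda>k. 2 * k + 1) ` {..<n})"
          "2 * j + 2 \<notin> (\<lambda>k. 2 * k + 1) ` {..<n}" by (auto, presburger)
        have "(\<Sum>m\<in>?I. (\<alpha> - \<epsilon> m) * (norm (F m y))\<^sup>2) = a * (norm (F 0 y))\<^sup>2 +
           ((\<alpha> - \<epsilon> (2 * j + 2)) * (norm (F (2 * j + 2) y))\<^sup>2 +
            (\<Sum>m\<in>(\<lambda>k. 2 * k + 1) ` {..<n}. (\<alpha> - \<epsilon> m) * (norm (F m y))\<^sup>2))"
          using notin by (simp add: \<epsilon>_def)
        then show ?thesis
          using * W1form[of y] room[of ?I y] psd_nonneg[OF A(2), of "y - spec_meas A {c..} y"] by simp
      qed
      then have "B (hadj W2 y) \<bullet> hadj W2 y \<le>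
         A y \<bullet> y - B (hadj W1 y) \<bullet> hadj W1 y - (\<alpha> - \<epsilon> (2 * j + 2)) * (norm (F (2 * j + 2) y))\<^sup>2"
        using W2(5)[of y] unfolding sums_def by (intro LIMSEQ_le_const2[of _ "B (hadj W2 y) \<bullet> hadj W2 y"]) auto
      then show ?thesis by (simp add: Cform)
    qed
    have AC: "psd (A - C)"
    proof (rule psd_diffI[OF psd_selfadj[OF Cp] psd_selfadj[OF A(2)]])
      fix x
      have "0 \<le> (\<alpha> - \<epsilon> (2 * 0 + 2)) * (norm (F (2 * 0 + 2) x))\<^sup>2"
        using eps(2)[of "2 * 0 + 2"] c by (intro mult_nonneg_nonneg) auto
      then show "C x \<bullet> x \<le> A x \<bullet> x" using bound[of x 0] by linarith
    qed
    have "\<alpha> - (\<alpha> - a) / real (j + 1) \<le> norm (A - C)" for j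
    proof -
      define m where "m = 2 * j + 2"
      obtain z where z: "F m z \<noteq> 0" using F(3)[of m] by (metis blinfun_eqI zero_blinfun.rep_eq)
      have "F m (F m z) = F m z" by (rule orth_proj_idem[OF prjD(2)[OF F(2)]])
      then have "(\<alpha> - \<epsilon> m) * (norm (F m z))\<^sup>2 \<le> (A - C) (F m z) \<bullet> F m z"
        using bound[of "F m z" j, folded m_def] by (simp add: blinfun.diff_left inner_diff_left)
      from norm_ge_form[OF z this] have "\<alpha> - \<epsilon> (2 * j + 2) \<le> norm (A - C)" by (simp add: m_def)
      moreover have "\<epsilon> (2 * j + 2) \<le> (\<alpha> - a) / real (j + 1)"
        unfolding \<epsilon>_def using a by (intro divide_left_mono) auto
      ultimately show ?thesis by simp
    qed
    then have ACn: "\<alpha> \<le> norm (A - C)" by (rule le_of_inverse_slack)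
    have Q1x: "Q1 = (1 - \<theta>) *\<^sub>R F 0 + \<theta> *\<^sub>R E + (u * v) *\<^sub>R X"
    proof (rule blinfun_eqI)
      fix y
      have "Q1 y = (u * u) *\<^sub>R F 0 y + (v * v) *\<^sub>R E y + (u * v) *\<^sub>R X y"
        by (simp add: Q1_def W1_def hadj_add hadj_scaleR X_def blinfun.bilinear_simps pisomD(4)[OF V(2)]
            pisomD(4)[OF T(2)] scaleR_add_right algebra_simps)
      then show "Q1 y = ((1 - \<theta>) *\<^sub>R F 0 + \<theta> *\<^sub>R E + (u * v) *\<^sub>R X) y"
        by (simp add: uv blinfun.bilinear_simps)
    qed
    have "\<phi> Q1 \<ge> \<theta> * \<phi> E"
    proof -
      have "u * v * \<phi> X = u * sqrt \<theta> * (s * \<phi> X)" by (simp add: v_def)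
      also have "\<dots> \<ge> 0"
        by (rule mult_nonneg_nonneg[OF _ s(2)]) (use \<theta> in \<open>simp add: u_def\<close>)
      finally have "u * v * \<phi> X \<ge> 0" .
      moreover have "(1 - \<theta>) * \<phi> (F 0) \<ge> 0"
        using \<theta> phi_nonneg[OF orth_proj_psd[OF prjD(2)[OF F(2)]]] by (intro mult_nonneg_nonneg) auto
      ultimately show ?thesis by (simp add: Q1x phi_add phi_scale)
    qed
    then have "b' * (\<theta> * \<phi> E) \<le> b' * \<phi> Q1" using b by simp
    moreover have "\<phi> (b' *\<^sub>R Q1) \<le> \<phi> C"
    proof (rule phi_mono)
      show "selfadj (b' *\<^sub>R Q1)"
        using selfadjD[OF orth_proj_selfadj[OF pisomD(2)[OF W1]]] by (simp add: selfadj_def blinfun.bilinear_simps)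
      show "selfadj C" by (rule psd_selfadj[OF Cp])
      fix x
      have "(b' *\<^sub>R Q1) x \<bullet> x = b' * (norm (hadj W1 x))\<^sup>2"
        by (simp add: blinfun.bilinear_simps orth_proj_inner[OF pisomD(2)[OF W1]] pisomD(10)[OF W1])
      also have "\<dots> \<le> B (hadj W1 x) \<bullet> hadj W1 x" by (rule Ple(2)[OF pisomD(8)[OF W1]])
      finally show "(b' *\<^sub>R Q1) x \<bullet> x \<le> C x \<bullet> x"
        using psd_nonneg[OF B(2), of "hadj W2 x"] by (simp add: Cform)
    qed
    moreover have "\<delta> \<le> b' * (\<theta> * \<phi> E)"
    proof -
      have "b' * \<theta> * \<gamma> \<le> b' * \<theta> * (4 * L * \<phi> E)" using b \<theta> phiE by (intro mult_left_mono) auto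
      then show ?thesis using L by (simp add: \<delta>_def field_simps)
    qed
    ultimately have "\<phi> C \<ge> \<delta>" by (simp add: phi_scale)
    then show ?thesis using Cv ueq Cp AC ACn by blast
  qed
  then show ?thesis using \<delta> by blast
qed

end

section \<open>The step for injective B\<close>

lemma orth_seq_add:
  fixes X Y :: "nat \<Rightarrow> 'h::real_inner op"
  assumes "orth_seq X" "orth_seq Y" "\<And>m n x. X m (Y n x) = 0"
  shows "orth_seq (\<lambda>n. X n + Y n)"
  unfolding orth_seq_def
  using orth_proj_add[OF orth_seqD(1)[OF assms(1)] orth_seqD(1)[OF assms(2)] assms(3)]
    orth_sym[OF assms(3) orth_seqD(1)[OF assms(1)] orth_seqD(1)[OF assms(2)]]
    orth_seqD(2)[OF assms(1)] orth_seqD(2)[OF assms(2)] assms(3)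
  by (simp add: blinfun.bilinear_simps)

lemma sum_pairs: "(\<Sum>m<2 * n. f m) = (\<Sum>k<n. f (2 * k) + f (2 * k + 1))"
  for f :: "nat \<Rightarrow> 'b::comm_monoid_add"
  by (induction n) (simp_all add: ac_simps)

lemma sums_pairs:
  fixes f :: "nat \<Rightarrow> 'b::real_normed_vector"
  assumes "f sums s" shows "(\<lambda>k. f (2 * k) + f (2 * k + 1)) sums s"
  unfolding sums_def sum_pairs[symmetric]
  using LIMSEQ_subseq_LIMSEQ[OF assms[unfolded sums_def], of "\<lambda>n. 2 * n"]
  by (simp add: strict_mono_def o_def)

context vn_state
begin

text \<open>One step when \<open>B\<close> is injective but not invertible. All pieces are now diagonal: a part of \<open>B\<close>
  near \<open>0\<close> depletes \<open>E\<close>, the upper part is parked near the top of the spectrum of \<open>A\<close>, and the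
  spectral pieces near \<open>0\<close> fill up the remaining space under a fraction \<open>\<kappa>\<^sub>j\<close> of \<open>A\<close>.\<close>

lemma step_injective:
  assumes B: "B \<in> vn" "psd B" "spec_meas B {\<alpha>..} = 0" "spec_meas B {..0} = 0"
    and near: "\<forall>t>0. spec_meas B {0<..<t} \<noteq> 0"
    and \<alpha>: "\<alpha> > 0" and gam: "\<gamma> > 0" and L: "L > 0"
  shows "\<exists>\<delta>>0. \<forall>A\<in>vn. psd A \<longrightarrow> norm A \<ge> \<alpha> \<longrightarrow> norm A \<le> L \<longrightarrow> \<gamma> \<le> \<phi> A \<longrightarrow>
    spec_meas A {..0} = 0 \<longrightarrow>
    (\<exists>C\<in>vn. ueq C B \<and> psd C \<and> psd (A - C) \<and> norm (A - C) \<ge> \<alpha> \<and> \<phi> C \<ge> \<delta> \<and>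
      (\<forall>x. (A - C) x = 0 \<longrightarrow> x = 0))"
proof -
  note sB = psd_selfadj[OF B(2)]
  have near0: "spec_meas B {0<..<t} \<noteq> 0" if "t > 0" for t using near that by blast
  have borel_Ico: "range (\<lambda>k. {f k..<g k}) \<subseteq> sets borel" for f g :: "nat \<Rightarrow> real" by auto
  have id0: "id_blinfun \<noteq> (0 :: 'h op)"
  proof
    assume "id_blinfun = (0 :: 'h op)"
    then have "x = 0" for x :: 'h by (metis blinfun_apply_id_blinfun id_apply zero_blinfun.rep_eq)
    then have "spec_meas B {0<..<1} = 0" by (intro blinfun_eqI) metis
    then show False using near0[of 1] by simp
  qed
  have phi1: "\<phi> id_blinfun > 0" by (rule phi_prj_pos[OF _ id0]) simp
  define c where "c = min (\<gamma> / (2 * \<phi> id_blinfun)) (\<alpha> / 2)"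
  have c: "0 < c" "c < \<alpha>" "c * \<phi> id_blinfun \<le> \<gamma> / 2"
  proof -
    show "0 < c" "c < \<alpha>" using gam phi1 \<alpha> by (auto simp: c_def)
    have "c * \<phi> id_blinfun \<le> \<gamma> / (2 * \<phi> id_blinfun) * \<phi> id_blinfun"
      using phi1 by (intro mult_right_mono) (auto simp: c_def)
    then show "c * \<phi> id_blinfun \<le> \<gamma> / 2" using phi1 by simp
  qed
  have c2: "c \<le> \<alpha> / 2" by (simp add: c_def)
  have c4: "c / 4 > 0" using c by simp
  \<comment> \<open>With b below c / 4, the piece B P fits into E with the strict slack c - b, which
    the injectivity of A - C will use.\<close>
  obtain b' b where b: "0 < b'" "b' < b" "b < c / 4" "spec_meas B {b'..<b} \<noteq> 0"
    using ex_compact_interval[OF sB near0[OF c4] c4] by blast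
  define P where "P = spec_meas B {b'..<b}"
  have P: "prj P" "P \<noteq> 0" using prj_spec_meas[OF sB B(1)] b(4) by (auto simp: P_def)
  have b\<alpha>: "b < \<alpha>" using b c by simp
  define a where "a = (\<alpha> + b) / 2"
  have a: "a < \<alpha>" "c < a" using b c2 b\<alpha> by (auto simp: a_def)
  define \<delta> where "\<delta> = b' * \<gamma> / (4 * L)"
  have \<delta>: "\<delta> > 0" using b gam L by (simp add: \<delta>_def)
  \<comment> \<open>The denominator n + 2 makes slot 2k strictly higher than the right end
    \<open>r (Suc k)\<close> even at k = 0; with n + 1 the two would coincide there.\<close>
  define \<epsilon> where "\<epsilon> n = (\<alpha> - a) / real (n + 2)" for n
  have eps: "0 < \<epsilon> n" "\<epsilon> n < \<alpha> - c" for n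
  proof -
    show "0 < \<epsilon> n" using a by (simp add: \<epsilon>_def)
    have "\<epsilon> n \<le> (\<alpha> - a) / 1" unfolding \<epsilon>_def using a by (intro divide_left_mono) auto
    then show "\<epsilon> n < \<alpha> - c" using a by simp
  qed
  define u where "u n = \<alpha> - \<epsilon> n" for n
  have u: "c < u n" for n using eps[of n] by (simp add: u_def)
  define r where "r = (\<lambda>k::nat. \<alpha> - (\<alpha> - b) / real (k + 1))"
  note r = increasing_thresholds[OF b\<alpha> r_def]
  have ru: "r (Suc k) < u (2 * k)" for k
  proof -
    have "(\<alpha> - a) / real (2 * k + 2) = (\<alpha> - b) / real (4 * k + 4)"
      by (simp add: a_def field_simps)
    also have "\<dots> < (\<alpha> - b) / real (k + 2)"
      using b\<alpha> by (intro divide_strict_left_mono) auto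
    finally show ?thesis by (simp add: r_def u_def \<epsilon>_def)
  qed
  define pt where "pt k = spec_meas B {r k..<r (Suc k)}" for k
  have ptp: "prj (pt n)" for n unfolding pt_def by (rule prj_spec_meas[OF sB B(1)]) simp
  have pto: "orth_seq pt" and ptsum: "\<And>x. (\<lambda>n. pt n x) sums spec_meas B {b..<\<alpha>} x"
    using spec_meas_sums[OF sB borel_Ico disjoint_incseq[OF r(1)]] unfolding pt_def r(5) .
  have ptB: "commutes B (pt n)" for n unfolding pt_def by (rule spec_meas_commutes[OF sB]) simp
  have ptle: "B (pt k y) \<bullet> pt k y \<le> r (Suc k) * (norm (pt k y))\<^sup>2" for k y
    by (rule spec_meas_le[OF sB, of "{r k..<r (Suc k)}"])
      (auto simp: pt_def orth_proj_idem[OF spec_meas(1)[OF sB]])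
  define \<kappa> where "\<kappa> j = c / 4 / 2 ^ j" for j :: nat
  have \<kappa>: "0 < \<kappa> j" "\<kappa> j \<le> c / 4" for j
  proof -
    show "0 < \<kappa> j" using c by (simp add: \<kappa>_def)
    have "c / 4 / 2 ^ j \<le> c / 4 / 1" using c by (intro divide_left_mono) auto
    then show "\<kappa> j \<le> c / 4" by (simp add: \<kappa>_def)
  qed
  have \<kappa>lim: "\<kappa> \<longlonglongrightarrow> 0"
  proof -
    have "(\<lambda>j. c / 4 * (1 / 2) ^ j) \<longlonglongrightarrow> c / 4 * 0"
      by (intro tendsto_intros LIMSEQ_realpow_zero) auto
    moreover have "\<kappa> = (\<lambda>j. c / 4 * (1 / 2) ^ j)"
      by (rule ext) (simp add: \<kappa>_def power_one_over field_simps)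
    ultimately show ?thesis by simp
  qed
  \<comment> \<open>Thresholds that cut (0, b') into spectrally nontrivial pieces, the n-th of which
    is bounded by \<kappa> n. They exist because B has spectrum arbitrarily close to 0; the clause
    for n = 0 fixes the starting point b'.\<close>
  have "\<exists>t. \<forall>n. (0 < t n \<and> t n \<le> \<kappa> n \<and> (n = 0 \<longrightarrow> t n = b')) \<and>
      (t (Suc n) < t n \<and> spec_meas B {t (Suc n)..<t n} \<noteq> 0)"
  proof (rule dependent_nat_choice)
    show "\<exists>x. 0 < x \<and> x \<le> \<kappa> 0 \<and> (0 = (0::nat) \<longrightarrow> x = b')" using b by (simp add: \<kappa>_def)
    fix t n assume t: "0 < t \<and> t \<le> \<kappa> n \<and> (n = 0 \<longrightarrow> t = b')"
    then obtain s' s where s: "0 < s'" "s' < s" "s < t" "spec_meas B {s'..<s} \<noteq> 0"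
      using ex_compact_interval[OF sB near0, of t] by blast
    \<comment> \<open>Lowering the left end to at most the next \<kappa> keeps [s', s) inside the
      interval and restores the invariant.\<close>
    define q where "q = min s' (\<kappa> (Suc n))"
    have "psub (spec_meas B {s'..<s}) (spec_meas B {q..<t})"
      by (rule spec_meas_mono[OF sB]) (use s in \<open>auto simp: q_def\<close>)
    then have "spec_meas B {q..<t} \<noteq> 0"
      using s(4) by (auto simp: psub_def) (metis blinfun_eqI zero_blinfun.rep_eq)
    then show "\<exists>y. (0 < y \<and> y \<le> \<kappa> (Suc n) \<and> (Suc n = 0 \<longrightarrow> y = b')) \<and> (y < t \<and> spec_meas B {y..<t} \<noteq> 0)"
      using s \<kappa>(1)[of "Suc n"] by (intro exI[of _ q]) (auto simp: q_def)
  qed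
  then obtain t where t: "\<And>n. 0 < t n" "\<And>n. t n \<le> \<kappa> n" "t 0 = b'" "\<And>n. t (Suc n) < t n"
    "\<And>n. spec_meas B {t (Suc n)..<t n} \<noteq> 0" by metis
  have tdec: "decseq t" by (rule decseq_SucI) (use t(4) in \<open>auto intro: less_imp_le\<close>)
  have tlim: "t \<longlonglongrightarrow> 0"
    by (rule real_tendsto_sandwich[OF _ _ tendsto_const \<kappa>lim]) (use t in \<open>auto intro: less_imp_le always_eventually\<close>)
  define pf where "pf k = spec_meas B {t (Suc k)..<t k}" for k
  have pfp: "prj (pf n)" for n unfolding pf_def by (rule prj_spec_meas[OF sB B(1)]) simp
  have pfo: "orth_seq pf" and pfsum: "\<And>x. (\<lambda>n. pf n x) sums spec_meas B {0<..<b'} x"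
    using spec_meas_sums[OF sB borel_Ico disjoint_decseq[OF tdec]]
    unfolding pf_def UN_decseq[OF tdec tlim t(1)] t(3) .
  have pfB: "commutes B (pf n)" for n unfolding pf_def by (rule spec_meas_commutes[OF sB]) simp
  have pfle: "B (pf k y) \<bullet> pf k y \<le> \<kappa> k * (norm (pf k y))\<^sup>2" for k y
    by (rule spec_meas_le[OF sB, of "{t (Suc k)..<t k}"])
      (use t(2)[of k] in \<open>auto simp: pf_def orth_proj_idem[OF spec_meas(1)[OF sB]]\<close>)
  define P2 P3 where "P2 = spec_meas B {b..<\<alpha>}" and "P3 = spec_meas B {0<..<b'}"
  have P12: "P (P2 x) = 0" for x
    unfolding P_def P2_def by (rule spec_meas_disjoint[OF sB]) auto
  have P13: "P (P3 x) = 0" for x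
    unfolding P_def P3_def using b by (intro spec_meas_disjoint[OF sB]) auto
  have P23: "P2 (P3 x) = 0" for x
    unfolding P2_def P3_def using b by (intro spec_meas_disjoint[OF sB]) auto
  have Pid: "(P + P2) + P3 = id_blinfun"
  proof -
    have 1: "{b'..<b} \<union> {b..<\<alpha>} = {b'..<\<alpha>}" "{b'..<b} \<inter> {b..<\<alpha>} = {}" using b b\<alpha> by auto
    have 2: "{b'..<\<alpha>} \<union> {0<..<b'} = {0<..<\<alpha>}" "{b'..<\<alpha>} \<inter> {0<..<b'} = {}" using b b\<alpha> by auto
    have 3: "{0<..<\<alpha>} \<union> ({..0} \<union> {\<alpha>..}) = UNIV" "{0<..<\<alpha>} \<inter> ({..0} \<union> {\<alpha>..}) = {}"
      "{..0} \<inter> {\<alpha>..} = {}" using \<alpha> by auto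
    show ?thesis
      using spec_meas_Un[OF sB _ _ 1(2)] spec_meas_Un[OF sB _ _ 2(2)] spec_meas_Un[OF sB _ _ 3(2)]
        spec_meas_Un[OF sB _ _ 3(3)] spec_meas_UNIV[OF sB] B(3,4)
      by (simp add: 1 2 3 P_def P2_def P3_def)
  qed
  have PB: "commutes B P" "commutes B P2" unfolding P_def P2_def by (rule spec_meas_commutes[OF sB], simp)+
  have Ple: "B y \<bullet> y \<le> b * (norm y)\<^sup>2" "b' * (norm y)\<^sup>2 \<le> B y \<bullet> y" if "P y = y" for y
    by (rule spec_meas_le[OF sB, of "{b'..<b}"]; use that in \<open>auto simp: P_def\<close>)
      (rule spec_meas_ge[OF sB, of "{b'..<b}"]; use that in \<open>auto simp: P_def\<close>)
  have "\<exists>C\<in>vn. ueq C B \<and> psd C \<and> psd (A - C) \<and> norm (A - C) \<ge> \<alpha> \<and> \<phi> C \<ge> \<delta> \<and>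
      (\<forall>x. (A - C) x = 0 \<longrightarrow> x = 0)"
    if A: "A \<in> vn" "psd A" "norm A \<ge> \<alpha>" "norm A \<le> L" "\<gamma> \<le> \<phi> A" "spec_meas A {..0} = 0" for A
  proof -
    note sA = psd_selfadj[OF A(2)]
    define Q where "Q = spec_meas A {c..}"
    obtain E F S where E: "prj E" and F: "orth_seq F" "\<And>k::nat. prj (F k)" "\<And>k. F k \<noteq> 0" and S: "prj S"
      "\<And>x. (\<lambda>k. blinfun_apply (F k) x) sums blinfun_apply S x" "psub S Q"
      and ES: "E = Q - S" and phiE: "\<gamma> \<le> 4 * L * \<phi> E"
      and room: "\<And>I x. finite I \<Longrightarrow> c * (norm (blinfun_apply E x))\<^sup>2 +
       (\<Sum>k\<in>I. u k * (norm (blinfun_apply (F k) x))\<^sup>2) + A (x - Q x) \<bullet> (x - Q x) \<le> A x \<bullet> x"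
      using spectral_profile[where \<epsilon> = \<epsilon>, OF A(1-4) c gam A(5) eps] unfolding u_def Q_def
      by (elim exE conjE) blast
    have Qp: "prj Q" unfolding Q_def by (rule prj_spec_meas[OF sA A(1)]) simp
    have FS: "psub (F k) S" for k by (rule orth_seq_psub_sum(2)[OF F(1) S(2)])
    have FQ: "psub (F k) Q" for k using psub_trans[OF FS S(3)] .
    have EF: "E (F k x) = 0" for k x
      using psubD[OF FS] psubD[OF FQ] by (simp add: ES blinfun.diff_left)
    have E0: "E \<noteq> 0" using phiE gam L by auto
    have EQ: "psub E Q" unfolding ES by (rule psub_diff(1)[OF S(3) prjD(2)[OF S(1)] prjD(2)[OF Qp]])
    define l where "l j = spec_meas A {c / 2 ^ Suc j..<c / 2 ^ j}" for j :: nat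
    have ldec: "decseq (\<lambda>j::nat. c / 2 ^ j)"
      using c by (intro decseq_SucI) (simp add: field_simps)
    have llim: "(\<lambda>j::nat. c / 2 ^ j) \<longlonglongrightarrow> 0"
      using tendsto_mult_right_zero[OF \<kappa>lim, of 4] by (simp add: \<kappa>_def)
    have lU: "(\<Union>j. {c / 2 ^ Suc j..<c / 2 ^ j}) = {0<..<c}"
      using UN_decseq[OF ldec llim] c by simp
    have lo: "orth_seq l" and lsum: "\<And>x. (\<lambda>j. l j x) sums spec_meas A {0<..<c} x"
      using spec_meas_sums[OF sA borel_Ico disjoint_decseq[OF ldec]] unfolding l_def lU .
    have lp: "prj (l j)" for j unfolding l_def by (rule prj_spec_meas[OF sA A(1)]) simp
    have Ql: "Q (l j x) = 0" for j x
    proof -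
      have "c / 2 ^ j \<le> c" using decseqD[OF ldec, of 0 j] by simp
      then show ?thesis unfolding Q_def l_def by (intro spec_meas_disjoint[OF sA]) auto
    qed
    have lQ: "l j (Q x) = 0" for j x by (rule orth_sym[OF Ql prjD(2)[OF Qp] prjD(2)[OF lp]])
    have lA: "commutes A (l j)" for j unfolding l_def by (rule spec_meas_commutes[OF sA]) simp
    have lge: "2 * \<kappa> j * (norm (l j x))\<^sup>2 \<le> A (l j x) \<bullet> l j x" for j x
    proof -
      have "2 * \<kappa> j = c / 2 ^ Suc j" by (simp add: \<kappa>_def)
      then show ?thesis
        by (simp only:) (rule spec_meas_ge[OF sA, of "{c / 2 ^ Suc j..<c / 2 ^ j}"],
          auto simp: l_def orth_proj_idem[OF spec_meas(1)[OF sA]])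
    qed
    have Xl: "X (l j x) = 0" if "psub X Q" "orth_proj X" for X j x
      using psubD'[OF that prjD(2)[OF Qp], of "l j x"] Ql by simp
    have Qid: "Q x + spec_meas A {0<..<c} x = x" for x
    proof -
      have 1: "{c..} \<union> {0<..<c} = {0<..}" "{c..} \<inter> {0<..<c} = {}" using c by auto
      have 2: "{0<..} \<union> {..0} = (UNIV::real set)" "{0<..} \<inter> {..0::real} = {}" by auto
      have "Q + spec_meas A {0<..<c} = id_blinfun"
        using spec_meas_Un[OF sA _ _ 1(2)] spec_meas_Un[OF sA _ _ 2(2)] spec_meas_UNIV[OF sA] A(6)
        by (simp add: 1 2 Q_def)
      then show ?thesis by (metis blinfun.add_left blinfun_apply_id_blinfun id_apply)
    qed
    obtain V where V: "V \<in> vn" "pisom V P E" using eqv_any[OF P E E0] by (auto simp: eqv_def)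
    have "\<exists>V G. V \<in> vn \<and> pisom V (pt k) G \<and> prj G \<and> psub G (F (2 * k))" for k
      using subeqv_any[OF ptp F(2,3), of k] unfolding subeqv_def eqv_def by blast
    then obtain Vt g where Vt: "\<And>k. Vt k \<in> vn" "\<And>k. pisom (Vt k) (pt k) (g k)"
      and g: "\<And>k. prj (g k)" "\<And>k. psub (g k) (F (2 * k))" by metis
    have oF: "orth_seq (\<lambda>k. F (2 * k))" "orth_seq (\<lambda>k. F (2 * k + 1))"
      using orth_seqD[OF F(1)] by (simp_all add: orth_seq_def)
    have og: "orth_seq g" by (rule orth_seq_psub[OF oF(1) prjD(2)[OF g(1)] g(2)])
    have gQ: "psub (g k) Q" for k using psub_trans[OF g(2) FQ] .
    \<comment> \<open>The part of an even slot that the piece placed there leaves uncovered.\<close>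
    define y where "y k = F (2 * k) - g k" for k
    have yp: "prj (y k)" for k unfolding y_def by (rule prj_diff[OF g(1) F(2) g(2)])
    have yF: "psub (y k) (F (2 * k))" for k
      unfolding y_def by (rule psub_diff(1)[OF g(2) prjD(2)[OF g(1)] prjD(2)[OF F(2)]])
    have yQ: "psub (y k) Q" for k using psub_trans[OF yF FQ] .
    have oy: "orth_seq y" by (rule orth_seq_psub[OF oF(1) prjD(2)[OF yp] yF])
    have Fy: "F (2 * m + 1) (y n x) = 0" for m n x
    proof -
      have "2 * m + 1 \<noteq> 2 * n" by presburger
      from orth_seqD(2)[OF F(1) this, of "y n x"] show ?thesis by (simp only: psubD[OF yF])
    qed
    define h where "h k = F (2 * k + 1) + y k" for k
    have oh: "orth_seq h" unfolding h_def by (rule orth_seq_add[OF oF(2) oy Fy])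
    have hp: "prj (h k)" for k unfolding h_def by (rule prj_add[OF F(2) yp Fy])
    have hQ: "psub (h k) Q" for k unfolding h_def by (rule psub_add[OF FQ yQ])
    have hl: "h k (l j x) = 0" for k j x by (rule Xl[OF hQ prjD(2)[OF hp]])
    \<comment> \<open>The space still free at level k: the odd slot, the rest of the even slot and
      one band of A below c. The odd slot makes it nonzero, hence equivalent to a filler piece
      exactly instead of merely containing a copy of it.\<close>
    define G where "G k = h k + l k" for k
    have oG: "orth_seq G" unfolding G_def by (rule orth_seq_add[OF oh lo hl])
    have Gp: "prj (G k)" for k unfolding G_def by (rule prj_add[OF hp lp hl])
    have G0: "G k \<noteq> 0" for k
    proof
      assume "G k = 0"
      then have Gz: "G k (F (2 * k + 1) x) = 0" for x by simp
      have "G k (F (2 * k + 1) x) = F (2 * k + 1) x" for x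
        using orth_sym[OF Fy[of k k] prjD(2)[OF F(2)] prjD(2)[OF yp], of x]
          lQ[of k "F (2 * k + 1) x"] psubD[OF FQ, of "2 * k + 1" x]
        by (simp add: G_def h_def blinfun.bilinear_simps orth_proj_idem[OF prjD(2)[OF F(2)]])
      then have "F (2 * k + 1) = 0" using Gz by (intro blinfun_eqI) simp
      then show False using F(3) by blast
    qed
    have gy: "g k (y n x) = 0" for k n x
    proof (cases "k = n")
      case True
      then show ?thesis
        using psub_diff(2)[OF g(2) prjD(2)[OF g(1)] prjD(2)[OF F(2)]] by (simp add: y_def)
    next
      case False
      then show ?thesis
        using orth_psub[OF orth_seqD(2)[OF oF(1) False] g(2) yF prjD(2)[OF g(1)] prjD(2)[OF F(2)]] by simp
    qed
    have gF: "g k (F (2 * n + 1) x) = 0" for k n x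
    proof -
      have "F (2 * k) (F (2 * n + 1) z) = 0" for z
        by (rule orth_seqD(2)[OF F(1)]) presburger
      then show ?thesis
        using psubD'[OF g(2) prjD(2)[OF g(1)] prjD(2)[OF F(2)], of k "F (2 * n + 1) x"] by simp
    qed
    have gG: "g k (G n x) = 0" for k n x
      using gF gy Xl[OF gQ prjD(2)[OF g(1)]] by (simp add: G_def h_def blinfun.bilinear_simps)
    have Eg: "E (g k x) = 0" for k x
      using EF[of "2 * k" "g k x"] psubD[OF g(2), of k x] by simp
    have EG: "E (G k x) = 0" for k x
      using EF psubD[OF yF, of k x] EF[of "2 * k" "y k x"] Xl[OF EQ prjD(2)[OF E]]
      by (simp add: G_def h_def blinfun.bilinear_simps)
    have "\<exists>V. V \<in> vn \<and> pisom V (pf k) (G k)" for k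
      using eqv_any[OF pfp _ Gp G0, of k k] t(5) by (auto simp: eqv_def pf_def)
    then obtain Vf where Vf: "\<And>k. Vf k \<in> vn" "\<And>k. pisom (Vf k) (pf k) (G k)" by metis
    obtain Wt P2' Rt where Wt: "Wt \<in> vn" "pisom Wt P2' Rt" "\<And>x. (\<lambda>n. pt n x) sums blinfun_apply P2' x"
      "\<And>x. (\<lambda>n. g n x) sums blinfun_apply Rt x"
      "\<And>z. (\<lambda>n. B (hadj (Vt n) z) \<bullet> hadj (Vt n) z) sums (B (hadj Wt z) \<bullet> hadj Wt z)"
      using assemble_blocks[OF Vt pto og ptB] by blast
    have P2': "P2' = P2"
      unfolding P2_def by (rule blinfun_eqI) (rule sums_unique2[OF Wt(3) ptsum])
    obtain Wf P3' Rf where Wf: "Wf \<in> vn" "pisom Wf P3' Rf" "\<And>x. (\<lambda>n. pf n x) sums blinfun_apply P3' x"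
      "\<And>x. (\<lambda>n. G n x) sums blinfun_apply Rf x"
      "\<And>z. (\<lambda>n. B (hadj (Vf n) z) \<bullet> hadj (Vf n) z) sums (B (hadj Wf z) \<bullet> hadj Wf z)"
      using assemble_blocks[OF Vf pfo oG pfB] by blast
    have P3': "P3' = P3"
      unfolding P3_def by (rule blinfun_eqI) (rule sums_unique2[OF Wf(3) pfsum])
    have ERt: "E (Rt x) = 0" for x by (rule orth_sums[OF Wt(4) Eg])
    have ERf: "E (Rf x) = 0" for x by (rule orth_sums[OF Wf(4) EG])
    have gRf: "g k (Rf x) = 0" for k x by (rule orth_sums[OF Wf(4) gG])
    have RtRf: "Rt (Rf x) = 0" for x
      using Wt(4)[of "Rf x"] sums_unique2[of "\<lambda>_. 0" "Rt (Rf x)" 0] by (simp add: gRf)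
    \<comment> \<open>E, the parked pieces and the filled space exhaust the identity, so W is
      unitary. An injective B has no kernel that could absorb a defect.\<close>
    have R: "E x + Rt x + Rf x = x" for x
    proof -
      have "(\<lambda>n. (g n x + G n x)) sums (Rt x + Rf x)" by (rule sums_add[OF Wt(4) Wf(4)])
      moreover have "(\<lambda>n. (F (2 * n) x + F (2 * n + 1) x) + l n x) sums (S x + spec_meas A {0<..<c} x)"
        by (rule sums_add[OF sums_pairs[OF S(2)] lsum])
      moreover have "(F (2 * n) x + F (2 * n + 1) x) + l n x = g n x + G n x" for n
        by (simp add: G_def h_def y_def blinfun.bilinear_simps)
      ultimately have "Rt x + Rf x = S x + spec_meas A {0<..<c} x"
        by (simp add: sums_unique2)
      then show ?thesis using Qid[of x] by (simp add: ES blinfun.diff_left algebra_simps)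
    qed
    define W1 where "W1 = V + Wt"
    have W1: "pisom W1 (P + P2) (E + Rt)"
      unfolding W1_def using pisom_add[OF V(2) Wt(2)] P12 ERt by (simp add: P2')
    define W where "W = W1 + Wf"
    have PP3: "(P + P2) (P3' x) = 0" for x by (simp add: blinfun.add_left P13 P23 P3')
    have "pisom W ((P + P2) + P3') ((E + Rt) + Rf)"
      unfolding W_def by (rule pisom_add[OF W1 Wf(2) PP3]) (simp add: blinfun.add_left ERf RtRf)
    moreover have "(E + Rt) + Rf = id_blinfun" by (rule blinfun_eqI) (simp add: blinfun.add_left R)
    ultimately have W: "pisom W id_blinfun id_blinfun" by (simp add: P3' Pid)
    have Wv: "W \<in> vn" unfolding W_def W1_def by (intro vn_intros V Wt Wf)
    define C where "C = W o\<^sub>L B o\<^sub>L hadj W"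
    have Cform: "C z \<bullet> z = B (hadj V z) \<bullet> hadj V z + B (hadj Wt z) \<bullet> hadj Wt z + B (hadj Wf z) \<bullet> hadj Wf z" for z
    proof -
      have "C z \<bullet> z = B (hadj W1 z) \<bullet> hadj W1 z + B (hadj Wf z) \<bullet> hadj Wf z"
        unfolding C_def conj_form W_def
        by (rule pisom_add_form[OF W1 Wf(2) PP3]) (intro commutes_intros PB)
      moreover have "B (hadj W1 z) \<bullet> hadj W1 z = B (hadj V z) \<bullet> hadj V z + B (hadj Wt z) \<bullet> hadj Wt z"
        unfolding W1_def by (rule pisom_add_form[OF V(2) Wt(2) _ PB(1)]) (simp add: P2' P12)
      ultimately show ?thesis by simp
    qed
    have Cv: "C \<in> vn" unfolding C_def by (intro vn_intros Wv B vn_hadj)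
    have Cp: "psd C" unfolding C_def by (rule psd_conj'[OF B(2)])
    have ueq: "ueq C B" unfolding C_def by (rule isometry_ueq[OF B(1) sB Wv W]) simp
    let ?n = "\<lambda>X x. (norm (blinfun_apply X x))\<^sup>2"
    have Gn: "?n (G k) x = ?n (F (2 * k + 1)) x + (?n (F (2 * k)) x - ?n (g k) x) + ?n (l k) x" for k x
    proof -
      have "G k x \<bullet> x = F (2 * k + 1) x \<bullet> x + (F (2 * k) x \<bullet> x - g k x \<bullet> x) + l k x \<bullet> x"
        by (simp add: G_def h_def y_def blinfun.bilinear_simps inner_add_left inner_diff_left)
      then show ?thesis
        using orth_proj_inner prjD(2) Gp F(2) g(1) lp by metis
    qed
    have gFn: "?n (g k) x \<le> ?n (F (2 * k)) x" for k x
      by (intro power_mono psub_norm_le[OF g(2)] prjD(2) g F) auto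
    \<comment> \<open>The slack of A over C at level k. All four coefficients are positive, so the
      vanishing of every \<open>D k x\<close> together with E x = 0 forces x = 0.\<close>
    define D where "D k x = (u (2 * k) - \<kappa> k) * (?n (F (2 * k)) x - ?n (g k) x) +
      (u (2 * k) - r (Suc k)) * ?n (g k) x + (u (2 * k + 1) - \<kappa> k) * ?n (F (2 * k + 1)) x + \<kappa> k * ?n (l k) x" for k x
    have coef: "0 < u m - \<kappa> k" "0 < u (2 * k) - r (Suc k)" for m k
      using u[of m] \<kappa>(2)[of k] c ru[of k] by auto
    have Dpos: "0 \<le> (u (2 * k) - \<kappa> k) * (?n (F (2 * k)) x - ?n (g k) x)"
      "0 \<le> (u (2 * k) - r (Suc k)) * ?n (g k) x" "0 \<le> (u (2 * k + 1) - \<kappa> k) * ?n (F (2 * k + 1)) x"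
      "0 \<le> \<kappa> k * ?n (l k) x" for k x
      using coef(1)[of "2 * k" k] coef(2)[of k] coef(1)[of "2 * k + 1" k] gFn[of k x] \<kappa>(1)[of k]
      by (simp_all add: mult_nonneg_nonneg less_imp_le del: diff_gt_0_iff_gt)
    have D0: "0 \<le> D k x" for k x unfolding D_def by (intro add_nonneg_nonneg Dpos)
    have bound: "C x \<bullet> x + (c - b) * ?n E x + D j x \<le> A x \<bullet> x" for x j
    proof -
      have blocks: "(\<Sum>k<n. B (hadj (Vt k) x) \<bullet> hadj (Vt k) x) + (\<Sum>k<n. B (hadj (Vf k) x) \<bullet> hadj (Vf k) x)
          \<le> A x \<bullet> x - c * ?n E x - D j x" if "n > j" for n
      proof -
        have 1: "B (hadj (Vt k) x) \<bullet> hadj (Vt k) x \<le> r (Suc k) * ?n (g k) x" for k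
          using ptle[of k "hadj (Vt k) x"] by (simp add: pisomD(8,10)[OF Vt(2)])
        have 2: "B (hadj (Vf k) x) \<bullet> hadj (Vf k) x \<le> \<kappa> k * ?n (G k) x" for k
          using pfle[of k "hadj (Vf k) x"] by (simp add: pisomD(8,10)[OF Vf(2)])
        have "B (hadj (Vt k) x) \<bullet> hadj (Vt k) x + B (hadj (Vf k) x) \<bullet> hadj (Vf k) x \<le>
           (u (2 * k) * ?n (F (2 * k)) x + u (2 * k + 1) * ?n (F (2 * k + 1)) x) + 2 * \<kappa> k * ?n (l k) x - D k x" for k
          using 1[of k] 2[of k] unfolding Gn D_def by (simp add: algebra_simps)
        then have "(\<Sum>k<n. B (hadj (Vt k) x) \<bullet> hadj (Vt k) x + B (hadj (Vf k) x) \<bullet> hadj (Vf k) x) \<le>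
          (\<Sum>k<n. (u (2 * k) * ?n (F (2 * k)) x + u (2 * k + 1) * ?n (F (2 * k + 1)) x) + 2 * \<kappa> k * ?n (l k) x - D k x)"
          by (intro sum_mono)
        also have "\<dots> = (\<Sum>m<2 * n. u m * ?n (F m) x) + (\<Sum>k<n. 2 * \<kappa> k * ?n (l k) x) - (\<Sum>k<n. D k x)"
          by (simp only: sum_subtractf sum.distrib sum_pairs)
        also have "\<dots> \<le> (\<Sum>m<2 * n. u m * ?n (F m) x) + A (x - Q x) \<bullet> (x - Q x) - D j x"
        proof -
          have "(\<Sum>k<n. 2 * \<kappa> k * ?n (l k) x) \<le> (\<Sum>k<n. A (l k (x - Q x)) \<bullet> l k (x - Q x))"
            using lge[of _ x] by (intro sum_mono) (simp add: blinfun.diff_right lQ)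
          also have "\<dots> \<le> A (x - Q x) \<bullet> (x - Q x)"
            by (rule orth_commute_form_sum[OF A(2) lo lA]) simp
          moreover have "D j x \<le> (\<Sum>k<n. D k x)"
            using that D0 by (intro member_le_sum) auto
          ultimately show ?thesis by linarith
        qed
        also have "\<dots> \<le> A x \<bullet> x - c * ?n E x - D j x" using room[of "{..<2 * n}" x] by simp
        finally show ?thesis by (simp add: sum.distrib)
      qed
      have "B (hadj Wt x) \<bullet> hadj Wt x + B (hadj Wf x) \<bullet> hadj Wf x \<le> A x \<bullet> x - c * ?n E x - D j x"
      proof (rule LIMSEQ_le_const2)
        show "(\<lambda>n. (\<Sum>k<n. B (hadj (Vt k) x) \<bullet> hadj (Vt k) x) + (\<Sum>k<n. B (hadj (Vf k) x) \<bullet> hadj (Vf k) x))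
           \<longlonglongrightarrow> B (hadj Wt x) \<bullet> hadj Wt x + B (hadj Wf x) \<bullet> hadj Wf x"
          using Wt(5)[of x] Wf(5)[of x] unfolding sums_def by (rule tendsto_add)
        show "\<exists>N. \<forall>n\<ge>N. (\<Sum>k<n. B (hadj (Vt k) x) \<bullet> hadj (Vt k) x) + (\<Sum>k<n. B (hadj (Vf k) x) \<bullet> hadj (Vf k) x)
          \<le> A x \<bullet> x - c * ?n E x - D j x"
          using blocks by (intro exI[of _ "Suc j"]) auto
      qed
      moreover have "B (hadj V x) \<bullet> hadj V x \<le> b * ?n E x"
        using Ple(1)[OF pisomD(8)[OF V(2)], of x] by (simp add: pisomD(10)[OF V(2)])
      ultimately show ?thesis by (simp add: Cform algebra_simps)
    qed
    have cb: "0 < c - b" using b c by simp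
    have cbE: "0 \<le> (c - b) * ?n E x" for x using cb by simp
    have AC: "psd (A - C)"
    proof (rule psd_diffI[OF psd_selfadj[OF Cp] psd_selfadj[OF A(2)]])
      fix x show "C x \<bullet> x \<le> A x \<bullet> x" using bound[of x 0] cbE[of x] D0[of 0 x] by linarith
    qed
    have inj: "x = 0" if "(A - C) x = 0" for x
    proof -
      have "A x \<bullet> x - C x \<bullet> x = 0"
        using arg_cong[OF that, of "\<lambda>z. z \<bullet> x"] by (simp add: blinfun.diff_left inner_diff_left)
      then have "(c - b) * ?n E x + D j x \<le> 0" for j using bound[of x j] by linarith
      then have "(c - b) * ?n E x = 0" "D j x = 0" for j
        using cbE[of x] D0[of _ x] by (metis add_nonneg_eq_0_iff antisym add_nonneg_nonneg)+
      then have Ex: "E x = 0" and "D j x = 0" for j using cb by auto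
      have "?n (F (2 * j)) x - ?n (g j) x = 0" "?n (g j) x = 0" "?n (F (2 * j + 1)) x = 0" "?n (l j) x = 0" for j
      proof -
        have "(u (2 * j) - \<kappa> j) * (?n (F (2 * j)) x - ?n (g j) x) = 0" "(u (2 * j) - r (Suc j)) * ?n (g j) x = 0"
          "(u (2 * j + 1) - \<kappa> j) * ?n (F (2 * j + 1)) x = 0" "\<kappa> j * ?n (l j) x = 0"
          using Dpos[of j x] \<open>D j x = 0\<close> unfolding D_def by linarith+
        then show "?n (F (2 * j)) x - ?n (g j) x = 0" "?n (g j) x = 0" "?n (F (2 * j + 1)) x = 0" "?n (l j) x = 0"
          using coef(1)[of "2 * j" j] coef(2)[of j] coef(1)[of "2 * j + 1" j] \<kappa>(1)[of j] by simp_all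
      qed
      then have "G j x = 0" "g j x = 0" for j using Gn[of j x] by simp_all
      then have "Rt x = 0" "Rf x = 0" using Wt(4)[of x] Wf(4)[of x] sums_unique2[of "\<lambda>_. 0" _ 0] by simp_all
      then show ?thesis using R[of x] Ex by simp
    qed
    \<comment> \<open>The odd slots are filled only up to \<kappa> j, so A - C is at least u m -
      \<kappa> j on them, and this tends to \<alpha>.\<close>
    have "\<alpha> - ((\<alpha> - a) + c) / real (j + 1) \<le> norm (A - C)" for j
    proof -
      define m where "m = 2 * j + 1"
      obtain z where z: "F m z \<noteq> 0" using F(3)[of m] by (metis blinfun_eqI zero_blinfun.rep_eq)
      define x where "x = F m z"
      have "F m x = x" unfolding x_def by (rule orth_proj_idem[OF prjD(2)[OF F(2)]])
      then have "(u m - \<kappa> j) * (norm x)\<^sup>2 \<le> D j x"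
        using Dpos[of j x] unfolding D_def by (simp add: m_def)
      then have "(u m - \<kappa> j) * (norm x)\<^sup>2 \<le> (A - C) x \<bullet> x"
        using bound[of x j] cbE[of x] by (simp add: blinfun.diff_left inner_diff_left)
      from norm_ge_form[OF _ this] have "u m - \<kappa> j \<le> norm (A - C)" using z by (simp add: x_def)
      moreover have "\<epsilon> m \<le> (\<alpha> - a) / real (j + 1)"
        unfolding \<epsilon>_def m_def using a by (intro divide_left_mono) auto
      moreover have "\<kappa> j \<le> c / real (j + 1)"
      proof -
        have "real (j + 1) \<le> 2 ^ j" using Suc_leI[OF less_exp[of j]] by (metis Suc_eq_plus1 numeral_power_le_of_nat_cancel_iff of_nat_le_iff of_nat_numeral of_nat_power)
        moreover have "(2::real) ^ j \<le> 4 * 2 ^ j" by simp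
        ultimately have "real (j + 1) \<le> 4 * 2 ^ j" by linarith
        then have "c / (4 * 2 ^ j) \<le> c / real (j + 1)" using c by (intro divide_left_mono) auto
        then show ?thesis by (simp add: \<kappa>_def)
      qed
      ultimately show ?thesis by (simp add: u_def add_divide_distrib)
    qed
    then have ACn: "\<alpha> \<le> norm (A - C)" by (rule le_of_inverse_slack)
    have "\<phi> (b' *\<^sub>R E) \<le> \<phi> C"
    proof (rule phi_mono)
      show "selfadj (b' *\<^sub>R E)"
        using selfadjD[OF orth_proj_selfadj[OF prjD(2)[OF E]]] by (simp add: selfadj_def blinfun.bilinear_simps)
      show "selfadj C" by (rule psd_selfadj[OF Cp])
      fix x
      have "(b' *\<^sub>R E) x \<bullet> x = b' * (norm (hadj V x))\<^sup>2"
        by (simp add: blinfun.bilinear_simps orth_proj_inner[OF prjD(2)[OF E]] pisomD(10)[OF V(2)])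
      also have "\<dots> \<le> B (hadj V x) \<bullet> hadj V x" by (rule Ple(2)[OF pisomD(8)[OF V(2)]])
      finally show "(b' *\<^sub>R E) x \<bullet> x \<le> C x \<bullet> x"
        using psd_nonneg[OF B(2), of "hadj Wt x"] psd_nonneg[OF B(2), of "hadj Wf x"] by (simp add: Cform)
    qed
    moreover have "\<delta> \<le> b' * \<phi> E"
    proof -
      have "b' * \<gamma> \<le> b' * (4 * L * \<phi> E)" using b phiE by (intro mult_left_mono) auto
      then show ?thesis using L by (simp add: \<delta>_def field_simps)
    qed
    ultimately have "\<phi> C \<ge> \<delta>" by (simp add: phi_scale)
    then show ?thesis using Cv ueq Cp AC ACn inj by blast
  qed
  then show ?thesis using \<delta> by blast
qed

end

section \<open>Eigenvectors at the norm and nonvanishing spectral pieces\<close>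

lemma norm_mono_psd:
  fixes S T :: "'h::real_inner op"
  assumes "psd S" "psd (T - S)"
  shows "norm S \<le> norm T"
proof (rule psd_norm_le[OF assms(1)])
  show "S x \<bullet> x \<le> norm T * (norm x)\<^sup>2" for x
    using psd_nonneg[OF assms(2), of x] psd_le_norm[of T x] by (simp add: blinfun.diff_left inner_diff_left)
qed simp

text \<open>The operator \<alpha> - T is positive and its form vanishes at x, so it annihilates
  x.\<close>

lemma eigenvector_of_bound:
  fixes T :: "'h::real_inner op"
  assumes "psd T" "norm T \<le> \<alpha>" "\<alpha> * (norm x)\<^sup>2 \<le> T x \<bullet> x"
  shows "T x = \<alpha> *\<^sub>R x"
proof -
  have D: "psd (\<alpha> *\<^sub>R id_blinfun - T)"
  proof (rule psd_diffI)
    show "selfadj (\<alpha> *\<^sub>R id_blinfun :: 'h op)" by (simp add: selfadj_def blinfun.scaleR_left)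
    fix x
    have "T x \<bullet> x \<le> norm T * (norm x)\<^sup>2" by (rule psd_le_norm)
    also have "\<dots> \<le> \<alpha> * (norm x)\<^sup>2" using assms(2) by (intro mult_right_mono) auto
    finally show "T x \<bullet> x \<le> (\<alpha> *\<^sub>R id_blinfun) x \<bullet> x" by (simp add: blinfun.scaleR_left dot_square_norm)
  qed (rule psd_selfadj[OF assms(1)])
  have "(\<alpha> *\<^sub>R id_blinfun - T) x \<bullet> x \<le> 0"
    using assms(3) by (simp add: blinfun.bilinear_simps inner_diff_left dot_square_norm)
  then have "(\<alpha> *\<^sub>R id_blinfun - T) x = 0"
    using psd_nonneg[OF D, of x] psd_zero_iff[OF D, of x] by simp
  then show ?thesis by (simp add: blinfun.bilinear_simps)
qed

lemma spec_meas_top_0: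
  fixes T :: "'h::real_hilbert op"
  assumes "psd T" "norm T \<le> \<alpha>" "\<And>x. T x = \<alpha> *\<^sub>R x \<Longrightarrow> x = 0"
  shows "spec_meas T {\<alpha>..} = 0"
proof (rule blinfun_eqI)
  fix x
  let ?y = "spec_meas T {\<alpha>..} x"
  have "\<alpha> * (norm ?y)\<^sup>2 \<le> T ?y \<bullet> ?y"
    by (rule spec_meas_ge[OF psd_selfadj[OF assms(1)], of "{\<alpha>..}"])
      (auto simp: orth_proj_idem[OF spec_meas(1)[OF psd_selfadj[OF assms(1)]]])
  then show "spec_meas T {\<alpha>..} x = blinfun_apply 0 x"
    using assms(3) eigenvector_of_bound[OF assms(1,2)] by simp
qed

lemma spec_meas_atMost_0:
  fixes T :: "'h::real_hilbert op"
  assumes "psd T" "\<And>x. T x = 0 \<Longrightarrow> x = 0"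
  shows "spec_meas T {..0} = 0"
proof (rule blinfun_eqI)
  fix x
  have "T (spec_meas T {..0} x) = 0"
    by (rule ker_atMost_0[OF assms(1)]) (simp add: orth_proj_idem[OF spec_meas(1)[OF psd_selfadj[OF assms(1)]]])
  then show "spec_meas T {..0} x = blinfun_apply 0 x" using assms(2) by simp
qed

text \<open>With neither kernel nor spectrum in (0, t), the form of T would be at least t, which
  bounds T below and excludes the given x.\<close>

lemma spec_meas_near_0:
  fixes T :: "'h::real_hilbert op"
  assumes T: "psd T" "spec_meas T {..0} = 0" and "t > 0" and nb: "\<exists>x. norm (T x) < t * norm x"
  shows "spec_meas T {0<..<t} \<noteq> 0"
proof
  note sa = psd_selfadj[OF T(1)]
  assume 0: "spec_meas T {0<..<t} = 0"
  have "{0<..<t} \<union> {..0} = {..<t}" "{0<..<t} \<inter> {..0} = {}" using \<open>t > 0\<close> by auto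
  then have "spec_meas T {..<t} = 0" using spec_meas_Un[OF sa, of "{0<..<t}" "{..0}"] 0 T(2) by simp
  then have "spec_meas T {t..} = id_blinfun" using spec_meas_compl[OF sa, of "{..<t}"] by (simp add: Compl_lessThan)
  then have "t * (norm x)\<^sup>2 \<le> T x \<bullet> x" for x by (intro spec_meas_ge[OF sa, of "{t..}"]) auto
  then have "t * (norm x)\<^sup>2 \<le> norm (T x) * norm x" for x
    using norm_cauchy_schwarz order_trans by blast
  then have "t * norm x * norm x \<le> norm (T x) * norm x" for x by (simp add: power2_eq_square mult.assoc)
  then have "t * norm x \<le> norm (T x)" for x
    by (cases "x = 0") (simp_all add: mult_le_cancel_right)
  then show False using nb by (meson not_le)
qed

lemma spec_meas_interior_nonzero:
  fixes T :: "'h::real_hilbert op"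
  assumes T: "psd T" "T \<noteq> 0" "spec_meas T {\<alpha>..} = 0" and "\<alpha> > 0"
  shows "spec_meas T {0<..<\<alpha>} \<noteq> 0"
proof
  note sa = psd_selfadj[OF T(1)]
  assume 0: "spec_meas T {0<..<\<alpha>} = 0"
  have "{0<..<\<alpha>} \<union> {\<alpha>..} = - {..0}" "{0<..<\<alpha>} \<inter> {\<alpha>..} = {}" using \<open>\<alpha> > 0\<close> by auto
  then have "id_blinfun - spec_meas T {..0} = 0"
    using spec_meas_Un[OF sa, of "{0<..<\<alpha>}" "{\<alpha>..}"] spec_meas_compl[OF sa, of "{..0}"] 0 T(3) by simp
  then have "spec_meas T {..0} x = x" for x by (metis blinfun_apply_id_blinfun id_apply right_minus_eq)
  then have "T x = 0" for x by (rule ker_atMost_0[OF T(1)])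
  then show False using T(2) by (metis blinfun_eqI zero_blinfun.rep_eq)
qed

lemma ker_proj_eigen:
  fixes T Q :: "'h::real_hilbert op"
  assumes sa: "selfadj T" and Q_def: "Q = ker_proj (T - \<alpha> *\<^sub>R id_blinfun)"
  shows "T (Q x) = \<alpha> *\<^sub>R Q x" "Q x = x \<longleftrightarrow> T x = \<alpha> *\<^sub>R x" "Q (T x) = \<alpha> *\<^sub>R Q x"
proof -
  show 1: "T (Q x) = \<alpha> *\<^sub>R Q x" for x
    using ker_proj(2)[of "T - \<alpha> *\<^sub>R id_blinfun" x] by (simp add: Q_def blinfun.bilinear_simps)
  show "Q x = x \<longleftrightarrow> T x = \<alpha> *\<^sub>R x"
    using ker_proj(3)[of "T - \<alpha> *\<^sub>R id_blinfun" x] by (simp add: Q_def blinfun.bilinear_simps)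
  have sQ: "selfadj Q" unfolding Q_def by (rule orth_proj_selfadj[OF ker_proj(1)])
  show "Q (T x) = \<alpha> *\<^sub>R Q x"
  proof (rule inner_eqI)
    fix z
    show "Q (T x) \<bullet> z = \<alpha> *\<^sub>R Q x \<bullet> z" by (simp add: selfadjD[OF sQ] selfadjD[OF sa] 1)
  qed
qed

section \<open>Exhausting A, and sufficiency\<close>

context vn_state
begin

lemma phi_pos: "T \<in> vn \<Longrightarrow> psd T \<Longrightarrow> T \<noteq> 0 \<Longrightarrow> 0 < \<phi> T"
  using phi_nonneg[of T] phi_faithful[of T] by (metis order_le_less)

text \<open>At every stage a \<open>C\<close> is chosen that is at least half as large, as measured by \<open>\<phi>\<close>, as any
  admissible one. The \<open>\<phi>\<close>-sizes are summable, so a nonzero limit of the residuals, which would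
  allow choices of a fixed size, is impossible.\<close>

lemma greedy_exhaustion:
  fixes cls R :: "'h op \<Rightarrow> bool"
  assumes A0: "cls A0" and cls: "\<And>A. cls A \<Longrightarrow> A \<in> vn \<and> psd A \<and> A \<noteq> 0"
    and step: "\<And>\<gamma> L. \<gamma> > 0 \<Longrightarrow> L > 0 \<Longrightarrow> \<exists>\<delta>>0. \<forall>A. cls A \<longrightarrow> norm A \<le> L \<longrightarrow> \<gamma> \<le> \<phi> A \<longrightarrow>
      (\<exists>C. R C \<and> psd C \<and> cls (A - C) \<and> \<phi> C \<ge> \<delta>)"
  shows "\<exists>C. \<forall>j::nat. R (C j) \<and> (\<forall>x. (\<lambda>j. blinfun_apply (C j) x) sums A0 x)"
proof -
  define adm where "adm A C \<longleftrightarrow> R C \<and> psd C \<and> cls (A - C)" for A C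
  have le: "\<phi> C \<le> \<phi> A" if "adm A C" for A C
    using phi_nonneg[of "A - C"] cls[of "A - C"] that by (simp add: adm_def phi_diff)
  have best: "\<exists>C. adm A C \<and> (\<forall>C'. adm A C' \<longrightarrow> \<phi> C' \<le> 2 * \<phi> C)" if cA: "cls A" for A
  proof -
    have "\<phi> A > 0" using cls[OF cA] phi_pos by blast
    moreover have "norm A + 1 > 0" by (simp add: add_nonneg_pos)
    ultimately obtain \<delta> where "\<delta> > 0" and \<delta>: "\<forall>A'. cls A' \<longrightarrow> norm A' \<le> norm A + 1 \<longrightarrow> \<phi> A \<le> \<phi> A' \<longrightarrow>
      (\<exists>C. R C \<and> psd C \<and> cls (A' - C) \<and> \<phi> C \<ge> \<delta>)"
      using step by blast
    have "norm A \<le> norm A + 1" by simp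
    then obtain C0 where C0: "adm A C0" "\<phi> C0 \<ge> \<delta>" "\<delta> > 0"
      using \<delta>[rule_format, OF cA _ order_refl] \<open>\<delta> > 0\<close> unfolding adm_def by blast
    \<comment> \<open>The attainable values of \<phi> are bounded by \<phi> A and have a positive
      supremum, so some admissible C exceeds half of it.\<close>
    define X where "X = \<phi> ` {C. adm A C}"
    have X: "X \<noteq> {}" "bdd_above X" using C0 le by (auto simp: X_def intro!: bdd_aboveI)
    have "Sup X \<ge> \<phi> C0" using C0 X by (intro cSup_upper) (auto simp: X_def)
    then have "Sup X / 2 < Sup X" using C0 by simp
    then obtain C where C: "adm A C" "Sup X / 2 < \<phi> C" 
      using less_cSupD[OF X(1), of "Sup X / 2"] unfolding X_def by blast
    have "\<phi> C' \<le> 2 * \<phi> C" if "adm A C'" for C'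
      using cSup_upper[of "\<phi> C'" X] X(2) that C(2) by (auto simp: X_def)
    then show ?thesis using C by blast
  qed
  have "\<exists>f. \<forall>n. (cls (f n) \<and> (n = 0 \<longrightarrow> f n = A0)) \<and>
      (adm (f n) (f n - f (Suc n)) \<and> (\<forall>C'. adm (f n) C' \<longrightarrow> \<phi> C' \<le> 2 * \<phi> (f n - f (Suc n))))"
  proof (rule dependent_nat_choice)
    show "\<exists>A. cls A \<and> (0 = (0::nat) \<longrightarrow> A = A0)" using A0 by blast
    fix A n assume "cls A \<and> (n = (0::nat) \<longrightarrow> A = A0)"
    then obtain C where C: "adm A C" "\<And>C'. adm A C' \<Longrightarrow> \<phi> C' \<le> 2 * \<phi> C" using best by blast
    then show "\<exists>A'. (cls A' \<and> (Suc n = 0 \<longrightarrow> A' = A0)) \<and>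
        (adm A (A - A') \<and> (\<forall>C'. adm A C' \<longrightarrow> \<phi> C' \<le> 2 * \<phi> (A - A')))"
      by (intro exI[of _ "A - C"]) (auto simp: adm_def)
  qed
  then obtain f where f: "\<And>n. cls (f n)" "f 0 = A0" "\<And>n. adm (f n) (f n - f (Suc n))"
    "\<And>n C'. adm (f n) C' \<Longrightarrow> \<phi> C' \<le> 2 * \<phi> (f n - f (Suc n))" by metis
  define C where "C n = f n - f (Suc n)" for n
  have C: "R (C n)" "psd (C n)" for n using f(3)[of n] by (auto simp: C_def adm_def)
  have tel: "(\<Sum>j<n. C j) = A0 - f n" for n by (induction n) (simp_all add: C_def f(2))
  have fp: "psd (f n)" "f n \<in> vn" for n using cls[OF f(1)] by blast+
  have "summable (\<lambda>n. \<phi> (C n))"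
  proof (rule summableI_nonneg_bounded[of _ "\<phi> A0"])
    show "0 \<le> \<phi> (C n)" for n by (rule phi_nonneg[OF C(2)])
    show "(\<Sum>i<n. \<phi> (C i)) \<le> \<phi> A0" for n
      using phi_nonneg[OF fp(1), of n] by (simp add: phi_sum[symmetric] tel phi_diff)
  qed
  then have small: "(\<lambda>n. \<phi> (C n)) \<longlonglongrightarrow> 0" by (rule summable_LIMSEQ_zero)
  have "\<exists>S::'h op. selfadj S \<and> (\<forall>x. (\<lambda>n. (- f n) x) \<longlonglongrightarrow> S x) \<and> (\<forall>n x. (- f n) x \<bullet> x \<le> S x \<bullet> x)"
  proof (rule monotone_strong_limit[where K = 0])
    show "selfadj (- f n)" for n
      using selfadjD[OF psd_selfadj[OF fp(1)]] by (simp add: selfadj_def blinfun.minus_left)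
    show "(- f n) x \<bullet> x \<le> (- f (Suc n)) x \<bullet> x" for n x
      using psd_nonneg[OF C(2), of n x] by (simp add: C_def blinfun.bilinear_simps inner_diff_left)
    show "(- f n) x \<bullet> x \<le> 0 * (norm x)\<^sup>2" for n x
      using psd_nonneg[OF fp(1), of n x] by (simp add: blinfun.minus_left)
  qed
  then obtain S :: "'h op" where S: "selfadj S" "\<And>x. (\<lambda>n. (- f n) x) \<longlonglongrightarrow> S x"
    "\<And>n x. (- f n) x \<bullet> x \<le> S x \<bullet> x" by blast
  define T where "T = - S"
  have flim: "(\<lambda>n. f n x) \<longlonglongrightarrow> T x" for x
    using tendsto_minus[OF S(2)[of x]] by (simp add: T_def blinfun.minus_left)
  have Tv: "T \<in> vn" by (rule vn_limit[OF fp(2) flim])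
  have Tf: "T x \<bullet> x \<le> f n x \<bullet> x" for n x using S(3)[of n x] by (simp add: T_def blinfun.minus_left)
  have sT: "selfadj T" using S(1) by (simp add: T_def selfadj_def blinfun.minus_left)
  have Tp: "psd T"
  proof -
    have "0 \<le> T x \<bullet> x" for x
      using psd_nonneg[OF fp(1), of _ x]
      by (intro LIMSEQ_le_const[OF tendsto_inner[OF flim tendsto_const]]) auto
    then show ?thesis using sT by (simp add: psd_def)
  qed
  have "T = 0"
  proof (rule ccontr)
    assume "T \<noteq> 0"
    then have "\<phi> T > 0" by (rule phi_pos[OF Tv Tp])
    then obtain \<delta> where \<delta>: "\<delta> > 0" "\<And>A. cls A \<Longrightarrow> norm A \<le> norm A0 + 1 \<Longrightarrow> \<phi> T \<le> \<phi> A \<Longrightarrow>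
      \<exists>C. R C \<and> psd C \<and> cls (A - C) \<and> \<phi> C \<ge> \<delta>"
      using step[of "\<phi> T" "norm A0 + 1"] by (metis add_nonneg_pos norm_ge_zero zero_less_one)
    \<comment> \<open>Every residual dominates T and has norm at most that of \<open>A0\<close>, so
      one \<delta> serves all stages; the greedy choice secures half of it.\<close>
    have "\<phi> (C n) \<ge> \<delta> / 2" for n
    proof -
      have "psd (A0 - f n)" unfolding tel[symmetric] using C(2) by (induction n) (auto intro: psd_add)
      then have "norm (f n) \<le> norm A0" by (rule norm_mono_psd[OF fp(1)])
      moreover have "\<phi> T \<le> \<phi> (f n)" by (rule phi_mono[OF sT psd_selfadj[OF fp(1)] Tf])
      ultimately obtain C' where "adm (f n) C'" "\<phi> C' \<ge> \<delta>" using \<delta>(2)[OF f(1), of n] by (auto simp: adm_def)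
      then show ?thesis using f(4)[of n C'] by (simp add: C_def)
    qed
    then have "\<delta> / 2 \<le> 0" by (intro LIMSEQ_le_const[OF small]) auto
    then show False using \<delta> by simp
  qed
  then have "(\<lambda>n. A0 x - f n x) \<longlonglongrightarrow> A0 x - 0" for x
    using tendsto_diff[OF tendsto_const flim[of x], of "A0 x"] by simp
  moreover have "(\<Sum>j<n. C j x) = A0 x - f n x" for n x
    using arg_cong[OF tel[of n], of "\<lambda>S. blinfun_apply S x"] by (simp add: blinfun.sum_left blinfun.diff_left)
  ultimately have "(\<lambda>j. C j x) sums A0 x" for x by (simp add: sums_def)
  then show ?thesis using C(1) by blast
qed

text \<open>The greedy argument, with a class of residuals that always admit another copy: positive
  of norm at least \<alpha>, and also injective when B is, because an injective copy cannot lie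
  below an operator with a kernel.\<close>

lemma sum_of_copies:
  assumes A: "A \<in> vn" "psd A" and B: "B \<in> vn" "psd B" "B \<noteq> 0" "norm B \<le> norm A"
    and top: "\<And>x. B x = norm A *\<^sub>R x \<Longrightarrow> x = 0"
    and ker: "ker_proj B \<noteq> 0 \<or> (\<forall>x. A x = 0 \<longrightarrow> x = 0) \<and> (\<forall>t>0. \<exists>x. norm (B x) < t * norm x)"
  shows "\<exists>C. \<forall>j::nat. ueq (C j) B \<and> (\<forall>x. (\<lambda>j. blinfun_apply (C j) x) sums A x)"
proof -
  define \<alpha> where "\<alpha> = norm A"
  have \<alpha>: "\<alpha> > 0" using B(3,4) by (simp add: \<alpha>_def) (metis norm_le_zero_iff not_le order_trans zero_less_norm_iff)
  have t: "spec_meas B {\<alpha>..} = 0" by (rule spec_meas_top_0[OF B(2)]) (use B(4) top in \<open>auto simp: \<alpha>_def\<close>)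
  have int: "spec_meas B {0<..<\<alpha>} \<noteq> 0" by (rule spec_meas_interior_nonzero[OF B(2,3) t \<alpha>])
  show ?thesis
  proof (cases "ker_proj B = 0")
    case False
    define cls where "cls A \<longleftrightarrow> A \<in> vn \<and> psd A \<and> \<alpha> \<le> norm A" for A
    show ?thesis
    proof (rule greedy_exhaustion[of cls])
      show "cls A" using A by (simp add: cls_def \<alpha>_def)
      show "A \<in> vn \<and> psd A \<and> A \<noteq> 0" if "cls A" for A using that \<alpha> by (auto simp: cls_def)
      fix \<gamma> L :: real assume "\<gamma> > 0" "L > 0"
      from step_with_kernel[OF B(1,2) int t False \<alpha> this]
      show "\<exists>\<delta>>0. \<forall>A. cls A \<longrightarrow> norm A \<le> L \<longrightarrow> \<gamma> \<le> \<phi> A \<longrightarrow>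
          (\<exists>C. ueq C B \<and> psd C \<and> cls (A - C) \<and> \<delta> \<le> \<phi> C)"
        unfolding cls_def using vn_intros(4) by meson
    qed
  next
    case True
    then have A0: "\<And>x. A x = 0 \<Longrightarrow> x = 0" and nb: "\<And>t. t > 0 \<Longrightarrow> \<exists>x. norm (B x) < t * norm x"
      using ker by blast+
    have "x = 0" if "B x = 0" for x
      using that ker_proj(3)[of B x] True by simp
    then have B0: "spec_meas B {..0} = 0" by (rule spec_meas_atMost_0[OF B(2)])
    have near: "\<forall>t>0. spec_meas B {0<..<t} \<noteq> 0" using spec_meas_near_0[OF B(2) B0] nb by blast
    define cls where "cls A \<longleftrightarrow> A \<in> vn \<and> psd A \<and> \<alpha> \<le> norm A \<and> (\<forall>x. A x = 0 \<longrightarrow> x = 0)" for A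
    show ?thesis
    proof (rule greedy_exhaustion[of cls])
      show "cls A" using A A0 by (simp add: cls_def \<alpha>_def)
      show "A \<in> vn \<and> psd A \<and> A \<noteq> 0" if "cls A" for A using that \<alpha> by (auto simp: cls_def)
      fix \<gamma> L :: real assume "\<gamma> > 0" "L > 0"
      from step_injective[OF B(1,2) t B0 near \<alpha> this]
      obtain \<delta> where "\<delta> > 0" and \<delta>: "\<forall>A\<in>vn. psd A \<longrightarrow> \<alpha> \<le> norm A \<longrightarrow> norm A \<le> L \<longrightarrow> \<gamma> \<le> \<phi> A \<longrightarrow>
        spec_meas A {..0} = 0 \<longrightarrow> (\<exists>C\<in>vn. ueq C B \<and> psd C \<and> psd (A - C) \<and> \<alpha> \<le> norm (A - C) \<and> \<delta> \<le> \<phi> C \<and>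
          (\<forall>x. (A - C) x = 0 \<longrightarrow> x = 0))" by (elim exE conjE) (rule that)
      have "\<exists>C. ueq C B \<and> psd C \<and> cls (A - C) \<and> \<delta> \<le> \<phi> C" if h: "cls A" "norm A \<le> L" "\<gamma> \<le> \<phi> A" for A
      proof -
        have hA: "A \<in> vn" "psd A" "\<alpha> \<le> norm A" "\<And>x. A x = 0 \<Longrightarrow> x = 0"
          using h(1) by (auto simp: cls_def)
        from \<delta>[rule_format, OF hA(1-3) h(2,3) spec_meas_atMost_0[OF hA(2,4)]] obtain C where "C \<in> vn" "ueq C B" "psd C" "psd (A - C)" "\<alpha> \<le> norm (A - C)" "\<delta> \<le> \<phi> C"
          "\<forall>x. (A - C) x = 0 \<longrightarrow> x = 0"
          by blast
        then show ?thesis using h(1) vn_intros(4) unfolding cls_def by blast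
      qed
      then show "\<exists>\<delta>>0. \<forall>A. cls A \<longrightarrow> norm A \<le> L \<longrightarrow> \<gamma> \<le> \<phi> A \<longrightarrow>
          (\<exists>C. ueq C B \<and> psd C \<and> cls (A - C) \<and> \<delta> \<le> \<phi> C)" using \<open>\<delta> > 0\<close> by blast
    qed
  qed
qed

lemma prj_eigen:
  assumes "T \<in> vn" "selfadj T"
  shows "prj (ker_proj (T - \<alpha> *\<^sub>R id_blinfun))"
proof (rule prj_ker)
  show "selfadj (T - \<alpha> *\<^sub>R id_blinfun)"
    using selfadjD[OF assms(2)] by (simp add: selfadj_def blinfun.bilinear_simps inner_diff_left inner_diff_right)
qed (intro vn_intros assms)

text \<open>Split E into infinitely many nonzero orthogonal pieces. Each is equivalent to Q, and
  both are proper, so \<alpha> times the piece is a copy of \<alpha> Q. A piece is proper because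
  the next one is nonzero and orthogonal to it.\<close>

lemma scaled_projection_sum:
  assumes Q: "prj Q" "Q \<noteq> 0" "Q \<noteq> id_blinfun" and E: "prj E" "E \<noteq> 0"
  shows "\<exists>C. \<forall>j::nat. ueq (C j) (\<alpha> *\<^sub>R Q) \<and> (\<forall>x. (\<lambda>j. blinfun_apply (C j) x) sums (\<alpha> *\<^sub>R E) x)"
proof -
  obtain p where p: "orth_seq p" "\<And>n::nat. prj (p n)" "\<And>n. p n \<noteq> 0" "\<And>x. (\<lambda>n. blinfun_apply (p n) x) sums E x"
    using ex_orth_split[OF E] by blast
  have p1: "p n \<noteq> id_blinfun" for n
  proof
    assume "p n = id_blinfun"
    then have "p (Suc n) x = 0" for x using orth_seqD(2)[OF p(1), of n "Suc n" x] by simp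
    then show False using p(3)[of "Suc n"] by (metis blinfun_eqI zero_blinfun.rep_eq)
  qed
  have BQ: "\<alpha> *\<^sub>R Q \<in> vn" "selfadj (\<alpha> *\<^sub>R Q)"
    using vn_intros(5)[OF prjD(1)[OF Q(1)]] selfadjD[OF orth_proj_selfadj[OF prjD(2)[OF Q(1)]]]
    by (auto simp: selfadj_def blinfun.scaleR_left)
  have "ueq (\<alpha> *\<^sub>R p n) (\<alpha> *\<^sub>R Q)" for n
  proof -
    obtain V where V: "V \<in> vn" "pisom V Q (p n)" using eqv_any[OF Q(1,2) p(2,3)] by (auto simp: eqv_def)
    have "V o\<^sub>L (\<alpha> *\<^sub>R Q) o\<^sub>L hadj V = \<alpha> *\<^sub>R p n"
      by (rule blinfun_eqI) (simp add: blinfun.bilinear_simps pisomD[OF V(2)])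
    then show ?thesis
      using pisom_ueq[OF BQ V _ Q(3) p1] by (simp add: blinfun.scaleR_left orth_proj_idem[OF prjD(2)[OF Q(1)]])
  qed
  moreover have "(\<lambda>j. (\<alpha> *\<^sub>R p j) x) sums (\<alpha> *\<^sub>R E) x" for x
    using sums_scaleR_right[OF p(4)[of x], of \<alpha>] by (simp add: blinfun.scaleR_left)
  ultimately show ?thesis by (intro exI[of _ "\<lambda>j. \<alpha> *\<^sub>R p j"]) simp
qed

text \<open>Every copy of \<open>B\<close> consists of \<open>\<alpha>\<close> times a projection below the eigenprojection of \<open>A\<close> and a
  copy of the part of \<open>B\<close> without eigenvalue \<open>\<alpha>\<close>; copies of the latter
  sum to the rest of \<open>A\<close> by the case without the eigenvalue.\<close>

lemma sum_of_copies_eigenvalue: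
  assumes A: "A \<in> vn" "psd A" "norm A = \<alpha>" and B: "B \<in> vn" "psd B" "norm B = \<alpha>" "\<alpha> > 0"
    and Q: "Q = ker_proj (B - \<alpha> *\<^sub>R id_blinfun)" "Q \<noteq> 0" "B \<noteq> \<alpha> *\<^sub>R Q" and K: "ker_proj B \<noteq> 0"
    and E: "E = ker_proj (A - \<alpha> *\<^sub>R id_blinfun)" "E \<noteq> 0"
  shows "\<exists>C. \<forall>j::nat. ueq (C j) B \<and> (\<forall>x. (\<lambda>j. blinfun_apply (C j) x) sums A x)"
proof -
  note sA = psd_selfadj[OF A(2)] and sB = psd_selfadj[OF B(2)]
  have Qp: "prj Q" unfolding Q(1) by (rule prj_eigen[OF B(1) sB])
  have Ep: "prj E" unfolding E(1) by (rule prj_eigen[OF A(1) sA])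
  note BQ = ker_proj_eigen[OF sB Q(1)]
  note AE = ker_proj_eigen[OF sA E(1)]
  note QQ = orth_proj_idem[OF prjD(2)[OF Qp]] and sQ = selfadjD[OF orth_proj_selfadj[OF prjD(2)[OF Qp]]]
  obtain p where p: "orth_seq p" "\<And>n::nat. prj (p n)" "\<And>n. p n \<noteq> 0" "\<And>n. psub (p n) E"
    "\<And>x. (\<lambda>n. blinfun_apply (p n) x) sums E x"
    using ex_orth_split[OF Ep E(2)] by blast
  \<comment> \<open>The piece \<open>p 0\<close> of the eigenprojection stays in A' to keep its norm
    at \<alpha>; the pieces from index 1 on will receive the eigenprojection Q of the
    copies.\<close>
  define A' where "A' = A - \<alpha> *\<^sub>R (E - p 0)"
  define B' where "B' = B - \<alpha> *\<^sub>R Q"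
  have A'v: "A' \<in> vn" "B' \<in> vn" unfolding A'_def B'_def by (intro vn_intros A B prjD(1) Ep p Qp)+
  have B'x: "B' x \<bullet> x = B (x - Q x) \<bullet> (x - Q x)" for x
  proof -
    have "commutes B Q" by (simp add: commutes_def BQ)
    from orth_commute_form[OF prjD(2)[OF Qp] this, of x] show ?thesis
      by (simp add: B'_def blinfun.bilinear_simps inner_diff_left BQ QQ orth_proj_inner[OF prjD(2)[OF Qp]] dot_square_norm)
  qed
  have sB': "selfadj B'"
    using selfadjD[OF sB] sQ by (simp add: B'_def selfadj_def blinfun.bilinear_simps inner_diff_left inner_diff_right)
  have B'p: "psd B'" using sB' B'x psd_nonneg[OF B(2)] by (simp add: psd_def)
  have B'Q: "B' (Q x) = 0" "Q (B' x) = 0" for x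
    by (simp_all add: B'_def blinfun.bilinear_simps BQ QQ)
  have nB': "norm B' \<le> \<alpha>"
  proof -
    have "psd (B - B')" unfolding B'_def using psd_scaleR[OF orth_proj_psd[OF prjD(2)[OF Qp]]] B(4) by simp
    from norm_mono_psd[OF B'p this] show ?thesis using B(3) by simp
  qed
  have B'0: "B' \<noteq> 0" using Q(3) by (simp add: B'_def)
  have sA': "selfadj A'"
    using selfadjD[OF sA] selfadjD[OF orth_proj_selfadj[OF prjD(2)[OF Ep]]]
      selfadjD[OF orth_proj_selfadj[OF prjD(2)[OF p(2)]]]
    by (simp add: A'_def selfadj_def blinfun.bilinear_simps inner_diff_left inner_diff_right)
  have A'x: "A' x \<bullet> x = \<alpha> * (norm (p 0 x))\<^sup>2 + A (x - E x) \<bullet> (x - E x)" for x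
  proof -
    have "commutes A E" by (simp add: commutes_def AE)
    from orth_commute_form[OF prjD(2)[OF Ep] this, of x] show ?thesis
      by (simp add: A'_def blinfun.bilinear_simps inner_diff_left AE orth_proj_idem[OF prjD(2)[OF Ep]]
          orth_proj_inner[OF prjD(2)[OF Ep]] orth_proj_inner[OF prjD(2)[OF p(2)]] dot_square_norm right_diff_distrib)
  qed
  have A'p: "psd A'" using sA' A'x psd_nonneg[OF A(2)] B(4) by (simp add: psd_def)
  have "norm A' = \<alpha>"
  proof (rule antisym)
    have "psd (A - A')"
      unfolding A'_def
      using psd_scaleR[OF orth_proj_psd[OF orth_proj_diff[OF p(4)]], of 0 \<alpha>] prjD(2) p(2) Ep B(4) by simp
    from norm_mono_psd[OF A'p this] show "norm A' \<le> \<alpha>" using A(3) by simp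
    obtain z where z: "p 0 z \<noteq> 0" using p(3)[of 0] by (metis blinfun_eqI zero_blinfun.rep_eq)
    have "\<alpha> * (norm (p 0 z))\<^sup>2 \<le> A' (p 0 z) \<bullet> p 0 z"
      using A'x[of "p 0 z"] psd_nonneg[OF A(2)] by (simp add: orth_proj_idem[OF prjD(2)[OF p(2)]])
    then show "\<alpha> \<le> norm A'" by (rule norm_ge_form[OF z])
  qed
  have top: "x = 0" if "B' x = \<alpha> *\<^sub>R x" for x
  proof -
    have "\<alpha> *\<^sub>R Q x = 0" using arg_cong[OF that, of "blinfun_apply Q"] by (simp add: B'Q blinfun.scaleR_right)
    then have "Q x = 0" using B(4) by simp
    moreover have "Q x = x"
      unfolding BQ(2) using that \<open>Q x = 0\<close> by (simp add: B'_def blinfun.bilinear_simps)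
    ultimately show ?thesis by simp
  qed
  \<comment> \<open>The range of Q has become part of the kernel of B', so the kernel case of
    \<open>sum_of_copies\<close> applies to B'.\<close>
  have KB': "ker_proj B' \<noteq> 0"
  proof
    assume 0: "ker_proj B' = 0"
    have "Q x = 0" for x using ker_proj(3)[of B' "Q x"] B'Q(1) 0 by simp
    then show False using Q(2) by (metis blinfun_eqI zero_blinfun.rep_eq)
  qed
  obtain C' where C': "\<And>j::nat. ueq (C' j) B'" "\<And>x. (\<lambda>j. blinfun_apply (C' j) x) sums A' x"
    using sum_of_copies[OF A'v(1) A'p A'v(2) B'p B'0] nB' \<open>norm A' = \<alpha>\<close> top KB' by auto
  obtain U where U: "\<And>j. U j \<in> vn" "\<And>j. pisom (U j) id_blinfun id_blinfun" "\<And>j. C' j = U j o\<^sub>L B' o\<^sub>L hadj (U j)"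
    using C'(1) unfolding ueq_def by metis
  have C'psd: "psd (C' j)" for j unfolding U(3) by (rule psd_conj'[OF B'p])
  have A'P: "A' (p (Suc n) x) = 0" for n x
    using psubD[OF p(4), of "Suc n" x] AE(1)[of "p (Suc n) x"] orth_seqD(2)[OF p(1), of 0 "Suc n" x]
    by (simp add: A'_def blinfun.bilinear_simps)
  \<comment> \<open>A' vanishes on these pieces, hence so does each of its positive summands; the
    copies of B' leave the pieces free.\<close>
  have C'P: "C' j (p (Suc n) x) = 0" for j n x
  proof -
    let ?y = "p (Suc n) x"
    have s: "(\<lambda>j. C' j ?y \<bullet> ?y) sums 0"
      using bounded_linear.sums[OF bounded_linear_inner_left C'(2)[of ?y], of ?y] by (simp add: A'P)
    have "C' j ?y \<bullet> ?y = 0"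
      using suminf_eq_zero_iff[OF sums_summable[OF s] psd_nonneg[OF C'psd]] sums_unique[OF s] by simp
    then show ?thesis using psd_zero_iff[OF C'psd] by blast
  qed
  define K' where "K' = ker_proj B'"
  \<comment> \<open>The support projection of B'. It is orthogonal to Q, so the unitary belonging to
    B' can be kept on Z and replaced on Q.\<close>
  define Z where "Z = id_blinfun - K'"
  have K'p: "prj K'" unfolding K'_def by (rule prj_ker[OF sB' A'v(2)])
  have Zp: "prj Z" unfolding Z_def by (rule prj_diff[OF K'p]) auto
  have B'K: "B' (K' x) = 0" "B' x = 0 \<longleftrightarrow> K' x = x" for x by (auto simp: K'_def ker_proj)
  have KB: "K' (B' x) = 0" for x
  proof (rule inner_eqI)
    fix z
    show "K' (B' x) \<bullet> z = 0 \<bullet> z"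
      by (simp add: selfadjD[OF orth_proj_selfadj[OF prjD(2)[OF K'p]]] selfadjD[OF sB'] B'K)
  qed
  have ZQ: "Z (Q x) = 0" for x using B'K(2)[of "Q x"] B'Q(1)[of x] by (simp add: Z_def blinfun.diff_left)
  have QZ: "Q (Z x) = 0" for x by (rule orth_sym[OF ZQ prjD(2)[OF Zp] prjD(2)[OF Qp]])
  have "ueq (C' j + \<alpha> *\<^sub>R p (Suc j)) B" for j
  proof -
    define V1 where "V1 = U j o\<^sub>L Z"
    define S1 where "S1 = U j o\<^sub>L Z o\<^sub>L hadj (U j)"
    have V1: "pisom V1 Z S1" unfolding V1_def S1_def by (rule pisom_restrict(1)[OF U(2) prjD(2)[OF Zp]]) simp
    obtain V2 where V2: "V2 \<in> vn" "pisom V2 Q (p (Suc j))"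
      using eqv_any[OF Qp Q(2) p(2,3)] by (auto simp: eqv_def)
    have S1P: "S1 (p (Suc n) x) = 0" for n x
    proof -
      let ?y = "p (Suc n) x"
      have "hadj (U j) (C' j ?y) = B' (hadj (U j) ?y)" by (simp add: U(3) pisomD(3)[OF U(2)])
      then have "B' (hadj (U j) ?y) = 0" by (simp add: C'P)
      then have "Z (hadj (U j) ?y) = 0" using B'K(2) by (simp add: Z_def blinfun.diff_left)
      then show ?thesis by (simp add: S1_def)
    qed
    define V where "V = V1 + V2"
    have V: "pisom V (Z + Q) (S1 + p (Suc j))" unfolding V_def by (rule pisom_add[OF V1 V2(2) ZQ S1P])
    have Vv: "V \<in> vn" unfolding V_def V1_def by (intro vn_intros U V2 prjD(1) Zp)
    have BZ: "B (Z x) = B' x" for x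
    proof -
      have "B (K' x) = \<alpha> *\<^sub>R Q (K' x)" using B'K(1)[of x] by (simp add: B'_def blinfun.bilinear_simps)
      moreover have "Q (K' x) = Q x" using QZ[of x] by (simp add: Z_def blinfun.bilinear_simps)
      ultimately show ?thesis by (simp add: Z_def B'_def blinfun.bilinear_simps)
    qed
    have BZQ: "B ((Z + Q) x) = B x" for x
      by (simp add: blinfun.bilinear_simps BZ BQ) (simp add: B'_def blinfun.bilinear_simps)
    have ne1: "Z + Q \<noteq> id_blinfun"
    proof
      assume eq: "Z + Q = id_blinfun"
      obtain z where z: "ker_proj B z \<noteq> 0" using K by (metis blinfun_eqI zero_blinfun.rep_eq)
      define x where "x = ker_proj B z"
      have Bx: "B x = 0" by (simp add: x_def ker_proj)
      have "\<alpha> *\<^sub>R Q x = 0" using BQ(3)[of x] Bx by simp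
      then have Qx: "Q x = 0" using B(4) by simp
      then have "B' x = 0" using Bx by (simp add: B'_def blinfun.bilinear_simps)
      then have "Z x = 0" using B'K(2) by (simp add: Z_def blinfun.diff_left)
      then have "(Z + Q) x = 0" using Qx by (simp add: blinfun.add_left)
      then show False using eq z by (simp add: x_def)
    qed
    \<comment> \<open>The nonzero piece with index j + 2 is orthogonal to both summands.\<close>
    have ne2: "S1 + p (Suc j) \<noteq> id_blinfun"
    proof
      assume eq: "S1 + p (Suc j) = id_blinfun"
      have "(S1 + p (Suc j)) (p (Suc (Suc j)) x) = 0" for x
        using S1P[of "Suc j" x] orth_seqD(2)[OF p(1), of "Suc j" "Suc (Suc j)" x] by (simp add: blinfun.add_left)
      then have "p (Suc (Suc j)) x = 0" for x using eq by simp
      then show False using p(3)[of "Suc (Suc j)"] by (metis blinfun_eqI zero_blinfun.rep_eq)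
    qed
    have "V o\<^sub>L B o\<^sub>L hadj V = C' j + \<alpha> *\<^sub>R p (Suc j)"
    proof (rule blinfun_eqI)
      fix x
      have hZ: "hadj Z = Z" using prjD(2)[OF Zp] by (simp add: selfadj_hadj[symmetric] orth_proj_selfadj)
      have h2: "Q (hadj V2 x) = hadj V2 x" by (rule pisomD(8)[OF V2(2)])
      have "B (hadj V x) = B' (hadj (U j) x) + \<alpha> *\<^sub>R hadj V2 x"
        using BQ(1)[of "hadj V2 x"] by (simp add: V_def V1_def hadj_add hadj_compose hZ blinfun.bilinear_simps BZ h2)
      moreover have "V (B' y) = U j (B' y)" for y
        using pisomD(5)[OF V2(2), of "B' y"]
        by (simp add: V_def V1_def blinfun.bilinear_simps B'Q Z_def KB)
      moreover have "V (hadj V2 x) = p (Suc j) x"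
        using ZQ[of "hadj V2 x"] by (simp add: V_def V1_def blinfun.bilinear_simps h2 pisomD(4)[OF V2(2)])
      ultimately show "(V o\<^sub>L B o\<^sub>L hadj V) x = (C' j + \<alpha> *\<^sub>R p (Suc j)) x"
        by (simp add: blinfun.bilinear_simps U(3))
    qed
    moreover have "ueq (V o\<^sub>L B o\<^sub>L hadj V) B" by (rule pisom_ueq[OF B(1) sB Vv V BZQ ne1 ne2])
    ultimately show ?thesis by simp
  qed
  moreover have "(\<lambda>j. (C' j + \<alpha> *\<^sub>R p (Suc j)) x) sums A x" for x
  proof -
    have "(\<lambda>j. p (Suc j) x) sums (E x - p 0 x)" 
      using p(5)[of x] sums_iff_shift[of "\<lambda>n. p n x" 1 "E x - p 0 x"] by simp
    then have "(\<lambda>j. C' j x + \<alpha> *\<^sub>R p (Suc j) x) sums (A' x + \<alpha> *\<^sub>R (E x - p 0 x))"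
      by (intro sums_add C'(2) sums_scaleR_right)
    then show ?thesis by (simp add: A'_def blinfun.bilinear_simps)
  qed
  ultimately show ?thesis by (intro exI[of _ "\<lambda>j. C' j + \<alpha> *\<^sub>R p (Suc j)"]) simp
qed

end

section \<open>Complex Hilbert spaces\<close>

lemma Re_cinner: "Re (cinner x y) = x \<bullet> (y :: 'a::chilbert_space)"
  by (simp add: inner_eq_Re_cinner)

lemma Im_cinner: "Im (cinner x y) = - ((\<i> *\<^sub>C x) \<bullet> (y :: 'a::chilbert_space))"
  by (simp add: inner_eq_Re_cinner cinner_scaleC_left)

lemma cinner_scaleC_right: "cinner x (c *\<^sub>C y) = cnj c * cinner x (y :: 'a::chilbert_space)"
  by (metis cinner_commute cinner_scaleC_left complex_cnj_mult)

lemma cinner_add_right: "cinner x (y + z) = cinner x y + cinner x (z :: 'a::chilbert_space)"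
  by (metis cinner_add_left cinner_commute complex_cnj_add)

lemma scaleC_one: "1 *\<^sub>C x = (x :: 'a::chilbert_space)"
  using scaleR_eq_scaleC[of 1 x] by simp

lemma scaleC_zero: "0 *\<^sub>C x = (0 :: 'a::chilbert_space)"
  using scaleR_eq_scaleC[of 0 x] by simp

lemma bounded_opsD: "T \<in> bounded_ops \<Longrightarrow> T (c *\<^sub>C x) = c *\<^sub>C T x"
  by (simp add: bounded_ops_def)

lemma scalar_op_apply [simp]: "scalar_op c x = c *\<^sub>C x"
  by (transfer, simp)

lemma bounded_ops_iff: "T \<in> bounded_ops \<longleftrightarrow> (\<forall>c. commutes (scalar_op c) T)"
  by (auto simp: bounded_ops_def commutes_def)

lemma cinner_hadj:
  fixes T :: "'a::chilbert_space op"
  assumes "T \<in> bounded_ops"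
  shows "cinner (T x) y = cinner x (hadj T y)"
proof (rule complex_eqI)
  show "Re (cinner (T x) y) = Re (cinner x (hadj T y))" by (simp add: Re_cinner hadj)
  show "Im (cinner (T x) y) = Im (cinner x (hadj T y))"
    by (simp add: Im_cinner hadj[symmetric] bounded_opsD[OF assms])
qed

lemma adj_eq_hadj:
  fixes T :: "'a::chilbert_space op"
  assumes "T \<in> bounded_ops"
  shows "adj T = hadj T"
  unfolding adj_def
proof (rule the_equality)
  show "\<forall>x y. cinner (T x) y = cinner x (hadj T y)" using cinner_hadj[OF assms] by blast
  fix S :: "'a op" assume S: "\<forall>x y. cinner (blinfun_apply T x) y = cinner x (blinfun_apply S y)"
  have "T x \<bullet> y = x \<bullet> S y" for x y
    unfolding Re_cinner[symmetric] using S by simp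
  then show "S = hadj T" using hadj_unique[of T S] by simp
qed

lemma hadj_bounded_ops:
  fixes T :: "'a::chilbert_space op"
  assumes "T \<in> bounded_ops"
  shows "hadj T \<in> bounded_ops"
  unfolding bounded_ops_def
proof (intro CollectI allI)
  fix c x
  have "z \<bullet> hadj T (c *\<^sub>C x) = z \<bullet> (c *\<^sub>C hadj T x)" for z
    unfolding Re_cinner[symmetric] cinner_hadj[OF assms, symmetric] cinner_scaleC_right by simp
  then show "hadj T (c *\<^sub>C x) = c *\<^sub>C hadj T x"
    by (intro inner_eqI[of "hadj T (c *\<^sub>C x)"]) (simp add: inner_commute)
qed

text \<open>A real quadratic form makes the form of T minus its adjoint vanish identically. Over the
  complex numbers polarization, with y and with i y, then makes that difference zero.\<close>

lemma positive_op_psd: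
  fixes T :: "'a::chilbert_space op"
  assumes "positive_op T"
  shows "psd T"
proof -
  have T: "T \<in> bounded_ops" and re: "\<And>x. cinner (T x) x \<in> \<real>" and pos: "\<And>x. 0 \<le> Re (cinner (T x) x)"
    using assms by (auto simp: positive_op_def)
  define D where "D = T - hadj T"
  have Db: "D (c *\<^sub>C x) = c *\<^sub>C D x" for c x
    using bounded_opsD[OF T, of c x] bounded_opsD[OF hadj_bounded_ops[OF T], of c x]
      scaleC_add_right[of c "D x" "hadj T x"] by (simp add: D_def blinfun.diff_left)
  have cdiff: "cinner (x - y) z = cinner x z - cinner y z" for x y z :: 'a
    using cinner_add_left[of "x - y" y z] by simp
  have D0: "cinner (D x) x = 0" for x
  proof -
    have "cinner (hadj T x) x = cnj (cinner (T x) x)"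
      using cinner_hadj[OF T, of x x] cinner_commute[of "hadj T x" x] by simp
    also have "\<dots> = cinner (T x) x" using re[of x] by (simp add: Reals_cnj_iff)
    finally show ?thesis by (simp add: D_def blinfun.diff_left cdiff)
  qed
  have "cinner (D x) y = 0" for x y
  proof -
    have 1: "cinner (D x) y + cinner (D y) x = 0" for x y
      using D0[of "x + y"] D0[of x] D0[of y]
      by (simp add: blinfun.add_right cinner_add_left cinner_add_right add.commute)
    have "- \<i> * cinner (D x) y + \<i> * cinner (D y) x = 0"
      using 1[of x "\<i> *\<^sub>C y"] by (simp add: Db cinner_scaleC_left cinner_scaleC_right)
    then have "\<i> * (cinner (D y) x - cinner (D x) y) = 0" by (simp add: algebra_simps)
    then have "cinner (D y) x = cinner (D x) y" by simp
    then show ?thesis using 1[of x y] by simp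
  qed
  then have "D x \<bullet> y = 0" for x y using Re_cinner[of "D x" y] by simp
  then have "D x = 0" for x by (metis inner_eq_zero_iff)
  then have "T = hadj T" by (intro blinfun_eqI) (simp add: D_def blinfun.diff_left)
  then show ?thesis using pos by (simp add: psd_def selfadj_hadj Re_cinner)
qed

lemma is_projection_iff: "is_projection P \<longleftrightarrow> P \<in> bounded_ops \<and> orth_proj P"
proof -
  have "P o\<^sub>L P = P \<longleftrightarrow> (\<forall>x. P (P x) = P x)"
    by (metis blinfun_apply_blinfun_compose blinfun_eqI)
  then show ?thesis by (auto simp: is_projection_def orth_proj_def selfadj_hadj adj_eq_hadj)
qed

lemma null_proj_eq:
  fixes T :: "'a::chilbert_space op"
  assumes "ker_proj T \<in> bounded_ops"
  shows "null_proj T = ker_proj T"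
  unfolding null_proj_def
proof (rule the_equality)
  show "is_projection (ker_proj T) \<and> range (blinfun_apply (ker_proj T)) = {x. blinfun_apply T x = 0}"
    using assms ker_proj(1,4)[of T] by (simp add: is_projection_iff)
  show "P = ker_proj T" if "is_projection P \<and> range (blinfun_apply P) = {x. blinfun_apply T x = 0}" for P
    by (rule orth_proj_eqI) (use that ker_proj(1,4)[of T] in \<open>auto simp: is_projection_iff\<close>)
qed

lemma bicommutes_bounded_ops: "T \<in> bounded_ops \<Longrightarrow> bicommutes T Z \<Longrightarrow> Z \<in> bounded_ops"
  by (simp add: bounded_ops_iff bicommutes_def)

subsection \<open>Spectral projections for the largest spectral value\<close>

lemma spec_meas_is_spectral_measure:
  fixes T :: "'a::chilbert_space op"
  assumes T: "T \<in> bounded_ops" "psd T"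
  shows "is_spectral_measure T (spec_meas T)"
proof -
  note sa = psd_selfadj[OF T(2)]
  have E: "spec_meas T S \<in> bounded_ops" if "S \<in> sets borel" for S
    by (rule bicommutes_bounded_ops[OF T(1) spec_meas(2)[OF sa that]])
  define K where "K = norm T + 1"
  have "psub (spec_meas T {-K<..K}) (spec_meas T {-K..K})" by (rule spec_meas_mono[OF sa]) auto
  then have "spec_meas T {-K..K} = id_blinfun"
    using spec_meas_bounded[OF sa, of K] by (intro blinfun_eqI) (simp add: K_def psub_def)
  then have "projection_valued_measure (spec_meas T)"
    unfolding projection_valued_measure_def
    using spec_meas(1)[OF sa] spec_meas_sums(2)[OF sa] spec_meas_UNIV[OF sa] E
    by (auto simp: is_projection_iff)
  moreover have "cinner (T x) x = complex_of_real (integral\<^sup>L (diagonal_measure (spec_meas T) x) (\<lambda>t. t))" for x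
  proof (rule complex_eqI)
    show "Re (cinner (T x) x) = Re (complex_of_real (integral\<^sup>L (diagonal_measure (spec_meas T) x) (\<lambda>t. t)))"
      using spectral_integral[OF sa, of x] spec_meas_measure_of[OF sa, of x]
      by (simp add: Re_cinner diagonal_measure_def)
    have "cinner (T x) x = cnj (cinner (T x) x)"
      using cinner_hadj[OF T(1), of x x] sa cinner_commute[of x "T x"] by (simp add: selfadj_hadj)
    then show "Im (cinner (T x) x) = Im (complex_of_real (integral\<^sup>L (diagonal_measure (spec_meas T) x) (\<lambda>t. t)))"
      by (simp add: complex_eq_iff)
  qed
  ultimately show ?thesis by (simp add: is_spectral_measure_def)
qed

context
  fixes E :: "real set \<Rightarrow> 'a::chilbert_space op"
  assumes pvm: "projection_valued_measure E"
begin

lemma pvm_proj: "S \<in> sets borel \<Longrightarrow> orth_proj (E S)"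
  using pvm by (auto simp: projection_valued_measure_def is_projection_iff)

lemma pvm_sums:
  "range S \<subseteq> sets borel \<Longrightarrow> disjoint_family S \<Longrightarrow> (\<lambda>n::nat. E (S n) x) sums E (\<Union>n. S n) x"
  using pvm by (auto simp: projection_valued_measure_def)

lemma pvm_empty: "E {} x = 0"
proof -
  have "(\<lambda>n::nat. E {} x) sums E {} x" using pvm_sums[of "\<lambda>_. {}" x] by (simp add: disjoint_family_on_def)
  then have "(\<lambda>n::nat. E {} x) \<longlonglongrightarrow> 0" by (rule summable_LIMSEQ_zero[OF sums_summable])
  then show ?thesis by (simp add: LIMSEQ_const_iff)
qed

lemma pvm_Un:
  assumes "A \<in> sets borel" "B \<in> sets borel" "A \<inter> B = {}"
  shows "E (A \<union> B) x = E A x + E B x"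
proof -
  have "(\<lambda>n. E (binaryset A B n) x) sums E (\<Union>n. binaryset A B n) x"
    by (rule pvm_sums) (use assms in \<open>auto simp: range_binaryset_eq disjoint_family_on_def binaryset_def\<close>)
  moreover have "(\<lambda>n. E (binaryset A B n) x) sums (E A x + E B x)"
    by (rule binaryset_sums) (rule pvm_empty)
  ultimately show ?thesis unfolding UN_binaryset_eq by (rule sums_unique2)
qed

lemma pvm_disjoint:
  assumes "A \<in> sets borel" "B \<in> sets borel" "A \<inter> B = {}"
  shows "E A (E B x) = 0"
proof -
  let ?y = "E B x"
  have "E (A \<union> B) ?y \<bullet> ?y = E A ?y \<bullet> ?y + E B ?y \<bullet> ?y" by (simp add: pvm_Un assms inner_add_left)
  also have "\<dots> = (norm (E A ?y))\<^sup>2 + (norm ?y)\<^sup>2"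
    by (simp add: orth_proj_inner[OF pvm_proj] orth_proj_idem[OF pvm_proj] assms dot_square_norm)
  finally have "(norm (E A ?y))\<^sup>2 + (norm ?y)\<^sup>2 = (norm (E (A \<union> B) ?y))\<^sup>2"
    using orth_proj_inner[OF pvm_proj, of "A \<union> B" ?y] assms by simp
  also have "\<dots> \<le> (norm ?y)\<^sup>2" by (intro power_mono orth_proj_norm_le pvm_proj) (use assms in auto)
  finally show ?thesis by simp
qed

lemma diagonal_measure_sets [simp]: "sets (diagonal_measure E x) = sets borel"
  using sets.sigma_sets_eq[of "borel :: real measure"] by (simp add: diagonal_measure_def)

lemma diagonal_measure_emeasure:
  assumes "S \<in> sets borel"
  shows "emeasure (diagonal_measure E x) S = ennreal ((norm (E S x))\<^sup>2)"
proof -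
  have form: "Re (cinner (E S x) x) = (norm (E S x))\<^sup>2" if "S \<in> sets borel" for S
    by (simp add: Re_cinner orth_proj_inner[OF pvm_proj[OF that]])
  have "emeasure (diagonal_measure E x) S = ennreal (Re (cinner (E S x) x))"
    unfolding diagonal_measure_def
  proof (rule emeasure_measure_of_sigma[OF _ _ _ assms])
    show "sigma_algebra (UNIV :: real set) (sets borel)" using sets.sigma_algebra_axioms[of "borel :: real measure"] by simp
    show "positive (sets borel) (\<lambda>S. ennreal (Re (cinner (E S x) x)))"
      by (simp add: positive_def Re_cinner pvm_empty)
    show "countably_additive (sets borel) (\<lambda>S. ennreal (Re (cinner (E S x) x)))"
      unfolding countably_additive_def
    proof (intro allI impI)
      fix A :: "nat \<Rightarrow> real set"
      assume A: "range A \<subseteq> sets borel" "disjoint_family A"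
      show "(\<Sum>i. ennreal (Re (cinner (E (A i) x) x))) = ennreal (Re (cinner (E (\<Union>i. A i) x) x))"
      proof (rule suminf_ennreal_eq)
        show "0 \<le> Re (cinner (E (A i) x) x)" for i using form[of "A i"] A by auto
        show "(\<lambda>i. Re (cinner (E (A i) x) x)) sums Re (cinner (E (\<Union>i. A i) x) x)"
          unfolding Re_cinner by (rule bounded_linear.sums[OF bounded_linear_inner_left pvm_sums[OF A]])
      qed
    qed
  qed
  then show ?thesis by (simp add: form[OF assms])
qed

lemma diagonal_measure_finite: "finite_measure (diagonal_measure E x)"
proof (rule finite_measureI)
  have "space (diagonal_measure E x) = UNIV" by (simp add: diagonal_measure_def)
  then show "emeasure (diagonal_measure E x) (space (diagonal_measure E x)) \<noteq> \<infinity>"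
    by (simp add: diagonal_measure_emeasure)
qed

lemma diagonal_measure_measure:
  "S \<in> sets borel \<Longrightarrow> measure (diagonal_measure E x) S = (norm (E S x))\<^sup>2"
  by (simp add: measure_def diagonal_measure_emeasure)

lemma pvm_UNIV: "E UNIV x = x"
  using pvm by (simp add: projection_valued_measure_def)

lemma diagonal_measure_concentrated:
  assumes "I \<in> sets borel" "E I x = x"
  shows "measure (diagonal_measure E x) (- I) = 0"
  using pvm_disjoint[of "- I" I x] assms by (simp add: diagonal_measure_measure)

end

text \<open>The projection at the point \<open>norm T\<close> is thus the same for every spectral
  measure of T, which evaluates the definite description in \<open>spectral_proj\<close>. In one
  direction the integral is taken over a single point; in the other, the diagonal measure has no
  mass above \<open>norm T\<close>, and the integral of \<open>norm T - t\<close> vanishes.\<close>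

lemma top_spectral_projection:
  fixes T :: "'a::chilbert_space op"
  assumes E: "is_spectral_measure T E" and T: "psd T"
  shows "E {norm T} x = x \<longleftrightarrow> T x = norm T *\<^sub>R x"
proof
  define \<alpha> where "\<alpha> = norm T"
  have pvm: "projection_valued_measure E" using E by (simp add: is_spectral_measure_def)
  have int: "T x \<bullet> x = (\<integral>t. t \<partial>diagonal_measure E x)" for x
    using E by (metis Re_cinner Re_complex_of_real is_spectral_measure_def)
  note conc = integral_concentrated[OF diagonal_measure_finite[OF pvm] diagonal_measure_sets[OF pvm]]
  have mU: "measure (diagonal_measure E x) UNIV = (norm x)\<^sup>2" for x
    by (simp add: diagonal_measure_measure[OF pvm] pvm_UNIV[OF pvm])
  {
    assume "E {norm T} x = x"
    then have "\<alpha> * measure (diagonal_measure E x) UNIV \<le> (\<integral>t. t \<partial>diagonal_measure E x)"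
      using diagonal_measure_concentrated[OF pvm, of "{\<alpha>}" x]
      by (intro conc(2)[of "{\<alpha>}" \<alpha> \<alpha>]) (auto simp: \<alpha>_def)
    then show "T x = norm T *\<^sub>R x"
      using int[of x] by (intro eigenvector_of_bound[OF T]) (simp_all add: mU \<alpha>_def)
  }
  assume eig: "T x = norm T *\<^sub>R x"
  obtain K where K: "E {-K..K} = id_blinfun" using pvm by (auto simp: projection_valued_measure_def)
  let ?M = "diagonal_measure E x"
  \<comment> \<open>A nonzero vector in this range would have a form exceeding the norm of T. The
    cap K confines the set to a bounded interval, as \<open>integral_concentrated\<close>
    requires.\<close>
  have above: "E {\<alpha> + 1 / real (Suc n)..K} z = 0" for n z
  proof -
    let ?I = "{\<alpha> + 1 / real (Suc n)..K}" and ?y = "E {\<alpha> + 1 / real (Suc n)..K} z"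
    have "E ?I ?y = ?y" by (rule orth_proj_idem[OF pvm_proj[OF pvm]]) simp
    then have "(\<alpha> + 1 / real (Suc n)) * measure (diagonal_measure E ?y) UNIV \<le> (\<integral>t. t \<partial>diagonal_measure E ?y)"
      by (intro conc(2)[of ?I _ K] diagonal_measure_concentrated[OF pvm]) auto
    also have "\<dots> = T ?y \<bullet> ?y" by (simp add: int)
    also have "\<dots> \<le> \<alpha> * (norm ?y)\<^sup>2" unfolding \<alpha>_def by (rule psd_le_norm)
    finally have "1 / real (Suc n) * (norm ?y)\<^sup>2 \<le> 0" by (simp add: mU distrib_right)
    then show ?thesis by (simp add: divide_le_0_iff)
  qed
  have "emeasure ?M (\<Union>n. {\<alpha> + 1 / real (Suc n)..K}) = 0"
  proof (rule emeasure_UN_eq_0)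
    show "emeasure ?M {\<alpha> + 1 / real (Suc n)..K} = 0" for n
      using diagonal_measure_emeasure[OF pvm, of "{\<alpha> + 1 / real (Suc n)..K}" x] unfolding above by simp
  qed (auto simp: diagonal_measure_sets[OF pvm])
  moreover have "emeasure ?M (- {-K..K}) = 0"
    using diagonal_measure_concentrated[OF pvm, of "{-K..K}" x] K
    by (simp add: finite_measure.emeasure_eq_measure[OF diagonal_measure_finite[OF pvm]])
  ultimately have "emeasure ?M ((\<Union>n. {\<alpha> + 1 / real (Suc n)..K}) \<union> - {-K..K}) = 0"
    by (intro emeasure_Un_null_set[THEN trans]) (auto simp: null_sets_def diagonal_measure_sets[OF pvm])
  moreover have "{\<alpha><..} \<subseteq> (\<Union>n. {\<alpha> + 1 / real (Suc n)..K}) \<union> - {-K..K}"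
  proof
    fix t assume "t \<in> {\<alpha><..}"
    then obtain n where "inverse (real (Suc n)) < t - \<alpha>" using reals_Archimedean[of "t - \<alpha>"] by auto
    then show "t \<in> (\<Union>n. {\<alpha> + 1 / real (Suc n)..K}) \<union> - {-K..K}" 
    proof (cases "t \<le> K")
      case True
      with \<open>inverse (real (Suc n)) < t - \<alpha>\<close> have "t \<in> {\<alpha> + 1 / real (Suc n)..K}"
        by (simp add: inverse_eq_divide)
      then show ?thesis by blast
    qed auto
  qed
  ultimately have ae: "AE t in ?M. t \<le> \<alpha>"
    by (intro AE_I[of _ _ "(\<Union>n. {\<alpha> + 1 / real (Suc n)..K}) \<union> - {-K..K}"])
      (auto simp: diagonal_measure_sets[OF pvm] not_le)
  interpret finite_measure ?M by (rule diagonal_measure_finite[OF pvm])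
  have "integrable ?M (\<lambda>t. t)"
    by (rule conc(1)[of "{-K..K}" "-K" K]) (use diagonal_measure_concentrated[OF pvm, of "{-K..K}" x] K in auto)
  then have ig: "integrable ?M (\<lambda>t. \<alpha> - t)" by simp
  have "space ?M = UNIV" by (simp add: diagonal_measure_def)
  then have "(\<integral>t. \<alpha> - t \<partial>?M) = \<alpha> * (norm x)\<^sup>2 - T x \<bullet> x"
    using \<open>integrable ?M (\<lambda>t. t)\<close> by (simp add: int mU)
  also have "\<dots> = 0" by (simp add: eig \<alpha>_def dot_square_norm)
  finally have "AE t in ?M. \<alpha> - t = 0"
    using integral_nonneg_eq_0_iff_AE[OF ig] ae by (auto elim!: eventually_mono)
  then have "emeasure ?M (- {\<alpha>}) = 0"
    using AE_iff_measurable[of "- {\<alpha>}" ?M "\<lambda>t. \<alpha> - t = 0"] \<open>space ?M = UNIV\<close>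
    by (auto simp: diagonal_measure_sets[OF pvm])
  then have "E (- {\<alpha>}) x = 0" by (simp add: diagonal_measure_emeasure[OF pvm])
  then show "E {norm T} x = x"
    using pvm_Un[OF pvm, of "{\<alpha>}" "- {\<alpha>}" x] pvm_UNIV[OF pvm, of x] by (simp add: \<alpha>_def)
qed

lemma spectral_proj_top:
  fixes T :: "'a::chilbert_space op"
  assumes T: "T \<in> bounded_ops" "psd T"
  shows "spectral_proj {norm T} T = ker_proj (T - norm T *\<^sub>R id_blinfun)"
proof -
  have eq: "E {norm T} = ker_proj (T - norm T *\<^sub>R id_blinfun)" if E: "is_spectral_measure T E" for E
  proof (rule orth_proj_eqI)
    show o: "orth_proj (E {norm T})" using E by (intro pvm_proj) (auto simp: is_spectral_measure_def)
    show "range (E {norm T}) = range (ker_proj (T - norm T *\<^sub>R id_blinfun))"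
      unfolding ker_proj(4) using top_spectral_projection[OF E T(2)] orth_proj_range[OF o]
      by (auto simp: blinfun.bilinear_simps)
  qed (rule ker_proj)
  show ?thesis
    unfolding spectral_proj_def
    by (rule the_equality) (use eq spec_meas_is_spectral_measure[OF T] in \<open>metis, metis\<close>)
qed

subsection \<open>Type III factors\<close>

lemma commutant_vn_alg:
  assumes "von_neumann_algebra M"
  shows "vn_alg (commutant M)" "vn_alg.vn (commutant M) = M"
proof -
  have M: "M \<subseteq> bounded_ops" "\<And>T. T \<in> M \<Longrightarrow> adj T \<in> M" "commutant (commutant M) = M"
    using assms by (auto simp: von_neumann_algebra_def)
  show vn: "vn_alg (commutant M)"
  proof
    fix S assume S: "S \<in> commutant M"
    have "hadj S o\<^sub>L T = T o\<^sub>L hadj S" if "T \<in> M" for T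
    proof -
      have "T \<in> bounded_ops" using that M(1) by blast
      then have "hadj T \<in> M" using M(2)[OF that] adj_eq_hadj by metis
      then have "S o\<^sub>L hadj T = hadj T o\<^sub>L S" using S by (simp add: commutant_def)
      from arg_cong[OF this, of hadj] show ?thesis by (simp add: hadj_compose)
    qed
    then show "hadj S \<in> commutant M" using S hadj_bounded_ops[of S] by (simp add: commutant_def)
  qed
  interpret vn_alg "commutant M" by (rule vn)
  \<comment> \<open>The scalars lie in the commutant, so the members of \<open>vn\<close>, a priori
    only real-linear, are complex-linear.\<close>
  have sc: "scalar_op c \<in> commutant M" for c
  proof -
    have "scalar_op c \<in> bounded_ops" by (simp add: bounded_ops_def scaleC_scaleC mult.commute)
    moreover have "scalar_op c o\<^sub>L S = S o\<^sub>L scalar_op c" if "S \<in> M" for S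
      using that M(1) by (intro blinfun_eqI) (auto simp: bounded_opsD)
    ultimately show ?thesis by (simp add: commutant_def)
  qed
  show "vn = M"
  proof (intro equalityI subsetI)
    fix T assume T: "T \<in> vn"
    then have "T \<in> bounded_ops" using sc by (auto simp: vn_def bounded_ops_iff)
    moreover have "T o\<^sub>L S = S o\<^sub>L T" if "S \<in> commutant M" for S
      using T that by (intro blinfun_eqI) (simp add: vn_def commutes_def)
    ultimately have "T \<in> commutant (commutant M)" by (simp add: commutant_def)
    then show "T \<in> M" using M(3) by simp
  next
    fix T assume "T \<in> M"
    then have "S o\<^sub>L T = T o\<^sub>L S" if "S \<in> commutant M" for S using that by (simp add: commutant_def)
    then show "T \<in> vn" by (auto simp: vn_def commutes_def) (metis blinfun_apply_blinfun_compose)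
  qed
qed

context
  fixes M :: "'a::chilbert_space op set"
  assumes M: "von_neumann_algebra M"
begin

interpretation vn_alg "commutant M" by (rule commutant_vn_alg(1)[OF M])

lemma vn_eq: "vn = M"
  by (rule commutant_vn_alg(2)[OF M])

lemma M_bounded: "T \<in> M \<Longrightarrow> T \<in> bounded_ops"
  using M by (auto simp: von_neumann_algebra_def)

lemma prj_iff: "prj P \<longleftrightarrow> P \<in> projections M"
  using M_bounded by (auto simp: prj_def projections_def is_projection_iff vn_eq)

lemma psub_iff: "psub P Q \<longleftrightarrow> subprojection P Q"
  unfolding psub_def subprojection_def by (metis blinfun_apply_blinfun_compose blinfun_eqI)

lemma eqv_iff:
  assumes "prj P"
  shows "eqv P Q \<longleftrightarrow> mvn_equiv M P Q"
proof
  assume "eqv P Q"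
  then obtain V where V: "V \<in> M" "pisom V P Q" by (auto simp: eqv_def vn_eq)
  then show "mvn_equiv M P Q"
    unfolding mvn_equiv_def using adj_eq_hadj[OF M_bounded[OF V(1)]]
    by (intro bexI[of _ V] conjI blinfun_eqI) (simp_all add: pisomD[OF V(2)])
next
  assume "mvn_equiv M P Q"
  then obtain V where V': "V \<in> M" "adj V o\<^sub>L V = P" "V o\<^sub>L adj V = Q"
    by (auto simp: mvn_equiv_def)
  have V: "V \<in> M" "hadj V o\<^sub>L V = P" "V o\<^sub>L hadj V = Q"
    using V' unfolding adj_eq_hadj[OF M_bounded[OF V'(1)]] by blast+
  have "pisom V P (V o\<^sub>L hadj V)"
    by (rule pisomI[OF prjD(2)[OF assms]]) (simp flip: V(2))
  then show "eqv P Q" using V by (auto simp: eqv_def vn_eq)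
qed

lemma subeqv_iff:
  assumes "prj P"
  shows "subeqv P Q \<longleftrightarrow> mvn_subequiv M P Q"
  unfolding subeqv_def mvn_subequiv_def using eqv_iff[OF assms] by (auto simp: prj_iff psub_iff)

lemma null_proj_ker_proj: "T \<in> M \<Longrightarrow> null_proj T = ker_proj T"
proof (rule null_proj_eq)
  assume T: "T \<in> M"
  have inv: "commutes (scalar_op c) (ker_proj T)" for c
    unfolding ker_proj_def
  proof (rule proj_on_commutes[OF kernel_closed_subspace])
    fix x assume "x \<in> {x. T x = 0}"
    then show "scalar_op c x \<in> {x. T x = 0}"
      using bounded_opsD[OF M_bounded[OF T]] scaleC_add_right[of c 0 0] by simp
    have "hadj (scalar_op c :: 'a op) = scalar_op (cnj c)"
      by (rule hadj_unique) (simp add: Re_cinner[symmetric] cinner_scaleC_left cinner_scaleC_right)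
    then show "hadj (scalar_op c) x \<in> {x. T x = 0}"
      using \<open>x \<in> {x. T x = 0}\<close> bounded_opsD[OF M_bounded[OF T]] scaleC_add_right[of "cnj c" 0 0] by simp
  qed
  then show "ker_proj T \<in> bounded_ops" by (simp add: bounded_ops_iff)
qed

lemma type_III_factor_locale:
  assumes "factor M" "type_III M" "sigma_finite_algebra M"
  shows "vn_factor_III (commutant M)"
proof
  fix Z assume Z: "prj Z" "\<And>T. T \<in> vn \<Longrightarrow> commutes T Z"
  have "Z \<in> M" using prjD(1)[OF Z(1)] by (simp add: vn_eq)
  moreover have "Z o\<^sub>L T = T o\<^sub>L Z" if "T \<in> M" for T
    using Z(2)[of T] that by (intro blinfun_eqI) (simp add: vn_eq commutes_def)
  ultimately have "Z \<in> M \<inter> commutant M" using M_bounded by (simp add: commutant_def)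
  then obtain c where c: "Z = scalar_op c" using assms(1) by (auto simp: factor_def)
  show "Z = 0 \<or> Z = id_blinfun"
  proof (cases "\<forall>x. Z x = 0")
    case True
    then show ?thesis by (auto intro: blinfun_eqI)
  next
    case False
    then obtain x where x: "Z x \<noteq> 0" by blast
    have "Z (Z x) = Z x" by (rule orth_proj_idem[OF prjD(2)[OF Z(1)]])
    then have "c *\<^sub>C Z x = Z x" by (simp add: c)
    then have "(c - 1) *\<^sub>C Z x = 0"
      using scaleC_add_left[of "c - 1" 1 "Z x"] by (simp add: scaleC_one)
    then have "cmod (c - 1) * norm (Z x) = 0" by (metis norm_scaleC norm_zero)
    then have "c = 1" using x by simp
    then show ?thesis by (auto simp: c scaleC_one intro: blinfun_eqI)
  qed
next
  fix F :: "'a op set"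
  assume F: "\<And>P. P \<in> F \<Longrightarrow> prj P \<and> P \<noteq> 0"
    and o: "pairwise (\<lambda>P Q. \<forall>x. blinfun_apply P (blinfun_apply Q x) = 0) F"
  have "F \<subseteq> projections M - {0}" using F prj_iff by blast
  moreover have "pairwise (\<lambda>P Q. P o\<^sub>L Q = 0) F"
    unfolding pairwise_def
  proof (intro ballI impI, rule blinfun_eqI)
    fix P Q x assume "P \<in> F" "Q \<in> F" "P \<noteq> Q"
    then show "(P o\<^sub>L Q) x = blinfun_apply 0 x" using o by (simp add: pairwise_def)
  qed
  ultimately show "countable F" using assms(3) unfolding sigma_finite_algebra_def by blast
next
  fix P assume P: "prj P" "P \<noteq> 0"
  then have "\<not> finite_projection M P" using assms(2) by (auto simp: type_III_def)
  then show "\<exists>Q. prj Q \<and> psub Q P \<and> eqv P Q \<and> Q \<noteq> P"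
    using P(1) eqv_iff[OF P(1)] by (auto simp: finite_projection_def prj_iff psub_iff)
qed

end

section \<open>Unitaries, the point 0 of the spectrum, necessity and the equivalence\<close>

lemma unitary_op_iff:
  fixes U :: "'a::chilbert_space op"
  assumes "U \<in> bounded_ops"
  shows "unitary_op U \<longleftrightarrow> pisom U id_blinfun id_blinfun"
proof -
  have "hadj U o\<^sub>L U = id_blinfun \<longleftrightarrow> (\<forall>x. hadj U (U x) = x)" "U o\<^sub>L hadj U = id_blinfun \<longleftrightarrow> (\<forall>x. U (hadj U x) = x)"
    by (metis blinfun_apply_blinfun_compose blinfun_apply_id_blinfun blinfun_eqI id_apply)+
  then show ?thesis using assms by (simp add: unitary_op_def pisom_def adj_eq_hadj)
qed

text \<open>For a positive operator invertibility amounts to a lower bound, by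
  \<open>selfadj_inverse\<close>; the inverse inherits complex linearity.\<close>

lemma spectrum_0_iff:
  fixes B :: "'a::chilbert_space op"
  assumes B: "B \<in> bounded_ops" "psd B"
  shows "0 \<in> spectrum B \<longleftrightarrow> (\<forall>t>0. \<exists>x. norm (B x) < t * norm x)"
proof -
  have s0: "scalar_op 0 = (0 :: 'a op)" by (rule blinfun_eqI) (simp add: scaleC_zero)
  have "(\<exists>S\<in>bounded_ops. S o\<^sub>L B = id_blinfun \<and> B o\<^sub>L S = id_blinfun) \<longleftrightarrow>
      (\<exists>t>0. \<forall>x. t * norm x \<le> norm (B x))"
  proof
    assume "\<exists>S\<in>bounded_ops. S o\<^sub>L B = id_blinfun \<and> B o\<^sub>L S = id_blinfun"
    then obtain S :: "'a op" where "S o\<^sub>L B = id_blinfun" by blast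
    then have SB: "S (B x) = x" for x by (metis blinfun_apply_blinfun_compose blinfun_apply_id_blinfun id_apply)
    define K where "K = norm S + 1"
    have K: "K > 0" by (simp add: K_def add_nonneg_pos)
    have "norm x \<le> K * norm (B x)" for x
    proof -
      have "norm x \<le> norm S * norm (B x)" using norm_blinfun[of S "B x"] by (simp add: SB)
      also have "\<dots> \<le> K * norm (B x)" by (intro mult_right_mono) (auto simp: K_def)
      finally show ?thesis .
    qed
    then show "\<exists>t>0. \<forall>x. t * norm x \<le> norm (B x)"
      using K by (intro exI[of _ "1 / K"]) (simp add: field_simps)
  next
    assume "\<exists>t>0. \<forall>x. t * norm x \<le> norm (B x)"
    then obtain t where "t > 0" "\<And>x. t * norm x \<le> norm (B x)" by blast
    then obtain G :: "'a op" where G: "\<And>x. B (G x) = x" "\<And>x. G (B x) = x"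
      using selfadj_inverse[OF psd_selfadj[OF B(2)]] by blast
    have "G (c *\<^sub>C x) = c *\<^sub>C G x" for c x
    proof -
      have "B (c *\<^sub>C G x) = c *\<^sub>C x" by (simp add: bounded_opsD[OF B(1)] G)
      then show ?thesis by (metis G(2))
    qed
    then show "\<exists>S\<in>bounded_ops. S o\<^sub>L B = id_blinfun \<and> B o\<^sub>L S = id_blinfun"
      using G by (intro bexI[of _ G] conjI blinfun_eqI) (simp_all add: bounded_ops_def)
  qed
  then show ?thesis by (simp add: spectrum_def s0) (meson not_le)
qed

context vn_factor_III
begin

lemma copies_necessary:
  assumes A: "A \<in> vn" "psd A" and B: "B \<in> vn" "psd B" "B \<noteq> 0"
    and C: "\<And>j::nat. ueq (C j) B" "\<And>x. (\<lambda>j. blinfun_apply (C j) x) sums A x"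
    and Q: "Q = ker_proj (B - norm B *\<^sub>R id_blinfun)" and E: "E = ker_proj (A - norm A *\<^sub>R id_blinfun)"
  shows "norm B \<le> norm A" "\<forall>t>0. \<exists>x. norm (B x) < t * norm x" "subeqv (ker_proj A) (ker_proj B)"
    "norm A = norm B \<Longrightarrow> Q \<noteq> 0 \<Longrightarrow> E \<noteq> 0 \<and> ker_proj B \<noteq> 0"
    "norm A = norm B \<Longrightarrow> B = norm B *\<^sub>R Q \<Longrightarrow> A = norm A *\<^sub>R E"
proof -
  obtain U where U: "\<And>j. U j \<in> vn" "\<And>j. pisom (U j) id_blinfun id_blinfun" "\<And>j. C j = U j o\<^sub>L B o\<^sub>L hadj (U j)"
    using C(1) unfolding ueq_def by metis
  note sB = psd_selfadj[OF B(2)]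
  have hU: "hadj (U j) (U j x) = x" "U j (hadj (U j) x) = x" "norm (hadj (U j) x) = norm x" "norm (U j x) = norm x" for j x
    using pisomD(3,4,9,10)[OF U(2), of j x] by simp_all
  have CU: "C j (U j x) = U j (B x)" for j x by (simp add: U(3) hU)
  have Cp: "psd (C j)" for j unfolding U(3) by (rule psd_conj'[OF B(2)])
  have sums: "(\<lambda>j. C j x \<bullet> x) sums (A x \<bullet> x)" for x
    by (rule bounded_linear.sums[OF bounded_linear_inner_left C(2)])
  have part: "(\<Sum>j\<in>I. C j x \<bullet> x) \<le> A x \<bullet> x" if "finite I" for I x
    using sum_le_suminf[OF sums_summable[OF sums] that psd_nonneg[OF Cp]] sums_unique[OF sums, of x] by simp
  have CA: "C j x \<bullet> x \<le> A x \<bullet> x" for j x using part[of "{j}" x] by simp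
  \<comment> \<open>Two distinct summands fit below A at once. This is what makes an eigenvector of
    one copy a null vector of another.\<close>
  have C2: "C i x \<bullet> x + C j x \<bullet> x \<le> A x \<bullet> x" if "i \<noteq> j" for i j x using part[of "{i, j}" x] that by simp
  show nBA: "norm B \<le> norm A"
  proof (rule psd_norm_le[OF B(2)])
    fix x
    have "B x \<bullet> x = C 0 (U 0 x) \<bullet> U 0 x" by (simp add: CU hadj hU)
    also have "\<dots> \<le> A (U 0 x) \<bullet> U 0 x" by (rule CA)
    also have "\<dots> \<le> norm A * (norm x)\<^sup>2" using psd_le_norm[of A "U 0 x"] by (simp add: hU)
    finally show "B x \<bullet> x \<le> norm A * (norm x)\<^sup>2" .
  qed simp
  obtain x0 where "B x0 \<noteq> 0" using B(3) by (metis blinfun_eqI zero_blinfun.rep_eq)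
  then have x0: "x0 \<noteq> 0" by auto
  show "\<forall>t>0. \<exists>x. norm (B x) < t * norm x"
  proof (intro allI impI, rule ccontr)
    fix t :: real assume t: "t > 0" and "\<not> (\<exists>x. norm (B x) < t * norm x)"
    then have le: "t * norm x \<le> norm (B x)" for x by (meson not_le)
    have "norm (C j x0) \<ge> t * norm x0" for j
      using le[of "hadj (U j) x0"] by (simp add: U(3) hU)
    moreover have "(\<lambda>j. norm (C j x0)) \<longlonglongrightarrow> 0"
      using tendsto_norm[OF summable_LIMSEQ_zero[OF sums_summable[OF C(2)]]] by simp
    ultimately have "t * norm x0 \<le> 0" by (intro LIMSEQ_le_const[of _ 0]) auto
    then show False using t x0 by (simp add: mult_le_0_iff)
  qed
  have KA: "prj (ker_proj A)" by (rule prj_ker[OF psd_selfadj[OF A(2)] A(1)])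
  have KB: "prj (ker_proj B)" by (rule prj_ker[OF sB B(1)])
  show "subeqv (ker_proj A) (ker_proj B)"
  \<comment> \<open>A nonzero kernel projection of B receives every projection, so the condition
    says something about A only when B is injective.\<close>
  proof (cases "ker_proj B = 0")
    case False
    then show ?thesis by (rule subeqv_any[OF KA KB])
  next
    case True
    have "ker_proj A x = 0" for x
    proof -
      let ?y = "ker_proj A x"
      have "C 0 ?y \<bullet> ?y = 0"
        using CA[of 0 ?y] psd_nonneg[OF Cp, of 0 ?y] by (simp add: ker_proj(2))
      then have "C 0 ?y = 0" using psd_zero_iff[OF Cp] by blast
      then have "hadj (U 0) (C 0 ?y) = 0" by simp
      then have "B (hadj (U 0) ?y) = 0" by (simp add: U(3) hU)
      then have "hadj (U 0) ?y = 0" using ker_proj(3)[of B "hadj (U 0) ?y"] True by simp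
      then show ?thesis using hU(2)[of 0 ?y] by simp
    qed
    then have "ker_proj A = 0" by (intro blinfun_eqI) simp
    then show ?thesis unfolding subeqv_def using eqv_refl[of 0] by (intro exI[of _ 0]) simp
  qed
  note BQ = ker_proj_eigen[OF sB Q] and AE = ker_proj_eigen[OF psd_selfadj[OF A(2)] E]
  {
    assume n: "norm A = norm B" and Q0: "Q \<noteq> 0"
    obtain z where z: "Q z \<noteq> 0" using Q0 by (metis blinfun_eqI zero_blinfun.rep_eq)
    define x where "x = U 0 (Q z)"
    have x: "x \<noteq> 0" using z hU(4)[of 0 "Q z"] by (auto simp: x_def)
    have C0: "C 0 x = norm A *\<^sub>R x" by (simp add: x_def CU BQ(1) n blinfun.scaleR_right)
    have "norm A * (norm x)\<^sup>2 \<le> A x \<bullet> x" using CA[of 0 x] by (simp add: C0 dot_square_norm)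
    then have Ax: "A x = norm A *\<^sub>R x" by (intro eigenvector_of_bound[OF A(2)]) simp_all
    then have "E x = x" using AE(2) by blast
    then have "E \<noteq> 0" using x by auto
    \<comment> \<open>At x the copy \<open>C 0\<close> already uses up the whole form of A.\<close>
    have "C 1 x \<bullet> x = 0"
      using C2[of 0 1 x] psd_nonneg[OF Cp, of 1 x] by (simp add: C0 Ax)
    then have "C 1 x = 0" using psd_zero_iff[OF Cp] by blast
    then have "hadj (U 1) (C 1 x) = 0" by simp
    then have "B (hadj (U 1) x) = 0" by (simp add: U(3) hU)
    moreover have "hadj (U 1) x \<noteq> 0" using hU(3)[of 1 x] x by auto
    ultimately have "ker_proj B \<noteq> 0" using ker_proj(3)[of B "hadj (U 1) x"] by auto
    then show "E \<noteq> 0 \<and> ker_proj B \<noteq> 0" using \<open>E \<noteq> 0\<close> by blast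
  }
  assume n: "norm A = norm B" and BQ': "B = norm B *\<^sub>R Q"
  have \<alpha>: "norm A > 0" using n B(3) by simp
  have oQ: "orth_proj Q" unfolding Q by (rule ker_proj(1))
  define P where "P j = U j o\<^sub>L Q o\<^sub>L hadj (U j)" for j
  have Pj: "orth_proj (P j)" for j
    unfolding P_def by (rule pisomD(2)[OF pisom_restrict(1)[OF U(2) oQ]]) simp
  have CP: "C j x = norm A *\<^sub>R P j x" for j x
    by (simp add: U(3) P_def) (subst BQ', simp add: blinfun.bilinear_simps n)
  \<comment> \<open>On the range of \<open>P j\<close> one scaled projection already attains the
    norm of A, which leaves no room for a second.\<close>
  have "P i (P j x) = 0" if "i \<noteq> j" for i j x
  proof -
    let ?y = "P j x"
    have "norm A * (norm (P i ?y))\<^sup>2 + norm A * (norm ?y)\<^sup>2 \<le> A ?y \<bullet> ?y"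
      using C2[OF that, of ?y] by (simp add: CP orth_proj_inner[OF Pj] orth_proj_idem[OF Pj] dot_square_norm)
    also have "\<dots> \<le> norm A * (norm ?y)\<^sup>2" by (rule psd_le_norm)
    finally show ?thesis using \<alpha> by (simp add: mult_le_0_iff)
  qed
  then have oP: "orth_seq P" using Pj by (simp add: orth_seq_def)
  obtain R :: "'h op" where R: "orth_proj R" "\<And>x. (\<lambda>j. P j x) sums R x" using orth_seq_sums[OF oP] by blast
  have AR: "A x = norm A *\<^sub>R R x" for x
  proof (rule sums_unique2[OF C(2)])
    show "(\<lambda>j. C j x) sums (norm A *\<^sub>R R x)" unfolding CP by (rule sums_scaleR_right[OF R(2)])
  qed
  have "E = R"
  proof (rule orth_proj_eqI)
    show "orth_proj E" unfolding E by (rule ker_proj(1))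
    have "E x = x \<longleftrightarrow> R x = x" for x using AE(2)[of x] AR[of x] \<alpha> by simp
    then show "range E = range R"
      using orth_proj_range[OF R(1)] orth_proj_range[of E] ker_proj(1) unfolding E by blast
  qed (rule R)
  then show "A = norm A *\<^sub>R E" using AR by (intro blinfun_eqI) (simp add: blinfun.scaleR_left)
qed

end

theorem corollary5p6:
  fixes M :: "('a::chilbert_space \<Rightarrow>\<^sub>L 'a) set" and A B :: "'a \<Rightarrow>\<^sub>L 'a"
  assumes "factor M" and "type_III M" and "sigma_finite_algebra M"
    and "A \<in> positive_part M" and "B \<in> positive_part M" and "B \<noteq> 0"
  shows
    "let
       c1 = (norm A > norm B \<and> 0 \<in> spectrum B \<and> mvn_subequiv M (null_proj A) (null_proj B));
       c2 = (norm A = norm B \<and> spectral_proj {norm B} B = 0 \<and> 0 \<in> spectrum B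
               \<and> mvn_subequiv M (null_proj A) (null_proj B));
       c3 = (norm A = norm B \<and> spectral_proj {norm B} B \<noteq> 0
               \<and> B \<noteq> norm B *\<^sub>R spectral_proj {norm B} B
               \<and> spectral_proj {norm A} A \<noteq> 0 \<and> null_proj B \<noteq> 0);
       c4 = (norm A = norm B \<and> B = norm B *\<^sub>R spectral_proj {norm B} B
               \<and> A = norm A *\<^sub>R spectral_proj {norm A} A
               \<and> spectral_proj {norm A} A \<noteq> 0 \<and> null_proj B \<noteq> 0)
     in ((\<exists>C :: nat \<Rightarrow> ('a \<Rightarrow>\<^sub>L 'a). (\<forall>j. unitarily_equiv M (C j) B) \<and> C strong_sums A)
           \<longleftrightarrow> c1 \<or> c2 \<or> c3 \<or> c4)
        \<and> \<not> (c1 \<and> c2) \<and> \<not> (c1 \<and> c3) \<and> \<not> (c1 \<and> c4)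
        \<and> \<not> (c2 \<and> c3) \<and> \<not> (c2 \<and> c4) \<and> \<not> (c3 \<and> c4)"
proof -
  have M: "von_neumann_algebra M" using assms(1) by (simp add: factor_def)
  interpret vn_factor_III "commutant M" by (rule type_III_factor_locale[OF M assms(1-3)])
  obtain \<phi> where \<phi>: "\<And>S T. \<phi> (S + T) = \<phi> S + \<phi> T" "\<And>r T. \<phi> (r *\<^sub>R T) = r * \<phi> T"
    "\<And>T :: 'a op. psd T \<Longrightarrow> 0 \<le> \<phi> T" "\<And>T. T \<in> vn \<Longrightarrow> psd T \<Longrightarrow> \<phi> T = 0 \<Longrightarrow> T = 0"
    using ex_faithful_functional by blast
  interpret vn_state "commutant M" \<phi> by unfold_locales (use \<phi> in auto)
  note vnM = vn_eq[OF M]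
  have AM: "A \<in> M" "B \<in> M" and pos: "positive_op A" "positive_op B"
    using assms(4,5) by (auto simp: positive_part_def)
  have A: "A \<in> vn" "psd A" and B: "B \<in> vn" "psd B"
    using AM pos positive_op_psd vnM by auto
  have bnd: "A \<in> bounded_ops" "B \<in> bounded_ops" using AM M_bounded[OF M] by auto
  define Q E where "Q = ker_proj (B - norm B *\<^sub>R id_blinfun)" and "E = ker_proj (A - norm A *\<^sub>R id_blinfun)"
  have sp: "spectral_proj {norm B} B = Q" "spectral_proj {norm A} A = E"
    using spectral_proj_top bnd A B by (auto simp: Q_def E_def)
  define KA KB where "KA = ker_proj A" and "KB = ker_proj B"
  have np: "null_proj A = KA" "null_proj B = KB"
    using null_proj_ker_proj[OF M] AM by (auto simp: KA_def KB_def)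
  have KAp: "prj KA" unfolding KA_def by (rule prj_ker[OF psd_selfadj[OF A(2)] A(1)])
  have sub: "mvn_subequiv M KA KB \<longleftrightarrow> subeqv KA KB" using subeqv_iff[OF M KAp] by simp
  have spec0: "0 \<in> spectrum B \<longleftrightarrow> (\<forall>t>0. \<exists>x. norm (B x) < t * norm x)"
    by (rule spectrum_0_iff[OF bnd(2) B(2)])
  have ue: "unitarily_equiv M C B \<longleftrightarrow> ueq C B" for C
    unfolding unitarily_equiv_def ueq_def vnM
    using unitary_op_iff adj_eq_hadj M_bounded[OF M] by (metis (no_types, lifting))
  have sumsE: "(\<exists>C :: nat \<Rightarrow> 'a op. (\<forall>j. unitarily_equiv M (C j) B) \<and> C strong_sums A) \<longleftrightarrow>
      (\<exists>C. \<forall>j::nat. ueq (C j) B \<and> (\<forall>x. (\<lambda>j. blinfun_apply (C j) x) sums A x))"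
    by (auto simp: strong_sums_def ue)
  define c1 c2 c3 c4 where "c1 \<longleftrightarrow> norm A > norm B \<and> 0 \<in> spectrum B \<and> subeqv KA KB"
    and "c2 \<longleftrightarrow> norm A = norm B \<and> Q = 0 \<and> 0 \<in> spectrum B \<and> subeqv KA KB"
    and "c3 \<longleftrightarrow> norm A = norm B \<and> Q \<noteq> 0 \<and> B \<noteq> norm B *\<^sub>R Q \<and> E \<noteq> 0 \<and> KB \<noteq> 0"
    and "c4 \<longleftrightarrow> norm A = norm B \<and> B = norm B *\<^sub>R Q \<and> A = norm A *\<^sub>R E \<and> E \<noteq> 0 \<and> KB \<noteq> 0"
  note BQ = ker_proj_eigen[OF psd_selfadj[OF B(2)] Q_def]
  have nec: "c1 \<or> c2 \<or> c3 \<or> c4"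
    if ex: "\<exists>C. \<forall>j::nat. ueq (C j) B \<and> (\<forall>x. (\<lambda>j. blinfun_apply (C j) x) sums A x)"
  proof -
    obtain C where C: "\<And>j::nat. ueq (C j) B" "\<And>x. (\<lambda>j. blinfun_apply (C j) x) sums A x" using ex by blast
    note n = copies_necessary[OF A B assms(6) C Q_def E_def, folded KA_def KB_def]
    show ?thesis
    proof (cases "norm A = norm B")
      case False
      then show ?thesis using n(1-3) spec0 by (auto simp: c1_def)
    next
      case True
      show ?thesis
      proof (cases "Q = 0")
        case True
        then show ?thesis using n(2,3) spec0 \<open>norm A = norm B\<close> by (simp add: c2_def)
      next
        case False
        then show ?thesis using n(4,5)[OF True] True unfolding c3_def c4_def by blast
      qed
    qed
  qed
  \<comment> \<open>In the first condition the norm of A exceeds that of B and so is no eigenvalue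
    of B; in the second the eigenprojection is zero. Either way \<open>sum_of_copies\<close>
    applies.\<close>
  have suf12: "\<exists>C. \<forall>j::nat. ueq (C j) B \<and> (\<forall>x. (\<lambda>j. blinfun_apply (C j) x) sums A x)" if c: "c1 \<or> c2"
  proof (rule sum_of_copies[OF A B assms(6)])
    show "norm B \<le> norm A" using c by (auto simp: c1_def c2_def)
    show "x = 0" if x: "B x = norm A *\<^sub>R x" for x
      using c
    proof
      assume "c1"
      then have lt: "norm B < norm A" by (simp add: c1_def)
      have "norm A * norm x = norm (B x)" by (simp add: x)
      also have "\<dots> \<le> norm B * norm x" by (rule norm_blinfun)
      finally show "x = 0" using lt by (simp add: mult_le_cancel_right)
    next
      assume "c2"
      then have "Q = 0" "norm A = norm B" by (auto simp: c2_def)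
      then show "x = 0" using BQ(2)[of x] x by simp
    qed
    have s0: "0 \<in> spectrum B" and se: "subeqv KA KB" using c by (auto simp: c1_def c2_def)
    \<comment> \<open>If B is injective, subequivalence to the zero projection forces A to be
      injective.\<close>
    show "ker_proj B \<noteq> 0 \<or> (\<forall>x. A x = 0 \<longrightarrow> x = 0) \<and> (\<forall>t>0. \<exists>x. norm (B x) < t * norm x)"
    proof (cases "KB = 0")
      case True
      obtain R where R: "psub R 0" "eqv KA R" using se True by (auto simp: subeqv_def)
      have "R = 0" using R(1) by (intro blinfun_eqI) (simp add: psub_def)
      then have "KA = 0" using eqv_zero_iff[OF R(2)] by simp
      then have "\<forall>x. A x = 0 \<longrightarrow> x = 0" using ker_proj(3)[of A] by (simp add: KA_def)
      then show ?thesis using s0 spec0 by blast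
    qed (simp add: KB_def)
  qed
  have suf3: "\<exists>C. \<forall>j::nat. ueq (C j) B \<and> (\<forall>x. (\<lambda>j. blinfun_apply (C j) x) sums A x)" if "c3"
    using that assms(6) E_def
    by (intro sum_of_copies_eigenvalue[OF A _ B refl _ Q_def, of E]) (auto simp: c3_def KB_def)
  have suf4: "\<exists>C. \<forall>j::nat. ueq (C j) B \<and> (\<forall>x. (\<lambda>j. blinfun_apply (C j) x) sums A x)" if c: "c4"
  proof -
    have Qp: "prj Q" unfolding Q_def by (rule prj_eigen[OF B(1) psd_selfadj[OF B(2)]])
    have Ep: "prj E" unfolding E_def by (rule prj_eigen[OF A(1) psd_selfadj[OF A(2)]])
    have BE: "B = norm B *\<^sub>R Q" "A = norm B *\<^sub>R E" "E \<noteq> 0" "KB \<noteq> 0" using c by (auto simp: c4_def)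
    have Q0: "Q \<noteq> 0" using BE(1) assms(6) by auto
    have Q1: "Q \<noteq> id_blinfun"
    proof
      assume Q1: "Q = id_blinfun"
      obtain z where z: "KB z \<noteq> 0" using BE(4) by (metis blinfun_eqI zero_blinfun.rep_eq)
      have "B (KB z) = norm B *\<^sub>R KB z" using BQ(1)[of "KB z"] Q1 by simp
      moreover have "B (KB z) = 0" by (simp add: KB_def ker_proj)
      ultimately show False using z assms(6) by simp
    qed
    show ?thesis using scaled_projection_sum[OF Qp Q0 Q1 Ep BE(3), of "norm B"] BE(1,2) by metis
  qed
  \<comment> \<open>The norms separate the first condition, the eigenprojection Q the second from
    the third, the shape of B the third from the fourth. The second and fourth together would give Q
    = 0 and hence B = 0.\<close>
  have excl: "\<not> (c1 \<and> c2)" "\<not> (c1 \<and> c3)" "\<not> (c1 \<and> c4)" "\<not> (c2 \<and> c3)" "\<not> (c2 \<and> c4)" "\<not> (c3 \<and> c4)"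
    using assms(6) by (auto simp: c1_def c2_def c3_def c4_def)
  show ?thesis
    unfolding Let_def sumsE sp np sub
    unfolding c1_def[symmetric] c2_def[symmetric] c3_def[symmetric] c4_def[symmetric]
    using nec suf12 suf3 suf4 excl by blast
qed

end
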